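(* There is an isomorphism of algebras $\mathcal S\simeq\mathbb C[T_{\widehat M_-}]$, where $\mathbb C[T_{\widehat M_-}]$ is the monoid algebra over $\mathbb C$ of the monoid $T_{\widehat M_-}=\{t_\lambda\mid\lambda\in\widehat M_-\}$ (a polynomial ring in $l$ variables).
   Context: Affine data (conventions of Kac, Infinite dimensional Lie algebras). $A$ is a generalized Cartan matrix of affine type $X_N^{(r)}$, $I=\{0,\dots,l\}$, $\mathring I=\{1,\dots,l\}$; $\mathfrak h$ is the Cartan subalgebra of the affine Lie algebra $\mathfrak g(A)$, with simple roots $\alpha_i$ and coroots $\alpha_i^\vee$ ($i\in I$), pairing $\langle\lambda,h\rangle$, labels $a_i,a_i^\vee$, $\delta=\sum_{i\in I} a_i\alpha_i$, $K=\sum_{i\in I} a_i^\vee\alpha_i^\vee$, normalized invariant form $(\cdot|\cdot)$ on $\mathfrak h$ and $\mathfrak h^*$, and the induced isomorphism $\nu:\mathfrak h\to\mathfrak h^*$. $\mathring{\mathfrak h}^*$ is the complex span of $\alpha_i$, $i\in\mathring I$. $\Delta,\Delta_+,\Delta^{re}$: roots, positive roots, real roots; $\mathring\Delta$ is the finite root system with basis $\{\alpha_i\}_{i\in\mathring I}$. $\overline{\Lambda_i},\overline{\Lambda_i^\vee}$ ($i\in\mathring I$) are the fundamental weights and coweights of $\mathring\Delta$. $r_\alpha(\lambda)=\lambda-\langle\lambda,\alpha^\vee\rangle\alpha$, $r_i=r_{\alpha_i}$, $\mathring W=\langle r_i\mid i\in\mathring I\rangle$, $W=\langle r_i\mid i\in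 I\rangle$; $m_{ij}$ is the order of $r_ir_j$, if finite. For $\alpha\in\mathring{\mathfrak h}^*$, $t_\alpha(\lambda)=\lambda+\langle\lambda,K\rangle\alpha-\bigl((\lambda|\alpha)+\tfrac12|\alpha|^2\langle\lambda,K\rangle\bigr)\delta$ on $\mathfrak h^*$. $\gamma_\alpha=r$ if $\alpha$ is a long real root, $\gamma_\alpha=1$ otherwise. $\widehat M=\{\lambda\in\mathring{\mathfrak h}^*\mid(\alpha|\lambda)\in\gamma_\alpha\mathbb Z\ \forall\alpha\in\Delta^{re}\}$ has $\mathbb Z$-basis $\lambda_i=\nu(\overline{\Lambda_i^\vee})$ if $r=1$, $\lambda_i=\overline{\Lambda_i}$ otherwise ($i\in\mathring I$); $\widehat M_-=\bigoplus_{i\in\mathring I}\mathbb Z_{\le0}\lambda_i$. $T_{\widehat M}=\{t_\lambda\mid\lambda\in\widehat M\}$, $\widehat W=\mathring W\ltimes T_{\widehat M}$, which acts on $\Delta$. $\Omega\subset\widehat W$ is the subgroup stabilizing the affine Weyl chamber, $\widehat W=W\rtimes\Omega$. $\Delta_{\hat w}=\Delta_+\cap(-\hat w\Delta_+)$, $\ell(\hat w)=|\Delta_{\hat w}|$. A reduced expression is $\hat w=r_{i_1}\cdots r_{i_\ell}\omega$ with $\ell=\ell(\hat w)$, $\omega\in\Omega$; then $\Delta_{\hat w}=\{\alpha^1,\dots,\alpha^\ell\}$ with $\alpha^n=r_{i_1}\cdots r_{i_{n-1}}(\alpha_{i_n})$. Root algebra. $\mathcal T$ is the tensor (free associative) algebra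 over $\mathbb C$ on independent variables $R_\alpha$, $\alpha\in\Delta^{re}$, with $\widehat W$-action ${}^{\hat w}R_\alpha=R_{\hat w(\alpha)}$. $\widetilde{\mathcal R}$ is the quotient of $\mathcal T$ by the two-sided ideal generated by all ${}^{\hat w}(R_{\alpha_i}R_{r_i\alpha_j}R_{r_ir_j\alpha_i}\cdots)-{}^{\hat w}(R_{\alpha_j}R_{r_j\alpha_i}R_{r_jr_i\alpha_j}\cdots)$, with $m_{ij}$ factors in each product, for $\hat w\in\widehat W$ and $i\ne j\in I$ with $m_{ij}$ finite (no relation in rank 2, i.e. $l=1$). For $\hat w\in\widehat W$, choose a reduced expression $\hat w=r_{i_1}\cdots r_{i_\ell}\omega$ with $\ell=\ell(\hat w)$, $\omega\in\Omega$, and put $\alpha^n=r_{i_1}\cdots r_{i_{n-1}}(\alpha_{i_n})$ for $1\le n\le\ell$; then $R_{\hat w}=R_{\alpha^1}\cdots R_{\alpha^\ell}\in\widetilde{\mathcal R}$ (independent of the reduced expression; $R_\omega=1$ for $\omega\in\Omega$). $\mathcal R=\widetilde{\mathcal R}\rtimes T_{\widehat M}$, with product $(R\,t_\lambda)(R'\,t_\mu)=R\,({}^{t_\lambda}R')\,t_{\lambda+\mu}$. For $\lambda\in\widehat M_-$, $Y^\lambda=R_{t_\lambda}t_\lambda\in\mathcal R$, and $\mathcal S\subset\mathcal R$ is the subalgebra generated by $\{Y^\lambda\mid\lambda\in\widehat M_-\}$. *)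

theory Defs
  imports
    Complex_Main
    "HOL-Library.Poly_Mapping"
    "HOL-Algebra.Module"
    "HOL-Algebra.QuotRing"
    "HOL-Algebra.Subrings"
    "HOL-Algebra.Bij"
    "HOL-Algebra.Generated_Groups"
begin

section \<open>Complex associative algebras\<close>

text \<open>
  A (unital, not necessarily commutative) algebra over the complex numbers is carried by a
  \<^typ>\<open>(complex, 'a) module\<close> record, i.e. a ring record together with a scalar multiplication.
\<close>

definition alg_iso ::
  "(complex, 'a, 'm) module_scheme \<Rightarrow> (complex, 'b, 'n) module_scheme \<Rightarrow> ('a \<Rightarrow> 'b) set" where
  "alg_iso A B =
    {h \<in> ring_iso A B. \<forall>c. \<forall>x\<in>carrier A. h (c \<odot>\<^bsub>A\<^esub> x) = c \<odot>\<^bsub>B\<^esub> h x}"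

definition alg_isomorphic ::
  "(complex, 'a, 'm) module_scheme \<Rightarrow> (complex, 'b, 'n) module_scheme \<Rightarrow> bool" where
  "alg_isomorphic A B \<longleftrightarrow> alg_iso A B \<noteq> {}"

definition is_subalgebra :: "'a set \<Rightarrow> (complex, 'a, 'm) module_scheme \<Rightarrow> bool" where
  "is_subalgebra B A \<longleftrightarrow> subring B A \<and> (\<forall>c. \<forall>x\<in>B. c \<odot>\<^bsub>A\<^esub> x \<in> B)"

definition subalgebra_generated ::
  "(complex, 'a) module \<Rightarrow> 'a set \<Rightarrow> (complex, 'a) module" where
  "subalgebra_generated A X = A\<lparr>carrier := \<Inter>{B. is_subalgebra B A \<and> X \<subseteq> B}\<rparr>"

definition quotient_algebra ::
  "(complex, 'a) module \<Rightarrow> 'a set \<Rightarrow> (complex, 'a set) module" where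
  "quotient_algebra A J =
    \<lparr>carrier = carrier (A Quot J), mult = mult (A Quot J), one = one (A Quot J),
     zero = zero (A Quot J), add = add (A Quot J),
     smult = (\<lambda>c Y. \<Union>y\<in>Y. J +>\<^bsub>A\<^esub> (c \<odot>\<^bsub>A\<^esub> y))\<rparr>"

definition mult_list :: "('a, 'm) monoid_scheme \<Rightarrow> 'a list \<Rightarrow> 'a" where
  "mult_list A xs = foldr (mult A) xs (one A)"

definition complex_algebra :: "(complex, complex) module" where
  "complex_algebra = \<lparr>carrier = UNIV, mult = (*), one = 1, zero = 0, add = (+), smult = (*)\<rparr>"

text \<open>
  The crossed product of an algebra \<open>B\<close> with a monoid \<open>G\<close> acting on \<open>B\<close>: formal sums
  \<open>\<Sum>g. f g \<cdot> g\<close> with finite support, multiplied by \<open>(b g)(b' g') = b (\<^sup>g b') (g g')\<close>.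
\<close>

definition crossed_product ::
  "(complex, 'b) module \<Rightarrow> ('g, 'm) monoid_scheme \<Rightarrow> ('g \<Rightarrow> 'b \<Rightarrow> 'b) \<Rightarrow> (complex, 'g \<Rightarrow> 'b) module"
where
  "crossed_product B G act =
    \<lparr>carrier = {f. range f \<subseteq> carrier B \<and> finite {g. f g \<noteq> \<zero>\<^bsub>B\<^esub>} \<and> {g. f g \<noteq> \<zero>\<^bsub>B\<^esub>} \<subseteq> carrier G},
     mult = (\<lambda>f h k. \<Oplus>\<^bsub>B\<^esub>p \<in> {(x, y). f x \<noteq> \<zero>\<^bsub>B\<^esub> \<and> h y \<noteq> \<zero>\<^bsub>B\<^esub> \<and> x \<otimes>\<^bsub>G\<^esub> y = k}.
               f (fst p) \<otimes>\<^bsub>B\<^esub> act (fst p) (h (snd p))),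
     one = (\<lambda>g. if g = \<one>\<^bsub>G\<^esub> then \<one>\<^bsub>B\<^esub> else \<zero>\<^bsub>B\<^esub>),
     zero = (\<lambda>g. \<zero>\<^bsub>B\<^esub>),
     add = (\<lambda>f h g. f g \<oplus>\<^bsub>B\<^esub> h g),
     smult = (\<lambda>c f g. c \<odot>\<^bsub>B\<^esub> f g)\<rparr>"

definition single_term :: "(complex, 'b) module \<Rightarrow> 'b \<Rightarrow> 'g \<Rightarrow> 'g \<Rightarrow> 'b" where
  "single_term B b g = (\<lambda>k. if k = g then b else \<zero>\<^bsub>B\<^esub>)"

definition monoid_algebra :: "('g, 'm) monoid_scheme \<Rightarrow> (complex, 'g \<Rightarrow> complex) module" where
  "monoid_algebra G = crossed_product complex_algebra G (\<lambda>_ z. z)"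

definition free_monoid :: "'v set \<Rightarrow> 'v list monoid" where
  "free_monoid V = \<lparr>carrier = lists V, mult = (@), one = []\<rparr>"

definition free_algebra :: "'v set \<Rightarrow> (complex, 'v list \<Rightarrow> complex) module" where
  "free_algebra V = monoid_algebra (free_monoid V)"

text \<open>
  Monomials are finitely supported exponent functions \<^typ>\<open>'v \<Rightarrow>\<^sub>0 nat\<close>; the ring operations are
  the library's convolution operations on \<^typ>\<open>('v \<Rightarrow>\<^sub>0 nat) \<Rightarrow>\<^sub>0 complex\<close>.
\<close>

definition polynomial_algebra :: "'v set \<Rightarrow> (complex, ('v \<Rightarrow>\<^sub>0 nat) \<Rightarrow>\<^sub>0 complex) module" where
  "polynomial_algebra V =
    \<lparr>carrier = {p. \<forall>m \<in> Poly_Mapping.keys p. Poly_Mapping.keys m \<subseteq> V},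
     mult = (*), one = 1, zero = 0, add = (+), smult = (\<lambda>c p. Poly_Mapping.map ((*) c) p)\<rparr>"


section \<open>Generalized Cartan matrices of affine type\<close>

text \<open>
  The affine types \<open>X\<^sub>N\<^sup>(\<^sup>r\<^sup>)\<close> of Kac's tables Aff 1, Aff 2, Aff 3. The argument is always \<open>l\<close>, so
  the constructors stand, in this order, for \<open>A\<^sub>l\<^sup>(\<^sup>1\<^sup>)\<close>, \<open>B\<^sub>l\<^sup>(\<^sup>1\<^sup>)\<close>, \<open>C\<^sub>l\<^sup>(\<^sup>1\<^sup>)\<close>, \<open>D\<^sub>l\<^sup>(\<^sup>1\<^sup>)\<close>,
  \<open>E\<^sub>6\<^sup>(\<^sup>1\<^sup>)\<close>, \<open>E\<^sub>7\<^sup>(\<^sup>1\<^sup>)\<close>, \<open>E\<^sub>8\<^sup>(\<^sup>1\<^sup>)\<close>, \<open>F\<^sub>4\<^sup>(\<^sup>1\<^sup>)\<close>, \<open>G\<^sub>2\<^sup>(\<^sup>1\<^sup>)\<close>; \<open>A\<^sub>2\<^sub>l\<^sup>(\<^sup>2\<^sup>)\<close>, \<open>A\<^sub>2\<^sub>l\<^sub>-\<^sub>1\<^sup>(\<^sup>2\<^sup>)\<close>,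
  \<open>D\<^sub>l\<^sub>+\<^sub>1\<^sup>(\<^sup>2\<^sup>)\<close>, \<open>E\<^sub>6\<^sup>(\<^sup>2\<^sup>)\<close>; \<open>D\<^sub>4\<^sup>(\<^sup>3\<^sup>)\<close>.
\<close>

datatype affine_type =
    Aff1_A nat | Aff1_B nat | Aff1_C nat | Aff1_D nat
  | Aff1_E6 | Aff1_E7 | Aff1_E8 | Aff1_F4 | Aff1_G2
  | Aff2_A_even nat | Aff2_A_odd nat | Aff2_D nat | Aff2_E6
  | Aff3_D4

fun admissible :: "affine_type \<Rightarrow> bool" where
  "admissible (Aff1_A l) \<longleftrightarrow> l \<ge> 1"
| "admissible (Aff1_B l) \<longleftrightarrow> l \<ge> 3"
| "admissible (Aff1_C l) \<longleftrightarrow> l \<ge> 2"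
| "admissible (Aff1_D l) \<longleftrightarrow> l \<ge> 4"
| "admissible (Aff2_A_even l) \<longleftrightarrow> l \<ge> 1"
| "admissible (Aff2_A_odd l) \<longleftrightarrow> l \<ge> 3"
| "admissible (Aff2_D l) \<longleftrightarrow> l \<ge> 2"
| "admissible _ \<longleftrightarrow> True"

fun affine_rank :: "affine_type \<Rightarrow> nat" where
  "affine_rank (Aff1_A l) = l"
| "affine_rank (Aff1_B l) = l"
| "affine_rank (Aff1_C l) = l"
| "affine_rank (Aff1_D l) = l"
| "affine_rank Aff1_E6 = 6"
| "affine_rank Aff1_E7 = 7"
| "affine_rank Aff1_E8 = 8"
| "affine_rank Aff1_F4 = 4"
| "affine_rank Aff1_G2 = 2"
| "affine_rank (Aff2_A_even l) = l"
| "affine_rank (Aff2_A_odd l) = l"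
| "affine_rank (Aff2_D l) = l"
| "affine_rank Aff2_E6 = 4"
| "affine_rank Aff3_D4 = 2"

text \<open>The number \<open>r\<close> in \<open>X\<^sub>N\<^sup>(\<^sup>r\<^sup>)\<close>.\<close>

fun affine_twist :: "affine_type \<Rightarrow> nat" where
  "affine_twist (Aff2_A_even l) = 2"
| "affine_twist (Aff2_A_odd l) = 2"
| "affine_twist (Aff2_D l) = 2"
| "affine_twist Aff2_E6 = 2"
| "affine_twist Aff3_D4 = 3"
| "affine_twist _ = 1"

definition chain :: "nat \<Rightarrow> nat \<Rightarrow> (nat \<times> nat) set" where
  "chain m n = (\<lambda>i. (i, Suc i)) ` {m..<n}"

text \<open>The edges of the Dynkin diagram (disregarding multiplicities), each listed in one direction.\<close>

fun dynkin_edges :: "affine_type \<Rightarrow> (nat \<times> nat) set" where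
  "dynkin_edges (Aff1_A l) = chain 0 l \<union> {(l, 0)}"
| "dynkin_edges (Aff1_B l) = {(0, 2)} \<union> chain 1 l"
| "dynkin_edges (Aff1_C l) = chain 0 l"
| "dynkin_edges (Aff1_D l) = {(0, 2), (l - 2, l)} \<union> chain 1 (l - 1)"
| "dynkin_edges Aff1_E6 = chain 1 5 \<union> {(3, 6), (6, 0)}"
| "dynkin_edges Aff1_E7 = chain 0 6 \<union> {(3, 7)}"
| "dynkin_edges Aff1_E8 = chain 0 7 \<union> {(5, 8)}"
| "dynkin_edges Aff1_F4 = chain 0 4"
| "dynkin_edges Aff1_G2 = chain 0 2"
| "dynkin_edges (Aff2_A_even l) = chain 0 l"
| "dynkin_edges (Aff2_A_odd l) = {(0, 2)} \<union> chain 1 l"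
| "dynkin_edges (Aff2_D l) = chain 0 l"
| "dynkin_edges Aff2_E6 = chain 0 4"
| "dynkin_edges Aff3_D4 = chain 0 2"

text \<open>
  An entry \<open>((i, j), m)\<close> says \<open>a\<^sub>i\<^sub>j = -m\<close>; since \<open>a\<^sub>i\<^sub>j = \<langle>\<alpha>\<^sub>j, \<alpha>\<^sub>i\<^sup>\<or>\<rangle>\<close>, the arrow on the bond points
  towards the vertex \<open>i\<close> (the shorter root). All remaining edges have entry \<open>-1\<close>.
\<close>

fun dynkin_arrows :: "affine_type \<Rightarrow> ((nat \<times> nat) \<times> int) list" where
  "dynkin_arrows (Aff1_A l) = (if l = 1 then [((0, 1), 2), ((1, 0), 2)] else [])"
| "dynkin_arrows (Aff1_B l) = [((l, l - 1), 2)]"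
| "dynkin_arrows (Aff1_C l) = [((1, 0), 2), ((l - 1, l), 2)]"
| "dynkin_arrows Aff1_F4 = [((3, 2), 2)]"
| "dynkin_arrows Aff1_G2 = [((2, 1), 3)]"
| "dynkin_arrows (Aff2_A_even l) = (if l = 1 then [((0, 1), 4)] else [((0, 1), 2), ((l - 1, l), 2)])"
| "dynkin_arrows (Aff2_A_odd l) = [((l - 1, l), 2)]"
| "dynkin_arrows (Aff2_D l) = [((0, 1), 2), ((l, l - 1), 2)]"
| "dynkin_arrows Aff2_E6 = [((2, 3), 2)]"
| "dynkin_arrows Aff3_D4 = [((1, 2), 3)]"
| "dynkin_arrows _ = []"

definition cartan_matrix :: "affine_type \<Rightarrow> nat \<Rightarrow> nat \<Rightarrow> int" where
  "cartan_matrix X i j =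
    (if i = j then 2
     else if (i, j) \<in> dynkin_edges X \<or> (j, i) \<in> dynkin_edges X
       then - (case map_of (dynkin_arrows X) (i, j) of None \<Rightarrow> 1 | Some m \<Rightarrow> m)
     else 0)"

text \<open>
  The vector of relatively prime positive integers in the kernel of an
  \<open>(n + 1) \<times> (n + 1)\<close> matrix of affine type.
\<close>

definition kernel_labels :: "nat \<Rightarrow> (nat \<Rightarrow> nat \<Rightarrow> int) \<Rightarrow> nat \<Rightarrow> nat" where
  "kernel_labels n M =
    (THE a. (\<forall>i\<le>n. 0 < a i) \<and> (\<forall>i>n. a i = 0) \<and> Gcd (a ` {..n}) = 1 \<and>
            (\<forall>i\<le>n. (\<Sum>j\<le>n. M i j * int (a j)) = 0))"


section \<open>The affine root datum and its root algebra\<close>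

type_synonym vec = "nat \<Rightarrow> complex"
type_synonym linmap = "vec \<Rightarrow> vec"
type_synonym tensor = "vec list \<Rightarrow> complex"

locale affine_datum =
  fixes X :: affine_type
  assumes admissible: "admissible X"
begin

abbreviation l :: nat where "l \<equiv> affine_rank X"
abbreviation r :: nat where "r \<equiv> affine_twist X"
abbreviation a_mat :: "nat \<Rightarrow> nat \<Rightarrow> int" where "a_mat \<equiv> cartan_matrix X"

text \<open>The labels \<open>a\<^sub>i\<close> and \<open>a\<^sub>i\<^sup>\<or>\<close>.\<close>

definition lab :: "nat \<Rightarrow> nat" where "lab = kernel_labels l a_mat"
definition colab :: "nat \<Rightarrow> nat" where "colab = kernel_labels l (\<lambda>i j. a_mat j i)"

subsection \<open>Cartan subalgebra\<close>

text \<open>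
  Both \<open>\<hh>\<^sup>*\<close> and \<open>\<hh>\<close> have dimension \<open>l + 2\<close> and are given by coordinates \<open>0, \<dots>, l + 1\<close>: a vector
  of \<open>\<hh>\<^sup>*\<close> by its coordinates in the basis \<open>\<alpha>\<^sub>0, \<dots>, \<alpha>\<^sub>l, \<Lambda>\<^sub>0\<close>, a vector of \<open>\<hh>\<close> by its coordinates in
  the basis \<open>\<alpha>\<^sub>0\<^sup>\<or>, \<dots>, \<alpha>\<^sub>l\<^sup>\<or>, d\<close>. Linear maps of \<open>\<hh>\<^sup>*\<close> are written as functions on all of
  \<^typ>\<open>vec\<close>; those below neither read nor change the coordinates beyond \<open>l + 1\<close>.
\<close>

definition hdual :: "vec set" where
  "hdual = {v. \<forall>i > Suc l. v i = 0}"

text \<open>The real form of \<open>\<hh>\<^sup>*\<close>: the real span of \<open>\<alpha>\<^sub>0, \<dots>, \<alpha>\<^sub>l, \<Lambda>\<^sub>0\<close>.\<close>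

definition hdual_real :: "vec set" where
  "hdual_real = {v \<in> hdual. \<forall>i. v i \<in> \<real>}"

text \<open>The complex span of \<open>\<alpha>\<^sub>1, \<dots>, \<alpha>\<^sub>l\<close> in \<open>\<hh>\<^sup>*\<close>; the same coordinate set read in \<open>\<hh>\<close> is the span of
  \<open>\<alpha>\<^sub>1\<^sup>\<or>, \<dots>, \<alpha>\<^sub>l\<^sup>\<or>\<close>.\<close>

definition finite_part :: "vec set" where
  "finite_part = {v. \<forall>i. i \<notin> {1..l} \<longrightarrow> v i = 0}"

text \<open>\<open>\<langle>\<alpha>\<^sub>i, \<alpha>\<^sub>j\<^sup>\<or>\<rangle> = a\<^sub>j\<^sub>i\<close>, \<open>\<langle>\<Lambda>\<^sub>0, \<alpha>\<^sub>j\<^sup>\<or>\<rangle> = \<delta>\<^sub>0\<^sub>j\<close>, \<open>\<langle>\<alpha>\<^sub>i, d\<rangle> = \<delta>\<^sub>0\<^sub>i\<close>, \<open>\<langle>\<Lambda>\<^sub>0, d\<rangle> = 0\<close>.\<close>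

definition pairing_basis :: "nat \<Rightarrow> nat \<Rightarrow> complex" where
  "pairing_basis i j =
    (if i \<le> l \<and> j \<le> l then of_int (a_mat j i)
     else if (i, j) = (Suc l, 0) \<or> (i, j) = (0, Suc l) then 1 else 0)"

definition pairing :: "vec \<Rightarrow> vec \<Rightarrow> complex" where
  "pairing v h = (\<Sum>i\<le>Suc l. \<Sum>j\<le>Suc l. v i * h j * pairing_basis i j)"

text \<open>The normalized invariant form on \<open>\<hh>\<^sup>*\<close>: \<open>(\<alpha>\<^sub>i|\<alpha>\<^sub>j) = a\<^sub>i\<^sup>\<or> a\<^sub>i\<^sup>-\<^sup>1 a\<^sub>i\<^sub>j\<close>,
  \<open>(\<alpha>\<^sub>0|\<Lambda>\<^sub>0) = a\<^sub>0\<^sup>-\<^sup>1\<close>, \<open>(\<alpha>\<^sub>i|\<Lambda>\<^sub>0) = 0\<close> for \<open>1 \<le> i \<le> l\<close>, \<open>(\<Lambda>\<^sub>0|\<Lambda>\<^sub>0) = 0\<close>.\<close>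

definition form_basis :: "nat \<Rightarrow> nat \<Rightarrow> complex" where
  "form_basis i j =
    (if i \<le> l \<and> j \<le> l then of_nat (colab i) / of_nat (lab i) * of_int (a_mat i j)
     else if (i, j) = (Suc l, 0) \<or> (i, j) = (0, Suc l) then 1 / of_nat (lab 0) else 0)"

definition form :: "vec \<Rightarrow> vec \<Rightarrow> complex" where
  "form u v = (\<Sum>i\<le>Suc l. \<Sum>j\<le>Suc l. u i * v j * form_basis i j)"

text \<open>The isomorphism from \<open>\<hh>\<close> to \<open>\<hh>\<^sup>*\<close> induced by the form:
  \<open>a\<^sub>i\<^sup>\<or> \<nu>(\<alpha>\<^sub>i\<^sup>\<or>) = a\<^sub>i \<alpha>\<^sub>i\<close>, \<open>\<nu>(d) = a\<^sub>0 \<Lambda>\<^sub>0\<close>.\<close>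

definition nu :: "vec \<Rightarrow> vec" where
  "nu h = (\<lambda>i. if i \<le> l then of_nat (lab i) / of_nat (colab i) * h i
               else if i = Suc l then of_nat (lab 0) * h i else 0)"

definition unit_vec :: "nat \<Rightarrow> vec" where
  "unit_vec i = (\<lambda>j. if j = i then 1 else 0)"

abbreviation \<alpha> :: "nat \<Rightarrow> vec" where "\<alpha> \<equiv> unit_vec"
abbreviation \<alpha>_vee :: "nat \<Rightarrow> vec" where "\<alpha>_vee \<equiv> unit_vec"

definition \<delta> :: vec where
  "\<delta> = (\<lambda>i. if i \<le> l then of_nat (lab i) else 0)"

definition K :: vec where
  "K = (\<lambda>i. if i \<le> l then of_nat (colab i) else 0)"

subsection \<open>Weyl group and roots\<close>

definition s :: "nat \<Rightarrow> vec \<Rightarrow> vec" where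
  "s i v = (\<lambda>j. v j - pairing v (\<alpha>_vee i) * \<alpha> i j)"

definition W :: "linmap set" where
  "W = generate (BijGroup UNIV) (s ` {0..l})"

definition W_fin :: "linmap set" where
  "W_fin = generate (BijGroup UNIV) (s ` {1..l})"

definition real_roots :: "vec set" where
  "real_roots = {w (\<alpha> i) | w i. w \<in> W \<and> i \<le> l}"

text \<open>The imaginary roots of an affine algebra are the non-zero integer multiples of \<open>\<delta>\<close>.\<close>

definition roots :: "vec set" where
  "roots = real_roots \<union> {(\<lambda>i. of_int n * \<delta> i) | n :: int. n \<noteq> 0}"

definition pos_roots :: "vec set" where
  "pos_roots = {\<beta> \<in> roots. \<forall>i. \<beta> i \<in> \<nat>}"

definition long_real_root :: "vec \<Rightarrow> bool" where
  "long_real_root \<beta> \<longleftrightarrow> \<beta> \<in> real_roots \<and> (\<forall>\<beta>'\<in>real_roots. Re (form \<beta>' \<beta>') \<le> Re (form \<beta> \<beta>))"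

definition \<gamma> :: "vec \<Rightarrow> nat" where
  "\<gamma> \<beta> = (if long_real_root \<beta> then r else 1)"

subsection \<open>Translations and the extended affine Weyl group\<close>

definition t :: "vec \<Rightarrow> vec \<Rightarrow> vec" where
  "t \<beta> v = (\<lambda>i. v i + pairing v K * \<beta> i
                 - (form v \<beta> + 1 / 2 * form \<beta> \<beta> * pairing v K) * \<delta> i)"

definition M_hat :: "vec set" where
  "M_hat = {v \<in> finite_part. \<forall>\<beta>\<in>real_roots. \<exists>n::int. form \<beta> v = of_nat (\<gamma> \<beta>) * of_int n}"

definition fund_weight :: "nat \<Rightarrow> vec" where
  "fund_weight i =
    (THE v. v \<in> finite_part \<and> (\<forall>j\<in>{1..l}. pairing v (\<alpha>_vee j) = (if i = j then 1 else 0)))"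

definition fund_coweight :: "nat \<Rightarrow> vec" where
  "fund_coweight i =
    (THE h. h \<in> finite_part \<and> (\<forall>j\<in>{1..l}. pairing (\<alpha> j) h = (if i = j then 1 else 0)))"

definition basis_M_hat :: "nat \<Rightarrow> vec" where
  "basis_M_hat i = (if r = 1 then nu (fund_coweight i) else fund_weight i)"

definition M_hat_minus :: "vec set" where
  "M_hat_minus =
    {(\<lambda>k. \<Sum>i=1..l. of_int (n i) * basis_M_hat i k) | n :: nat \<Rightarrow> int. \<forall>i\<in>{1..l}. n i \<le> 0}"

definition T_group :: "linmap monoid" where
  "T_group = \<lparr>carrier = t ` M_hat, mult = (\<circ>), one = id\<rparr>"

definition T_minus :: "linmap monoid" where
  "T_minus = \<lparr>carrier = t ` M_hat_minus, mult = (\<circ>), one = id\<rparr>"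

definition W_hat :: "linmap set" where
  "W_hat = {w \<circ> t \<mu> | w \<mu>. w \<in> W_fin \<and> \<mu> \<in> M_hat}"

definition affine_chamber :: "vec set" where
  "affine_chamber = {v \<in> hdual_real. \<forall>i\<le>l. 0 \<le> Re (pairing v (\<alpha>_vee i))}"

definition \<Omega> :: "linmap set" where
  "\<Omega> = {w \<in> W_hat. w ` affine_chamber = affine_chamber}"

definition inversions :: "linmap \<Rightarrow> vec set" where
  "inversions w = pos_roots \<inter> {(\<lambda>i. - w \<beta> i) | \<beta>. \<beta> \<in> pos_roots}"

definition len :: "linmap \<Rightarrow> nat" where
  "len w = card (inversions w)"

definition reduced_expression :: "linmap \<Rightarrow> nat list \<times> linmap \<Rightarrow> bool" where
  "reduced_expression w = (\<lambda>(is, \<omega>).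
     set is \<subseteq> {0..l} \<and> \<omega> \<in> \<Omega> \<and> length is = len w \<and> w = foldr (\<lambda>i f. s i \<circ> f) is \<omega>)"

text \<open>The sequence \<open>\<alpha>\<^sub>i\<^sub>1, s\<^sub>i\<^sub>1(\<alpha>\<^sub>i\<^sub>2), s\<^sub>i\<^sub>1 s\<^sub>i\<^sub>2(\<alpha>\<^sub>i\<^sub>3), \<dots>\<close> attached to a word \<open>i\<^sub>1 i\<^sub>2 i\<^sub>3 \<dots>\<close>.\<close>

fun root_sequence :: "nat list \<Rightarrow> vec list" where
  "root_sequence [] = []"
| "root_sequence (i # is) = \<alpha> i # map (s i) (root_sequence is)"

fun alternating :: "nat \<Rightarrow> nat \<Rightarrow> nat \<Rightarrow> nat list" where
  "alternating i j 0 = []"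
| "alternating i j (Suc m) = i # alternating j i m"

definition finite_order :: "nat \<Rightarrow> nat \<Rightarrow> bool" where
  "finite_order i j \<longleftrightarrow> (\<exists>m>0. (s i \<circ> s j) ^^ m = id)"

text \<open>\<open>m\<^sub>i\<^sub>j\<close>; meaningful only if \<^term>\<open>finite_order i j\<close>.\<close>

definition m_ord :: "nat \<Rightarrow> nat \<Rightarrow> nat" where
  "m_ord i j = (LEAST m. m > 0 \<and> (s i \<circ> s j) ^^ m = id)"

subsection \<open>The root algebra\<close>

definition tensor_alg :: "(complex, tensor) module" where
  "tensor_alg = free_algebra real_roots"

definition tensor_gen :: "vec \<Rightarrow> tensor" where
  "tensor_gen \<beta> = single_term complex_algebra 1 [\<beta>]"

text \<open>
  The action sending the generator of a real root \<open>\<beta>\<close> to that of \<open>w \<beta>\<close>: a word \<open>\<beta>\<^sub>1 \<beta>\<^sub>2 \<dots>\<close> goes to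
  \<open>(w \<beta>\<^sub>1) (w \<beta>\<^sub>2) \<dots>\<close>, so coefficients are pulled back along the bijection \<open>w\<close>.
\<close>

definition tensor_act :: "linmap \<Rightarrow> tensor \<Rightarrow> tensor" where
  "tensor_act w p = (\<lambda>\<beta>s. p (map (inv_into UNIV w) \<beta>s))"

definition braid_relations :: "tensor set" where
  "braid_relations =
    {tensor_act w (mult_list tensor_alg (map tensor_gen (root_sequence (alternating i j (m_ord i j)))))
       \<ominus>\<^bsub>tensor_alg\<^esub>
     tensor_act w (mult_list tensor_alg (map tensor_gen (root_sequence (alternating j i (m_ord i j)))))
     | w i j. w \<in> W_hat \<and> i \<le> l \<and> j \<le> l \<and> i \<noteq> j \<and> finite_order i j}"

definition braid_ideal :: "tensor set" where
  "braid_ideal = Idl\<^bsub>tensor_alg\<^esub> braid_relations"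

definition R_tilde :: "(complex, tensor set) module" where
  "R_tilde = quotient_algebra tensor_alg braid_ideal"

definition R_gen :: "vec \<Rightarrow> tensor set" where
  "R_gen \<beta> = braid_ideal +>\<^bsub>tensor_alg\<^esub> tensor_gen \<beta>"

definition R_elem :: "linmap \<Rightarrow> tensor set" where
  "R_elem w = mult_list R_tilde (map R_gen (root_sequence (fst (SOME e. reduced_expression w e))))"

text \<open>The action on the quotient: the image of a coset is a coset, the ideal being stable.\<close>

definition R_act :: "linmap \<Rightarrow> tensor set \<Rightarrow> tensor set" where
  "R_act w C = tensor_act w ` C"

definition root_alg :: "(complex, linmap \<Rightarrow> tensor set) module" where
  "root_alg = crossed_product R_tilde T_group R_act"

definition Y :: "vec \<Rightarrow> linmap \<Rightarrow> tensor set" where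
  "Y \<mu> = single_term R_tilde (R_elem (t \<mu>)) (t \<mu>)"

definition S_alg :: "(complex, linmap \<Rightarrow> tensor set) module" where
  "S_alg = subalgebra_generated root_alg (Y ` M_hat_minus)"

end

end

theory Submission
  imports Defs
begin

text \<open>
  Sending \<open>R t\<^sub>\<lambda>\<close> to \<open>t\<^sub>\<lambda>\<close>, with every generator going to \<open>1\<close>, shows that the elements \<open>Y\<^sup>\<lambda>\<close>
  are linearly independent, so everything rests on \<open>Y\<^sup>\<lambda> Y\<^sup>\<mu> = Y\<^sup>\<lambda>\<^sup>+\<^sup>\<mu>\<close>. A real root that \<open>t\<^sub>\<lambda>\<close>
  inverts is moved by antidominant translations in one direction only, hence
  \<open>\<ell>(t\<^sub>\<lambda> t\<^sub>\<mu>) = \<ell>(t\<^sub>\<lambda>) + \<ell>(t\<^sub>\<mu>)\<close>, and reduced expressions of \<open>t\<^sub>\<lambda>\<close> and \<open>t\<^sub>\<mu>\<close> concatenate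
  to one of \<open>t\<^sub>\<lambda>\<^sub>+\<^sub>\<mu>\<close>; by Matsumoto's theorem the product of root generators does not depend on
  the reduced expression modulo the braid relations. To have the length theory one needs that
  \<open>r\<^sub>0\<close> is a reflection of the finite Weyl group followed by a translation, and that
  every real root has coordinates of one sign; both come from the positive semidefinite form.
\<close>

section \<open>Labels of the affine diagrams\<close>

text \<open>Real roots are given only as an orbit, and two facts about them are invisible from that
  side: that their coordinates have one sign, and that \<beta> + \<gamma> n \<delta> is again a
  root, which is what lets \<open>M_hat\<close> act by translations. Both are read off from an
  intrinsic description, the vectors of a given norm in a suitable lattice. It treats all types at
  once, so case distinctions over the affine types stay within this section, which is why labels and
  colabels are tabulated first. The label at vertex 0 is 2 for A_2l^(2) and 1 otherwise, and has to
  be carried through all formulas for \<theta> and r_0. The braid relations are imposed in all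
  translates under \<open>W_hat\<close>; Matsumoto's argument relies on this, since after the first
  letter of a word the remaining roots appear transformed by a reflection. Finiteness of inversion
  sets has to be proved as well: lengths are cardinalities, and the cardinality of an infinite set
  is 0 by convention, so an equation of lengths alone would say nothing.\<close>

fun labels :: "affine_type \<Rightarrow> nat \<Rightarrow> nat" where
  "labels (Aff1_A l) i = (if i \<le> l then 1 else 0)"
| "labels (Aff1_B l) i = (if i \<le> 1 then 1 else if i \<le> l then 2 else 0)"
| "labels (Aff1_C l) i = (if i = 0 \<or> i = l then 1 else if i \<le> l then 2 else 0)"
| "labels (Aff1_D l) i = (if i \<le> 1 \<or> i = l - 1 \<or> i = l then 1 else if i \<le> l then 2 else 0)"
| "labels Aff1_E6 i = (if i \<le> 6 then [1,1,2,3,2,1,2] ! i else 0)"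
| "labels Aff1_E7 i = (if i \<le> 7 then [1,2,3,4,3,2,1,2] ! i else 0)"
| "labels Aff1_E8 i = (if i \<le> 8 then [1,2,3,4,5,6,4,2,3] ! i else 0)"
| "labels Aff1_F4 i = (if i \<le> 4 then [1,2,3,4,2] ! i else 0)"
| "labels Aff1_G2 i = (if i \<le> 2 then [1,2,3] ! i else 0)"
| "labels (Aff2_A_even l) i = (if i = l then 1 else if i \<le> l then 2 else 0)"
| "labels (Aff2_A_odd l) i = (if i \<le> 1 \<or> i = l then 1 else if i \<le> l then 2 else 0)"
| "labels (Aff2_D l) i = (if i \<le> l then 1 else 0)"
| "labels Aff2_E6 i = (if i \<le> 4 then [1,2,3,2,1] ! i else 0)"
| "labels Aff3_D4 i = (if i \<le> 2 then [1,2,1] ! i else 0)"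

fun colabels :: "affine_type \<Rightarrow> nat \<Rightarrow> nat" where
  "colabels (Aff1_A l) i = (if i \<le> l then 1 else 0)"
| "colabels (Aff1_B l) i = (if i \<le> 1 \<or> i = l then 1 else if i \<le> l then 2 else 0)"
| "colabels (Aff1_C l) i = (if i \<le> l then 1 else 0)"
| "colabels (Aff1_D l) i = (if i \<le> 1 \<or> i = l - 1 \<or> i = l then 1 else if i \<le> l then 2 else 0)"
| "colabels Aff1_E6 i = (if i \<le> 6 then [1,1,2,3,2,1,2] ! i else 0)"
| "colabels Aff1_E7 i = (if i \<le> 7 then [1,2,3,4,3,2,1,2] ! i else 0)"
| "colabels Aff1_E8 i = (if i \<le> 8 then [1,2,3,4,5,6,4,2,3] ! i else 0)"
| "colabels Aff1_F4 i = (if i \<le> 4 then [1,2,3,2,1] ! i else 0)"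
| "colabels Aff1_G2 i = (if i \<le> 2 then [1,2,1] ! i else 0)"
| "colabels (Aff2_A_even l) i = (if i = 0 then 1 else if i \<le> l then 2 else 0)"
| "colabels (Aff2_A_odd l) i = (if i \<le> 1 then 1 else if i \<le> l then 2 else 0)"
| "colabels (Aff2_D l) i = (if i = 0 \<or> i = l then 1 else if i \<le> l then 2 else 0)"
| "colabels Aff2_E6 i = (if i \<le> 4 then [1,2,3,4,2] ! i else 0)"
| "colabels Aff3_D4 i = (if i \<le> 2 then [1,2,3] ! i else 0)"

lemma mem_chain: "(i, j) \<in> chain m n \<longleftrightarrow> j = Suc i \<and> m \<le> i \<and> i < n"
  by (auto simp: chain_def)

lemma le_numeral_cases: "(i::nat) \<le> numeral k \<longleftrightarrow> i = numeral k \<or> i \<le> pred_numeral k"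
  by (auto simp: le_Suc_eq numeral_eq_Suc)

lemmas cartan_simps = cartan_matrix_def mem_chain

lemma labels_pos: "i \<le> affine_rank X \<Longrightarrow> admissible X \<Longrightarrow> 0 < labels X i \<and> 0 < colabels X i"
  by (cases X) (auto simp: le_numeral_cases le_Suc_eq)

lemma labels_zero: "i > affine_rank X \<Longrightarrow> admissible X \<Longrightarrow> labels X i = 0 \<and> colabels X i = 0"
  by (cases X) auto

lemma colabel_0: "admissible X \<Longrightarrow> colabels X 0 = 1"
  by (cases X) auto

lemma arrow_nonneg:
  assumes "map_of (dynkin_arrows X) p = Some m" shows "m > 0"
  using map_of_SomeD[OF assms] by (cases X) (auto split: if_splits)

lemma cartan_diag [simp]: "cartan_matrix X i i = 2"
  by (simp add: cartan_matrix_def)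

lemma cartan_nonpos: "i \<noteq> j \<Longrightarrow> cartan_matrix X i j \<le> 0"
  by (auto simp: cartan_matrix_def split: option.splits dest: arrow_nonneg)

lemma cartan_nonzero_iff:
  "cartan_matrix X i j \<noteq> 0 \<longleftrightarrow> i = j \<or> (i, j) \<in> dynkin_edges X \<or> (j, i) \<in> dynkin_edges X"
  by (auto simp: cartan_matrix_def split: option.splits dest: arrow_nonneg)

lemma chain_rec: "chain m n = (if m < n then insert (m, Suc m) (chain (Suc m) n) else {})"
  by (auto simp: mem_chain)

lemma chain_small:
  "chain (Suc 0) 5 = {(1, 2), (2, 3), (3, 4), (4, 5)}"
  "chain 0 6 = {(0, 1), (1, 2), (2, 3), (3, 4), (4, 5), (5, 6)}"
  "chain 0 7 = {(0, 1), (1, 2), (2, 3), (3, 4), (4, 5), (5, 6), (6, 7)}"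
  "chain (Suc 0) 3 = {(1, 2), (2, 3)}"
  "chain 0 4 = {(0, 1), (1, 2), (2, 3), (3, 4)}"
  "chain 0 2 = {(0, 1), (1, 2)}"
  "chain 0 (Suc 0) = {(0, 1)}"
  by (simp_all add: chain_rec[of _ "numeral _"] chain_rec[of _ "Suc 0"]; simp_all add: eval_nat_numeral)+

lemma edge_irrefl: "admissible X \<Longrightarrow> (i, j) \<in> dynkin_edges X \<Longrightarrow> i \<noteq> j"
  by (cases X) (auto simp: mem_chain)

lemma cartan_edge:
  assumes "admissible X" "(i, j) \<in> dynkin_edges X"
  shows "cartan_matrix X i j = - (case map_of (dynkin_arrows X) (i, j) of None \<Rightarrow> 1 | Some m \<Rightarrow> m)"
    "cartan_matrix X j i = - (case map_of (dynkin_arrows X) (j, i) of None \<Rightarrow> 1 | Some m \<Rightarrow> m)"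
  using assms edge_irrefl[OF assms] by (auto simp: cartan_matrix_def)

text \<open>Divided by the two labels, this says that the diagonal matrix of the ratios colabel /
  label symmetrizes the Cartan matrix. Multiplied out, the equation stays in the integers.\<close>

lemma cartan_symmetrizable_edge:
  assumes adm: "admissible X" and e: "(i, j) \<in> dynkin_edges X"
  shows "int (colabels X i) * cartan_matrix X i j * int (labels X j) =
         int (colabels X j) * cartan_matrix X j i * int (labels X i)"
  unfolding cartan_edge[OF adm e]
proof (cases X)
  case (Aff1_A l)
  then show "int (colabels X i) * - (case map_of (dynkin_arrows X) (i, j) of None \<Rightarrow> 1 | Some m \<Rightarrow> m) * int (labels X j) =
         int (colabels X j) * - (case map_of (dynkin_arrows X) (j, i) of None \<Rightarrow> 1 | Some m \<Rightarrow> m) * int (labels X i)" using adm e by (auto simp: mem_chain)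
qed (use adm e in \<open>auto simp: mem_chain chain_small\<close>)

text \<open>A row of a Cartan matrix is supported on a vertex and its neighbours. In the infinite
  families, some small members aside, these are at most four indices, so the kernel equations reduce
  to sums of two, three or four terms.\<close>

lemma sum_support2:
  fixes f :: "nat \<Rightarrow> int"
  assumes "\<And>j. j \<le> n \<Longrightarrow> j \<noteq> p \<Longrightarrow> j \<noteq> q \<Longrightarrow> f j = 0" "p \<le> n" "q \<le> n" "p \<noteq> q"
  shows "(\<Sum>j\<le>n. f j) = f p + f q"
proof -
  have "(\<Sum>j\<le>n. f j) = sum f {p, q}"
    by (rule sum.mono_neutral_right) (use assms in auto)
  then show ?thesis using assms by simp
qed

lemma sum_support3:
  fixes f :: "nat \<Rightarrow> int"
  assumes "\<And>j. j \<le> n \<Longrightarrow> j \<noteq> p \<Longrightarrow> j \<noteq> q \<Longrightarrow> j \<noteq> u \<Longrightarrow> f j = 0"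
    "p \<le> n" "q \<le> n" "u \<le> n" "p \<noteq> q" "p \<noteq> u" "q \<noteq> u"
  shows "(\<Sum>j\<le>n. f j) = f p + f q + f u"
proof -
  have "(\<Sum>j\<le>n. f j) = sum f {p, q, u}"
    by (rule sum.mono_neutral_right) (use assms in auto)
  then show ?thesis using assms by simp
qed

lemma sum_support4:
  fixes f :: "nat \<Rightarrow> int"
  assumes "\<And>j. j \<le> n \<Longrightarrow> j \<noteq> p \<Longrightarrow> j \<noteq> q \<Longrightarrow> j \<noteq> u \<Longrightarrow> j \<noteq> v \<Longrightarrow> f j = 0"
    "p \<le> n" "q \<le> n" "u \<le> n" "v \<le> n" "p \<noteq> q" "p \<noteq> u" "q \<noteq> u" "p \<noteq> v" "q \<noteq> v" "u \<noteq> v"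
  shows "(\<Sum>j\<le>n. f j) = f p + f q + f u + f v"
proof -
  have "(\<Sum>j\<le>n. f j) = sum f {p, q, u, v}"
    by (rule sum.mono_neutral_right) (use assms in auto)
  then show ?thesis using assms by simp
qed

lemma cartan_labels_A:
  assumes "l \<ge> 2" "i \<le> l"
  shows "(\<Sum>j\<le>l. cartan_matrix (Aff1_A l) i j * int (labels (Aff1_A l) j)) = 0"
proof -
  obtain m where m: "l = Suc m" "m \<ge> 1" using assms by (cases l) auto
  consider "i = 0" | "i = l" | k where "i = Suc k" "i < l" using assms by (cases i) force+
  then show ?thesis
  proof cases
    case 1 then show ?thesis using m by (subst sum_support3[of l 0 1 l]) (auto simp: cartan_simps)
  next
    case 2 then show ?thesis using m by (subst sum_support3[of l 0 m l]) (auto simp: cartan_simps)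
  next
    case 3 then show ?thesis using m by (subst sum_support3[of l k i "Suc i"]) (auto simp: cartan_simps)
  qed
qed

lemma cartan_labels_B:
  assumes "l \<ge> 3" "i \<le> l"
  shows "(\<Sum>j\<le>l. cartan_matrix (Aff1_B l) i j * int (labels (Aff1_B l) j)) = 0"
proof -
  obtain m where m: "l = Suc m" "m \<ge> 2" using assms by (cases l) auto
  consider "i = 0" | "i = 1" | "i = 2" | "i = l" "i \<ge> 3" | k where "i = Suc k" "i < l" "i \<ge> 3" using assms
    by (cases i) force+
  then show ?thesis
  proof cases
    case 1 then show ?thesis using m by (subst sum_support2[of l 0 2]) (auto simp: cartan_simps)
  next
    case 2 then show ?thesis using m by (subst sum_support2[of l 1 2]) (auto simp: cartan_simps)
  next
    case 3 then show ?thesis using m by (subst sum_support4[of l 0 1 2 3]) (auto simp: cartan_simps)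
  next
    case 4 then show ?thesis using m by (subst sum_support2[of l m l]) (auto simp: cartan_simps)
  next
    case 5 then show ?thesis using m by (subst sum_support3[of l k i "Suc i"]) (auto simp: cartan_simps)
  qed
qed

lemma cartan_labels_C:
  assumes "l \<ge> 2" "i \<le> l"
  shows "(\<Sum>j\<le>l. cartan_matrix (Aff1_C l) i j * int (labels (Aff1_C l) j)) = 0"
    "(\<Sum>j\<le>l. cartan_matrix (Aff2_A_even l) i j * int (labels (Aff2_A_even l) j)) = 0"
    "(\<Sum>j\<le>l. cartan_matrix (Aff2_D l) i j * int (labels (Aff2_D l) j)) = 0"
proof -
  obtain m where m: "l = Suc m" "m \<ge> 1" using assms by (cases l) auto
  consider "i = 0" | "i = l" | k where "i = Suc k" "i < l" using assms by (cases i) force+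
  note c = this
  show "(\<Sum>j\<le>l. cartan_matrix (Aff1_C l) i j * int (labels (Aff1_C l) j)) = 0" using c
  proof cases
    case 1 then show ?thesis using m by (subst sum_support2[of l 0 1]) (auto simp: cartan_simps)
  next
    case 2 then show ?thesis using m by (subst sum_support2[of l m l]) (auto simp: cartan_simps)
  next
    case 3 then show ?thesis using m by (subst sum_support3[of l k i "Suc i"]) (auto simp: cartan_simps)
  qed
  show "(\<Sum>j\<le>l. cartan_matrix (Aff2_A_even l) i j * int (labels (Aff2_A_even l) j)) = 0" using c
  proof cases
    case 1 then show ?thesis using m by (subst sum_support2[of l 0 1]) (auto simp: cartan_simps)
  next
    case 2 then show ?thesis using m by (subst sum_support2[of l m l]) (auto simp: cartan_simps)
  next
    case 3 then show ?thesis using m by (subst sum_support3[of l k i "Suc i"]) (auto simp: cartan_simps)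
  qed
  show "(\<Sum>j\<le>l. cartan_matrix (Aff2_D l) i j * int (labels (Aff2_D l) j)) = 0" using c
  proof cases
    case 1 then show ?thesis using m by (subst sum_support2[of l 0 1]) (auto simp: cartan_simps)
  next
    case 2 then show ?thesis using m by (subst sum_support2[of l m l]) (auto simp: cartan_simps)
  next
    case 3 then show ?thesis using m by (subst sum_support3[of l k i "Suc i"]) (auto simp: cartan_simps)
  qed
qed

lemma cartan_labels_A2odd:
  assumes "l \<ge> 3" "i \<le> l"
  shows "(\<Sum>j\<le>l. cartan_matrix (Aff2_A_odd l) i j * int (labels (Aff2_A_odd l) j)) = 0"
proof -
  obtain m where m: "l = Suc m" "m \<ge> 2" using assms by (cases l) auto
  consider "i = 0" | "i = 1" | "i = 2" | "i = l" "i \<ge> 3" | k where "i = Suc k" "i < l" "i \<ge> 3" using assms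
    by (cases i) force+
  then show ?thesis
  proof cases
    case 1 then show ?thesis using m by (subst sum_support2[of l 0 2]) (auto simp: cartan_simps)
  next
    case 2 then show ?thesis using m by (subst sum_support2[of l 1 2]) (auto simp: cartan_simps)
  next
    case 3 then show ?thesis using m by (subst sum_support4[of l 0 1 2 3]) (auto simp: cartan_simps)
  next
    case 4 then show ?thesis using m by (subst sum_support2[of l m l]) (auto simp: cartan_simps)
  next
    case 5 then show ?thesis using m by (subst sum_support3[of l k i "Suc i"]) (auto simp: cartan_simps)
  qed
qed

lemma cartan_labels_D:
  assumes "l \<ge> 5" "i \<le> l"
  shows "(\<Sum>j\<le>l. cartan_matrix (Aff1_D l) i j * int (labels (Aff1_D l) j)) = 0"
proof -
  obtain m where m: "l = Suc (Suc (Suc m))" "m \<ge> 2" using assms(1) by (intro that[of "l - 3"]) auto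
  consider "i = 0" | "i = 1" | "i = 2" | "i = Suc m" | "i = Suc (Suc m)" | "i = l" | k where "i = Suc k" "k < m" "i \<ge> 3"
    using assms m by (cases i) force+
  then show ?thesis
  proof cases
    case 1 then show ?thesis using m by (subst sum_support2[of l 0 2]) (auto simp: cartan_simps)
  next
    case 2 then show ?thesis using m by (subst sum_support2[of l 1 2]) (auto simp: cartan_simps)
  next
    case 3 then show ?thesis using m by (subst sum_support4[of l 0 1 2 3]) (auto simp: cartan_simps)
  next
    case 4 then show ?thesis using m by (subst sum_support4[of l m i "Suc i" l]) (auto simp: cartan_simps)
  next
    case 5 then show ?thesis using m by (subst sum_support2[of l "Suc m" i]) (auto simp: cartan_simps)
  next
    case 6 then show ?thesis using m by (subst sum_support2[of l "Suc m" i]) (auto simp: cartan_simps)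
  next
    case 7 then show ?thesis using m by (subst sum_support3[of l k i "Suc i"]) (auto simp: cartan_simps)
  qed
qed

lemma atMost_small:
  "{..Suc 0} = {0,1}" "{..2::nat} = {0,1,2}" "{..4::nat} = {0,1,2,3,4}" "{..6::nat} = {0,1,2,3,4,5,6}"
  "{..7::nat} = {0,1,2,3,4,5,6,7}" "{..8::nat} = {0,1,2,3,4,5,6,7,8}"
  by auto

text \<open>Next to the exceptional types, the list contains the members of infinite families where
  the general pattern of neighbours degenerates: A_1^(1) and A_2^(2), with a single bond, and
  D_4^(1), where the two branch vertices coincide.\<close>

lemma cartan_labels_exceptional:
  assumes "X \<in> {Aff1_E6, Aff1_E7, Aff1_E8, Aff1_F4, Aff1_G2, Aff2_E6, Aff3_D4, Aff1_A 1, Aff1_D 4, Aff2_A_even 1}"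
    "i \<in> {..affine_rank X}"
  shows "(\<Sum>j\<in>{..affine_rank X}. cartan_matrix X i j * int (labels X j)) = 0"
  using assms by (auto simp: atMost_small cartan_matrix_def chain_small)

lemma cartan_labels:
  assumes "admissible X" "i \<le> affine_rank X"
  shows "(\<Sum>j\<le>affine_rank X. cartan_matrix X i j * int (labels X j)) = 0"
proof (cases X)
  case (Aff1_A l)
  then show ?thesis using assms cartan_labels_A[of l i] cartan_labels_exceptional[of X i] by (cases "l = 1") auto
next
  case (Aff1_D l)
  then show ?thesis using assms cartan_labels_D[of l i] cartan_labels_exceptional[of X i] by (cases "l = 4") auto
next
  case (Aff2_A_even l)
  then show ?thesis using assms cartan_labels_C(2)[of l i] cartan_labels_exceptional[of X i] by (cases "l = 1") auto
qed (use assms cartan_labels_B cartan_labels_C cartan_labels_A2odd cartan_labels_exceptional[of X i] in auto)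

text \<open>The ratio colabel / label is half the squared length of the simple root, so its only
  values are 1, q and 1/q. Here q = 3 is taken for G_2^(1) and D_4^(3) alone; three different
  lengths occur only for A_2l^(2).\<close>

lemma label_ratio_cases:
  assumes "admissible X"
  obtains q where "q \<in> {2, 3}" "\<forall>i\<le>affine_rank X. colabels X i = labels X i \<or>
     colabels X i = q * labels X i \<or> labels X i = q * colabels X i"
proof (cases "X = Aff1_G2 \<or> X = Aff3_D4")
  case True
  then show ?thesis using that[of 3] by (auto simp: le_numeral_cases le_Suc_eq)
next
  case False
  have "\<forall>i\<le>affine_rank X. colabels X i = labels X i \<or>
     colabels X i = 2 * labels X i \<or> labels X i = 2 * colabels X i"
    using False assms by (cases X) (auto simp: le_numeral_cases le_Suc_eq)
  then show ?thesis using that[of 2] by auto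
qed

text \<open>Read as statements on half squared lengths, this and the next two lemmas say that the
  longest simple roots have the value r and that every other value is 1/n: the dichotomy behind the
  factor \<gamma>.\<close>

lemma colabels_le_twist: "admissible X \<Longrightarrow> i \<le> affine_rank X \<Longrightarrow> colabels X i \<le> affine_twist X * labels X i"
  by (cases X) (auto simp: le_numeral_cases le_Suc_eq)

lemma colabels_eq_twist:
  assumes "admissible X"
  shows "\<exists>i\<le>affine_rank X. colabels X i = affine_twist X * labels X i"
  using assms
  by (intro exI[of _ "case X of Aff2_A_even n \<Rightarrow> n | Aff2_A_odd n \<Rightarrow> n | Aff2_D n \<Rightarrow> 1 | Aff2_E6 \<Rightarrow> 3 | Aff3_D4 \<Rightarrow> 2 | _ \<Rightarrow> 0"])
     (cases X; auto)

lemma colabels_twist_or_dvd: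
  "admissible X \<Longrightarrow> i \<le> affine_rank X \<Longrightarrow> colabels X i = affine_twist X * labels X i \<or> colabels X i dvd labels X i"
  by (cases X) (auto simp: le_numeral_cases le_Suc_eq)

text \<open>From here to \<open>colabels_eq_label_0\<close>: the arithmetic of labels that will put
  the basis of \<open>M_hat\<close>, the root \<open>theta\<close> and the translation
  \<open>mu0\<close> into their lattices, and that gives \<theta> the length of a simple
  root.\<close>

lemma untwisted_label_0: "admissible X \<Longrightarrow> affine_twist X = 1 \<Longrightarrow> labels X 0 = 1"
  by (cases X) auto

lemma twisted_labels_dvd:
  "admissible X \<Longrightarrow> affine_twist X \<noteq> 1 \<Longrightarrow> i \<in> {1..affine_rank X} \<Longrightarrow> labels X i dvd colabels X i"
  by (cases X) (auto simp: le_numeral_cases le_Suc_eq)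

lemma label_0_dvd_colabels:
  "admissible X \<Longrightarrow> i \<in> {1..affine_rank X} \<Longrightarrow> labels X 0 dvd colabels X i"
  by (cases X) (auto simp: le_numeral_cases le_Suc_eq)

lemma label_0_dvd_cartan:
  assumes "admissible X" shows "int (labels X 0) dvd cartan_matrix X 0 i"
proof (cases "\<exists>n. X = Aff2_A_even n")
  case True
  then show ?thesis using assms by (auto simp: cartan_simps)
next
  case False
  then have "labels X 0 = 1" using assms by (cases X) auto
  then show ?thesis by simp
qed

lemma colabels_eq_label_0:
  assumes "admissible X"
  shows "\<exists>i\<le>affine_rank X. colabels X i = labels X 0 * labels X i"
  using assms by (intro exI[of _ "case X of Aff2_A_even n \<Rightarrow> n | _ \<Rightarrow> 0"]) (cases X; auto)

lemma chain_closed: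
  assumes "P m" "\<And>i. m \<le> i \<Longrightarrow> i < n \<Longrightarrow> P i \<Longrightarrow> P (Suc i)" "m \<le> i" "i \<le> n"
  shows "P (i::nat)"
  using assms(3,4) by (induction i rule: dec_induct) (use assms(1,2) in auto)

text \<open>Connectedness of the diagram as an induction principle starting at vertex 0. The step is
  an equivalence because edges are stored as ordered pairs and may have to be crossed in either
  direction.\<close>

lemma dynkin_connected:
  assumes adm: "admissible X" and P0: "P 0"
    and cl: "\<And>i j. (i, j) \<in> dynkin_edges X \<Longrightarrow> P i \<longleftrightarrow> P j" and i: "i \<le> affine_rank X"
  shows "P i"
proof -
  have ch: "P m \<Longrightarrow> chain m n \<subseteq> dynkin_edges X \<Longrightarrow> m \<le> k \<Longrightarrow> k \<le> n \<Longrightarrow> P k" for m n k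
    using chain_closed[of P m n k] cl by (auto simp: subset_iff mem_chain)
  show ?thesis
  proof (cases X)
    case (Aff1_B n)
    then have "P 1" using cl[of 0 2] cl[of 1 2] P0 adm by (auto simp: mem_chain)
    then show ?thesis using ch[of 1 n i] Aff1_B P0 i by (cases "i = 0") auto
  next
    case (Aff2_A_odd n)
    then have "P 1" using cl[of 0 2] cl[of 1 2] P0 adm by (auto simp: mem_chain)
    then show ?thesis using ch[of 1 n i] Aff2_A_odd P0 i by (cases "i = 0") auto
  next
    case (Aff1_D n)
    then have "P 1" using cl[of 0 2] cl[of 1 2] P0 adm by (auto simp: mem_chain)
    then have *: "P k" if "1 \<le> k" "k \<le> n - 1" for k using ch[of 1 "n - 1" k] Aff1_D that by auto
    then have "P n" using cl[of "n - 2" n] Aff1_D adm *[of "n - 2"] by auto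
    then show ?thesis using * Aff1_D P0 i by (cases "i = 0"; cases "i = n") auto
  next
    case Aff1_E6
    then have 6: "P 6" and "P 1" using cl[of 6 0] cl[of 3 6] cl[of 2 3] cl[of 1 2] P0 by (auto simp: mem_chain)
    then show ?thesis using ch[of 1 5 i] Aff1_E6 P0 i by (cases "i = 0"; cases "i = 6") auto
  next
    case Aff1_E7
    have "P 3" using ch[of 0 6 3] Aff1_E7 P0 by auto
    then have "P 7" using cl[of 3 7] Aff1_E7 by auto
    then show ?thesis using ch[of 0 6 i] Aff1_E7 P0 i by (cases "i = 7") auto
  next
    case Aff1_E8
    have "P 5" using ch[of 0 7 5] Aff1_E8 P0 by auto
    then have "P 8" using cl[of 5 8] Aff1_E8 by auto
    then show ?thesis using ch[of 0 7 i] Aff1_E8 P0 i by (cases "i = 8") auto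
  qed (use ch[of 0 "affine_rank X" i] P0 i in auto)
qed

text \<open>Perron--Frobenius: a vector in the kernel is a multiple of the positive one, as one sees at an
  index where the ratio of the two is minimal.\<close>

lemma cartan_kernel_unique:
  fixes b c :: "nat \<Rightarrow> real"
  assumes adm: "admissible X"
    and M: "M = cartan_matrix X \<or> M = (\<lambda>i j. cartan_matrix X j i)"
    and b: "\<And>i. i \<le> affine_rank X \<Longrightarrow> 0 < b i" "\<And>i. i \<le> affine_rank X \<Longrightarrow> (\<Sum>j\<le>affine_rank X. M i j * b j) = 0"
    and c: "\<And>i. i \<le> affine_rank X \<Longrightarrow> (\<Sum>j\<le>affine_rank X. M i j * c j) = 0"
  obtains q where "\<And>i. i \<le> affine_rank X \<Longrightarrow> c i = q * b i"
proof -
  let ?n = "affine_rank X"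
  define q where "q = Min ((\<lambda>i. c i / b i) ` {..?n})"
  have q: "q \<le> c i / b i" if "i \<le> ?n" for i unfolding q_def using that by auto
  have "q \<in> (\<lambda>i. c i / b i) ` {..?n}" unfolding q_def by (intro Min_in) auto
  then obtain k where k: "k \<le> ?n" "q = c k / b k" by auto
  define e where "e i = c i - q * b i" for i
  have e0: "0 \<le> e i" if "i \<le> ?n" for i
    using q[OF that] b(1)[OF that] by (auto simp: e_def field_simps)
  have ek: "e k = 0" using k b(1)[of k] by (auto simp: e_def)
  have es: "(\<Sum>j\<le>?n. M i j * e j) = 0" if "i \<le> ?n" for i
  proof -
    have "(\<Sum>j\<le>?n. M i j * e j) = (\<Sum>j\<le>?n. M i j * c j) - q * (\<Sum>j\<le>?n. M i j * b j)"
      by (simp add: e_def sum_distrib_left sum_subtractf algebra_simps)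
    then show ?thesis using b c that by simp
  qed
  have Mneg: "M i j \<le> 0" if "i \<noteq> j" for i j using M cartan_nonpos that by (metis (full_types))
  \<comment> \<open>At a zero of \<open>e\<close> all summands of the kernel equation have the same
    sign, so \<open>e\<close> vanishes at every neighbour too.\<close>
  have step: "e j = 0" if "e i = 0" "i \<le> ?n" "j \<le> ?n" "M i j \<noteq> 0" for i j
  proof -
    have "(\<Sum>j\<le>?n. - (M i j * e j)) = 0" using es[OF that(2)] by (simp add: sum_negf)
    moreover have "0 \<le> - (M i j * e j)" if "j \<le> ?n" for j
      using Mneg[of i j] e0[OF that] \<open>e i = 0\<close> by (cases "i = j") (auto simp: mult_nonpos_nonneg)
    ultimately have "- (M i j * e j) = 0" using sum_nonneg_eq_0_iff[of "{..?n}" "\<lambda>j. - (M i j * e j)"] that by auto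
    then show ?thesis using that by simp
  qed
  have edge: "i \<le> ?n \<and> j \<le> ?n" if "(i, j) \<in> dynkin_edges X" for i j
    using that adm by (cases X) (auto simp: mem_chain)
  have cl: "e i = 0 \<longleftrightarrow> e j = 0" if "(i, j) \<in> dynkin_edges X" for i j
    using step[of i j] step[of j i] edge[OF that] that M cartan_nonzero_iff[of X i j] cartan_nonzero_iff[of X j i] by auto
  have "e 0 = 0"
  proof (rule ccontr)
    assume "e 0 \<noteq> 0"
    then have "e k \<noteq> 0" using dynkin_connected[OF adm, of "\<lambda>i. e i \<noteq> 0" k] cl k by auto
    then show False using ek by simp
  qed
  then have "e i = 0" if "i \<le> ?n" for i using dynkin_connected[OF adm, of "\<lambda>i. e i = 0" i] cl that by auto
  then show ?thesis using that[of q] by (auto simp: e_def)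
qed

lemma label_eq_1: "admissible X \<Longrightarrow> \<exists>i\<le>affine_rank X. labels X i = 1"
  by (intro exI[of _ "case X of Aff2_A_even n \<Rightarrow> n | _ \<Rightarrow> 0"]) (cases X; auto)

lemma cartan_symmetrizable:
  assumes adm: "admissible X"
  shows "int (colabels X i) * cartan_matrix X i j * int (labels X j) =
         int (colabels X j) * cartan_matrix X j i * int (labels X i)"
proof (cases "cartan_matrix X i j \<noteq> 0 \<or> cartan_matrix X j i \<noteq> 0")
  case True
  then consider "i = j" | "(i, j) \<in> dynkin_edges X" | "(j, i) \<in> dynkin_edges X"
    using cartan_nonzero_iff[of X i j] cartan_nonzero_iff[of X j i] by metis
  then show ?thesis using cartan_symmetrizable_edge[OF adm] by cases auto
qed auto

text \<open>No second pass through the types: symmetrizability turns the transposed kernel equation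
  into the one for the labels.\<close>

lemma cartan_colabels:
  assumes adm: "admissible X" and i: "i \<le> affine_rank X"
  shows "(\<Sum>j\<le>affine_rank X. cartan_matrix X j i * int (colabels X j)) = 0"
proof -
  have "int (labels X i) * (\<Sum>j\<le>affine_rank X. cartan_matrix X j i * int (colabels X j)) =
    (\<Sum>j\<le>affine_rank X. int (colabels X j) * cartan_matrix X j i * int (labels X i))"
    by (simp add: sum_distrib_left mult_ac)
  also have "\<dots> = int (colabels X i) * (\<Sum>j\<le>affine_rank X. cartan_matrix X i j * int (labels X j))"
    unfolding sum_distrib_left
  proof (intro sum.cong refl)
    fix j
    show "int (colabels X j) * cartan_matrix X j i * int (labels X i) =
      int (colabels X i) * (cartan_matrix X i j * int (labels X j))"
      using cartan_symmetrizable[OF adm, of j i] by (simp add: mult.assoc)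
  qed
  finally show ?thesis using cartan_labels[OF adm i] labels_pos[OF i adm] by simp
qed

lemma Gcd_image_mult_nat: "finite A \<Longrightarrow> Gcd ((\<lambda>j. c * f j) ` A) = c * Gcd (f ` A)" for c :: nat
proof -
  have "(\<lambda>j. c * f j) ` A = (*) c ` (f ` A)" by auto
  then show ?thesis by (simp only: Gcd_mult) simp
qed

text \<open>An entry 1 makes the gcd of \<open>f\<close> equal to 1. Any other candidate
  \<open>a\<close> is proportional to \<open>f\<close> by \<open>cartan_kernel_unique\<close>;
  taking the gcd over j in a_i f_j = f_i a_j leaves a_i = f_i.\<close>

lemma kernel_labels_eqI:
  assumes adm: "admissible X"
    and M: "M = cartan_matrix X \<or> M = (\<lambda>i j. cartan_matrix X j i)"
    and f: "\<And>i. i \<le> affine_rank X \<Longrightarrow> 0 < f i" "\<And>i. i > affine_rank X \<Longrightarrow> f i = 0"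
      "\<exists>i\<le>affine_rank X. f i = 1"
      "\<And>i. i \<le> affine_rank X \<Longrightarrow> (\<Sum>j\<le>affine_rank X. M i j * int (f j)) = 0"
  shows "kernel_labels (affine_rank X) M = f"
proof -
  let ?n = "affine_rank X"
  have gcd_f: "Gcd (f ` {..?n}) = 1"
  proof -
    obtain i where "i \<le> ?n" "f i = 1" using f(3) by auto
    then have "Gcd (f ` {..?n}) dvd 1" by (metis Gcd_dvd atMost_iff imageI)
    then show ?thesis by simp
  qed
  show ?thesis unfolding kernel_labels_def
  proof (rule the_equality)
    show "(\<forall>i\<le>?n. 0 < f i) \<and> (\<forall>i>?n. f i = 0) \<and> Gcd (f ` {..?n}) = 1 \<and> (\<forall>i\<le>?n. (\<Sum>j\<le>?n. M i j * int (f j)) = 0)"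
      using f gcd_f by auto
  next
    fix a assume a: "(\<forall>i\<le>?n. 0 < a i) \<and> (\<forall>i>?n. a i = 0) \<and> Gcd (a ` {..?n}) = 1 \<and> (\<forall>i\<le>?n. (\<Sum>j\<le>?n. M i j * int (a j)) = 0)"
    have real_sum: "(\<Sum>j\<le>?n. real_of_int (M i j) * real (g j)) = real_of_int (\<Sum>j\<le>?n. M i j * int (g j))" for g i
      by simp
    obtain q where q: "\<And>i. i \<le> ?n \<Longrightarrow> real (a i) = q * real (f i)"
    proof (rule cartan_kernel_unique[OF adm M, of "\<lambda>i. real (f i)" "\<lambda>i. real (a i)"])
      show "0 < real (f i)" if "i \<le> ?n" for i using f(1)[OF that] by simp
      show "(\<Sum>j\<le>?n. real_of_int (M i j) * real (f j)) = 0" if "i \<le> ?n" for i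
        unfolding real_sum using f(4)[OF that] by simp
      show "(\<Sum>j\<le>?n. real_of_int (M i j) * real (a j)) = 0" if "i \<le> ?n" for i
        unfolding real_sum using a that by simp
    qed blast
    have cross: "a i * f j = f i * a j" if "i \<le> ?n" "j \<le> ?n" for i j
    proof -
      have "real (a i * f j) = real (f i * a j)" using q[OF that(1)] q[OF that(2)] by simp
      then show ?thesis using of_nat_eq_iff by blast
    qed
    show "a = f"
    proof
      fix i
      show "a i = f i"
      proof (cases "i \<le> ?n")
        case True
        have "(\<lambda>j. a i * f j) ` {..?n} = (\<lambda>j. f i * a j) ` {..?n}"
          using cross[OF True] by (intro image_cong) auto
        then have "a i * Gcd (f ` {..?n}) = f i * Gcd (a ` {..?n})" by (metis Gcd_image_mult_nat finite_atMost)
        then show ?thesis using gcd_f a by simp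
      next
        case False
        then show ?thesis using a f(2) by simp
      qed
    qed
  qed
qed

section \<open>The positive semidefinite form on the real span of the simple roots\<close>

context affine_datum
begin

lemma lab_eq: "lab = labels X"
  unfolding lab_def
  by (rule kernel_labels_eqI[OF admissible])
     (use admissible labels_pos labels_zero label_eq_1 cartan_labels in auto)

lemma colab_eq: "colab = colabels X"
  unfolding colab_def
  by (rule kernel_labels_eqI[OF admissible])
     (use admissible labels_pos labels_zero colabel_0 cartan_colabels in auto)

abbreviation ar :: "nat \<Rightarrow> nat \<Rightarrow> real" where "ar i j \<equiv> real_of_int (a_mat i j)"
abbreviation lr :: "nat \<Rightarrow> real" where "lr i \<equiv> real (lab i)"

text \<open>Half the squared length of \<alpha>_i in the normalized form, and at the same time the
  factor by which row i of the Cartan matrix is multiplied to symmetrize it.\<close>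

definition half_norm :: "nat \<Rightarrow> real" where "half_norm i = real (colab i) / real (lab i)"

lemma lr_pos: "i \<le> l \<Longrightarrow> 0 < lr i" using labels_pos admissible by (simp add: lab_eq)
lemma colab_pos: "i \<le> l \<Longrightarrow> 0 < colab i" using labels_pos admissible by (simp add: colab_eq)
lemma half_norm_pos: "i \<le> l \<Longrightarrow> 0 < half_norm i" using lr_pos colab_pos by (simp add: half_norm_def)
lemma colab_0: "colab 0 = 1" using colabel_0 admissible by (simp add: colab_eq)

lemma ar_lr: "i \<le> l \<Longrightarrow> (\<Sum>j\<le>l. ar i j * lr j) = 0"
  using arg_cong[OF cartan_labels[OF admissible, of i], of real_of_int] unfolding lab_eq by simp

lemma ar_colab: "i \<le> l \<Longrightarrow> (\<Sum>j\<le>l. ar j i * real (colab j)) = 0"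
  using arg_cong[OF cartan_colabels[OF admissible, of i], of real_of_int] unfolding colab_eq by simp

lemma half_norm_ar_sym:
  assumes "i \<le> l" "j \<le> l" shows "half_norm i * ar i j = half_norm j * ar j i"
proof -
  have "real (colab i) * ar i j * lr j = real (colab j) * ar j i * lr i"
    using arg_cong[OF cartan_symmetrizable[OF admissible, of i j], of real_of_int] unfolding lab_eq colab_eq by simp
  then show ?thesis using lr_pos[OF assms(1)] lr_pos[OF assms(2)] by (simp add: half_norm_def field_simps)
qed

lemma ar_nonpos: "i \<noteq> j \<Longrightarrow> ar i j \<le> 0" using cartan_nonpos by simp

text \<open>The normalized form on the real span of the simple roots. It is kept apart from the
  complex \<open>form\<close> because positivity and minimal norms need an order.\<close>

definition B :: "(nat \<Rightarrow> real) \<Rightarrow> (nat \<Rightarrow> real) \<Rightarrow> real" where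
  "B x y = (\<Sum>i\<le>l. \<Sum>j\<le>l. x i * y j * (half_norm i * ar i j))"

lemma B_sym: "B x y = B y x"
proof -
  have "B x y = (\<Sum>j\<le>l. \<Sum>i\<le>l. x i * y j * (half_norm i * ar i j))" unfolding B_def by (rule sum.swap)
  also have "\<dots> = B y x" unfolding B_def
    by (intro sum.cong refl) (simp add: half_norm_ar_sym mult_ac)
  finally show ?thesis .
qed

lemma B_lin: "B (\<lambda>i. p * x i + q * z i) y = p * B x y + q * B z y"
  by (simp add: B_def sum_distrib_left sum.distrib algebra_simps)

lemma B_lin': "B y (\<lambda>i. p * x i + q * z i) = p * B y x + q * B y z"
  by (simp add: B_sym[of y] B_lin)

definition er :: "nat \<Rightarrow> nat \<Rightarrow> real" where "er i = (\<lambda>j. if j = i then 1 else 0)"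

lemma B_er: assumes "i \<le> l" shows "B (er i) y = half_norm i * (\<Sum>j\<le>l. ar i j * y j)"
proof -
  have "B (er i) y = (\<Sum>k\<le>l. if k = i then \<Sum>j\<le>l. y j * (half_norm i * ar i j) else 0)"
    unfolding B_def er_def by (intro sum.cong refl) auto
  then show ?thesis using assms by (simp add: sum_distrib_left mult_ac)
qed

lemma B_er_er: "i \<le> l \<Longrightarrow> B (er i) (er i) = 2 * half_norm i"
  by (simp add: B_er) (simp add: er_def if_distrib cong: if_cong)

lemma B_expand: "B x x = (\<Sum>i\<le>l. x i * B (er i) x)"
  unfolding B_def[of x x] by (intro sum.cong refl) (simp add: B_er sum_distrib_left mult_ac)

text \<open>In the coordinates \<open>x\<^sub>i / a\<^sub>i\<close> the form becomes a nonnegative combination of squares of differences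
  along the edges of the Dynkin diagram.\<close>

lemma B_squares:
  "2 * B x x = (\<Sum>i\<le>l. \<Sum>j\<le>l. - (half_norm i * ar i j * lr i * lr j) * (x i / lr i - x j / lr j)\<^sup>2)"
proof -
  define b where "b i j = half_norm i * ar i j * lr i * lr j" for i j
  define y where "y i = x i / lr i" for i
  have b_sym: "b i j = b j i" if "i \<le> l" "j \<le> l" for i j
    using half_norm_ar_sym[OF that] by (simp add: b_def)
  \<comment> \<open>The labels lie in the kernel, so the rows of the rescaled matrix sum to zero.
    This is what removes the pure squares from the expansion of the squared differences.\<close>
  have row: "(\<Sum>j\<le>l. b i j) = 0" if "i \<le> l" for i
  proof -
    have "(\<Sum>j\<le>l. b i j) = half_norm i * lr i * (\<Sum>j\<le>l. ar i j * lr j)"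
      by (simp add: b_def sum_distrib_left mult_ac)
    then show ?thesis using ar_lr[OF that] by simp
  qed
  have r1: "(\<Sum>i\<le>l. \<Sum>j\<le>l. b i j * (y i)\<^sup>2) = 0"
    using row by (simp add: sum_distrib_right[symmetric])
  have "(\<Sum>i\<le>l. \<Sum>j\<le>l. b i j * (y j)\<^sup>2) = (\<Sum>j\<le>l. \<Sum>i\<le>l. b i j * (y j)\<^sup>2)" by (rule sum.swap)
  also have "\<dots> = (\<Sum>j\<le>l. \<Sum>i\<le>l. b j i * (y j)\<^sup>2)" by (intro sum.cong refl) (simp add: b_sym)
  finally have r2: "(\<Sum>i\<le>l. \<Sum>j\<le>l. b i j * (y j)\<^sup>2) = 0" using r1 by simp
  have "(\<Sum>i\<le>l. \<Sum>j\<le>l. - b i j * (y i - y j)\<^sup>2) =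
    (\<Sum>i\<le>l. \<Sum>j\<le>l. 2 * (b i j * y i * y j) - b i j * (y i)\<^sup>2 - b i j * (y j)\<^sup>2)"
    by (intro sum.cong refl) (simp add: power2_eq_square algebra_simps)
  also have "\<dots> = 2 * (\<Sum>i\<le>l. \<Sum>j\<le>l. b i j * y i * y j)"
    using r1 r2 by (simp add: sum_subtractf sum_distrib_left)
  also have "(\<Sum>i\<le>l. \<Sum>j\<le>l. b i j * y i * y j) = B x x" unfolding B_def
  proof (intro sum.cong refl)
    fix i j assume "i \<in> {..l}" "j \<in> {..l}"
    then have "lr i \<noteq> 0" "lr j \<noteq> 0" using lr_pos[of i] lr_pos[of j] by auto
    then show "b i j * y i * y j = x i * x j * (half_norm i * ar i j)" by (simp add: b_def y_def)
  qed
  finally show ?thesis by (simp add: b_def y_def)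
qed

lemma B_squares_term_nonneg:
  "i \<le> l \<Longrightarrow> j \<le> l \<Longrightarrow> 0 \<le> - (half_norm i * ar i j * lr i * lr j) * (x i / lr i - x j / lr j)\<^sup>2"
proof (cases "i = j")
  case False
  assume ij: "i \<le> l" "j \<le> l"
  have "half_norm i * ar i j * lr i * lr j \<le> 0"
    using ar_nonpos[OF False] half_norm_pos[OF ij(1)] lr_pos[OF ij(1)] lr_pos[OF ij(2)]
    by (simp add: mult_nonneg_nonpos mult_nonpos_nonneg)
  then show ?thesis by (simp add: mult_nonpos_nonneg)
qed auto

lemma B_nonneg: "0 \<le> B x x"
proof -
  have "0 \<le> 2 * B x x" unfolding B_squares
    by (intro sum_nonneg B_squares_term_nonneg) simp_all
  then show ?thesis by simp
qed

lemma B_squares_term_le: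
  assumes "i \<le> l" "j \<le> l"
  shows "- (half_norm i * ar i j * lr i * lr j) * (x i / lr i - x j / lr j)\<^sup>2 \<le> 2 * B x x"
proof -
  define f where "f i j = - (half_norm i * ar i j * lr i * lr j) * (x i / lr i - x j / lr j)\<^sup>2" for i j
  have nn: "0 \<le> f i j" if "i \<le> l" "j \<le> l" for i j
    unfolding f_def using that by (rule B_squares_term_nonneg)
  have "f i j \<le> (\<Sum>j\<le>l. f i j)"
    by (rule member_le_sum) (use assms nn in auto)
  also have "\<dots> \<le> (\<Sum>i\<le>l. \<Sum>j\<le>l. f i j)"
    by (rule member_le_sum[of i "{..l}" "\<lambda>i. \<Sum>j\<le>l. f i j"]) (use assms nn in \<open>auto intro!: sum_nonneg\<close>)
  also have "\<dots> = 2 * B x x" unfolding B_squares f_def ..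
  finally show ?thesis unfolding f_def .
qed

lemma edge_le: "(i, j) \<in> dynkin_edges X \<Longrightarrow> i \<le> l \<and> j \<le> l"
  using admissible by (cases X) (auto simp: mem_chain)

lemma edge_coeff_pos:
  assumes "(i, j) \<in> dynkin_edges X" shows "0 < - (half_norm i * ar i j * lr i * lr j)"
proof -
  have ij: "i \<noteq> j" using edge_irrefl[OF admissible assms] .
  have "ar i j \<noteq> 0" using cartan_nonzero_iff[of X i j] assms by simp
  then have "ar i j < 0" using ar_nonpos[OF ij] by simp
  then show ?thesis using half_norm_pos lr_pos edge_le[OF assms] by (simp add: mult_pos_neg mult_neg_pos)
qed

text \<open>All squares in \<open>B_squares\<close> have to vanish, and connectedness makes x_i /
  a_i constant: the radical of the form is spanned by \<delta>.\<close>

lemma B_eq_0_imp: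
  assumes "B x x = 0" "i \<le> l"
  shows "x i = x 0 / lr 0 * lr i"
proof -
  have "x i / lr i = x 0 / lr 0"
  proof (rule dynkin_connected[OF admissible, of "\<lambda>i. x i / lr i = x 0 / lr 0"])
    fix i j assume e: "(i, j) \<in> dynkin_edges X"
    have "- (half_norm i * ar i j * lr i * lr j) * (x i / lr i - x j / lr j)\<^sup>2 \<le> 0"
      using B_squares_term_le[of i j x] edge_le[OF e] assms(1) by simp
    moreover have "0 \<le> (x i / lr i - x j / lr j)\<^sup>2" by simp
    ultimately have "(x i / lr i - x j / lr j)\<^sup>2 = 0"
      using edge_coeff_pos[OF e] by (metis mult_pos_pos not_le order_le_less)
    then show "x i / lr i = x 0 / lr 0 \<longleftrightarrow> x j / lr j = x 0 / lr 0" by simp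
  qed (use assms in auto)
  then show ?thesis using lr_pos[OF assms(2)] by (simp add: field_simps)
qed

text \<open>A multiple of \<delta> with one coordinate zero is zero, all labels being positive. So
  the form is definite on vectors that miss a coordinate; this applies to the positive and negative
  parts of a vector of mixed sign and to the span of \<alpha>_1, ..., \<alpha>_l.\<close>

lemma B_pos:
  assumes "j \<le> l" "x j = 0" "i \<le> l" "x i \<noteq> 0"
  shows "0 < B x x"
proof (rule ccontr)
  assume "\<not> 0 < B x x"
  then have z: "B x x = 0" using B_nonneg[of x] by simp
  have "x 0 = 0" using B_eq_0_imp[OF z assms(1)] assms(2) lr_pos[OF assms(1)] lr_pos[of 0] by simp
  then show False using B_eq_0_imp[OF z assms(3)] assms(4) by simp
qed

lemma B_disjoint_nonpos:
  assumes "\<And>i. i \<le> l \<Longrightarrow> 0 \<le> x i" "\<And>i. i \<le> l \<Longrightarrow> 0 \<le> y i" "\<And>i. i \<le> l \<Longrightarrow> x i = 0 \<or> y i = 0"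
  shows "B x y \<le> 0"
  unfolding B_def
proof (intro sum_nonpos)
  fix i j assume ij: "i \<in> {..l}" "j \<in> {..l}"
  show "x i * y j * (half_norm i * ar i j) \<le> 0"
  proof (cases "i = j")
    case True then show ?thesis using assms(3)[of i] ij by auto
  next
    case False
    have "0 \<le> x i * y j" using assms(1)[of i] assms(2)[of j] ij by simp
    moreover have "half_norm i * ar i j \<le> 0" using ar_nonpos[OF False] half_norm_pos[of i] ij by (simp add: mult_nonneg_nonpos)
    ultimately show ?thesis by (rule mult_nonneg_nonpos)
  qed
qed

definition pos_part :: "(nat \<Rightarrow> real) \<Rightarrow> nat \<Rightarrow> real" where "pos_part x = (\<lambda>i. max (x i) 0)"

text \<open>The two parts have disjoint supports and off-diagonal Cartan entries are nonpositive, so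
  the mixed term can only raise the norm of x. A vector of mixed sign thus costs at least the norms
  of both of its parts.\<close>

lemma B_pos_part: "B (pos_part x) (pos_part x) + B (pos_part (\<lambda>i. - x i)) (pos_part (\<lambda>i. - x i)) \<le> B x x"
proof -
  let ?p = "pos_part x" and ?n = "pos_part (\<lambda>i. - x i)"
  have x: "x = (\<lambda>i. 1 * ?p i + (-1) * ?n i)" by (auto simp: pos_part_def)
  have "B x x = B ?p ?p + B ?n ?n - 2 * B ?p ?n"
    by (subst (1 2) x) (simp only: B_lin B_lin' B_sym[of ?n ?p], simp)
  moreover have "B ?p ?n \<le> 0" by (rule B_disjoint_nonpos) (auto simp: pos_part_def)
  ultimately show ?thesis by simp
qed

definition sr :: "nat \<Rightarrow> (nat \<Rightarrow> real) \<Rightarrow> nat \<Rightarrow> real" where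
  "sr i x = (\<lambda>j. x j - (\<Sum>k\<le>l. ar i k * x k) * er i j)"

lemma B_sr: assumes i: "i \<le> l" shows "B (sr i x) (sr i x) = B x x"
proof -
  define p where "p = (\<Sum>k\<le>l. ar i k * x k)"
  have s: "sr i x = (\<lambda>j. 1 * x j + (-p) * er i j)" by (auto simp: sr_def p_def)
  have e: "B (er i) x = half_norm i * p" using B_er[OF i] by (simp add: p_def)
  have "B (sr i x) (sr i x) = B x x - 2 * p * B (er i) x + p * p * B (er i) (er i)"
    unfolding s by (simp only: B_lin B_lin' B_sym[of x "er i"]) (simp add: algebra_simps)
  then show ?thesis using e B_er_er[OF i] by simp
qed

lemma sr_other: "j \<noteq> i \<Longrightarrow> sr i x j = x j" by (simp add: sr_def er_def)

section \<open>Lattices stable under the Weyl group\<close>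

text \<open>For a root length \<open>m\<close>, the vectors \<open>c\<^sub>i \<alpha>\<^sub>i\<close> with \<open>c\<^sub>i = max 1 (m / |\<alpha>\<^sub>i|\<^sup>2)\<close> span a
  Weyl-stable lattice in which \<open>m\<close> is the least positive norm; the vectors of norm \<open>m\<close> in it turn out to
  be exactly the conjugates of the \<open>c\<^sub>i \<alpha>\<^sub>i\<close> of norm \<open>m\<close>, and each of them has coordinates of one sign.\<close>

definition scaling :: "real \<Rightarrow> nat \<Rightarrow> real" where "scaling m i = max 1 (m / (2 * half_norm i))"

definition root_length :: "real \<Rightarrow> bool" where "root_length m \<longleftrightarrow> (\<exists>k\<le>l. m = 2 * half_norm k)"

definition scaled_lattice :: "real \<Rightarrow> (nat \<Rightarrow> real) set" where
  "scaled_lattice m = {x. (\<forall>i>l. x i = 0) \<and> (\<forall>i\<le>l. \<exists>n::int. x i = of_int n * scaling m i)}"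

lemma root_length_pos: "root_length m \<Longrightarrow> 0 < m"
  using half_norm_pos by (auto simp: root_length_def)

text \<open>Half squared lengths lie in {1, q, 1/q}, so any two of them differ by a factor 1, q or
  q^2.\<close>

lemma half_norm_ratio:
  assumes "i \<le> l" "k \<le> l"
  shows "\<exists>n::nat. n > 0 \<and> (half_norm k = real n * half_norm i \<or> half_norm i = real n * half_norm k)"
proof -
  obtain q where q: "q \<in> {2, 3::nat}" "\<forall>i\<le>l. colab i = lab i \<or> colab i = q * lab i \<or> lab i = q * colab i"
    using label_ratio_cases[OF admissible] unfolding lab_eq colab_eq by metis
  have d: "half_norm i = 1 \<or> half_norm i = real q \<or> real q * half_norm i = 1" if i: "i \<le> l" for i
  proof -
    have p: "lr i > 0" "real (colab i) > 0" using lr_pos[OF i] colab_pos[OF i] by auto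
    from q(2) i consider "colab i = lab i" | "colab i = q * lab i" | "lab i = q * colab i" by auto
    then show ?thesis
    proof cases
      case 1 then show ?thesis using p by (simp add: half_norm_def)
    next
      case 2 then show ?thesis using p by (simp add: half_norm_def)
    next
      case 3 then show ?thesis using p by (simp add: half_norm_def)
    qed
  qed
  have "q > 0" using q by auto
  then have e: "half_norm j = 1 / real q" if "real q * half_norm j = 1" for j using that by (simp add: field_simps)
  from d[OF assms(1)] d[OF assms(2)] show ?thesis
    using \<open>q > 0\<close> by (elim disjE) (auto dest!: e intro: exI[of _ 1] exI[of _ q] exI[of _ "q * q"])
qed

lemma scaling_ge_1: "1 \<le> scaling m i" by (simp add: scaling_def)

lemma scaling_Ints: assumes "root_length m" "i \<le> l" shows "scaling m i \<in> \<int>"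
proof -
  obtain k where k: "k \<le> l" "m = 2 * half_norm k" using assms by (auto simp: root_length_def)
  have p: "half_norm i > 0" "half_norm k > 0" using half_norm_pos assms k by auto
  obtain n :: nat where n: "n > 0" "half_norm k = real n * half_norm i \<or> half_norm i = real n * half_norm k" using half_norm_ratio[OF assms(2) k(1)] by auto
  from n(2) show ?thesis
  proof
    assume "half_norm k = real n * half_norm i"
    then have "scaling m i = real n" using n p by (simp add: scaling_def k)
    then show ?thesis by simp
  next
    assume "half_norm i = real n * half_norm k"
    then have "m / (2 * half_norm i) = 1 / real n" using p n by (simp add: k)
    then have "scaling m i = 1" using n by (simp add: scaling_def)
    then show ?thesis by simp
  qed
qed

text \<open>The squared length of c_i \<alpha>_i is |\<alpha>_i|^2 when this is at least m, and m^2
  / |\<alpha>_i|^2 > m otherwise. A short root is thus scaled past the norm m and cannot produce a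
  vector of norm exactly m.\<close>

lemma scaling_norm: assumes m: "root_length m" and i: "i \<le> l"
  shows "m \<le> 2 * half_norm i * (scaling m i)\<^sup>2"
    and "2 * half_norm i * (scaling m i)\<^sup>2 = m \<Longrightarrow> scaling m i = 1 \<and> m = 2 * half_norm i"
proof -
  have p: "0 < half_norm i" "0 < m" using half_norm_pos[OF i] root_length_pos[OF m] by auto
  consider "scaling m i = 1" "m \<le> 2 * half_norm i" | "scaling m i = m / (2 * half_norm i)" "m > 2 * half_norm i"
    using p that by (cases "m \<le> 2 * half_norm i") (auto simp: scaling_def max_absorb1 max_absorb2)
  note c = this
  have "m \<le> 2 * half_norm i * (scaling m i)\<^sup>2 \<and> (2 * half_norm i * (scaling m i)\<^sup>2 = m \<longrightarrow> scaling m i = 1 \<and> m = 2 * half_norm i)"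
    using c
  proof cases
    case 2
    have "2 * half_norm i * (scaling m i)\<^sup>2 = m * (m / (2 * half_norm i))" using p by (simp add: 2 power2_eq_square)
    moreover have "m * (m / (2 * half_norm i)) > m" using p 2 by (simp add: field_simps)
    ultimately show ?thesis by linarith
  qed auto
  then show "m \<le> 2 * half_norm i * (scaling m i)\<^sup>2" "2 * half_norm i * (scaling m i)\<^sup>2 = m \<Longrightarrow> scaling m i = 1 \<and> m = 2 * half_norm i" by auto
qed

text \<open>Reflecting c_k \<alpha>_k in \<alpha>_i changes the coefficient at i by a_ik c_k, which
  must be a multiple of c_i. If both factors are ratios of lengths, the symmetry a_ik |\<alpha>_i|^2
  = a_ki |\<alpha>_k|^2 even gives a_ik c_k = a_ki c_i; if \<alpha>_k is longer than m allows, its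
  length is an integer multiple of m and the same computation applies.\<close>

lemma scaling_stable:
  assumes m: "root_length m" and i: "i \<le> l" and k: "k \<le> l"
  shows "\<exists>n::int. ar i k * scaling m k = of_int n * scaling m i"
proof -
  obtain t where t: "t \<le> l" "m = 2 * half_norm t" using m by (auto simp: root_length_def)
  have p: "half_norm i > 0" "half_norm k > 0" "half_norm t > 0" using half_norm_pos i k t by auto
  have rho: "m / (2 * half_norm j) = half_norm t / half_norm j" for j by (simp add: t)
  show ?thesis
  proof (cases "scaling m i = 1")
    case True
    obtain n where "scaling m k = of_int n" using scaling_Ints[OF m k] by (auto elim: Ints_cases)
    then show ?thesis using True by (intro exI[of _ "a_mat i k * n"]) simp
  next
    case False
    then have ci: "scaling m i = half_norm t / half_norm i" by (auto simp: scaling_def rho max_def split: if_splits)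
    have sym: "half_norm i * ar i k = half_norm k * ar k i" using half_norm_ar_sym[OF i k] .
    show ?thesis
    proof (cases "half_norm t \<ge> half_norm k")
      case True
      then have ck: "scaling m k = half_norm t / half_norm k" using p by (auto simp: scaling_def rho max_def field_simps)
      have "ar i k * scaling m k = ar k i * scaling m i"
        using sym p by (simp add: ci ck field_simps)
      then show ?thesis by blast
    next
      case False
      then have ck: "scaling m k = 1" using p by (auto simp: scaling_def rho max_def field_simps)
      obtain n :: nat where n: "n > 0" "half_norm k = real n * half_norm t \<or> half_norm t = real n * half_norm k" using half_norm_ratio[OF t(1) k] by auto
      have "half_norm k = real n * half_norm t"
      proof (rule ccontr)
        assume "half_norm k \<noteq> real n * half_norm t"
        then have "half_norm t = real n * half_norm k" using n by auto
        then have "half_norm t \<ge> half_norm k" using n p by (simp add: field_simps)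
        then show False using False by simp
      qed
      then have "ar i k * scaling m k = of_int (int n * a_mat k i) * scaling m i"
        using sym p by (simp add: ci ck field_simps)
      then show ?thesis by blast
    qed
  qed
qed

lemma scaled_lattice_sr:
  assumes m: "root_length m" and x: "x \<in> scaled_lattice m" and i: "i \<le> l"
  shows "sr i x \<in> scaled_lattice m"
proof -
  obtain n :: "nat \<Rightarrow> int" where n: "\<And>k. k \<le> l \<Longrightarrow> x k = of_int (n k) * scaling m k"
    using x unfolding scaled_lattice_def by (auto; metis)
  obtain e :: "nat \<Rightarrow> int" where e: "\<And>k. k \<le> l \<Longrightarrow> ar i k * scaling m k = of_int (e k) * scaling m i"
    using scaling_stable[OF m i] by metis
  have "(\<Sum>k\<le>l. ar i k * x k) = (\<Sum>k\<le>l. of_int (n k * e k) * scaling m i)"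
  proof (intro sum.cong refl)
    fix k assume "k \<in> {..l}"
    then have k: "k \<le> l" by simp
    have "ar i k * x k = of_int (n k) * (ar i k * scaling m k)" using n[OF k] by simp
    then show "ar i k * x k = of_int (n k * e k) * scaling m i" using e[OF k] by simp
  qed
  then have s: "(\<Sum>k\<le>l. ar i k * x k) = of_int (\<Sum>k\<le>l. n k * e k) * scaling m i"
    by (simp add: sum_distrib_right)
  show ?thesis unfolding scaled_lattice_def
  proof (intro CollectI conjI allI impI)
    fix j assume "l < j"
    then show "sr i x j = 0" using x i by (simp add: sr_def er_def scaled_lattice_def)
  next
    fix j assume j: "j \<le> l"
    show "\<exists>n::int. sr i x j = of_int n * scaling m j"
    proof (cases "j = i")
      case True
      have "sr i x j = of_int (n i - (\<Sum>k\<le>l. n k * e k)) * scaling m i"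
        using n[OF i] s True by (simp add: sr_def er_def algebra_simps)
      then show ?thesis using True by blast
    next
      case False
      then show ?thesis using n[OF j] by (auto simp: sr_other)
    qed
  qed
qed

lemma scaled_lattice_pos_part: "x \<in> scaled_lattice m \<Longrightarrow> pos_part x \<in> scaled_lattice m"
  unfolding scaled_lattice_def pos_part_def max_def by (auto intro: exI[of _ 0])

lemma scaled_lattice_uminus: "x \<in> scaled_lattice m \<Longrightarrow> (\<lambda>i. - x i) \<in> scaled_lattice m"
  unfolding scaled_lattice_def by (auto simp: minus_mult_left simp flip: of_int_minus)

lemma scaled_lattice_Ints: "root_length m \<Longrightarrow> x \<in> scaled_lattice m \<Longrightarrow> x i \<in> \<int>"
  by (cases "i \<le> l") (auto simp: scaled_lattice_def scaling_Ints dest!: spec[of _ i])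

lemma B_uminus: "B (\<lambda>i. - x i) (\<lambda>i. - x i) = B x x" by (simp add: B_def)

text \<open>The norm is the sum of the x_i (\<alpha>_i|x), so a positive norm forces a positive
  summand. Reflecting in such an i lowers the height, which drives both descents below.\<close>

lemma exists_pos_coroot:
  assumes "0 < B x x" "\<And>i. i \<le> l \<Longrightarrow> 0 \<le> x i"
  obtains i where "i \<le> l" "0 < x i" "0 < (\<Sum>k\<le>l. ar i k * x k)"
proof -
  have "\<exists>i\<le>l. 0 < x i * B (er i) x"
  proof (rule ccontr)
    assume "\<not> ?thesis"
    then have "B x x \<le> 0" unfolding B_expand by (intro sum_nonpos) (auto simp: not_less)
    then show False using assms by simp
  qed
  then obtain i where i: "i \<le> l" "0 < x i * B (er i) x" by auto
  then have "0 < x i" "0 < B (er i) x" using assms(2)[of i] by (auto simp: zero_less_mult_iff)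
  then show ?thesis using that[of i] i half_norm_pos[of i] by (auto simp: B_er zero_less_mult_iff)
qed

lemma sum_sr:
  assumes "i \<le> l" shows "(\<Sum>j\<le>l. sr i x j) = (\<Sum>j\<le>l. x j) - (\<Sum>k\<le>l. ar i k * x k)"
proof -
  have "(\<Sum>j\<le>l. er i j) = 1" using assms by (simp add: er_def)
  then show ?thesis unfolding sr_def by (simp add: sum_subtractf sum_distrib_left[symmetric])
qed

lemma height_decreases:
  assumes m: "root_length m" and x: "x \<in> scaled_lattice m" and i: "i \<le> l" and p: "0 < (\<Sum>k\<le>l. ar i k * x k)"
    and y: "\<And>j. j \<le> l \<Longrightarrow> 0 \<le> sr i x j"
  shows "nat \<lfloor>\<Sum>j\<le>l. sr i x j\<rfloor> < nat \<lfloor>\<Sum>j\<le>l. x j\<rfloor>"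
proof -
  have "(\<Sum>k\<le>l. ar i k * x k) \<in> \<int>" using scaled_lattice_Ints[OF m x] by (intro Ints_sum Ints_mult) auto
  then obtain n where n: "(\<Sum>k\<le>l. ar i k * x k) = of_int n" by (auto elim: Ints_cases)
  then have "n \<ge> 1" using p by simp
  moreover have "0 \<le> (\<Sum>j\<le>l. sr i x j)" using y by (intro sum_nonneg) auto
  ultimately show ?thesis using sum_sr[OF i, of x] n by simp
qed

lemma single_norm: "i \<le> l \<Longrightarrow> B (\<lambda>j. q * er i j) (\<lambda>j. q * er i j) = 2 * half_norm i * q\<^sup>2"
  using B_lin[of q "er i" 0 "er i" "\<lambda>j. q * er i j"] B_lin'[of "er i" q "er i" 0 "er i"]
  by (simp add: B_er_er power2_eq_square)

lemma scaled_lattice_coord_norm: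
  assumes m: "root_length m" and x: "x \<in> scaled_lattice m" and i: "i \<le> l" and "x i \<noteq> 0"
  shows "m \<le> 2 * half_norm i * (x i)\<^sup>2" and "2 * half_norm i * (x i)\<^sup>2 = m \<Longrightarrow> \<bar>x i\<bar> = scaling m i"
proof -
  obtain n :: int where n: "x i = of_int n * scaling m i" using x i by (auto simp: scaled_lattice_def)
  then have "n \<noteq> 0" using assms(4) by auto
  then have n1: "1 \<le> (real_of_int n)\<^sup>2" by (metis int_one_le_iff_zero_less of_int_1_le_iff of_int_power zero_less_power2)
  have c: "m \<le> 2 * half_norm i * (scaling m i)\<^sup>2" using scaling_norm[OF m i] by simp
  have e: "2 * half_norm i * (x i)\<^sup>2 = (2 * half_norm i * (scaling m i)\<^sup>2) * (real_of_int n)\<^sup>2" by (simp add: n power_mult_distrib)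
  have mp: "0 < m" using root_length_pos[OF m] .
  have "2 * half_norm i * (scaling m i)\<^sup>2 * 1 \<le> 2 * half_norm i * (x i)\<^sup>2" unfolding e
    by (rule mult_left_mono[OF n1]) (use c mp in linarith)
  then show "m \<le> 2 * half_norm i * (x i)\<^sup>2" using c by simp
  assume "2 * half_norm i * (x i)\<^sup>2 = m"
  then have "2 * half_norm i * (scaling m i)\<^sup>2 * (real_of_int n)\<^sup>2 = m" using e by simp
  moreover have "2 * half_norm i * (scaling m i)\<^sup>2 = m" using \<open>2 * half_norm i * (scaling m i)\<^sup>2 * 1 \<le> 2 * half_norm i * (x i)\<^sup>2\<close> c \<open>2 * half_norm i * (x i)\<^sup>2 = m\<close> by simp
  ultimately have "(real_of_int n)\<^sup>2 = 1" using mp by simp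
  then have "\<bar>real_of_int n\<bar> = 1" by (metis abs_1 power2_abs real_sqrt_abs real_sqrt_one)
  then show "\<bar>x i\<bar> = scaling m i" using scaling_ge_1[of m i] by (simp add: n abs_mult)
qed

text \<open>Descent on the height. A reflection changes one coordinate only: if it stays
  nonnegative, induction applies to the reflected vector; if it becomes negative, the negative part
  is a multiple of \<alpha>_i in the lattice, has norm at least m by itself, and
  \<open>B_pos_part\<close> transfers this bound to the whole vector.\<close>

lemma scaled_lattice_norm_ge_nonneg:
  assumes m: "root_length m"
  shows "x \<in> scaled_lattice m \<Longrightarrow> 0 < B x x \<Longrightarrow> (\<And>i. i \<le> l \<Longrightarrow> 0 \<le> x i) \<Longrightarrow> m \<le> B x x"
proof (induction "nat \<lfloor>\<Sum>j\<le>l. x j\<rfloor>" arbitrary: x rule: less_induct)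
  case less
  obtain i where i: "i \<le> l" "0 < x i" "0 < (\<Sum>k\<le>l. ar i k * x k)"
    using exists_pos_coroot[OF less.prems(2,3)] by metis
  let ?y = "sr i x"
  have y: "?y \<in> scaled_lattice m" "B ?y ?y = B x x" using scaled_lattice_sr[OF m less.prems(1) i(1)] B_sr[OF i(1)] by auto
  show ?case
  proof (cases "0 \<le> ?y i")
    case True
    have nn: "0 \<le> ?y j" if "j \<le> l" for j using True less.prems(3)[OF that] by (cases "j = i") (auto simp: sr_other)
    show ?thesis using less.hyps[OF height_decreases[OF m less.prems(1) i(1,3) nn] y(1)] y(2) less.prems(2) nn by auto
  next
    case False
    let ?n = "pos_part (\<lambda>i. - ?y i)"
    have "?n = (\<lambda>j. - ?y i * er i j)"
    proof
      fix j
      show "?n j = - ?y i * er i j"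
      proof (cases "j = i")
        case True then show ?thesis using False by (simp add: pos_part_def er_def)
      next
        case j: False
        have "0 \<le> x j" using less.prems by (cases "j \<le> l") (auto simp: scaled_lattice_def)
        then show ?thesis using j by (simp add: pos_part_def er_def sr_other)
      qed
    qed
    then have "B ?n ?n = 2 * half_norm i * (?y i)\<^sup>2" using single_norm[OF i(1), of "- ?y i"] by simp
    moreover have "m \<le> 2 * half_norm i * (?y i)\<^sup>2" using scaled_lattice_coord_norm[OF m y(1) i(1)] False by auto
    moreover have "0 \<le> B (pos_part ?y) (pos_part ?y)" by (rule B_nonneg)
    ultimately show ?thesis using B_pos_part[of ?y] y(2) by linarith
  qed
qed

text \<open>With both signs present, each of the two parts misses a coordinate, hence has positive
  norm, hence norm at least m; together they would exceed the total norm m.\<close>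

lemma scaled_lattice_sign:
  assumes m: "root_length m" and x: "x \<in> scaled_lattice m" "B x x = m"
  shows "(\<forall>i. 0 \<le> x i) \<or> (\<forall>i. x i \<le> 0)"
proof (rule ccontr)
  assume "\<not> ?thesis"
  then obtain i j where ij: "x i < 0" "0 < x j" by (auto simp: not_le)
  then have l: "i \<le> l" "j \<le> l" using x by (auto simp: scaled_lattice_def not_le[symmetric] intro: ccontr)
  let ?p = "pos_part x" and ?n = "pos_part (\<lambda>i. - x i)"
  have "0 < B ?p ?p" by (rule B_pos[OF l(1) _ l(2)]) (use ij in \<open>auto simp: pos_part_def\<close>)
  then have 1: "m \<le> B ?p ?p" by (intro scaled_lattice_norm_ge_nonneg[OF m] scaled_lattice_pos_part x) (auto simp: pos_part_def)
  have "0 < B ?n ?n" by (rule B_pos[OF l(2) _ l(1)]) (use ij in \<open>auto simp: pos_part_def\<close>)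
  then have 2: "m \<le> B ?n ?n" by (intro scaled_lattice_norm_ge_nonneg[OF m] scaled_lattice_pos_part scaled_lattice_uminus x) (auto simp: pos_part_def)
  show False using 1 2 B_pos_part[of x] x(2) root_length_pos[OF m] by simp
qed

section \<open>Words in the simple reflections and orbits of minimal vectors\<close>

definition sw :: "nat list \<Rightarrow> linmap" where "sw is = foldr (\<lambda>i f. s i \<circ> f) is id"

definition rvec :: "(nat \<Rightarrow> real) \<Rightarrow> vec" where "rvec x = (\<lambda>i. complex_of_real (x i))"

definition lin :: "linmap \<Rightarrow> bool" where
  "lin w \<longleftrightarrow> (\<forall>u v p q. w (\<lambda>i. p * u i + q * v i) = (\<lambda>i. p * w u i + q * w v i))"

lemma lin_comb: "lin w \<Longrightarrow> w (\<lambda>i. p * u i + q * v i) = (\<lambda>i. p * w u i + q * w v i)"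
  by (simp add: lin_def)

lemma lin_scale: "lin w \<Longrightarrow> w (\<lambda>i. p * u i) = (\<lambda>i. p * w u i)"
  using lin_comb[of w p u 0 u] by simp

lemma lin_uminus: "lin w \<Longrightarrow> w (\<lambda>i. - u i) = (\<lambda>i. - w u i)"
  using lin_scale[of w "-1" u] by simp

lemma lin_comp: "lin w \<Longrightarrow> lin w' \<Longrightarrow> lin (w \<circ> w')"
  by (simp add: lin_def)

lemma lin_id: "lin id" by (simp add: lin_def)

lemma pairing_lin: "pairing (\<lambda>i. p * u i + q * v i) h = p * pairing u h + q * pairing v h"
  by (simp add: pairing_def sum_distrib_left sum.distrib algebra_simps)

lemma s_lin: "lin (s i)"
  by (simp add: lin_def s_def pairing_lin algebra_simps)

lemma sw_Nil: "sw [] = id" by (simp add: sw_def)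
lemma sw_Cons: "sw (i # is) = s i \<circ> sw is" by (simp add: sw_def)
lemma sw_append: "sw (is @ js) = sw is \<circ> sw js"
  by (induction "is") (simp_all add: sw_Nil sw_Cons comp_assoc)

lemma sw_lin: "lin (sw is)"
  by (induction "is") (simp_all add: sw_Nil sw_Cons lin_id lin_comp s_lin del: comp_apply id_apply flip: id_def)

lemma pairing_coroot:
  assumes "i \<le> l"
  shows "pairing v (\<alpha>_vee i) = (\<Sum>k\<le>l. of_int (a_mat i k) * v k) + (if i = 0 then v (Suc l) else 0)"
proof -
  have "pairing v (\<alpha>_vee i) = (\<Sum>k\<le>Suc l. v k * pairing_basis k i)"
    unfolding pairing_def unit_vec_def
  proof (rule sum.cong[OF refl])
    fix k
    have "(\<Sum>j\<le>Suc l. v k * (if j = i then 1 else 0) * pairing_basis k j) =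
      (\<Sum>j\<le>Suc l. if j = i then v k * pairing_basis k i else 0)" by (intro sum.cong) auto
    then show "(\<Sum>j\<le>Suc l. v k * (if j = i then 1 else 0) * pairing_basis k j) = v k * pairing_basis k i"
      using assms by simp
  qed
  also have "\<dots> = (\<Sum>k\<le>l. v k * pairing_basis k i) + v (Suc l) * pairing_basis (Suc l) i" by simp
  also have "(\<Sum>k\<le>l. v k * pairing_basis k i) = (\<Sum>k\<le>l. of_int (a_mat i k) * v k)"
    using assms by (intro sum.cong) (auto simp: pairing_basis_def)
  finally show ?thesis using assms by (simp add: pairing_basis_def)
qed

lemma s_rvec: "i \<le> l \<Longrightarrow> x (Suc l) = 0 \<Longrightarrow> s i (rvec x) = rvec (sr i x)"
  unfolding s_def fun_eq_iff by (auto simp: pairing_coroot rvec_def sr_def er_def) (auto simp: unit_vec_def)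

lemma rvec_er: "rvec (er i) = \<alpha> i" by (auto simp: rvec_def er_def unit_vec_def)

lemma s_alpha: "i \<le> l \<Longrightarrow> s i (\<alpha> i) = (\<lambda>j. - \<alpha> i j)"
  unfolding s_def by (simp add: pairing_coroot) (simp add: unit_vec_def if_distrib fun_eq_iff cong: if_cong)

lemma s_invol: assumes "i \<le> l" shows "s i (s i v) = v"
proof -
  have "s i v = (\<lambda>j. 1 * v j + (- pairing v (\<alpha>_vee i)) * \<alpha> i j)" by (simp add: s_def)
  then have "s i (s i v) = (\<lambda>j. 1 * s i v j + (- pairing v (\<alpha>_vee i)) * s i (\<alpha> i) j)"
    using lin_comb[OF s_lin] by metis
  then show ?thesis unfolding s_alpha[OF assms] by (simp add: s_def)
qed

text \<open>The descent again. It stops when a reflection produces a negative coordinate: then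
  \<open>scaled_lattice_sign\<close> makes all coordinates nonpositive, so x was supported at i
  alone, and norm m forces x = \<alpha>_i. Only letters from the support are used; recording them in
  J later shows that \<theta> is conjugate to a simple root within the finite Weyl group.\<close>

lemma scaled_lattice_orbit_nonneg:
  assumes m: "root_length m" and J: "J \<subseteq> {..l}"
  shows "x \<in> scaled_lattice m \<Longrightarrow> B x x = m \<Longrightarrow> (\<And>i. x i \<noteq> 0 \<Longrightarrow> i \<in> J) \<Longrightarrow> (\<And>i. 0 \<le> x i) \<Longrightarrow>
    \<exists>is i. set is \<subseteq> J \<and> i \<in> J \<and> 2 * half_norm i = m \<and> rvec x = sw is (\<alpha> i)"
proof (induction "nat \<lfloor>\<Sum>j\<le>l. x j\<rfloor>" arbitrary: x rule: less_induct)
  case less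
  have pos: "0 < B x x" using less.prems root_length_pos[OF m] by simp
  obtain i where i: "i \<le> l" "0 < x i" "0 < (\<Sum>k\<le>l. ar i k * x k)"
    using exists_pos_coroot[OF pos less.prems(4)] by metis
  have iJ: "i \<in> J" using less.prems(3)[of i] i by simp
  let ?y = "sr i x"
  have y: "?y \<in> scaled_lattice m" "B ?y ?y = m" using scaled_lattice_sr[OF m less.prems(1) i(1)] B_sr[OF i(1)] less.prems(2) by auto
  have x0: "x (Suc l) = 0" using less.prems(1) by (simp add: scaled_lattice_def)
  show ?case
  proof (cases "\<forall>j. 0 \<le> ?y j")
    case True
    have yJ: "k \<in> J" if "?y k \<noteq> 0" for k using that iJ less.prems(3)[of k] by (cases "k = i") (auto simp: sr_other)
    obtain js j where j: "set js \<subseteq> J" "j \<in> J" "2 * half_norm j = m" "rvec ?y = sw js (\<alpha> j)"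
      using less.hyps[OF height_decreases[OF m less.prems(1) i(1,3)] y yJ] True by auto
    have "rvec x = s i (rvec ?y)" using s_rvec[of i x] i(1) x0 s_invol[of i "rvec x"] by simp
    also have "\<dots> = sw (i # js) (\<alpha> j)" using j by (simp add: sw_Cons)
    finally have "rvec x = sw (i # js) (\<alpha> j)" .
    then show ?thesis using j iJ by (intro exI[of _ "i # js"] exI[of _ j]) auto
  next
    case False
    then have neg: "?y j \<le> 0" for j using scaled_lattice_sign[OF m y] by auto
    have z: "x j = 0" if "j \<noteq> i" for j using neg[of j] less.prems(4)[of j] that by (simp add: sr_other)
    then have xs: "x = (\<lambda>j. x i * er i j)" by (auto simp: er_def)
    have "2 * half_norm i * (x i)\<^sup>2 = B x x" using single_norm[OF i(1), of "x i"] xs by metis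
    then have nm: "2 * half_norm i * (x i)\<^sup>2 = m" using less.prems(2) by simp
    have "\<bar>x i\<bar> = scaling m i" using scaled_lattice_coord_norm(2)[OF m less.prems(1) i(1) _ nm] i by simp
    then have c: "x i = scaling m i" using i by simp
    then have "scaling m i = 1" "m = 2 * half_norm i" using scaling_norm(2)[OF m i(1)] nm by auto
    then have "x = er i" using xs c by auto
    then show ?thesis using iJ \<open>m = 2 * half_norm i\<close> by (intro exI[of _ "[]"] exI[of _ i]) (simp add: sw_Nil rvec_er)
  qed
qed

lemma scaled_lattice_orbit:
  assumes m: "root_length m" and J: "J \<subseteq> {..l}" and x: "x \<in> scaled_lattice m" "B x x = m" and xJ: "\<And>i. x i \<noteq> 0 \<Longrightarrow> i \<in> J"
  obtains "is" i where "set is \<subseteq> J" "i \<in> J" "2 * half_norm i = m" "rvec x = sw is (\<alpha> i)"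
proof (cases "\<forall>i. 0 \<le> x i")
  case True
  then show ?thesis using scaled_lattice_orbit_nonneg[OF m J x xJ] that by auto
next
  case False
  then have "\<forall>i. 0 \<le> - x i" using scaled_lattice_sign[OF m x] by auto
  then obtain js i where j: "set js \<subseteq> J" "i \<in> J" "2 * half_norm i = m" "rvec (\<lambda>i. - x i) = sw js (\<alpha> i)"
    using scaled_lattice_orbit_nonneg[OF m J scaled_lattice_uminus[OF x(1)]] x(2) xJ by (auto simp: B_uminus)
  have "rvec x = (\<lambda>k. - rvec (\<lambda>i. - x i) k)" by (simp add: rvec_def)
  also have "\<dots> = sw (js @ [i]) (\<alpha> i)"
    using j J by (auto simp: sw_append sw_Cons sw_Nil s_alpha lin_uminus[OF sw_lin])
  finally show ?thesis using that[of "js @ [i]" i] j by auto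
qed

section \<open>The complex form, the Weyl group as a set of words, and real roots\<close>

lemma form_comb3: "form (\<lambda>i. u i + p * v i - q * w i) z = form u z + p * form v z - q * form w z"
  by (simp add: form_def sum.distrib sum_subtractf sum_distrib_left algebra_simps)

lemma form_sym: "form u v = form v u"
proof -
  have "form_basis i j = form_basis j i" for i j
  proof (cases "i \<le> l \<and> j \<le> l")
    case True
    have "complex_of_real (half_norm i * ar i j) = complex_of_real (half_norm j * ar j i)" using half_norm_ar_sym[of i j] True by simp
    then show ?thesis using True by (simp add: form_basis_def half_norm_def)
  qed (auto simp: form_basis_def)
  then have "form u v = (\<Sum>i\<le>Suc l. \<Sum>j\<le>Suc l. v j * u i * form_basis j i)"
    unfolding form_def by (simp add: mult_ac)
  also have "\<dots> = form v u" unfolding form_def by (rule sum.swap)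
  finally show ?thesis .
qed

lemma form_lin: "form (\<lambda>i. p * u i + q * v i) w = p * form u w + q * form v w"
  by (simp add: form_def sum_distrib_left sum.distrib algebra_simps)

lemma form_lin': "form w (\<lambda>i. p * u i + q * v i) = p * form w u + q * form w v"
  using form_lin form_sym by metis

lemma form_uminus: "form (\<lambda>i. - u i) w = - form u w"
  using form_lin[of "-1" u 0 u w] by simp

lemma form_alpha:
  assumes i: "i \<le> l" shows "form v (\<alpha> i) = of_real (half_norm i) * pairing v (\<alpha>_vee i)"
proof -
  have "form v (\<alpha> i) = (\<Sum>k\<le>Suc l. v k * form_basis k i)"
    unfolding form_def unit_vec_def
  proof (rule sum.cong[OF refl])
    fix k
    have "(\<Sum>j\<le>Suc l. v k * (if j = i then 1 else 0) * form_basis k j) =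
      (\<Sum>j\<le>Suc l. if j = i then v k * form_basis k i else 0)" by (intro sum.cong) auto
    then show "(\<Sum>j\<le>Suc l. v k * (if j = i then 1 else 0) * form_basis k j) = v k * form_basis k i"
      using i by simp
  qed
  also have "\<dots> = (\<Sum>k\<le>l. v k * form_basis k i) + v (Suc l) * form_basis (Suc l) i" by simp
  also have "(\<Sum>k\<le>l. v k * form_basis k i) = (\<Sum>k\<le>l. of_real (half_norm i) * (of_int (a_mat i k) * v k))"
  proof (intro sum.cong refl)
    fix k assume "k \<in> {..l}"
    then have k: "k \<le> l" by simp
    have "complex_of_real (half_norm k * ar k i) = complex_of_real (half_norm i * ar i k)" using half_norm_ar_sym[OF k i] by simp
    then show "v k * form_basis k i = of_real (half_norm i) * (of_int (a_mat i k) * v k)"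
      using k i by (simp add: form_basis_def half_norm_def)
  qed
  \<comment> \<open>At i = 0 both sides carry the factor 1 / a_0, because the colabel at 0 is
    1.\<close>
  also have "v (Suc l) * form_basis (Suc l) i = of_real (half_norm i) * (if i = 0 then v (Suc l) else 0)"
    using i by (auto simp: form_basis_def half_norm_def colab_0)
  finally show ?thesis using i by (simp add: pairing_coroot sum_distrib_left distrib_left)
qed

lemma form_rvec: "x (Suc l) = 0 \<Longrightarrow> y (Suc l) = 0 \<Longrightarrow> form (rvec x) (rvec y) = of_real (B x y)"
  by (simp add: form_def B_def rvec_def form_basis_def half_norm_def mult_ac)

lemma form_alpha_alpha: "i \<le> l \<Longrightarrow> form (\<alpha> i) (\<alpha> i) = of_real (2 * half_norm i)"
  using form_rvec[of "er i" "er i"] by (simp add: rvec_er B_er_er) (simp add: er_def B_er_er)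

lemma s_alt: "s i v = (\<lambda>j. 1 * v j + (- pairing v (\<alpha>_vee i)) * \<alpha> i j)"
  by (simp add: s_def)

lemma form_s: assumes i: "i \<le> l" shows "form (s i u) (s i v) = form u v"
proof -
  define p q where "p = pairing u (\<alpha>_vee i)" and "q = pairing v (\<alpha>_vee i)"
  have "form (s i u) (s i v) = form u v - q * form u (\<alpha> i) - p * form v (\<alpha> i) + p * q * form (\<alpha> i) (\<alpha> i)"
    unfolding s_alt form_lin form_lin' form_sym[of "\<alpha> i" v] p_def q_def by (simp add: algebra_simps)
  then show ?thesis unfolding form_alpha_alpha[OF i] unfolding form_alpha[OF i] p_def q_def by (simp add: algebra_simps)
qed

text \<open>The simple roots are orthogonal to \<delta>, and \<Lambda>_0 has product 1 with it, so
  only the coordinate at \<Lambda>_0 survives. By \<open>pairing_K\<close> the same coordinate is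
  the level, which makes the formula for t explicit in coordinates.\<close>

lemma form_delta: "form v \<delta> = v (Suc l)"
proof -
  have "form v \<delta> = (\<Sum>k\<le>Suc l. v k * (\<Sum>j\<le>Suc l. \<delta> j * form_basis k j))"
    by (simp add: form_def sum_distrib_left mult_ac del: sum.atMost_Suc)
  also have "\<dots> = (\<Sum>k\<le>l. v k * (\<Sum>j\<le>l. of_nat (lab j) * form_basis k j)) + v (Suc l) * (\<Sum>j\<le>l. of_nat (lab j) * form_basis (Suc l) j)"
    by (simp add: \<delta>_def)
  also have "(\<Sum>k\<le>l. v k * (\<Sum>j\<le>l. of_nat (lab j) * form_basis k j)) = 0"
  proof (intro sum.neutral ballI)
    fix k assume k: "k \<in> {..l}"
    have "(\<Sum>j\<le>l. of_nat (lab j) * form_basis k j) = of_real (half_norm k) * of_real (\<Sum>j\<le>l. ar k j * lr j)"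
      unfolding of_real_sum sum_distrib_left by (intro sum.cong refl) (use k in \<open>simp add: form_basis_def half_norm_def mult_ac\<close>)
    then have "(\<Sum>j\<le>l. of_nat (lab j) * form_basis k j) = 0" using k by (simp only: ar_lr atMost_iff) simp
    then show "v k * (\<Sum>j\<le>l. of_nat (lab j) * form_basis k j) = 0" by simp
  qed
  also have "(\<Sum>j\<le>l. of_nat (lab j) * form_basis (Suc l) j) = (\<Sum>j\<le>l. if j = 0 then 1 else 0)"
    by (intro sum.cong refl) (use lr_pos[of 0] in \<open>auto simp: form_basis_def\<close>)
  finally show ?thesis by simp
qed

lemma pairing_K: "pairing v K = v (Suc l)"
proof -
  have "pairing v K = (\<Sum>k\<le>Suc l. v k * (\<Sum>j\<le>Suc l. K j * pairing_basis k j))"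
    by (simp add: pairing_def sum_distrib_left mult_ac del: sum.atMost_Suc)
  also have "\<dots> = (\<Sum>k\<le>l. v k * (\<Sum>j\<le>l. of_nat (colab j) * pairing_basis k j)) + v (Suc l) * (\<Sum>j\<le>l. of_nat (colab j) * pairing_basis (Suc l) j)"
    by (simp add: K_def)
  also have "(\<Sum>k\<le>l. v k * (\<Sum>j\<le>l. of_nat (colab j) * pairing_basis k j)) = 0"
  proof (intro sum.neutral ballI)
    fix k assume k: "k \<in> {..l}"
    have "(\<Sum>j\<le>l. of_nat (colab j) * pairing_basis k j) = complex_of_real (\<Sum>j\<le>l. ar j k * real (colab j))"
      unfolding of_real_sum by (intro sum.cong refl) (use k in \<open>simp add: pairing_basis_def mult_ac\<close>)
    then have "(\<Sum>j\<le>l. of_nat (colab j) * pairing_basis k j) = 0" using k by (simp only: ar_colab atMost_iff) simp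
    then show "v k * (\<Sum>j\<le>l. of_nat (colab j) * pairing_basis k j) = 0" by simp
  qed
  also have "(\<Sum>j\<le>l. of_nat (colab j) * pairing_basis (Suc l) j) = (\<Sum>j\<le>l. if j = 0 then 1 else 0)"
    by (intro sum.cong refl) (auto simp: pairing_basis_def colab_0)
  finally show ?thesis by simp
qed

lemma delta_Suc_l [simp]: "\<delta> (Suc l) = 0" by (simp add: \<delta>_def)

lemma s_delta: assumes "i \<le> l" shows "s i \<delta> = \<delta>"
proof -
  have "of_real (half_norm i) * pairing \<delta> (\<alpha>_vee i) = form (\<alpha> i) \<delta>" using form_alpha[OF assms] form_sym by metis
  also have "\<dots> = 0" using assms by (simp add: form_delta unit_vec_def)
  finally show ?thesis using half_norm_pos[OF assms] by (simp add: s_def)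
qed

lemma s_other: "k \<noteq> i \<Longrightarrow> s i v k = v k" by (simp add: s_def unit_vec_def)

text \<open>The main control on coordinates: a word in 1, ..., l preserves the coordinate at
  \<alpha>_0, a word in two letters i, j preserves all the others, and no word touches the
  coordinate at \<Lambda>_0.\<close>

lemma sw_other: "k \<notin> set is \<Longrightarrow> sw is v k = v k"
  by (induction "is") (auto simp: sw_Nil sw_Cons s_other)

lemma form_sw: "set is \<subseteq> {..l} \<Longrightarrow> form (sw is u) (sw is v) = form u v"
  by (induction "is") (auto simp: sw_Nil sw_Cons form_s)

lemma sw_delta: "set is \<subseteq> {..l} \<Longrightarrow> sw is \<delta> = \<delta>"
  by (induction "is") (auto simp: sw_Nil sw_Cons s_delta)

lemma sw_rev: "set is \<subseteq> {..l} \<Longrightarrow> sw (rev is) (sw is v) = v"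
  by (induction "is") (auto simp: sw_Nil sw_Cons sw_append s_invol)

lemma sw_rev': "set is \<subseteq> {..l} \<Longrightarrow> sw is (sw (rev is) v) = v"
  using sw_rev[of "rev is" v] by simp

lemma sw_bij: "set is \<subseteq> {..l} \<Longrightarrow> bij (sw is)"
  by (rule o_bij[of "sw (rev is)"]) (auto simp: sw_rev sw_rev' fun_eq_iff)

lemma inv_sw: "set is \<subseteq> {..l} \<Longrightarrow> inv_into UNIV (sw is) = sw (rev is)"
  by (rule inv_unique_comp) (auto simp: sw_rev sw_rev' fun_eq_iff)

text \<open>Reflections are involutions, so inverses are words again and the generated group is just
  the set of words. Later statements on the Weyl groups are then inductions over lists.\<close>

lemma generate_reflections:
  assumes I: "I \<subseteq> {..l}"
  shows "generate (BijGroup UNIV) (s ` I) = {sw is | is. set is \<subseteq> I}"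
proof -
  have Bij: "sw is \<in> Bij UNIV" if "set is \<subseteq> I" for "is"
    using sw_bij[of "is"] that I by (auto simp: Bij_def)
  have mult: "sw is \<otimes>\<^bsub>BijGroup UNIV\<^esub> sw js = sw (is @ js)" if "set is \<subseteq> I" "set js \<subseteq> I" for "is" js
    using Bij[OF that(1)] Bij[OF that(2)] by (auto simp: BijGroup_def compose_def sw_append fun_eq_iff)
  have si: "s i = sw [i]" for i by (simp add: sw_Cons sw_Nil)
  show ?thesis
  proof (intro equalityI subsetI)
    fix w assume "w \<in> generate (BijGroup UNIV) (s ` I)"
    then show "w \<in> {sw is | is. set is \<subseteq> I}"
    proof (induction rule: generate.induct)
      case one
      show ?case by (auto simp: BijGroup_def sw_Nil fun_eq_iff intro!: exI[of _ "[]"])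
    next
      case (incl h)
      then obtain i where "i \<in> I" "h = s i" by auto
      then show ?case using si[of i] by (auto intro!: exI[of _ "[i]"])
    next
      case (inv h)
      then obtain i where i: "i \<in> I" "h = sw [i]" using si by auto
      have "inv\<^bsub>BijGroup UNIV\<^esub> h = inv_into UNIV h"
        unfolding i(2) using inv_BijGroup[OF Bij[of "[i]"]] i(1) by (simp add: restrict_def)
      also have "\<dots> = sw [i]" using inv_sw[of "[i]"] i I by auto
      finally show ?case using i by (auto intro!: exI[of _ "[i]"])
    next
      case (eng h1 h2)
      then obtain js ks where "h1 = sw js" "h2 = sw ks" "set js \<subseteq> I" "set ks \<subseteq> I" by auto
      then show ?case using mult[of js ks] by (auto intro!: exI[of _ "js @ ks"])
    qed
  next
    fix w assume "w \<in> {sw is | is. set is \<subseteq> I}"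
    then obtain "is" where "w = sw is" "set is \<subseteq> I" by auto
    then show "w \<in> generate (BijGroup UNIV) (s ` I)"
    proof (induction "is" arbitrary: w)
      case Nil
      have "\<one>\<^bsub>BijGroup UNIV\<^esub> = w" using Nil by (auto simp: BijGroup_def sw_Nil fun_eq_iff)
      then show ?case using generate.one by metis
    next
      case (Cons i "is")
      have "w = s i \<otimes>\<^bsub>BijGroup UNIV\<^esub> sw is" using mult[of "[i]" "is"] Cons.prems si by simp
      moreover have "sw is \<in> generate (BijGroup UNIV) (s ` I)" using Cons by simp
      moreover have "s i \<in> generate (BijGroup UNIV) (s ` I)" using Cons.prems by (intro generate.incl) simp
      ultimately show ?case using generate.eng by metis
    qed
  qed
qed

lemma W_eq: "W = {sw is | is. set is \<subseteq> {..l}}"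
  unfolding W_def using generate_reflections[of "{0..l}"] by (simp add: atLeast0AtMost)

lemma W_fin_eq: "W_fin = {sw is | is. set is \<subseteq> {1..l}}"
  unfolding W_fin_def using generate_reflections[of "{1..l}"] by simp

lemma real_roots_eq: "real_roots = {sw is (\<alpha> i) | is i. set is \<subseteq> {..l} \<and> i \<le> l}"
  unfolding real_roots_def W_eq by blast

lemma sw_real_roots: "set is \<subseteq> {..l} \<Longrightarrow> \<beta> \<in> real_roots \<Longrightarrow> sw is \<beta> \<in> real_roots"
proof -
  assume "is": "set is \<subseteq> {..l}" and "\<beta> \<in> real_roots"
  then obtain js i where "\<beta> = sw js (\<alpha> i)" "set js \<subseteq> {..l}" "i \<le> l" by (auto simp: real_roots_eq)
  then have "sw is \<beta> = sw (is @ js) (\<alpha> i)" "set (is @ js) \<subseteq> {..l}" using "is" by (auto simp: sw_append)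
  then show ?thesis using \<open>i \<le> l\<close> unfolding real_roots_eq by blast
qed

lemma er_scaled_lattice: "i \<le> l \<Longrightarrow> er i \<in> scaled_lattice (2 * half_norm i)"
  unfolding scaled_lattice_def er_def scaling_def using half_norm_pos[of i]
  by (auto intro: exI[of _ 1] exI[of _ 0])

lemma root_length_half_norm: "i \<le> l \<Longrightarrow> root_length (2 * half_norm i)" by (auto simp: root_length_def)

lemma sw_scaled_lattice:
  assumes m: "root_length m"
  shows "set is \<subseteq> {..l} \<Longrightarrow> x \<in> scaled_lattice m \<Longrightarrow> \<exists>y\<in>scaled_lattice m. B y y = B x x \<and> sw is (rvec x) = rvec y"
proof (induction "is")
  case (Cons i "is")
  then obtain y where y: "y \<in> scaled_lattice m" "B y y = B x x" "sw is (rvec x) = rvec y" by auto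
  have "sw (i # is) (rvec x) = rvec (sr i y)" using y Cons.prems by (simp add: sw_Cons s_rvec scaled_lattice_def)
  then show ?case using scaled_lattice_sr[OF m y(1), of i] B_sr[of i y] Cons.prems y by auto
qed (auto simp: sw_Nil)

lemma real_rootE:
  assumes "\<beta> \<in> real_roots"
  obtains x i where "i \<le> l" "\<beta> = rvec x" "x \<in> scaled_lattice (2 * half_norm i)" "B x x = 2 * half_norm i"
proof -
  obtain js i where j: "\<beta> = sw js (\<alpha> i)" "set js \<subseteq> {..l}" "i \<le> l" using assms by (auto simp: real_roots_eq)
  obtain y where "y \<in> scaled_lattice (2 * half_norm i)" "B y y = B (er i) (er i)" "sw js (rvec (er i)) = rvec y"
    using sw_scaled_lattice[OF root_length_half_norm[OF j(3)] j(2) er_scaled_lattice[OF j(3)]] by auto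
  then show ?thesis using that[of i y] j by (auto simp: rvec_er B_er_er)
qed

text \<open>With \<open>real_rootE\<close> this characterizes the real roots as the vectors of norm
  m in the scaled lattice for m, where m runs over the squared lengths of simple roots. Being a root
  can now be tested without exhibiting a Weyl group element.\<close>

lemma real_rootI:
  assumes "i \<le> l" "x \<in> scaled_lattice (2 * half_norm i)" "B x x = 2 * half_norm i"
  shows "rvec x \<in> real_roots"
proof -
  obtain js k where "set js \<subseteq> {..l}" "k \<in> {..l}" "rvec x = sw js (\<alpha> k)"
  proof (rule scaled_lattice_orbit[OF root_length_half_norm[OF assms(1)] order_refl assms(2,3)])
    show "x j \<noteq> 0 \<Longrightarrow> j \<in> {..l}" for j using assms(2) by (auto simp: scaled_lattice_def intro: ccontr)
  qed blast
  then show ?thesis unfolding real_roots_eq by blast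
qed

text \<open>Real roots suffice: the extended affine Weyl group fixes \<delta>, so imaginary roots
  never enter an inversion set.\<close>

definition Pos :: "vec set" where "Pos = {\<beta> \<in> real_roots. \<forall>i. \<beta> i \<in> \<nat>}"

lemma scaled_lattice_rvec_Nats:
  assumes "root_length m" "x \<in> scaled_lattice m" "\<And>i. 0 \<le> x i" shows "rvec x i \<in> \<nat>"
proof -
  obtain n where n: "x i = of_int n" using scaled_lattice_Ints[OF assms(1,2)] by (auto elim: Ints_cases)
  then have "x i = real (nat n)" using assms(3)[of i] by simp
  then have "rvec x i = of_nat (nat n)" by (simp add: rvec_def)
  then show ?thesis by simp
qed

lemma alpha_Pos: "i \<le> l \<Longrightarrow> \<alpha> i \<in> Pos"
  unfolding Pos_def real_roots_eq by (auto simp: unit_vec_def sw_Nil intro!: exI[of _ "[]"] exI[of _ i])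

lemma real_root_uminus: "\<beta> \<in> real_roots \<Longrightarrow> (\<lambda>i. - \<beta> i) \<in> real_roots"
proof (elim real_rootE)
  fix x i assume x: "i \<le> l" "\<beta> = rvec x" "x \<in> scaled_lattice (2 * half_norm i)" "B x x = 2 * half_norm i"
  have "rvec (\<lambda>i. - x i) \<in> real_roots" using real_rootI[OF x(1) scaled_lattice_uminus[OF x(3)]] x(4) by (simp add: B_uminus)
  then show ?thesis by (simp add: x(2) rvec_def)
qed

lemma real_root_sign:
  assumes "\<beta> \<in> real_roots" shows "\<beta> \<in> Pos \<or> (\<lambda>i. - \<beta> i) \<in> Pos"
proof -
  obtain x i where x: "i \<le> l" "\<beta> = rvec x" "x \<in> scaled_lattice (2 * half_norm i)" "B x x = 2 * half_norm i" using real_rootE[OF assms] by metis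
  note m = root_length_half_norm[OF x(1)]
  from scaled_lattice_sign[OF m x(3,4)] show ?thesis
  proof
    assume "\<forall>i. 0 \<le> x i"
    then show ?thesis using scaled_lattice_rvec_Nats[OF m x(3)] assms x(2) by (auto simp: Pos_def)
  next
    assume "\<forall>i. x i \<le> 0"
    then have "rvec (\<lambda>i. - x i) j \<in> \<nat>" for j using scaled_lattice_rvec_Nats[OF m scaled_lattice_uminus[OF x(3)]] by auto
    moreover have "rvec (\<lambda>i. - x i) = (\<lambda>i. - \<beta> i)" by (simp add: rvec_def x(2))
    ultimately show ?thesis using real_root_uminus[OF assms] by (auto simp: Pos_def)
  qed
qed

lemma real_root_nonzero: "\<beta> \<in> real_roots \<Longrightarrow> \<exists>i\<le>l. \<beta> i \<noteq> 0"
proof (elim real_rootE, rule ccontr)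
  fix x i assume x: "i \<le> l" "\<beta> = rvec x" "B x x = 2 * half_norm i" and "\<not> (\<exists>i\<le>l. \<beta> i \<noteq> 0)"
  then have "B x x = 0" by (auto simp: rvec_def B_def)
  then show False using x half_norm_pos[of i] by simp
qed

lemma Nats_uminus: "z \<in> \<nat> \<Longrightarrow> - z \<in> \<nat> \<Longrightarrow> z = (0::complex)"
  by (auto elim!: Nats_cases) (metis add.right_inverse neg_eq_iff_add_eq_0 of_nat_0_eq_iff of_nat_add add_is_0)

lemma Pos_not_neg: "\<beta> \<in> Pos \<Longrightarrow> (\<lambda>i. - \<beta> i) \<notin> Pos"
  using real_root_nonzero Nats_uminus by (auto simp: Pos_def) blast

lemma real_root_support: "\<beta> \<in> real_roots \<Longrightarrow> l < k \<Longrightarrow> \<beta> k = 0"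
  by (elim real_rootE) (auto simp: scaled_lattice_def rvec_def)

lemma real_root_Ints: "\<beta> \<in> real_roots \<Longrightarrow> \<exists>n::int. \<beta> k = of_int n"
proof (elim real_rootE)
  fix x i assume x: "i \<le> l" "\<beta> = rvec x" "x \<in> scaled_lattice (2 * half_norm i)"
  obtain n where "x k = of_int n" using scaled_lattice_Ints[OF root_length_half_norm[OF x(1)] x(3)] by (auto elim: Ints_cases)
  then show ?thesis by (auto simp: x(2) rvec_def)
qed

section \<open>Translations\<close>

lemma finite_part_Suc: "\<eta> \<in> finite_part \<Longrightarrow> \<eta> (Suc l) = 0"
  by (simp add: finite_part_def)

lemma t_alt: "t \<beta> v = (\<lambda>i. v i + v (Suc l) * \<beta> i - (form v \<beta> + 1 / 2 * form \<beta> \<beta> * v (Suc l)) * \<delta> i)"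
  by (simp add: t_def pairing_K)

lemma t_Suc: "\<eta> \<in> finite_part \<Longrightarrow> t \<eta> v (Suc l) = v (Suc l)"
  by (simp add: t_alt finite_part_Suc)

lemma form_delta': "form \<delta> v = v (Suc l)"
  using form_delta form_sym by metis

lemma finite_part_add: "\<eta> \<in> finite_part \<Longrightarrow> \<mu> \<in> finite_part \<Longrightarrow> (\<lambda>i. \<eta> i + \<mu> i) \<in> finite_part"
  by (simp add: finite_part_def)

lemma form_add_left: "form (\<lambda>i. u i + v i) w = form u w + form v w"
  using form_lin[of 1 u 1 v w] by simp

lemma form_add_right: "form w (\<lambda>i. u i + v i) = form w u + form w v"
  using form_lin'[of w 1 u 1 v] by simp

lemma t_t:
  assumes "\<eta> \<in> finite_part" "\<mu> \<in> finite_part"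
  shows "t \<eta> (t \<mu> v) = t (\<lambda>i. \<eta> i + \<mu> i) v"
proof -
  have "form (t \<mu> v) \<eta> = form v \<eta> + v (Suc l) * form \<mu> \<eta>"
    unfolding t_alt form_comb3 form_delta' using finite_part_Suc[OF assms(1)] by simp
  then show ?thesis
    unfolding t_alt[of \<eta>] t_Suc[OF assms(2)] unfolding t_alt
    by (simp add: form_add_left form_add_right form_sym[of \<mu> \<eta>] fun_eq_iff algebra_simps)
qed

lemma t_comp: "\<eta> \<in> finite_part \<Longrightarrow> \<mu> \<in> finite_part \<Longrightarrow> t \<eta> \<circ> t \<mu> = t (\<lambda>i. \<eta> i + \<mu> i)"
  by (auto simp: t_t)

lemma t_zero: "t (\<lambda>i. 0) = id"
  by (simp add: t_alt form_def fun_eq_iff)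

lemma t_lin: "lin (t \<eta>)"
  unfolding lin_def t_alt form_lin by (simp add: fun_eq_iff algebra_simps)

lemma form_t:
  assumes "\<eta> \<in> finite_part" shows "form (t \<eta> u) (t \<eta> v) = form u v"
proof -
  have e: "form (t \<eta> u) w = form u w + u (Suc l) * form \<eta> w - (form u \<eta> + 1 / 2 * form \<eta> \<eta> * u (Suc l)) * w (Suc l)" for u w
    unfolding t_alt form_comb3 form_delta' ..
  have "form u (t \<eta> v) = form (t \<eta> v) u" "form \<eta> (t \<eta> v) = form (t \<eta> v) \<eta>" by (rule form_sym)+
  then show ?thesis unfolding e[of u "t \<eta> v"] e t_Suc[OF assms] finite_part_Suc[OF assms]
    by (simp add: e finite_part_Suc[OF assms] form_sym[of v u] form_sym[of \<eta> u] form_sym[of \<eta> v] algebra_simps)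
qed

lemma t_delta: "\<eta> \<in> finite_part \<Longrightarrow> t \<eta> \<delta> = \<delta>"
  unfolding t_alt form_delta' by (simp add: finite_part_Suc)

text \<open>A word is linear, preserves the form, fixes \<delta> and keeps the coordinate at
  \<Lambda>_0, and the formula for t is built from these data only. This is the semidirect product
  relation between the Weyl group and translations.\<close>

lemma sw_t:
  assumes "set is \<subseteq> {..l}"
  shows "sw is (t \<eta> v) = t (sw is \<eta>) (sw is v)"
proof -
  have k: "sw is v (Suc l) = v (Suc l)" for v using sw_other[of "Suc l" "is"] assms by force
  define c where "c = - (form v \<eta> + 1 / 2 * form \<eta> \<eta> * v (Suc l))"
  define u where "u = (\<lambda>i. 1 * v i + v (Suc l) * \<eta> i)"
  have "t \<eta> v = (\<lambda>i. 1 * u i + c * \<delta> i)" by (simp add: t_alt u_def c_def algebra_simps)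
  then have "sw is (t \<eta> v) = (\<lambda>i. 1 * sw is u i + c * \<delta> i)"
    using lin_comb[OF sw_lin, of "is" 1 u c \<delta>] sw_delta[OF assms] by simp
  moreover have "sw is u = (\<lambda>i. 1 * sw is v i + v (Suc l) * sw is \<eta> i)"
    unfolding u_def by (rule lin_comb[OF sw_lin])
  ultimately show ?thesis
    unfolding t_alt[of "sw is \<eta>"] form_sw[OF assms] k c_def by (simp add: fun_eq_iff algebra_simps)
qed

lemma half_norm_le_twist: "i \<le> l \<Longrightarrow> half_norm i \<le> real r"
proof -
  assume i: "i \<le> l"
  have "real (colab i) \<le> real r * lr i"
    using colabels_le_twist[OF admissible i] unfolding lab_eq colab_eq of_nat_mult[symmetric] of_nat_le_iff .
  then show ?thesis using lr_pos[OF i] by (simp add: half_norm_def field_simps)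
qed

lemma half_norm_eq_twist: "\<exists>i\<le>l. half_norm i = real r"
proof -
  obtain i where "i \<le> l" "colab i = r * lab i" using colabels_eq_twist[OF admissible] unfolding lab_eq colab_eq by auto
  then show ?thesis using lr_pos[of i] by (auto simp: half_norm_def)
qed

lemma half_norm_twist_or: "i \<le> l \<Longrightarrow> half_norm i = real r \<or> (\<exists>n::nat. real n * half_norm i = 1)"
proof -
  assume i: "i \<le> l"
  have p: "lr i > 0" "colab i > 0" using lr_pos[OF i] colab_pos[OF i] by auto
  have "colab i = r * lab i \<or> colab i dvd lab i"
    using colabels_twist_or_dvd[OF admissible i] unfolding lab_eq colab_eq .
  then show ?thesis
  proof
    assume "colab i dvd lab i"
    then obtain n where "lab i = colab i * n" by auto
    then show ?thesis using p by (auto simp: half_norm_def intro!: exI[of _ n])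
  qed (use p in \<open>auto simp: half_norm_def\<close>)
qed

lemma half_norm_0: "half_norm 0 = 1 / lr 0" by (simp add: half_norm_def colab_0)

lemma real_root_form: "\<beta> \<in> real_roots \<Longrightarrow> \<exists>i\<le>l. form \<beta> \<beta> = of_real (2 * half_norm i)"
proof (elim real_rootE)
  fix x i assume x: "i \<le> l" "\<beta> = rvec x" "x \<in> scaled_lattice (2 * half_norm i)" "B x x = 2 * half_norm i"
  then have "form \<beta> \<beta> = of_real (2 * half_norm i)" using form_rvec[of x x] by (simp add: scaled_lattice_def)
  then show ?thesis using x by blast
qed

lemma long_real_root_iff:
  assumes "\<beta> \<in> real_roots" "i \<le> l" "form \<beta> \<beta> = of_real (2 * half_norm i)"
  shows "long_real_root \<beta> \<longleftrightarrow> half_norm i = real r"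
proof
  assume L: "long_real_root \<beta>"
  obtain k where k: "k \<le> l" "half_norm k = real r" using half_norm_eq_twist by auto
  have "\<alpha> k \<in> real_roots" using alpha_Pos[OF k(1)] by (simp add: Pos_def)
  then have "Re (form (\<alpha> k) (\<alpha> k)) \<le> Re (form \<beta> \<beta>)" using L by (auto simp: long_real_root_def)
  then have "half_norm k \<le> half_norm i" using assms(3) form_alpha_alpha[OF k(1)] by simp
  then show "half_norm i = real r" using k half_norm_le_twist[OF assms(2)] by simp
next
  assume d: "half_norm i = real r"
  show "long_real_root \<beta>" unfolding long_real_root_def
  proof (intro conjI ballI assms(1))
    fix \<beta>' assume "\<beta>' \<in> real_roots"
    then obtain k where "k \<le> l" "form \<beta>' \<beta>' = of_real (2 * half_norm k)" using real_root_form by blast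
    then show "Re (form \<beta>' \<beta>') \<le> Re (form \<beta> \<beta>)" using half_norm_le_twist[of k] d assms(3) by simp
  qed
qed

lemma gamma_eq:
  assumes "\<beta> \<in> real_roots" "i \<le> l" "form \<beta> \<beta> = of_real (2 * half_norm i)"
  shows "\<gamma> \<beta> = (if half_norm i = real r then r else 1)"
  unfolding \<gamma>_def using long_real_root_iff[OF assms] by simp

lemma B_lab: "B y lr = 0"
proof -
  have "B y lr = (\<Sum>i\<le>l. y i * half_norm i * (\<Sum>j\<le>l. ar i j * lr j))"
    unfolding B_def by (simp add: sum_distrib_left mult_ac)
  then show ?thesis using ar_lr by simp
qed

lemma lab_zero: "i > l \<Longrightarrow> lab i = 0" using labels_zero admissible by (simp add: lab_eq)

lemma rvec_lab: "rvec lr = \<delta>" by (auto simp: rvec_def \<delta>_def lab_zero fun_eq_iff)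

text \<open>The norm does not change since \<delta> is in the radical, so only lattice membership is
  at stake. Where \<alpha>_i is shorter than \<beta>, the number \<gamma> n a_i must be a multiple
  of |\<beta>|^2 / |\<alpha>_i|^2. This follows from a_i |\<alpha>_i|^2 / 2 being the colabel and
  from |\<beta>|^2 / 2 being either r, in which case \<gamma> = r, or of the form 1/j.\<close>

lemma real_root_shift:
  assumes \<beta>: "\<beta> \<in> real_roots"
  shows "(\<lambda>i. \<beta> i + of_int (int (\<gamma> \<beta>) * n) * \<delta> i) \<in> real_roots"
proof -
  obtain x t where x: "t \<le> l" "\<beta> = rvec x" "x \<in> scaled_lattice (2 * half_norm t)" "B x x = 2 * half_norm t" using real_rootE[OF \<beta>] by metis
  define q :: real where "q = of_int (int (\<gamma> \<beta>) * n)"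
  have f: "form \<beta> \<beta> = of_real (2 * half_norm t)" using x form_rvec[of x x] by (simp add: scaled_lattice_def)
  have pt: "half_norm t > 0" using half_norm_pos[OF x(1)] .
  have "(\<lambda>i. x i + q * lr i) \<in> scaled_lattice (2 * half_norm t)" unfolding scaled_lattice_def
  proof (intro CollectI conjI allI impI)
    fix i assume "l < i" then show "x i + q * lr i = 0" using x(3) by (simp add: scaled_lattice_def lab_zero)
  next
    fix i assume i: "i \<le> l"
    have p: "half_norm i > 0" "lr i > 0" using half_norm_pos[OF i] lr_pos[OF i] by auto
    obtain k :: int where k: "x i = of_int k * scaling (2 * half_norm t) i" using x(3) i by (auto simp: scaled_lattice_def)
    have "\<exists>j::int. q * lr i = of_int j * scaling (2 * half_norm t) i"
    proof (cases "half_norm t \<le> half_norm i")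
      case True
      then have "scaling (2 * half_norm t) i = 1" using p pt by (simp add: scaling_def max_absorb1)
      then show ?thesis by (intro exI[of _ "int (\<gamma> \<beta>) * n * int (lab i)"]) (simp add: q_def)
    next
      case False
      then have c: "scaling (2 * half_norm t) i = half_norm t / half_norm i" using p pt by (simp add: scaling_def max_absorb2)
      have dl: "half_norm i * lr i = real (colab i)" using p by (simp add: half_norm_def)
      from half_norm_twist_or[OF x(1)] show ?thesis
      proof
        assume "half_norm t = real r"
        then have "\<gamma> \<beta> = r" using gamma_eq[OF \<beta> x(1) f] by simp
        then have "q * lr i = of_int (n * int (colab i)) * (half_norm t / half_norm i)"
          using p pt \<open>half_norm t = real r\<close> dl by (simp add: q_def field_simps)
        then show ?thesis unfolding c by blast
      next
        assume "\<exists>n::nat. real n * half_norm t = 1"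
        then obtain j where j: "real j * half_norm t = 1" by auto
        have "of_int (int (\<gamma> \<beta>) * n * int (colab i) * int j) * (half_norm t / half_norm i) = q * real (colab i) / half_norm i * (real j * half_norm t)"
          by (simp add: q_def)
        also have "\<dots> = q * lr i" unfolding j dl[symmetric] using p by simp
        finally show ?thesis unfolding c by metis
      qed
    qed
    then obtain j :: int where "q * lr i = of_int j * scaling (2 * half_norm t) i" by auto
    then have "x i + q * lr i = of_int (k + j) * scaling (2 * half_norm t) i" using k by (simp add: distrib_right)
    then show "\<exists>n::int. x i + q * lr i = of_int n * scaling (2 * half_norm t) i" by blast
  qed
  moreover have "B (\<lambda>i. x i + q * lr i) (\<lambda>i. x i + q * lr i) = 2 * half_norm t"
    using B_lin[of 1 x q lr "\<lambda>i. x i + q * lr i"] B_lin'[of x 1 x q lr] B_lin'[of lr 1 x q lr] B_lab B_sym[of lr x] x(4) by simp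
  ultimately have "rvec (\<lambda>i. x i + q * lr i) \<in> real_roots" using real_rootI[OF x(1)] by simp
  moreover have "rvec (\<lambda>i. x i + q * lr i) = (\<lambda>i. \<beta> i + of_int (int (\<gamma> \<beta>) * n) * \<delta> i)"
    unfolding rvec_lab[symmetric] by (simp add: x(2) rvec_def q_def fun_eq_iff)
  ultimately show ?thesis by simp
qed

lemma M_hat_finite_part: "\<eta> \<in> M_hat \<Longrightarrow> \<eta> \<in> finite_part" by (simp add: M_hat_def)

lemma M_hat_form: "\<eta> \<in> M_hat \<Longrightarrow> \<beta> \<in> real_roots \<Longrightarrow> \<exists>n::int. form \<beta> \<eta> = of_int (int (\<gamma> \<beta>) * n)"
  by (auto simp: M_hat_def)

lemma t_real_root:
  assumes "\<beta> \<in> real_roots" shows "t \<eta> \<beta> = (\<lambda>i. \<beta> i - form \<beta> \<eta> * \<delta> i)"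
  using real_root_support[OF assms] by (simp add: t_alt)

lemma t_real_roots:
  assumes "\<eta> \<in> M_hat" "\<beta> \<in> real_roots" shows "t \<eta> \<beta> \<in> real_roots"
proof -
  obtain n where "form \<beta> \<eta> = of_int (int (\<gamma> \<beta>) * n)" using M_hat_form[OF assms] by auto
  then have "t \<eta> \<beta> = (\<lambda>i. \<beta> i + of_int (int (\<gamma> \<beta>) * (- n)) * \<delta> i)"
    unfolding t_real_root[OF assms(2)] by simp
  then show ?thesis using real_root_shift[OF assms(2)] by metis
qed

lemma M_hat_add: "\<eta> \<in> M_hat \<Longrightarrow> \<mu> \<in> M_hat \<Longrightarrow> (\<lambda>i. \<eta> i + \<mu> i) \<in> M_hat"
  unfolding M_hat_def
proof (intro CollectI conjI ballI; elim CollectE conjE)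
  fix \<beta> assume \<beta>: "\<beta> \<in> real_roots" and "\<forall>\<beta>\<in>real_roots. \<exists>n::int. form \<beta> \<eta> = of_nat (\<gamma> \<beta>) * of_int n"
    "\<forall>\<beta>\<in>real_roots. \<exists>n::int. form \<beta> \<mu> = of_nat (\<gamma> \<beta>) * of_int n"
  then obtain n m :: int where "form \<beta> \<eta> = of_nat (\<gamma> \<beta>) * of_int n" "form \<beta> \<mu> = of_nat (\<gamma> \<beta>) * of_int m" by blast
  then have "form \<beta> (\<lambda>i. \<eta> i + \<mu> i) = of_nat (\<gamma> \<beta>) * of_int (n + m)"
    by (simp add: form_add_right distrib_left)
  then show "\<exists>n::int. form \<beta> (\<lambda>i. \<eta> i + \<mu> i) = of_nat (\<gamma> \<beta>) * of_int n" by blast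
qed (rule finite_part_add)

lemma M_hat_uminus: "\<eta> \<in> M_hat \<Longrightarrow> (\<lambda>i. - \<eta> i) \<in> M_hat"
  unfolding M_hat_def
proof (intro CollectI conjI ballI; elim CollectE conjE)
  fix \<beta> assume \<beta>: "\<beta> \<in> real_roots" and "\<forall>\<beta>\<in>real_roots. \<exists>n::int. form \<beta> \<eta> = of_nat (\<gamma> \<beta>) * of_int n"
  then obtain n :: int where "form \<beta> \<eta> = of_nat (\<gamma> \<beta>) * of_int n" by blast
  then have "form \<beta> (\<lambda>i. - \<eta> i) = of_nat (\<gamma> \<beta>) * of_int (- n)"
    using form_uminus[of \<eta> \<beta>] form_sym[of \<beta>] by simp
  then show "\<exists>n::int. form \<beta> (\<lambda>i. - \<eta> i) = of_nat (\<gamma> \<beta>) * of_int n" by blast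
qed (simp add: finite_part_def)

lemma M_hat_zero: "(\<lambda>i. 0) \<in> M_hat"
  by (auto simp: M_hat_def finite_part_def form_def intro!: exI[of _ 0])

lemma gamma_sw: "set is \<subseteq> {..l} \<Longrightarrow> \<beta> \<in> real_roots \<Longrightarrow> \<gamma> (sw is \<beta>) = \<gamma> \<beta>"
  using real_root_form[of \<beta>] gamma_eq[of \<beta>] gamma_eq[of "sw is \<beta>"] by (auto simp: sw_real_roots form_sw)

lemma M_hat_sw:
  assumes "is": "set is \<subseteq> {1..l}" and \<eta>: "\<eta> \<in> M_hat" shows "sw is \<eta> \<in> M_hat"
  unfolding M_hat_def
proof (intro CollectI conjI ballI)
  have is': "set is \<subseteq> {..l}" "set (rev is) \<subseteq> {..l}" using "is" by auto
  have "k \<notin> {1..l} \<Longrightarrow> sw is \<eta> k = 0" for k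
    using sw_other[of k "is" \<eta>] "is" M_hat_finite_part[OF \<eta>] by (force simp: finite_part_def)
  then show "sw is \<eta> \<in> finite_part" by (simp add: finite_part_def)
  fix \<beta> assume \<beta>: "\<beta> \<in> real_roots"
  let ?b = "sw (rev is) \<beta>"
  have "?b \<in> real_roots" using sw_real_roots[OF is'(2) \<beta>] .
  then obtain n :: int where "form ?b \<eta> = of_nat (\<gamma> ?b) * of_int n" using \<eta> unfolding M_hat_def by blast
  moreover have "form \<beta> (sw is \<eta>) = form ?b \<eta>"
    using form_sw[OF is'(1), of ?b \<eta>] sw_rev'[OF is'(1)] by simp
  ultimately show "\<exists>n::int. form \<beta> (sw is \<eta>) = of_nat (\<gamma> \<beta>) * of_int n" using gamma_sw[OF is'(2) \<beta>] by auto
qed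

text \<open>An integral pairing with the coroot of \<beta> means a product with \<beta> in multiples
  of |\<beta>|^2 / 2, which for a long root is the divisibility by r required in
  \<open>M_hat\<close>. The coroot of vertex 0 is included to make the set stable under all
  reflections.\<close>

definition weight_lattice :: "vec set" where
  "weight_lattice = {v. \<forall>k\<le>l. \<exists>n::int. pairing v (\<alpha>_vee k) = of_int n}"

lemma pairing_alpha: "i \<le> l \<Longrightarrow> k \<le> l \<Longrightarrow> pairing (\<alpha> i) (\<alpha>_vee k) = of_int (a_mat k i)"
  by (simp add: pairing_coroot) (simp add: unit_vec_def if_distrib cong: if_cong)

lemma pairing_s: "i \<le> l \<Longrightarrow> k \<le> l \<Longrightarrow> pairing (s i v) (\<alpha>_vee k) = pairing v (\<alpha>_vee k) - pairing v (\<alpha>_vee i) * of_int (a_mat k i)"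
  unfolding s_alt pairing_lin by (simp add: pairing_alpha)

lemma weight_lattice_sw: "set is \<subseteq> {..l} \<Longrightarrow> v \<in> weight_lattice \<Longrightarrow> sw is v \<in> weight_lattice"
proof (induction "is")
  case (Cons i "is")
  then have IH: "\<exists>n::int. pairing (sw is v) (\<alpha>_vee k) = of_int n" if "k \<le> l" for k using that by (auto simp: weight_lattice_def)
  show ?case unfolding weight_lattice_def
  proof (intro CollectI allI impI)
    fix k assume k: "k \<le> l"
    have i: "i \<le> l" using Cons by auto
    obtain n m :: int where "pairing (sw is v) (\<alpha>_vee k) = of_int n" "pairing (sw is v) (\<alpha>_vee i) = of_int m" using IH k i by metis
    then have "pairing (sw (i # is) v) (\<alpha>_vee k) = of_int (n - m * a_mat k i)" using pairing_s[OF i k] by (simp add: sw_Cons)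
    then show "\<exists>n::int. pairing (sw (i # is) v) (\<alpha>_vee k) = of_int n" by blast
  qed
qed (simp add: sw_Nil)

lemma weight_lattice_form:
  assumes v: "v \<in> weight_lattice" and \<beta>: "\<beta> \<in> real_roots" "i \<le> l" "form \<beta> \<beta> = of_real (2 * half_norm i)"
  shows "\<exists>n::int. form \<beta> v = of_real (half_norm i) * of_int n"
proof -
  obtain js k where j: "\<beta> = sw js (\<alpha> k)" "set js \<subseteq> {..l}" "k \<le> l" using \<beta>(1) by (auto simp: real_roots_eq)
  have "complex_of_real (2 * half_norm k) = of_real (2 * half_norm i)" using \<beta>(3) j form_sw[OF j(2)] form_alpha_alpha[OF j(3)] by simp
  then have d: "half_norm k = half_norm i" using of_real_eq_iff by simp
  have "set (rev js) \<subseteq> {..l}" using j by simp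
  then have "sw (rev js) v \<in> weight_lattice" using weight_lattice_sw v by blast
  then obtain n :: int where "pairing (sw (rev js) v) (\<alpha>_vee k) = of_int n" using j(3) by (auto simp: weight_lattice_def)
  moreover have "form \<beta> v = form (\<alpha> k) (sw (rev js) v)"
    using form_sw[OF j(2), of "\<alpha> k" "sw (rev js) v"] sw_rev'[OF j(2)] j(1) by simp
  ultimately show ?thesis using form_alpha[OF j(3), of "sw (rev js) v"] d form_sym by metis
qed

lemma form_real_root_expand:
  assumes "\<beta> \<in> real_roots" shows "form \<beta> v = (\<Sum>k\<le>l. \<beta> k * form (\<alpha> k) v)"
proof -
  have *: "form (\<alpha> k) v = (\<Sum>j\<le>Suc l. v j * form_basis k j)" if "k \<le> l" for k
  proof -
    have "form (\<alpha> k) v = (\<Sum>i\<le>Suc l. if i = k then \<Sum>j\<le>Suc l. v j * form_basis k j else 0)"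
      unfolding form_def unit_vec_def by (intro sum.cong refl) auto
    then show ?thesis using that by simp
  qed
  have "form \<beta> v = (\<Sum>i\<le>l. \<Sum>j\<le>Suc l. \<beta> i * v j * form_basis i j)"
    unfolding form_def using real_root_support[OF assms, of "Suc l"] by (subst sum.atMost_Suc) simp
  also have "\<dots> = (\<Sum>k\<le>l. \<beta> k * form (\<alpha> k) v)"
    by (intro sum.cong refl) (simp add: * sum_distrib_left mult_ac del: sum.atMost_Suc)
  finally show ?thesis .
qed

text \<open>Real roots are integral combinations of simple roots, so integrality on the simple roots
  settles all roots with \<gamma> = 1. For long roots with r > 1 the product is r times an integer
  by \<open>weight_lattice_form\<close>.\<close>

lemma M_hatI:
  assumes v: "v \<in> finite_part" "\<And>k. k \<le> l \<Longrightarrow> \<exists>n::int. form (\<alpha> k) v = of_int n"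
    and w: "r = 1 \<or> v \<in> weight_lattice"
  shows "v \<in> M_hat"
  unfolding M_hat_def
proof (intro CollectI conjI ballI v(1))
  fix \<beta> assume \<beta>: "\<beta> \<in> real_roots"
  have int: "\<exists>n::int. form \<beta> v = of_int n"
  proof -
    obtain n :: "nat \<Rightarrow> int" where n: "\<And>k. k \<le> l \<Longrightarrow> form (\<alpha> k) v = of_int (n k)" using v(2) by metis
    obtain b :: "nat \<Rightarrow> int" where b: "\<And>k. \<beta> k = of_int (b k)" using real_root_Ints[OF \<beta>] by metis
    have "form \<beta> v = (\<Sum>k\<le>l. of_int (b k) * of_int (n k))"
      unfolding form_real_root_expand[OF \<beta>] by (intro sum.cong refl) (simp add: n b)
    then have "form \<beta> v = of_int (\<Sum>k\<le>l. b k * n k)" by simp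
    then show ?thesis by blast
  qed
  obtain i where i: "i \<le> l" "form \<beta> \<beta> = of_real (2 * half_norm i)" using real_root_form[OF \<beta>] by blast
  show "\<exists>n::int. form \<beta> v = of_nat (\<gamma> \<beta>) * of_int n"
  proof (cases "half_norm i = real r \<and> r \<noteq> 1")
    case True
    then have "v \<in> weight_lattice" "\<gamma> \<beta> = r" using w gamma_eq[OF \<beta> i] by auto
    then show ?thesis using weight_lattice_form[OF _ \<beta> i] True by auto
  next
    case False
    then have "\<gamma> \<beta> = 1" using gamma_eq[OF \<beta> i] by auto
    then show ?thesis using int by simp
  qed
qed

end

section \<open>Square linear systems over a field\<close>

lemma homogeneous_system:
  fixes v :: "'b \<Rightarrow> nat \<Rightarrow> 'a::field"
  shows "finite J \<Longrightarrow> n < card J \<Longrightarrow> \<exists>x. (\<exists>j\<in>J. x j \<noteq> 0) \<and> (\<forall>i<n. (\<Sum>j\<in>J. x j * v j i) = 0)"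
proof (induction n arbitrary: J v)
  case 0
  then obtain j where "j \<in> J" by fastforce
  then show ?case by (intro exI[of _ "\<lambda>_. 1"]) auto
next
  case (Suc n)
  show ?case
  proof (cases "\<forall>j\<in>J. v j n = 0")
    case True
    obtain x where x: "\<exists>j\<in>J. x j \<noteq> 0" "\<forall>i<n. (\<Sum>j\<in>J. x j * v j i) = 0" using Suc.IH[of J v] Suc.prems by auto
    then have "\<forall>i<Suc n. (\<Sum>j\<in>J. x j * v j i) = 0" using True by (auto simp: less_Suc_eq)
    then show ?thesis using x by blast
  next
    case False
    then obtain p where p: "p \<in> J" "v p n \<noteq> 0" by auto
    let ?J = "J - {p}"
    \<comment> \<open>Elimination: equation n is solved for the unknown p, and the result is
      substituted into the other equations.\<close>
    define u where "u j i = v j i - v j n / v p n * v p i" for j i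
    obtain x where x: "\<exists>j\<in>?J. x j \<noteq> 0" "\<forall>i<n. (\<Sum>j\<in>?J. x j * u j i) = 0"
    proof -
      have "n < card ?J" using Suc.prems p by (simp add: card_Diff_singleton)
      then show ?thesis using Suc.IH[of ?J u] Suc.prems(1) that by blast
    qed
    define y where "y j = (if j = p then - (\<Sum>j\<in>?J. x j * v j n) / v p n else x j)" for j
    have key: "(\<Sum>j\<in>J. y j * v j i) = (\<Sum>j\<in>?J. x j * u j i)" for i
    proof -
      have "(\<Sum>j\<in>J. y j * v j i) = y p * v p i + (\<Sum>j\<in>?J. y j * v j i)"
        using Suc.prems p by (simp add: sum.remove)
      also have "(\<Sum>j\<in>?J. y j * v j i) = (\<Sum>j\<in>?J. x j * v j i)" by (intro sum.cong) (auto simp: y_def)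
      also have "y p * v p i + (\<Sum>j\<in>?J. x j * v j i) = (\<Sum>j\<in>?J. x j * u j i)"
        by (simp add: y_def u_def right_diff_distrib sum_subtractf sum_distrib_right sum_divide_distrib)
           (simp add: sum_negf[symmetric] mult_ac)
      finally show ?thesis .
    qed
    have "(\<Sum>j\<in>J. y j * v j i) = 0" if "i < Suc n" for i
    proof (cases "i = n")
      case True
      have "u j n = 0" for j using p by (simp add: u_def)
      then show ?thesis using key[of n] True by simp
    next
      case False then show ?thesis using key[of i] x(2) that by simp
    qed
    moreover have "\<exists>j\<in>J. y j \<noteq> 0" using x(1) by (auto simp: y_def)
    ultimately show ?thesis by blast
  qed
qed

text \<open>The system with the extra column -b has more unknowns than equations, hence a nontrivial
  solution. Injectivity makes its last entry nonzero, and dividing by that entry gives a solution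
  for b.\<close>

lemma injective_system_solvable:
  fixes M :: "nat \<Rightarrow> nat \<Rightarrow> 'a::field"
  assumes inj: "\<And>x. (\<And>i. i < n \<Longrightarrow> (\<Sum>j<n. M i j * x j) = 0) \<Longrightarrow> (\<And>j. j < n \<Longrightarrow> x j = 0)"
  shows "\<exists>x. \<forall>i<n. (\<Sum>j<n. M i j * x j) = b i"
proof -
  define v where "v j i = (if j = n then - b i else M i j)" for j i
  obtain y where y: "\<exists>j\<le>n. y j \<noteq> 0" "\<forall>i<n. (\<Sum>j\<le>n. y j * v j i) = 0"
    using homogeneous_system[of "{..n}" n v] by auto
  have e: "(\<Sum>j<n. M i j * y j) = y n * b i" if "i < n" for i
  proof -
    have "(\<Sum>j<n. y j * v j i) = (\<Sum>j<n. M i j * y j)" by (intro sum.cong) (auto simp: v_def)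
    then have "(\<Sum>j\<le>n. y j * v j i) = (\<Sum>j<n. M i j * y j) - y n * b i"
      by (simp add: lessThan_Suc_atMost[symmetric] v_def)
    then show ?thesis using y(2) that by simp
  qed
  have "y n \<noteq> 0"
  proof
    assume z: "y n = 0"
    have "y j = 0" if "j < n" for j by (rule inj[of y]) (use e z that in auto)
    then show False using y(1) z by (metis order_le_less)
  qed
  then have "(\<Sum>j<n. M i j * (y j / y n)) = b i" if "i < n" for i
    using e[OF that] by (simp add: sum_divide_distrib[symmetric])
  then show ?thesis by (intro exI[of _ "\<lambda>j. y j / y n"]) auto
qed

section \<open>Fundamental weights and coweights inside the translation lattice\<close>

context affine_datum
begin

lemma form_finite_part_expand:
  assumes "v \<in> finite_part" "k \<le> l"
  shows "form (\<alpha> k) v = of_real (half_norm k) * (\<Sum>j\<in>{1..l}. of_int (a_mat k j) * v j)"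
proof -
  have "(\<Sum>j\<le>l. of_int (a_mat k j) * v j) = (\<Sum>j\<in>{1..l}. of_int (a_mat k j) * v j)"
    by (rule sum.mono_neutral_right) (use assms in \<open>auto simp: finite_part_def\<close>)
  then show ?thesis using form_alpha[OF assms(2), of v] finite_part_Suc[OF assms(1)]
    by (simp add: form_sym[of _ v] pairing_coroot[OF assms(2)])
qed

text \<open>The span of \<alpha>_1, ..., \<alpha>_l misses the coordinate 0, so the form is definite
  on it: the finite Cartan matrix is nonsingular. The complex version follows by taking real and
  imaginary parts.\<close>

lemma finite_part_eq_0_real:
  assumes y: "\<And>i. i \<notin> {1..l} \<Longrightarrow> y i = 0" and z: "\<And>k. k \<in> {1..l} \<Longrightarrow> (\<Sum>j\<in>{1..l}. ar k j * y j) = 0"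
  shows "y i = 0"
proof (rule ccontr)
  assume n: "y i \<noteq> 0"
  then have i: "i \<le> l" using y[of i] by (cases "i \<in> {1..l}") auto
  have "0 < B y y" by (rule B_pos[of 0 y i]) (use y n i in auto)
  moreover have "y k * B (er k) y = 0" if "k \<le> l" for k
  proof (cases "k = 0")
    case False
    have "(\<Sum>j\<le>l. ar k j * y j) = (\<Sum>j\<in>{1..l}. ar k j * y j)"
      by (rule sum.mono_neutral_right) (use y in auto)
    then show ?thesis using z[of k] False that by (simp add: B_er)
  qed (use y in auto)
  then have "B y y = 0" unfolding B_expand[of y] by (intro sum.neutral) auto
  ultimately show False by simp
qed

lemma finite_part_eq_0:
  assumes v: "v \<in> finite_part" and z: "\<And>k. k \<in> {1..l} \<Longrightarrow> form (\<alpha> k) v = 0"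
  shows "v i = 0"
proof -
  have s: "(\<Sum>j\<in>{1..l}. of_int (a_mat k j) * v j) = 0" if "k \<in> {1..l}" for k
    using form_finite_part_expand[OF v, of k] z[OF that] half_norm_pos[of k] that by auto
  have "Re (v i) = 0"
  proof (rule finite_part_eq_0_real[of "\<lambda>i. Re (v i)"])
    fix k assume "k \<in> {1..l}"
    then show "(\<Sum>j\<in>{1..l}. ar k j * Re (v j)) = 0" using arg_cong[OF s, of k Re] by simp
  qed (use v in \<open>auto simp: finite_part_def\<close>)
  moreover have "Im (v i) = 0"
  proof (rule finite_part_eq_0_real[of "\<lambda>i. Im (v i)"])
    fix k assume "k \<in> {1..l}"
    then show "(\<Sum>j\<in>{1..l}. ar k j * Im (v j)) = 0" using arg_cong[OF s, of k Im] by simp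
  qed (use v in \<open>auto simp: finite_part_def\<close>)
  ultimately show ?thesis by (simp add: complex_eq_iff)
qed

lemma finite_part_eqI:
  assumes u: "u \<in> finite_part" and v: "v \<in> finite_part" and e: "\<And>k. k \<in> {1..l} \<Longrightarrow> form (\<alpha> k) u = form (\<alpha> k) v"
  shows "u = v"
proof
  fix i
  have "(\<lambda>i. 1 * u i + (-1) * v i) i = 0"
  proof (rule finite_part_eq_0)
    show "(\<lambda>i. 1 * u i + (-1) * v i) \<in> finite_part" using u v by (simp add: finite_part_def)
    show "form (\<alpha> k) (\<lambda>i. 1 * u i + (-1) * v i) = 0" if "k \<in> {1..l}" for k
      unfolding form_lin' using e[OF that] by simp
  qed
  then show "u i = v i" by simp
qed

lemma finite_part_dual_exists:
  "\<exists>v\<in>finite_part. \<forall>k\<in>{1..l}. form (\<alpha> k) v = b k"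
proof -
  have "\<exists>x. \<forall>i<l. (\<Sum>j<l. of_int (a_mat (Suc i) (Suc j)) * x j) = b (Suc i) / of_real (half_norm (Suc i))"
  proof (rule injective_system_solvable)
    fix x :: "nat \<Rightarrow> complex" and j
    assume z: "\<And>i. i < l \<Longrightarrow> (\<Sum>j<l. of_int (a_mat (Suc i) (Suc j)) * x j) = 0" and j: "j < l"
    define v where "v i = (if i \<in> {1..l} then x (i - 1) else 0)" for i
    have "v (Suc j) = 0"
    proof (rule finite_part_eq_0)
      show "v \<in> finite_part" by (simp add: finite_part_def v_def)
      then show "form (\<alpha> k) v = 0" if kl: "k \<in> {1..l}" for k
      proof -
        obtain k' where "k = Suc k'" "k' < l" using kl by (cases k) auto
        then show ?thesis using z[of k'] \<open>v \<in> finite_part\<close>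
          by (simp add: form_finite_part_expand) (simp add: sum.atLeast1_atMost_eq v_def)
      qed
    qed
    then show "x j = 0" using j by (simp add: v_def)
  qed
  then obtain x where x: "\<And>i. i < l \<Longrightarrow> (\<Sum>j<l. of_int (a_mat (Suc i) (Suc j)) * x j) = b (Suc i) / of_real (half_norm (Suc i))" by auto
  define v where "v i = (if i \<in> {1..l} then x (i - 1) else 0)" for i
  have v: "v \<in> finite_part" by (simp add: finite_part_def v_def)
  moreover have "form (\<alpha> k) v = b k" if kl: "k \<in> {1..l}" for k
  proof -
    obtain k' where "k = Suc k'" "k' < l" using kl by (cases k) auto
    then show ?thesis using x[of k'] half_norm_pos[of k]
      by (simp add: form_finite_part_expand[OF v]) (simp add: sum.atLeast1_atMost_eq v_def)
  qed
  ultimately show ?thesis by blast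
qed

text \<open>The imaginary part of v lies in the same span and is orthogonal to \<alpha>_1, ...,
  \<alpha>_l, hence vanishes.\<close>

lemma finite_part_real:
  assumes v: "v \<in> finite_part" and e: "\<And>k. k \<in> {1..l} \<Longrightarrow> form (\<alpha> k) v \<in> \<real>"
  shows "v i \<in> \<real>"
proof -
  define y where "y i = complex_of_real (Im (v i))" for i
  have "y i = 0"
  proof (rule finite_part_eq_0)
    show y: "y \<in> finite_part" using v by (simp add: finite_part_def y_def)
    fix k assume k: "k \<in> {1..l}"
    have "form (\<alpha> k) y = of_real (Im (form (\<alpha> k) v))"
      using k by (simp add: form_finite_part_expand[OF v] form_finite_part_expand[OF y]) (simp add: y_def)
    then show "form (\<alpha> k) y = 0" using e[OF k] by (simp add: complex_is_Real_iff)
  qed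
  then show ?thesis by (simp add: y_def complex_is_Real_iff)
qed

lemma form_alpha_pairing: "k \<le> l \<Longrightarrow> form (\<alpha> k) v = of_real (half_norm k) * pairing v (\<alpha>_vee k)"
  using form_alpha form_sym by metis

lemma fund_weight_props:
  assumes "i \<in> {1..l}"
  shows "fund_weight i \<in> finite_part" "\<And>j. j \<in> {1..l} \<Longrightarrow> form (\<alpha> j) (fund_weight i) = (if i = j then of_real (half_norm j) else 0)"
proof -
  have iff: "(\<forall>j\<in>{1..l}. pairing v (\<alpha>_vee j) = (if i = j then 1 else 0)) \<longleftrightarrow>
    (\<forall>j\<in>{1..l}. form (\<alpha> j) v = (if i = j then of_real (half_norm j) else 0))" for v
  proof (intro ball_cong refl)
    fix j assume "j \<in> {1..l}"
    then have "half_norm j \<noteq> 0" "j \<le> l" using half_norm_pos[of j] by auto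
    then show "(pairing v (\<alpha>_vee j) = (if i = j then 1 else 0)) = (form (\<alpha> j) v = (if i = j then of_real (half_norm j) else 0))"
      by (auto simp: form_alpha_pairing)
  qed
  obtain v where v: "v \<in> finite_part" "\<forall>j\<in>{1..l}. form (\<alpha> j) v = (if i = j then of_real (half_norm j) else 0)"
    using finite_part_dual_exists[of "\<lambda>j. if i = j then of_real (half_norm j) else 0"] by auto
  have "fund_weight i = v" unfolding fund_weight_def iff
    by (rule the_equality) (use v in \<open>auto intro!: finite_part_eqI\<close>)
  then show "fund_weight i \<in> finite_part" "\<And>j. j \<in> {1..l} \<Longrightarrow> form (\<alpha> j) (fund_weight i) = (if i = j then of_real (half_norm j) else 0)"
    using v by auto
qed

lemma nu_finite_part: "h \<in> finite_part \<Longrightarrow> nu h \<in> finite_part"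
  by (auto simp: nu_def finite_part_def)

lemma form_alpha_nu:
  assumes h: "h \<in> finite_part" and j: "j \<in> {1..l}"
  shows "form (\<alpha> j) (nu h) = pairing (\<alpha> j) h"
proof -
  have "form (\<alpha> j) (nu h) = (\<Sum>k\<in>{1..l}. of_real (half_norm j * ar j k) * nu h k)"
    using form_finite_part_expand[OF nu_finite_part[OF h], of j] j by (simp add: sum_distrib_left mult_ac)
  also have "\<dots> = (\<Sum>k\<in>{1..l}. of_int (a_mat k j) * h k)"
  proof (intro sum.cong refl)
    fix k assume k: "k \<in> {1..l}"
    then have "half_norm j * ar j k = half_norm k * ar k j" using half_norm_ar_sym j by simp
    moreover have "nu h k = h k / of_real (half_norm k)" using k by (simp add: nu_def half_norm_def)
    ultimately show "of_real (half_norm j * ar j k) * nu h k = of_int (a_mat k j) * h k"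
      using half_norm_pos[of k] k by simp
  qed
  also have "\<dots> = (\<Sum>k\<le>Suc l. h k * pairing_basis j k)"
    by (rule sum.mono_neutral_cong_left) (use h j in \<open>auto simp: finite_part_def pairing_basis_def\<close>)
  also have "\<dots> = pairing (\<alpha> j) h"
  proof -
    have "pairing (\<alpha> j) h = (\<Sum>i\<le>Suc l. if i = j then \<Sum>k\<le>Suc l. h k * pairing_basis j k else 0)"
      unfolding pairing_def unit_vec_def by (intro sum.cong refl) auto
    then show ?thesis using j by simp
  qed
  finally show ?thesis .
qed

lemma fund_coweight_props:
  assumes "i \<in> {1..l}"
  shows "nu (fund_coweight i) \<in> finite_part"
    "\<And>j. j \<in> {1..l} \<Longrightarrow> form (\<alpha> j) (nu (fund_coweight i)) = (if i = j then 1 else 0)"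
proof -
  obtain v where v: "v \<in> finite_part" "\<forall>j\<in>{1..l}. form (\<alpha> j) v = (if i = j then 1 else 0)"
    using finite_part_dual_exists[of "\<lambda>j. if i = j then 1 else 0"] by auto
  \<comment> \<open>The inverse of \<open>nu\<close> on the finite part, where \<open>nu\<close>
    divides coordinate k by \<open>half_norm k\<close>.\<close>
  define h where "h k = of_real (half_norm k) * v k" for k
  have h: "h \<in> finite_part" using v(1) by (simp add: h_def finite_part_def)
  have "nu h = v"
  proof
    fix k
    show "nu h k = v k"
    proof (cases "k \<le> l")
      case True
      then show ?thesis using lr_pos[of k] colab_pos[of k] by (simp add: nu_def h_def half_norm_def)
    next
      case False
      then show ?thesis using v(1) by (simp add: nu_def h_def finite_part_def)
    qed
  qed
  have inj: "g = h" if g: "g \<in> finite_part" "nu g = nu h" for g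
  proof
    fix k
    have "nu g k = nu h k" using g by simp
    then show "g k = h k" using g h lr_pos[of k] colab_pos[of k]
      by (cases "k \<le> l") (auto simp: nu_def finite_part_def)
  qed
  have "fund_coweight i = h" unfolding fund_coweight_def
  proof (rule the_equality)
    show "h \<in> finite_part \<and> (\<forall>j\<in>{1..l}. pairing (\<alpha> j) h = (if i = j then 1 else 0))"
      using h v form_alpha_nu[OF h] \<open>nu h = v\<close> by simp
    fix g assume g: "g \<in> finite_part \<and> (\<forall>j\<in>{1..l}. pairing (\<alpha> j) g = (if i = j then 1 else 0))"
    then have "nu g = v" using form_alpha_nu[of g] v nu_finite_part[of g] by (intro finite_part_eqI) auto
    then show "g = h" using inj g \<open>nu h = v\<close> by simp
  qed
  then show "nu (fund_coweight i) \<in> finite_part"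
    "\<And>j. j \<in> {1..l} \<Longrightarrow> form (\<alpha> j) (nu (fund_coweight i)) = (if i = j then 1 else 0)"
    using \<open>nu h = v\<close> v by auto
qed

text \<open>The product of \<alpha>_j with the basis vector \<lambda>_j: 1 for coweights, half the
  squared length of \<alpha>_j for weights. Up to this factor the \<lambda>_j are dual to the simple
  roots.\<close>

definition bnorm :: "nat \<Rightarrow> real" where "bnorm j = (if r = 1 then 1 else half_norm j)"

lemma bnorm_pos: "j \<le> l \<Longrightarrow> 0 < bnorm j" using half_norm_pos by (simp add: bnorm_def)

lemma basis_M_hat_props:
  assumes "i \<in> {1..l}"
  shows "basis_M_hat i \<in> finite_part"
    "\<And>j. j \<in> {1..l} \<Longrightarrow> form (\<alpha> j) (basis_M_hat i) = (if i = j then of_real (bnorm j) else 0)"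
  using fund_weight_props[OF assms] fund_coweight_props[OF assms] by (auto simp: basis_M_hat_def bnorm_def)

text \<open>Vectors of the finite part are orthogonal to \<delta>, the combination of the simple
  roots by the labels, so their product with \<alpha>_0 is determined by the others.\<close>

lemma alpha_0_form:
  assumes v: "v \<in> finite_part"
  shows "of_real (lr 0) * form (\<alpha> 0) v = - (\<Sum>j\<in>{1..l}. of_real (lr j) * form (\<alpha> j) v)"
proof -
  have e: "\<delta> i = (\<Sum>k\<le>l. of_real (lr k) * \<alpha> k i)" for i
    by (auto simp: \<delta>_def unit_vec_def if_distrib cong: if_cong)
  have "form \<delta> v = (\<Sum>k\<le>l. of_real (lr k) * form (\<alpha> k) v)"
  proof -
    have *: "form (\<alpha> k) v = (\<Sum>j\<le>Suc l. v j * form_basis k j)" if "k \<le> l" for k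
    proof -
      have "form (\<alpha> k) v = (\<Sum>i\<le>Suc l. if i = k then \<Sum>j\<le>Suc l. v j * form_basis k j else 0)"
        unfolding form_def unit_vec_def by (intro sum.cong refl) auto
      then show ?thesis using that by simp
    qed
    have "form \<delta> v = (\<Sum>i\<le>l. \<Sum>j\<le>Suc l. \<delta> i * v j * form_basis i j)"
      unfolding form_def by (subst sum.atMost_Suc) simp
    also have "\<dots> = (\<Sum>k\<le>l. of_real (lr k) * form (\<alpha> k) v)"
      by (intro sum.cong refl) (simp add: * \<delta>_def sum_distrib_left mult_ac del: sum.atMost_Suc)
    finally show ?thesis .
  qed
  then have "0 = (\<Sum>k\<le>l. of_real (lr k) * form (\<alpha> k) v)" using form_delta'[of v] finite_part_Suc[OF v] by simp
  also have "{..l} = insert 0 {1..l}" by auto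
  finally show ?thesis by (simp add: eq_neg_iff_add_eq_0)
qed

text \<open>The delicate value is the one at \<alpha>_0, which is -a_i \<open>bnorm i\<close> / a_0.
  In the untwisted case a_0 = 1 and \<open>bnorm i\<close> = 1; in the twisted case a_i
  \<open>bnorm i\<close> is the colabel at i, which a_0 divides.\<close>

lemma basis_M_hat_M_hat:
  assumes i: "i \<in> {1..l}"
  shows "basis_M_hat i \<in> M_hat"
proof -
  let ?b = "basis_M_hat i"
  note b = basis_M_hat_props[OF i]
  have l0: "lr 0 > 0" using lr_pos by simp
  have sum: "(\<Sum>j\<in>{1..l}. of_real (lr j) * form (\<alpha> j) ?b) = complex_of_real (lr i * bnorm i)"
  proof -
    have "(\<Sum>j\<in>{1..l}. of_real (lr j) * form (\<alpha> j) ?b) = (\<Sum>j\<in>{1..l}. if j = i then of_real (lr i * bnorm i) else 0)"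
      by (intro sum.cong refl) (auto simp: b)
    then show ?thesis using i by simp
  qed
  have a0: "form (\<alpha> 0) ?b = of_real (- lr i * bnorm i / lr 0)"
    using alpha_0_form[OF b(1)] l0 unfolding sum by (simp add: field_simps)
  show ?thesis
  proof (cases "r = 1")
    case True
    have lab0: "lab 0 = 1" using untwisted_label_0[OF admissible True] by (simp add: lab_eq)
    show ?thesis
    proof (rule M_hatI[OF b(1)])
      fix k assume k: "k \<le> l"
      show "\<exists>n::int. form (\<alpha> k) ?b = of_int n"
      proof (cases "k = 0")
        case True
        have "form (\<alpha> k) ?b = of_int (- int (lab i))" using a0 lab0 True \<open>r = 1\<close> by (simp add: bnorm_def)
        then show ?thesis by blast
      next
        case False
        then have "form (\<alpha> k) ?b = of_int (if i = k then 1 else 0)" using b(2)[of k] k \<open>r = 1\<close> by (simp add: bnorm_def)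
        then show ?thesis by blast
      qed
    qed (use True in simp)
  next
    case False
    have bn: "bnorm j = half_norm j" for j using False by (simp add: bnorm_def)
    have p: "lr i > 0" using lr_pos i by simp
    have li: "lr i * half_norm i = real (colab i)" using p by (simp add: half_norm_def)
    obtain c where c: "colab i = lab i * c"
      using twisted_labels_dvd[OF admissible False i] by (auto simp: lab_eq colab_eq)
    obtain c' where c': "colab i = lab 0 * c'"
      using label_0_dvd_colabels[OF admissible i] by (auto simp: lab_eq colab_eq)
    have di: "half_norm i = real c" using p by (simp add: half_norm_def c)
    have a0': "form (\<alpha> 0) ?b = of_int (- int c')" using a0 l0 li c' by (simp add: bn)
    show ?thesis
    proof (rule M_hatI[OF b(1)])
      fix k assume k: "k \<le> l"
      show "\<exists>n::int. form (\<alpha> k) ?b = of_int n"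
      proof (cases "k = 0")
        case True
        then show ?thesis using a0' by blast
      next
        case False
        then have "form (\<alpha> k) ?b = of_int (if i = k then int c else 0)" using b(2)[of k] k di by (auto simp: bn)
        then show ?thesis by blast
      qed
    next
      have "\<exists>n::int. pairing ?b (\<alpha>_vee k) = of_int n" if k: "k \<le> l" for k
      proof (cases "k = 0")
        case True
        have "form (\<alpha> 0) ?b = of_real (1 / lr 0) * pairing ?b (\<alpha>_vee 0)" using form_alpha_pairing[of 0 ?b] by (simp add: half_norm_0)
        then have "pairing ?b (\<alpha>_vee 0) = of_int (- int (colab i))" using a0' l0 c' by (simp add: field_simps)
        then show ?thesis using True by blast
      next
        case False
        then have "pairing ?b (\<alpha>_vee k) = of_int (if i = k then 1 else 0)"
          using b(2)[of k] k form_alpha_pairing[of k ?b] half_norm_pos[of k] by (auto simp: bn)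
        then show ?thesis by blast
      qed
      then show "r = 1 \<or> ?b \<in> weight_lattice" by (simp add: weight_lattice_def)
    qed
  qed
qed

section \<open>The root \<theta> and the decomposition of r_0\<close>

lemma root_length_theta: "root_length (2 * lr 0)"
proof -
  obtain k where "k \<le> l" "colab k = lab 0 * lab k" using colabels_eq_label_0[OF admissible] by (auto simp: lab_eq colab_eq)
  then have "half_norm k = lr 0" using lr_pos[of k] by (simp add: half_norm_def)
  then show ?thesis using \<open>k \<le> l\<close> unfolding root_length_def by auto
qed

text \<open>The root \<theta> = \<delta> - a_0 \<alpha>_0, of squared length 2 a_0.\<close>

definition theta :: "nat \<Rightarrow> real" where "theta i = (if i \<in> {1..l} then lr i else 0)"

lemma theta_scaled_lattice: "theta \<in> scaled_lattice (2 * lr 0)"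
  unfolding scaled_lattice_def
proof (intro CollectI conjI allI impI)
  fix i assume i: "i \<le> l"
  show "\<exists>n::int. theta i = of_int n * scaling (2 * lr 0) i"
  proof (cases "i = 0")
    case True then show ?thesis by (simp add: theta_def)
  next
    case False
    have p: "half_norm i > 0" "lr i > 0" "lr 0 > 0" using half_norm_pos[OF i] lr_pos[OF i] lr_pos[of 0] by auto
    show ?thesis
    proof (cases "lr 0 \<le> half_norm i")
      case True
      then have "scaling (2 * lr 0) i = 1" using p by (simp add: scaling_def max_absorb1)
      then show ?thesis using False i by (intro exI[of _ "int (lab i)"]) (simp add: theta_def)
    next
      case c: False
      then have c: "scaling (2 * lr 0) i = lr 0 / half_norm i" using p by (simp add: scaling_def max_absorb2)
      obtain m where m: "colab i = lab 0 * m"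
        using label_0_dvd_colabels[OF admissible, of i] i False by (auto simp: lab_eq colab_eq)
      have "half_norm i * lr i = lr 0 * real m" using p m by (simp add: half_norm_def)
      then have "theta i = of_int (int m) * scaling (2 * lr 0) i" using p False i by (simp add: c theta_def field_simps)
      then show ?thesis by blast
    qed
  qed
qed (simp add: theta_def)

lemma theta_alt: "theta = (\<lambda>i. 1 * lr i + (- lr 0) * er 0 i)"
proof
  fix i show "theta i = 1 * lr i + (- lr 0) * er 0 i"
    by (cases "i = 0"; cases "i \<le> l") (auto simp: theta_def er_def lab_zero)
qed

lemma theta_norm: "B theta theta = 2 * lr 0"
  unfolding theta_alt B_lin B_lin' B_lab
  using B_lab[of "er 0"] B_sym[of "er 0" lr] B_er_er[of 0] lr_pos[of 0] by (simp add: half_norm_0)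

text \<open>The support of \<theta> avoids vertex 0 and the descent uses only letters from the
  support, so a word of the finite Weyl group takes a simple root \<alpha>_j with j \<ge> 1 to
  \<theta>. The reflection in \<theta> is then a word of the finite Weyl group too.\<close>

lemma theta_orbit:
  obtains "is" j where "set is \<subseteq> {1..l}" "j \<in> {1..l}" "half_norm j = lr 0" "rvec theta = sw is (\<alpha> j)"
proof (rule scaled_lattice_orbit[OF root_length_theta, of "{1..l}", OF _ theta_scaled_lattice theta_norm])
  show "theta i \<noteq> 0 \<Longrightarrow> i \<in> {1..l}" for i by (auto simp: theta_def split: if_splits)
qed (use that in auto)

text \<open>The image of the coroot of \<theta> under \<nu>, that is 2 \<theta> /
  |\<theta>|^2.\<close>

definition mu0 :: vec where "mu0 = (\<lambda>i. rvec theta i / of_real (lr 0))"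

lemma rvec_theta: "rvec theta = (\<lambda>i. \<delta> i - of_real (lr 0) * \<alpha> 0 i)"
proof
  fix i show "rvec theta i = \<delta> i - of_real (lr 0) * \<alpha> 0 i"
    by (cases "i = 0"; cases "i \<le> l") (auto simp: theta_def rvec_def \<delta>_def unit_vec_def)
qed

lemma mu0_alt: "mu0 = (\<lambda>i. of_real (1 / lr 0) * \<delta> i + (-1) * \<alpha> 0 i)"
  using lr_pos[of 0] by (auto simp: mu0_def rvec_theta diff_divide_distrib fun_eq_iff)

lemma mu0_finite_part: "mu0 \<in> finite_part"
  by (auto simp: mu0_def finite_part_def rvec_def theta_def)

lemma form_mu0: "form v mu0 = v (Suc l) / of_real (lr 0) - form v (\<alpha> 0)"
  unfolding mu0_alt form_lin' form_delta by simp

lemma mu0_M_hat: "mu0 \<in> M_hat"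
proof (rule M_hatI[OF mu0_finite_part])
  have l0: "lr 0 > 0" using lr_pos by simp
  have f: "form (\<alpha> k) mu0 = - of_real (half_norm 0) * of_int (a_mat 0 k)" if "k \<le> l" for k
  proof -
    have "form (\<alpha> k) mu0 = - form (\<alpha> k) (\<alpha> 0)"
      using form_mu0[of "\<alpha> k"] that by (simp add: unit_vec_def)
    then show ?thesis using form_alpha[of 0 "\<alpha> k"] pairing_alpha[OF that, of 0] by simp
  qed
  fix k assume k: "k \<le> l"
  obtain c where "a_mat 0 k = int (lab 0) * c" using label_0_dvd_cartan[OF admissible, of k] by (auto simp: lab_eq)
  then have "form (\<alpha> k) mu0 = of_int (- c)" using f[OF k] l0 by (simp add: half_norm_0)
  then show "\<exists>n::int. form (\<alpha> k) mu0 = of_int n" by blast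
next
  have "\<exists>n::int. pairing mu0 (\<alpha>_vee k) = of_int n" if k: "k \<le> l" for k
  proof -
    have "pairing \<delta> (\<alpha>_vee k) = 0"
      using form_alpha[OF k, of \<delta>] form_delta'[of "\<alpha> k"] half_norm_pos[OF k] k by (simp add: unit_vec_def)
    then have "pairing mu0 (\<alpha>_vee k) = of_int (- a_mat k 0)"
      unfolding mu0_alt pairing_lin using pairing_alpha[of 0 k] k by simp
    then show ?thesis by blast
  qed
  then show "r = 1 \<or> mu0 \<in> weight_lattice" by (simp add: weight_lattice_def)
qed

text \<open>As \<alpha>_0 = (\<delta> - \<theta>) / a_0, the reflections in \<alpha>_0 and \<theta>
  agree up to multiples of \<theta> and \<delta> that the translation by \<open>mu0\<close> accounts
  for. This puts r_0, and with it every word in all the reflections, into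
  \<open>W_hat\<close>.\<close>

lemma s_0_decomp:
  obtains "is" where "set is \<subseteq> {1..l}" "s 0 = t mu0 \<circ> sw is"
proof -
  obtain js j where j: "set js \<subseteq> {1..l}" "j \<in> {1..l}" "half_norm j = lr 0" "rvec theta = sw js (\<alpha> j)"
    by (rule theta_orbit)
  have js: "set js \<subseteq> {..l}" using j by auto
  define a0 where "a0 = complex_of_real (lr 0)"
  have a0: "a0 \<noteq> 0" using lr_pos[of 0] by (simp add: a0_def)
  let ?th = "rvec theta"
  \<comment> \<open>Conjugating s_j by the word that takes \<alpha>_j to \<theta> gives the
    reflection in \<theta>; the denominator is a_0 because |\<theta>|^2 = 2 a_0.\<close>
  have R: "sw (js @ [j] @ rev js) v = (\<lambda>i. v i - form v ?th / a0 * ?th i)" for v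
  proof -
    have jl: "j \<le> l" using j by simp
    have "form (sw (rev js) v) (\<alpha> j) = form v ?th"
      using form_sw[OF js, of "sw (rev js) v" "\<alpha> j"] sw_rev'[OF js] j(4) by simp
    then have p: "pairing (sw (rev js) v) (\<alpha>_vee j) = form v ?th / a0"
      using form_alpha[OF jl, of "sw (rev js) v"] a0 j(3) by (simp add: a0_def field_simps)
    have "sw (js @ [j] @ rev js) v = sw js (s j (sw (rev js) v))" by (simp add: sw_append sw_Cons sw_Nil)
    also have "\<dots> = (\<lambda>i. 1 * sw js (sw (rev js) v) i + (- form v ?th / a0) * sw js (\<alpha> j) i)"
      unfolding s_alt p lin_comb[OF sw_lin, symmetric] by simp
    finally show ?thesis using sw_rev'[OF js] j(4) by simp
  qed
  have al0: "\<alpha> 0 = (\<lambda>i. (\<delta> i - ?th i) / a0)" using a0 by (auto simp: rvec_theta a0_def)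
  have muth: "mu0 = (\<lambda>i. ?th i / a0)" by (simp add: mu0_def a0_def)
  have fmu: "form v mu0 = form v ?th / a0" for v
    using form_lin'[of v "1 / a0" ?th 0 ?th] by (simp add: muth)
  have thth: "form ?th ?th = 2 * a0" using form_rvec[of theta theta] theta_norm by (simp add: theta_def a0_def)
  have "s 0 v = t mu0 (sw (js @ [j] @ rev js) v)" for v
  proof -
    let ?u = "(\<lambda>i. v i - form v ?th / a0 * ?th i)"
    have "form v (\<alpha> 0) = 1 / a0 * pairing v (\<alpha>_vee 0)"
      using form_alpha[of 0 v] by (simp add: half_norm_0 a0_def)
    moreover have "form v (\<alpha> 0) = (v (Suc l) - form v ?th) / a0"
      using form_lin'[of v "1 / a0" \<delta> "- 1 / a0" ?th] by (simp add: al0 form_delta diff_divide_distrib)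
    ultimately have p: "pairing v (\<alpha>_vee 0) = v (Suc l) - form v ?th" using a0 by simp
    have fu: "form ?u ?th = - form v ?th"
      using form_lin[of 1 v "- form v ?th / a0" ?th ?th] a0 thth by simp
    have fm: "form mu0 mu0 = 2 / a0"
      using fmu[of mu0] form_sym[of mu0 ?th] fmu[of ?th] thth a0 by simp
    have uS: "?u (Suc l) = v (Suc l)" by (simp add: rvec_def theta_def)
    show ?thesis unfolding R t_alt[of mu0 ?u] uS fmu[of ?u] fu fm s_def p unfolding al0
      using a0 by (simp add: muth fun_eq_iff field_simps)
  qed
  then have "s 0 = t mu0 \<circ> sw (js @ [j] @ rev js)" by auto
  then show ?thesis using that[of "js @ [j] @ rev js"] j by auto
qed

section \<open>The extended affine Weyl group acting on real roots\<close>

lemma W_hatE: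
  assumes "w \<in> W_hat"
  obtains "is" \<mu> where "set is \<subseteq> {1..l}" "\<mu> \<in> M_hat" "w = sw is \<circ> t \<mu>"
  using assms unfolding W_hat_def W_fin_eq by auto

lemma W_hatI: "set is \<subseteq> {1..l} \<Longrightarrow> \<mu> \<in> M_hat \<Longrightarrow> sw is \<circ> t \<mu> \<in> W_hat"
  unfolding W_hat_def W_fin_eq by blast

lemma W_hat_comp:
  assumes "w \<in> W_hat" "w' \<in> W_hat" shows "w \<circ> w' \<in> W_hat"
proof -
  obtain js \<mu> where w: "set js \<subseteq> {1..l}" "\<mu> \<in> M_hat" "w = sw js \<circ> t \<mu>" using assms(1) by (rule W_hatE)
  obtain ks \<nu> where w': "set ks \<subseteq> {1..l}" "\<nu> \<in> M_hat" "w' = sw ks \<circ> t \<nu>" using assms(2) by (rule W_hatE)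
  have ks: "set ks \<subseteq> {..l}" "set (rev ks) \<subseteq> {1..l}" using w' by auto
  let ?m = "sw (rev ks) \<mu>"
  have m: "?m \<in> M_hat" by (rule M_hat_sw[OF ks(2) w(2)])
  have "t \<mu> (sw ks v) = sw ks (t ?m v)" for v
    using sw_t[OF ks(1), of ?m v] sw_rev'[OF ks(1)] by simp
  then have "w \<circ> w' = sw (js @ ks) \<circ> (t ?m \<circ> t \<nu>)"
    by (intro ext) (simp add: w(3) w'(3) sw_append)
  also have "t ?m \<circ> t \<nu> = t (\<lambda>i. ?m i + \<nu> i)" using m w'(2) by (intro t_comp M_hat_finite_part)
  finally show ?thesis by (simp only:) (rule W_hatI, use M_hat_add[OF m w'(2)] w(1) w'(1) in auto)
qed

lemma sw_fin_W_hat: "set is \<subseteq> {1..l} \<Longrightarrow> sw is \<in> W_hat"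
  using W_hatI[of "is" "\<lambda>i. 0"] M_hat_zero by (simp add: t_zero)

lemma t_W_hat: "\<mu> \<in> M_hat \<Longrightarrow> t \<mu> \<in> W_hat"
  using W_hatI[of "[]" \<mu>] by (simp add: sw_Nil)

lemma s_W_hat: assumes "i \<le> l" shows "s i \<in> W_hat"
proof (cases "i = 0")
  case True
  obtain js where "set js \<subseteq> {1..l}" "s 0 = t mu0 \<circ> sw js" by (rule s_0_decomp)
  then show ?thesis using True W_hat_comp[OF t_W_hat[OF mu0_M_hat] sw_fin_W_hat] by simp
next
  case False
  then show ?thesis using sw_fin_W_hat[of "[i]"] assms by (simp add: sw_Cons sw_Nil)
qed

lemma sw_W_hat: "set is \<subseteq> {..l} \<Longrightarrow> sw is \<in> W_hat"
proof (induction "is")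
  case Nil then show ?case using sw_fin_W_hat[of "[]"] by simp
next
  case (Cons i "is")
  then show ?case unfolding sw_Cons by (intro W_hat_comp s_W_hat) auto
qed

lemma W_hat_lin: "w \<in> W_hat \<Longrightarrow> lin w"
  by (elim W_hatE) (simp add: lin_comp sw_lin t_lin)

lemma W_hat_form: assumes "w \<in> W_hat" shows "form (w u) (w v) = form u v"
proof -
  obtain js \<mu> where w: "set js \<subseteq> {1..l}" "\<mu> \<in> M_hat" "w = sw js \<circ> t \<mu>" using assms by (rule W_hatE)
  have js: "set js \<subseteq> {..l}" using w by auto
  show ?thesis using form_sw[OF js] form_t[OF M_hat_finite_part[OF w(2)]] by (simp add: w(3))
qed

lemma W_hat_delta: assumes "w \<in> W_hat" shows "w \<delta> = \<delta>"
proof -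
  obtain js \<mu> where w: "set js \<subseteq> {1..l}" "\<mu> \<in> M_hat" "w = sw js \<circ> t \<mu>" using assms by (rule W_hatE)
  have js: "set js \<subseteq> {..l}" using w by auto
  show ?thesis using sw_delta[OF js] t_delta[OF M_hat_finite_part[OF w(2)]] by (simp add: w(3))
qed

lemma W_hat_real_roots: assumes "w \<in> W_hat" "\<beta> \<in> real_roots" shows "w \<beta> \<in> real_roots"
proof -
  obtain js \<mu> where w: "set js \<subseteq> {1..l}" "\<mu> \<in> M_hat" "w = sw js \<circ> t \<mu>" using assms(1) by (rule W_hatE)
  have js: "set js \<subseteq> {..l}" using w by auto
  show ?thesis using sw_real_roots[OF js t_real_roots[OF w(2) assms(2)]] by (simp add: w(3))
qed

lemma W_hat_inverse: assumes "w \<in> W_hat" shows "\<exists>w'\<in>W_hat. w \<circ> w' = id \<and> w' \<circ> w = id"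
proof -
  obtain js \<mu> where w: "set js \<subseteq> {1..l}" "\<mu> \<in> M_hat" "w = sw js \<circ> t \<mu>" using assms by (rule W_hatE)
  have js: "set js \<subseteq> {..l}" "set (rev js) \<subseteq> {1..l}" using w by auto
  let ?m = "\<lambda>i. - \<mu> i"
  have m: "?m \<in> M_hat" by (rule M_hat_uminus[OF w(2)])
  have "t \<mu> (t ?m v) = v" "t ?m (t \<mu> v) = v" for v
    using t_t[OF M_hat_finite_part[OF w(2)] M_hat_finite_part[OF m], of v]
      t_t[OF M_hat_finite_part[OF m] M_hat_finite_part[OF w(2)], of v] t_zero by simp_all
  then have "w \<circ> (t ?m \<circ> sw (rev js)) = id" "(t ?m \<circ> sw (rev js)) \<circ> w = id"
    using sw_rev[OF js(1)] sw_rev'[OF js(1)] by (auto simp: w(3) intro!: ext)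
  moreover have "t ?m \<circ> sw (rev js) \<in> W_hat" by (intro W_hat_comp t_W_hat m sw_fin_W_hat js)
  ultimately show ?thesis by blast
qed

abbreviation iv :: "linmap \<Rightarrow> linmap" where "iv w \<equiv> inv_into UNIV w"

lemma W_hat_bij: "w \<in> W_hat \<Longrightarrow> bij w"
  using W_hat_inverse o_bij by blast

lemma iv_W_hat: "w \<in> W_hat \<Longrightarrow> iv w \<in> W_hat"
  using W_hat_inverse inv_unique_comp by metis

lemma iv_left [simp]: "w \<in> W_hat \<Longrightarrow> iv w (w v) = v"
  using W_hat_bij by (simp add: bij_is_inj)

lemma iv_right [simp]: "w \<in> W_hat \<Longrightarrow> w (iv w v) = v"
  using W_hat_bij by (simp add: bij_is_surj surj_f_inv_f)

lemma id_W_hat: "id \<in> W_hat" using sw_fin_W_hat[of "[]"] by (simp add: sw_Nil)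

abbreviation neg :: "vec \<Rightarrow> vec" where "neg \<beta> \<equiv> (\<lambda>i. - \<beta> i)"

lemma Pos_real_roots: "\<beta> \<in> Pos \<Longrightarrow> \<beta> \<in> real_roots" by (simp add: Pos_def)

lemma W_hat_neg: "w \<in> W_hat \<Longrightarrow> w (neg \<beta>) = neg (w \<beta>)"
  using lin_uminus[OF W_hat_lin] by simp

lemma W_hat_sign: "w \<in> W_hat \<Longrightarrow> \<beta> \<in> real_roots \<Longrightarrow> w \<beta> \<in> Pos \<or> neg (w \<beta>) \<in> Pos"
  using real_root_sign W_hat_real_roots by blast

lemma lin_sum:
  assumes "lin w" "finite S"
  shows "w (\<lambda>i. \<Sum>k\<in>S. c k * u k i) = (\<lambda>i. \<Sum>k\<in>S. c k * w (u k) i)"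
  using assms(2)
proof (induction S rule: finite_induct)
  case empty
  show ?case using lin_scale[OF assms(1), of 0 "\<lambda>i. 0"] by simp
next
  case (insert a S)
  have "w (\<lambda>i. c a * u a i + 1 * (\<Sum>k\<in>S. c k * u k i)) = (\<lambda>i. c a * w (u a) i + 1 * w (\<lambda>i. \<Sum>k\<in>S. c k * u k i) i)"
    by (rule lin_comb[OF assms(1)])
  then show ?case using insert by simp
qed

lemma real_root_expand: "\<beta> \<in> real_roots \<Longrightarrow> \<beta> = (\<lambda>i. \<Sum>k\<le>l. \<beta> k * \<alpha> k i)"
proof
  fix i assume "\<beta> \<in> real_roots"
  then show "\<beta> i = (\<Sum>k\<le>l. \<beta> k * \<alpha> k i)"
    using real_root_support[of \<beta> i] by (cases "i \<le> l") (auto simp: unit_vec_def if_distrib cong: if_cong)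
qed

lemma lin_real_root: "lin w \<Longrightarrow> \<beta> \<in> real_roots \<Longrightarrow> w \<beta> = (\<lambda>i. \<Sum>k\<le>l. \<beta> k * w (\<alpha> k) i)"
  using lin_sum[of w "{..l}" \<beta> \<alpha>] real_root_expand[of \<beta>] by simp

text \<open>If w took n \<delta> to the negative of a positive root, then n \<delta> and -n \<delta>
  would both be positive, since w fixes \<delta>. So only real roots are inverted, and the condition
  can be phrased through the inverse of w.\<close>

lemma inversions_eq:
  assumes w: "w \<in> W_hat"
  shows "inversions w = {\<beta> \<in> Pos. neg (iv w \<beta>) \<in> Pos}"
proof (intro equalityI subsetI)
  fix \<beta> assume "\<beta> \<in> inversions w"
  then obtain \<gamma> where b: "\<beta> \<in> pos_roots" "\<gamma> \<in> pos_roots" "\<beta> = neg (w \<gamma>)" by (auto simp: inversions_def)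
  have "\<gamma> \<in> real_roots"
  proof (rule ccontr)
    assume "\<gamma> \<notin> real_roots"
    then obtain n :: int where n: "n \<noteq> 0" "\<gamma> = (\<lambda>i. of_int n * \<delta> i)" using b by (auto simp: pos_roots_def roots_def)
    then have "\<beta> = neg \<gamma>" using b(3) lin_scale[OF W_hat_lin[OF w]] W_hat_delta[OF w] by simp
    then have "\<gamma> 0 \<in> \<nat>" "- \<gamma> 0 \<in> \<nat>" using b by (auto simp: pos_roots_def)
    then have "\<gamma> 0 = 0" by (rule Nats_uminus)
    then show False using n lr_pos[of 0] by (simp add: \<delta>_def)
  qed
  then have g: "\<gamma> \<in> Pos" using b by (simp add: Pos_def pos_roots_def)
  have "\<beta> \<in> real_roots" using b(3) real_root_uminus W_hat_real_roots[OF w] \<open>\<gamma> \<in> real_roots\<close> by simp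
  then have "\<beta> \<in> Pos" using b by (simp add: Pos_def pos_roots_def)
  moreover have "neg (iv w \<beta>) = \<gamma>" unfolding b(3) W_hat_neg[OF w, symmetric] iv_left[OF w] by simp
  ultimately show "\<beta> \<in> {\<beta> \<in> Pos. neg (iv w \<beta>) \<in> Pos}" using g by simp
next
  fix \<beta> assume "\<beta> \<in> {\<beta> \<in> Pos. neg (iv w \<beta>) \<in> Pos}"
  moreover have "\<beta> = neg (w (neg (iv w \<beta>)))" unfolding W_hat_neg[OF w] iv_right[OF w] by simp
  ultimately show "\<beta> \<in> inversions w" unfolding inversions_def Pos_def pos_roots_def roots_def by blast
qed

lemma iv_comp: "x \<in> W_hat \<Longrightarrow> y \<in> W_hat \<Longrightarrow> iv (x \<circ> y) = iv y \<circ> iv x"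
  by (rule inv_unique_comp) (auto simp: fun_eq_iff)

lemma iv_s: "i \<le> l \<Longrightarrow> iv (s i) = s i"
  by (rule inv_unique_comp) (auto simp: fun_eq_iff s_invol)

lemma W_hat_inj: "w \<in> W_hat \<Longrightarrow> inj_on w S"
  using W_hat_bij bij_is_inj inj_on_subset by blast

section \<open>Inversions and the exchange condition\<close>

lemma inversions_comp_subset:
  assumes x: "x \<in> W_hat" and y: "y \<in> W_hat"
  shows "inversions (x \<circ> y) \<subseteq> inversions x \<union> x ` inversions y"
proof
  fix \<beta> assume "\<beta> \<in> inversions (x \<circ> y)"
  then have b: "\<beta> \<in> Pos" "neg (iv y (iv x \<beta>)) \<in> Pos"
    by (auto simp: inversions_eq[OF W_hat_comp[OF x y]] iv_comp[OF x y])
  show "\<beta> \<in> inversions x \<union> x ` inversions y"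
  proof (cases "neg (iv x \<beta>) \<in> Pos")
    case True then show ?thesis using b by (simp add: inversions_eq[OF x])
  next
    case False
    then have "iv x \<beta> \<in> Pos" using W_hat_sign[OF iv_W_hat[OF x]] b Pos_real_roots by blast
    then have "iv x \<beta> \<in> inversions y" using b by (simp add: inversions_eq[OF y])
    then show ?thesis using iv_right[OF x, of \<beta>] by (metis UnCI image_eqI)
  qed
qed

text \<open>The hypothesis prevents cancellation between the inversions of x and those of y; the
  union being disjoint, lengths add. It is applied to simple reflections, to elements of \<Omega>,
  to longest elements of rank two, and to antidominant translations.\<close>

lemma inversions_comp:
  assumes x: "x \<in> W_hat" and y: "y \<in> W_hat" and p: "\<And>\<beta>. \<beta> \<in> inversions y \<Longrightarrow> x \<beta> \<in> Pos"
  shows "inversions (x \<circ> y) = inversions x \<union> x ` inversions y" "inversions x \<inter> x ` inversions y = {}"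
proof -
  show "inversions (x \<circ> y) = inversions x \<union> x ` inversions y"
  proof (rule equalityI[OF inversions_comp_subset[OF x y]], rule subsetI)
    fix \<beta> assume "\<beta> \<in> inversions x \<union> x ` inversions y"
    then consider "\<beta> \<in> inversions x" | \<gamma> where "\<gamma> \<in> inversions y" "\<beta> = x \<gamma>" by blast
    then have "\<beta> \<in> Pos \<and> neg (iv y (iv x \<beta>)) \<in> Pos"
    proof cases
      case 1
      then have b: "\<beta> \<in> Pos" "neg (iv x \<beta>) \<in> Pos" by (auto simp: inversions_eq[OF x])
      \<comment> \<open>Otherwise \<open>neg (iv x \<beta>)\<close> is an inversion of y which x
        sends to the negative root -\<beta>.\<close>
      have "iv y (neg (iv x \<beta>)) \<in> Pos"
      proof (rule ccontr)
        assume "\<not> ?thesis"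
        then have "neg (iv y (neg (iv x \<beta>))) \<in> Pos" using W_hat_sign[OF iv_W_hat[OF y]] b Pos_real_roots by blast
        then have "neg (iv x \<beta>) \<in> inversions y" using b by (simp add: inversions_eq[OF y])
        then have "x (neg (iv x \<beta>)) \<in> Pos" by (rule p)
        then show False using Pos_not_neg[OF b(1)] by (simp add: W_hat_neg[OF x] iv_right[OF x])
      qed
      then show ?thesis using b by (simp add: W_hat_neg[OF iv_W_hat[OF y]])
    next
      case 2
      then show ?thesis using p[OF 2(1)] by (simp add: inversions_eq[OF y] iv_left[OF x])
    qed
    then show "\<beta> \<in> inversions (x \<circ> y)" by (simp add: inversions_eq[OF W_hat_comp[OF x y]] iv_comp[OF x y])
  qed
  show "inversions x \<inter> x ` inversions y = {}"
    using Pos_not_neg by (auto simp: inversions_eq[OF x] inversions_eq[OF y] iv_left[OF x])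
qed

lemma pos_by_coord: "\<beta> \<in> real_roots \<Longrightarrow> \<beta> k \<in> \<nat> \<Longrightarrow> \<beta> k \<noteq> 0 \<Longrightarrow> \<beta> \<in> Pos"
  using real_root_sign[of \<beta>] Nats_uminus[of "\<beta> k"] by (auto simp: Pos_def)

text \<open>A root concentrated at i has coordinate of absolute value c_i, by minimality of its norm
  in the lattice, and equality of norms then forces c_i = 1.\<close>

lemma real_root_multiple_simple:
  assumes \<beta>: "\<beta> \<in> Pos" and i: "i \<le> l" and z: "\<And>k. k \<noteq> i \<Longrightarrow> \<beta> k = 0"
  shows "\<beta> = \<alpha> i"
proof -
  obtain x j where x: "j \<le> l" "\<beta> = rvec x" "x \<in> scaled_lattice (2 * half_norm j)" "B x x = 2 * half_norm j"
    using real_rootE[OF Pos_real_roots[OF \<beta>]] by metis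
  have "x k = 0" if "k \<noteq> i" for k using z[OF that] by (simp add: x(2) rvec_def)
  then have xs: "x = (\<lambda>k. x i * er i k)" by (auto simp: er_def)
  then have n: "2 * half_norm i * (x i)\<^sup>2 = 2 * half_norm j" using single_norm[OF i, of "x i"] x(4) by metis
  then have "x i \<noteq> 0" using half_norm_pos[OF x(1)] by auto
  note m = root_length_half_norm[OF x(1)]
  have c: "\<bar>x i\<bar> = scaling (2 * half_norm j) i" using scaled_lattice_coord_norm(2)[OF m x(3) i \<open>x i \<noteq> 0\<close> n] .
  then have "2 * half_norm i * (scaling (2 * half_norm j) i)\<^sup>2 = 2 * half_norm j" using n by (metis power2_abs)
  then have "scaling (2 * half_norm j) i = 1" using scaling_norm(2)[OF m i] by blast
  then have "\<bar>x i\<bar> = 1" using c by simp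
  moreover have "0 \<le> x i"
  proof -
    have "\<beta> i \<in> \<nat>" using \<beta> by (simp add: Pos_def)
    then obtain q where "\<beta> i = of_nat q" by (auto elim: Nats_cases)
    then have "x i = real q" using x(2) by (metis of_real_eq_iff of_real_of_nat_eq rvec_def)
    then show ?thesis by simp
  qed
  ultimately have "x = er i" using xs by simp
  then show ?thesis by (simp add: x(2) rvec_er)
qed

text \<open>A positive root other than \<alpha>_i has a nonzero coordinate outside i. The reflection
  leaves that coordinate alone, and one positive coordinate decides the sign of a real root.\<close>

lemma s_Pos:
  assumes i: "i \<le> l" and \<beta>: "\<beta> \<in> Pos" "\<beta> \<noteq> \<alpha> i" shows "s i \<beta> \<in> Pos"
proof -
  obtain k where "k \<noteq> i" "\<beta> k \<noteq> 0" using real_root_multiple_simple[OF \<beta>(1) i] \<beta>(2) by blast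
  then show ?thesis using W_hat_real_roots[OF s_W_hat[OF i] Pos_real_roots[OF \<beta>(1)]] \<beta>(1)
    by (intro pos_by_coord[of _ k]) (auto simp: s_other Pos_def)
qed

lemma inversions_s: assumes i: "i \<le> l" shows "inversions (s i) = {\<alpha> i}"
  using alpha_Pos[OF i] Pos_not_neg s_Pos[OF i] by (auto simp: inversions_eq[OF s_W_hat[OF i]] iv_s[OF i] s_alpha[OF i])

lemma alpha_in_inversions: "w \<in> W_hat \<Longrightarrow> i \<le> l \<Longrightarrow> \<alpha> i \<in> inversions w \<longleftrightarrow> neg (iv w (\<alpha> i)) \<in> Pos"
  using alpha_Pos by (simp add: inversions_eq)

lemma inversions_step_up:
  assumes y: "y \<in> W_hat" and i: "i \<le> l" and n: "\<alpha> i \<notin> inversions y"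
  shows "inversions (s i \<circ> y) = insert (\<alpha> i) (s i ` inversions y)" "\<alpha> i \<notin> s i ` inversions y"
    "finite (inversions (s i \<circ> y)) \<longleftrightarrow> finite (inversions y)"
    "finite (inversions y) \<Longrightarrow> card (inversions (s i \<circ> y)) = Suc (card (inversions y))"
proof -
  have p: "s i \<beta> \<in> Pos" if "\<beta> \<in> inversions y" for \<beta>
  proof (rule s_Pos[OF i])
    show "\<beta> \<in> Pos" using that by (simp add: inversions_eq[OF y])
    show "\<beta> \<noteq> \<alpha> i" using that n by auto
  qed
  note c = inversions_comp[OF s_W_hat[OF i] y p, unfolded inversions_s[OF i]]
  show 1: "inversions (s i \<circ> y) = insert (\<alpha> i) (s i ` inversions y)" and 2: "\<alpha> i \<notin> s i ` inversions y"
    using c by auto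
  note inj = W_hat_inj[OF s_W_hat[OF i]]
  show "finite (inversions (s i \<circ> y)) \<longleftrightarrow> finite (inversions y)"
    unfolding 1 using finite_image_iff[OF inj] by simp
  show "card (inversions (s i \<circ> y)) = Suc (card (inversions y))" if "finite (inversions y)"
    unfolding 1 using that 2 card_image[OF inj] by simp
qed

text \<open>Since s_i negates \<alpha>_i, passing from w to s_i w changes the sign of the preimage
  of \<alpha>_i. Hence \<open>inversions_step_up\<close> applies to s_i w and returns w with length
  one larger.\<close>

lemma inversions_step_down:
  assumes w: "w \<in> W_hat" and i: "i \<le> l" and n: "\<alpha> i \<in> inversions w"
  shows "\<alpha> i \<notin> inversions (s i \<circ> w)" "s i \<circ> (s i \<circ> w) = w" "s i \<circ> w \<in> W_hat"
proof -
  show y: "s i \<circ> w \<in> W_hat" by (rule W_hat_comp[OF s_W_hat[OF i] w])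
  show "s i \<circ> (s i \<circ> w) = w" by (auto simp: s_invol[OF i])
  have "iv (s i \<circ> w) (\<alpha> i) = neg (iv w (\<alpha> i))"
    by (simp add: iv_comp[OF s_W_hat[OF i] w] iv_s[OF i] s_alpha[OF i] W_hat_neg[OF iv_W_hat[OF w]])
  then have "iv (s i \<circ> w) (\<alpha> i) \<in> Pos" using n by (simp add: alpha_in_inversions[OF w i])
  then show "\<alpha> i \<notin> inversions (s i \<circ> w)" using Pos_not_neg by (simp add: alpha_in_inversions[OF y i])
qed

lemma inversions_id: "inversions id = {}"
proof -
  have "iv id = id" by (rule inv_unique_comp) auto
  then show ?thesis using Pos_not_neg by (auto simp: inversions_eq[OF id_W_hat])
qed

lemma inversions_sw:
  "set is \<subseteq> {..l} \<Longrightarrow> finite (inversions (sw is)) \<and> card (inversions (sw is)) \<le> length is"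
proof (induction "is")
  case Nil then show ?case unfolding sw_Nil inversions_id by simp
next
  case (Cons i "is")
  then have i: "i \<le> l" and IH: "finite (inversions (sw is))" "card (inversions (sw is)) \<le> length is"
    and y: "sw is \<in> W_hat" by (auto intro: sw_W_hat)
  have y': "s i \<circ> sw is \<in> W_hat" by (rule W_hat_comp[OF s_W_hat[OF i] y])
  show ?case
  proof (cases "\<alpha> i \<in> inversions (sw is)")
    case False
    note u = inversions_step_up(3,4)[OF y i False]
    have f: "finite (inversions (s i \<circ> sw is))" using u(1) IH(1) by blast
    show ?thesis unfolding sw_Cons length_Cons u(2)[OF IH(1)] using f IH(2) by (intro conjI) (assumption, simp)
  next
    case True
    note d = inversions_step_down[OF y i True]
    note u = inversions_step_up(3,4)[OF d(3) i d(1), unfolded d(2)]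
    have f: "finite (inversions (s i \<circ> sw is))" using u(1) IH(1) by blast
    have "card (inversions (s i \<circ> sw is)) \<le> Suc (length is)" using u(2)[OF f] IH(2) by linarith
    then show ?thesis unfolding sw_Cons length_Cons using f by blast
  qed
qed

definition reduced_word :: "nat list \<Rightarrow> bool" where
  "reduced_word is \<longleftrightarrow> set is \<subseteq> {..l} \<and> card (inversions (sw is)) = length is"

lemma reduced_word_Cons:
  assumes "reduced_word (i # is)"
  shows "i \<le> l" "reduced_word is" "\<alpha> i \<in> inversions (sw (i # is))"
proof -
  have "is": "set is \<subseteq> {..l}" and i: "i \<le> l" and c: "card (inversions (s i \<circ> sw is)) = Suc (length is)"
    using assms by (auto simp: reduced_word_def sw_Cons)
  note f = inversions_sw[OF "is"] and y = sw_W_hat[OF "is"]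
  have n: "\<alpha> i \<notin> inversions (sw is)"
  proof
    assume True: "\<alpha> i \<in> inversions (sw is)"
    note d = inversions_step_down[OF y i True]
    note u = inversions_step_up(3,4)[OF d(3) i d(1), unfolded d(2)]
    have "card (inversions (sw is)) = Suc (card (inversions (s i \<circ> sw is)))" using u f by blast
    then show False using f c by linarith
  qed
  note u = inversions_step_up[OF y i n]
  show "i \<le> l" by (rule i)
  show "reduced_word is" using u(4) f c "is" by (simp add: reduced_word_def)
  show "\<alpha> i \<in> inversions (sw (i # is))" using u(1) by (simp add: sw_Cons)
qed

lemma reduced_word_append_left:
  assumes "reduced_word (is @ js)" shows "reduced_word is"
proof -
  have s: "set is \<subseteq> {..l}" "set js \<subseteq> {..l}" using assms by (auto simp: reduced_word_def)
  note f = inversions_sw[OF s(1)] inversions_sw[OF s(2)]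
  have "length is + length js = card (inversions (sw is \<circ> sw js))" using assms by (simp add: reduced_word_def sw_append)
  also have "\<dots> \<le> card (inversions (sw is) \<union> sw is ` inversions (sw js))"
    using f by (intro card_mono inversions_comp_subset sw_W_hat s) auto
  also have "\<dots> \<le> card (inversions (sw is)) + card (inversions (sw js))"
    by (rule order_trans[OF card_Un_le]) (use f card_image_le in auto)
  finally show ?thesis using f s by (simp add: reduced_word_def)
qed

lemma reflection_conj:
  assumes w: "w \<in> W_hat" and ik: "i \<le> l" "k \<le> l" and e: "w (\<alpha> i) = \<alpha> k"
  shows "w \<circ> s i = s k \<circ> w"
proof
  fix v
  have "complex_of_real (2 * half_norm k) = of_real (2 * half_norm i)"
    using W_hat_form[OF w, of "\<alpha> i" "\<alpha> i"] e form_alpha_alpha ik by simp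
  then have d: "half_norm k = half_norm i" using of_real_eq_iff by simp
  have "form (w v) (\<alpha> k) = form v (\<alpha> i)" using W_hat_form[OF w, of v "\<alpha> i"] e by simp
  then have "pairing (w v) (\<alpha>_vee k) = pairing v (\<alpha>_vee i)"
    using form_alpha[OF ik(1), of v] form_alpha[OF ik(2), of "w v"] half_norm_pos[OF ik(1)] d by simp
  moreover have "w (s i v) = (\<lambda>j. 1 * w v j + (- pairing v (\<alpha>_vee i)) * w (\<alpha> i) j)"
    unfolding s_alt by (rule lin_comb[OF W_hat_lin[OF w]])
  ultimately show "(w \<circ> s i) v = (s k \<circ> w) v" by (simp add: e s_alt)
qed

text \<open>Apply the letters of the word to \<alpha>_e from the right. At the letter i where the
  root turns negative it must have been \<alpha>_i, by \<open>s_Pos\<close>; the remaining word then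
  conjugates s_e into s_i, and the two reflections cancel.\<close>

lemma exchange:
  assumes "set is \<subseteq> {..l}" "e \<le> l" "neg (sw is (\<alpha> e)) \<in> Pos"
  shows "\<exists>js. set js \<subseteq> {..l} \<and> length js < length is \<and> sw is \<circ> s e = sw js"
  using assms(1,3)
proof (induction "is")
  case Nil
  then show ?case using Pos_not_neg[OF alpha_Pos[OF assms(2)]] by (simp add: sw_Nil)
next
  case (Cons i "is")
  then have i: "i \<le> l" and s: "set is \<subseteq> {..l}" by auto
  show ?case
  proof (cases "neg (sw is (\<alpha> e)) \<in> Pos")
    case True
    then obtain js where "set js \<subseteq> {..l}" "length js < length is" "sw is \<circ> s e = sw js" using Cons.IH s by blast
    moreover from this have "sw (i # is) \<circ> s e = sw (i # js)" unfolding sw_Cons by (simp only: comp_assoc)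
    ultimately show ?thesis using i by (intro exI[of _ "i # js"]) auto
  next
    case False
    then have p: "sw is (\<alpha> e) \<in> Pos"
      using W_hat_sign[OF sw_W_hat[OF s] Pos_real_roots[OF alpha_Pos[OF assms(2)]]] by blast
    have "sw is (\<alpha> e) = \<alpha> i"
    proof (rule ccontr)
      assume "sw is (\<alpha> e) \<noteq> \<alpha> i"
      then have "s i (sw is (\<alpha> e)) \<in> Pos" by (rule s_Pos[OF i p])
      then show False using Pos_not_neg Cons.prems(2) by (simp add: sw_Cons)
    qed
    then have "sw is \<circ> s e = s i \<circ> sw is" by (rule reflection_conj[OF sw_W_hat[OF s] assms(2) i])
    then have "sw is (s e v) = s i (sw is v)" for v by (metis comp_apply)
    then have "(sw (i # is) \<circ> s e) v = sw is v" for v by (simp add: sw_Cons s_invol[OF i])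
    then have "sw (i # is) \<circ> s e = sw is" by (rule ext)
    then show ?thesis using s by (intro exI[of _ "is"]) auto
  qed
qed

text \<open>Take a shortest word for the element. If it ended in a letter e, the word without that
  letter would send \<alpha>_e to a negative root, and \<open>exchange\<close> would produce a
  shorter word.\<close>

lemma sw_eq_id:
  assumes "set is \<subseteq> {..l}" "\<And>e. e \<le> l \<Longrightarrow> sw is (\<alpha> e) \<in> Pos"
  shows "sw is = id"
proof -
  obtain js where js: "set js \<subseteq> {..l}" "sw js = sw is"
    and min: "\<And>ks. set ks \<subseteq> {..l} \<Longrightarrow> sw ks = sw is \<Longrightarrow> length js \<le> length ks"
    using ex_has_least_nat[of "\<lambda>js. set js \<subseteq> {..l} \<and> sw js = sw is" "is" length] assms(1) by blast
  show ?thesis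
  proof (cases js rule: rev_cases)
    case Nil then show ?thesis using js by (simp add: sw_Nil)
  next
    case (snoc ks e)
    then have e: "e \<le> l" and ks: "set ks \<subseteq> {..l}" using js by auto
    have eq: "sw is = sw ks \<circ> s e" using js(2) snoc by (simp add: sw_append sw_Cons sw_Nil)
    have "sw is (\<alpha> e) = neg (sw ks (\<alpha> e))"
      by (simp add: eq s_alpha[OF e] W_hat_neg[OF sw_W_hat[OF ks]])
    then have "neg (sw ks (\<alpha> e)) \<in> Pos" using assms(2)[OF e] by simp
    from exchange[OF ks e this] obtain ls where ls: "set ls \<subseteq> {..l}" "length ls < length ks" "sw ks \<circ> s e = sw ls" by blast
    then have "length js \<le> length ls" using min[OF ls(1)] eq by simp
    then show ?thesis using ls snoc by simp
  qed
qed

section \<open>Rank two subgroups and their longest elements\<close>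

definition rank_two_pos :: "nat \<Rightarrow> nat \<Rightarrow> vec set" where
  "rank_two_pos i j = {\<beta> \<in> Pos. \<forall>k. k \<noteq> i \<longrightarrow> k \<noteq> j \<longrightarrow> \<beta> k = 0}"

text \<open>A positive root in the span of \<alpha>_i and \<alpha>_j is a combination of them with
  natural coefficients, so it turns negative under the inverse of w as soon as both of them
  do.\<close>

lemma rank_two_pos_subset_inversions:
  assumes w: "w \<in> W_hat" and ij: "i \<le> l" "j \<le> l" "i \<noteq> j" and n: "\<alpha> i \<in> inversions w" "\<alpha> j \<in> inversions w"
  shows "rank_two_pos i j \<subseteq> inversions w"
proof
  fix \<beta> assume b: "\<beta> \<in> rank_two_pos i j"
  then have bP: "\<beta> \<in> Pos" by (simp add: rank_two_pos_def)
  let ?v = "iv w"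
  have ni: "neg (?v (\<alpha> i)) \<in> Pos" "neg (?v (\<alpha> j)) \<in> Pos"
    using n alpha_in_inversions[OF w] ij by auto
  have ex: "?v \<beta> = (\<lambda>m. \<beta> i * ?v (\<alpha> i) m + \<beta> j * ?v (\<alpha> j) m)"
  proof -
    have "(\<Sum>k\<le>l. \<beta> k * ?v (\<alpha> k) m) = (\<Sum>k\<in>{i, j}. \<beta> k * ?v (\<alpha> k) m)" for m
      by (rule sum.mono_neutral_right) (use b ij in \<open>auto simp: rank_two_pos_def\<close>)
    then show ?thesis using lin_real_root[OF W_hat_lin[OF iv_W_hat[OF w]] Pos_real_roots[OF bP]] ij by simp
  qed
  have "neg (?v \<beta>) m \<in> \<nat>" for m
  proof -
    have "neg (?v \<beta>) m = \<beta> i * (neg (?v (\<alpha> i)) m) + \<beta> j * (neg (?v (\<alpha> j)) m)" by (simp add: ex)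
    moreover have "\<beta> i \<in> \<nat>" "\<beta> j \<in> \<nat>" "neg (?v (\<alpha> i)) m \<in> \<nat>" "neg (?v (\<alpha> j)) m \<in> \<nat>"
      using bP ni by (auto simp: Pos_def)
    ultimately show ?thesis by (metis Nats_add Nats_mult)
  qed
  then have "neg (?v \<beta>) \<in> Pos"
    using real_root_uminus W_hat_real_roots[OF iv_W_hat[OF w] Pos_real_roots[OF bP]] by (simp add: Pos_def)
  then show "\<beta> \<in> inversions w" using bP by (simp add: inversions_eq[OF w])
qed

lemma inversions_J_word:
  assumes ij: "i \<le> l" "j \<le> l" and ks: "set ks \<subseteq> {i, j}"
  shows "inversions (sw ks) \<subseteq> rank_two_pos i j"
proof
  fix \<beta> assume "\<beta> \<in> inversions (sw ks)"
  have ksl: "set ks \<subseteq> {..l}" using ks ij by auto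
  with \<open>\<beta> \<in> inversions (sw ks)\<close> have b: "\<beta> \<in> Pos" "neg (sw (rev ks) \<beta>) \<in> Pos"
    by (auto simp: inversions_eq[OF sw_W_hat[OF ksl]] inv_sw[OF ksl])
  have "\<beta> k = 0" if "k \<noteq> i" "k \<noteq> j" for k
  proof (rule Nats_uminus)
    show "\<beta> k \<in> \<nat>" using b by (simp add: Pos_def)
    have "sw (rev ks) \<beta> k = \<beta> k" using ks that by (intro sw_other) auto
    then show "- \<beta> k \<in> \<nat>" using b(2) unfolding Pos_def by (metis (mono_tags, lifting) mem_Collect_eq)
  qed
  then show "\<beta> \<in> rank_two_pos i j" using b by (simp add: rank_two_pos_def)
qed

lemma set_alternating: "set (alternating i j n) \<subseteq> {i, j}"
  by (induction n arbitrary: i j) auto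

lemma length_alternating: "length (alternating i j n) = n"
  by (induction n arbitrary: i j) auto

lemma alternating_snoc: "alternating i j (Suc n) = alternating i j n @ [if even n then i else j]"
  by (induction n arbitrary: i j) auto

lemma rank_two_pos_commute: "rank_two_pos i j = rank_two_pos j i" by (auto simp: rank_two_pos_def)

text \<open>Reduced alternating words have at most as many letters as there are positive roots in
  the plane, so there is a longest one. It must negate both \<alpha>_i and \<alpha>_j: one of them
  because it cannot be prolonged, the other because of its last letter. Hence it negates all
  positive roots of the plane, and its length is their number.\<close>

lemma maximal_alternating:
  assumes ij: "i \<le> l" "j \<le> l" "i \<noteq> j" and fin: "finite (rank_two_pos i j)"
  defines "x \<equiv> sw (alternating i j (card (rank_two_pos i j)))"
  shows "reduced_word (alternating i j (card (rank_two_pos i j)))" "inversions x = rank_two_pos i j" "\<And>\<beta>. \<beta> \<in> rank_two_pos i j \<Longrightarrow> neg (x \<beta>) \<in> rank_two_pos i j"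
proof -
  have sl: "set (alternating i j n) \<subseteq> {..l}" for n using set_alternating[of i j n] ij by auto
  have sub: "inversions (sw (alternating i j n)) \<subseteq> rank_two_pos i j" for n
    by (rule inversions_J_word[OF ij(1,2) set_alternating])
  have bound: "n \<le> card (rank_two_pos i j)" if "reduced_word (alternating i j n)" for n
    using card_mono[OF fin sub[of n]] that by (simp add: reduced_word_def length_alternating)
  define n where "n = (GREATEST n. reduced_word (alternating i j n))"
  have red0: "reduced_word (alternating i j 0)" unfolding reduced_word_def alternating.simps sw_Nil inversions_id by simp
  have redn: "reduced_word (alternating i j n)" unfolding n_def
    by (rule GreatestI_nat[of "\<lambda>n. reduced_word (alternating i j n)", OF red0]) (use bound in auto)
  have nmax: "\<not> reduced_word (alternating i j (Suc n))"
  proof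
    assume "reduced_word (alternating i j (Suc n))"
    then have "Suc n \<le> n" unfolding n_def by (rule Greatest_le_nat[of "\<lambda>n. reduced_word (alternating i j n)"]) (use bound in auto)
    then show False by simp
  qed
  let ?y = "sw (alternating i j n)"
  have y: "?y \<in> W_hat" by (rule sw_W_hat[OF sl])
  have cy: "card (inversions ?y) = n" using redn by (simp add: reduced_word_def length_alternating)
  have fy: "finite (inversions ?y)" using inversions_sw[OF sl] by blast
  have up: "card (inversions (z \<circ> s e)) = Suc (card (inversions z))"
    if "z \<in> W_hat" "finite (inversions z)" "e \<le> l" "z (\<alpha> e) \<in> Pos" for z e
    using inversions_comp[OF that(1) s_W_hat[OF that(3)]] that by (simp add: inversions_s[OF that(3)])
  \<comment> \<open>The letter that would come next in the alternating word; \<open>e'\<close> is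
    its present last letter.\<close>
  define e where "e = (if even n then i else j)"
  define e' where "e' = (if even n then j else i)"
  have e: "e \<le> l" "e' \<le> l" using ij by (auto simp: e_def e'_def)
  have sgn: "z (\<alpha> k) \<in> Pos \<or> neg (z (\<alpha> k)) \<in> Pos" if "z \<in> W_hat" "k \<le> l" for z k
    using W_hat_sign[OF that(1) Pos_real_roots[OF alpha_Pos[OF that(2)]]] .
  have ne: "neg (?y (\<alpha> e)) \<in> Pos"
  proof (rule ccontr)
    assume "\<not> ?thesis"
    then have "?y (\<alpha> e) \<in> Pos" using sgn[OF y e(1)] by blast
    from up[OF y fy e(1) this] have "card (inversions (sw (alternating i j (Suc n)))) = Suc n"
      unfolding alternating_snoc sw_append e_def[symmetric] by (simp add: sw_Cons sw_Nil cy)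
    then show False using nmax sl[of "Suc n"] by (simp add: reduced_word_def length_alternating)
  qed
  have "n \<noteq> 0"
  proof
    assume "n = 0"
    then show False using ne Pos_not_neg[OF alpha_Pos[OF e(1)]] by (simp add: sw_Nil)
  qed
  then obtain m where m: "n = Suc m" by (cases n) auto
  have em: "alternating i j n = alternating i j m @ [e']"
    unfolding m alternating_snoc using m by (simp add: e'_def)
  let ?z = "sw (alternating i j m)"
  have z: "?z \<in> W_hat" by (rule sw_W_hat[OF sl])
  have yz: "?y = ?z \<circ> s e'" unfolding em sw_append by (simp add: sw_Cons sw_Nil)
  have ne': "neg (?y (\<alpha> e')) \<in> Pos"
  proof (rule ccontr)
    assume "\<not> ?thesis"
    then have "?y (\<alpha> e') \<in> Pos" using sgn[OF y e(2)] by blast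
    from up[OF y fy e(2) this] have "card (inversions (?y \<circ> s e')) = Suc n" using cy by simp
    moreover have "?y \<circ> s e' = ?z" unfolding yz by (auto simp: s_invol[OF e(2)])
    ultimately show False using inversions_sw[OF sl[of m]] m by (simp add: length_alternating)
  qed
  have nij: "neg (?y (\<alpha> i)) \<in> Pos" "neg (?y (\<alpha> j)) \<in> Pos" using ne ne' by (auto simp: e_def e'_def split: if_splits)
  have ivy: "iv (iv ?y) = ?y" using y W_hat_bij by (simp add: inv_inv_eq)
  have "rank_two_pos i j \<subseteq> inversions (iv ?y)"
    by (rule rank_two_pos_subset_inversions[OF iv_W_hat[OF y] ij]) (use nij ij in \<open>auto simp: alpha_in_inversions[OF iv_W_hat[OF y]] ivy\<close>)
  then have neg_Pos: "neg (?y \<beta>) \<in> Pos" if "\<beta> \<in> rank_two_pos i j" for \<beta>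
    using that by (auto simp: inversions_eq[OF iv_W_hat[OF y]] ivy)
  have neg_rank_two_pos: "neg (?y \<beta>) \<in> rank_two_pos i j" if "\<beta> \<in> rank_two_pos i j" for \<beta>
  proof -
    have "?y \<beta> k = \<beta> k" if "k \<noteq> i" "k \<noteq> j" for k using set_alternating[of i j n] that by (intro sw_other) auto
    then show ?thesis using neg_Pos[OF that] that by (auto simp: rank_two_pos_def)
  qed
  \<comment> \<open>Negated images of the roots of the plane are inversions of the word, and there
    are as many of them as such roots; so n attains the upper bound.\<close>
  have "(\<lambda>\<beta>. neg (?y \<beta>)) ` rank_two_pos i j \<subseteq> inversions ?y"
  proof
    fix \<beta> assume "\<beta> \<in> (\<lambda>\<beta>. neg (?y \<beta>)) ` rank_two_pos i j"
    then obtain \<gamma> where g: "\<gamma> \<in> rank_two_pos i j" "\<beta> = neg (?y \<gamma>)" by auto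
    have "neg (iv ?y \<beta>) = \<gamma>" unfolding g(2) W_hat_neg[OF iv_W_hat[OF y]] iv_left[OF y] by simp
    then show "\<beta> \<in> inversions ?y" using neg_Pos[OF g(1)] g by (simp add: inversions_eq[OF y] rank_two_pos_def)
  qed
  then have "card ((\<lambda>\<beta>. neg (?y \<beta>)) ` rank_two_pos i j) \<le> n" using card_mono[OF fy] cy by metis
  moreover have "inj_on (\<lambda>\<beta>. neg (?y \<beta>)) (rank_two_pos i j)"
  proof (rule inj_onI)
    fix a b assume "neg (?y a) = neg (?y b)"
    then have "?y a = ?y b" by (simp add: fun_eq_iff)
    then show "a = b" by (metis iv_left[OF y])
  qed
  ultimately have "card (rank_two_pos i j) \<le> n" by (simp add: card_image)
  then have n: "n = card (rank_two_pos i j)" using bound[OF redn] by simp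
  show "reduced_word (alternating i j (card (rank_two_pos i j)))" using redn n by simp
  have "inversions ?y = rank_two_pos i j" by (rule card_subset_eq[OF fin sub]) (use cy n in simp)
  then show "inversions x = rank_two_pos i j" by (simp add: x_def n)
  show "neg (x \<beta>) \<in> rank_two_pos i j" if "\<beta> \<in> rank_two_pos i j" for \<beta> using neg_rank_two_pos[OF that] by (simp add: x_def n)
qed

lemma alternating_funpow:
  assumes "i \<le> l" "j \<le> l"
  shows "sw (alternating i j n) = ((s i \<circ> s j) ^^ n) \<circ> sw (alternating j i n)"
  using assms
proof (induction n arbitrary: i j)
  case 0 then show ?case by (simp add: sw_Nil)
next
  case (Suc n)
  have pow: "s i (((s j \<circ> s i) ^^ n) (s j v)) = ((s i \<circ> s j) ^^ Suc n) v" for v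
    by (induction n arbitrary: v) simp_all
  show ?case
  proof
    fix v
    have "sw (alternating i j (Suc n)) v = s i (((s j \<circ> s i) ^^ n) (sw (alternating i j n) v))"
    proof -
      have "sw (alternating j i n) v = ((s j \<circ> s i) ^^ n) (sw (alternating i j n) v)"
        using Suc.IH[of j i] Suc.prems by (metis comp_apply)
      then show ?thesis by (simp add: sw_Cons)
    qed
    also have "\<dots> = s i (((s j \<circ> s i) ^^ n) (s j (s j (sw (alternating i j n) v))))"
      using s_invol Suc.prems by simp
    also have "\<dots> = ((s i \<circ> s j) ^^ Suc n) (s j (sw (alternating i j n) v))" by (rule pow)
    also have "s j (sw (alternating i j n) v) = sw (alternating j i (Suc n)) v" by (simp add: sw_Cons)
    finally show "sw (alternating i j (Suc n)) v = (((s i \<circ> s j) ^^ Suc n) \<circ> sw (alternating j i (Suc n))) v"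
      by (metis comp_apply)
  qed
qed

lemma alternating_W_hat: "i \<le> l \<Longrightarrow> j \<le> l \<Longrightarrow> set (alternating i j n) \<subseteq> {..l}"
  using set_alternating[of i j n] by auto

lemma alternating_eq_iff:
  assumes "i \<le> l" "j \<le> l"
  shows "sw (alternating i j n) = sw (alternating j i n) \<longleftrightarrow> (s i \<circ> s j) ^^ n = id"
proof
  assume e: "sw (alternating i j n) = sw (alternating j i n)"
  have b: "sw (alternating j i n) \<in> W_hat" using alternating_W_hat assms by (intro sw_W_hat)
  have "((s i \<circ> s j) ^^ n) v = v" for v
    using fun_cong[OF alternating_funpow[OF assms, of n], of "iv (sw (alternating j i n)) v"] e b by simp
  then show "(s i \<circ> s j) ^^ n = id" by (simp add: fun_eq_iff)
qed (use alternating_funpow[OF assms, of n] in simp)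

text \<open>Both longest words permute the positive roots of the plane up to sign, so their quotient
  keeps \<alpha>_i and \<alpha>_j positive. Any other \<alpha>_e stays positive because its
  coordinate at e is untouched, and \<open>sw_eq_id\<close> makes the quotient trivial.\<close>

lemma alternating_longest_eq:
  assumes ij: "i \<le> l" "j \<le> l" "i \<noteq> j" and fin: "finite (rank_two_pos i j)"
  shows "sw (alternating i j (card (rank_two_pos i j))) = sw (alternating j i (card (rank_two_pos i j)))"
proof -
  let ?N = "card (rank_two_pos i j)"
  let ?a = "alternating i j ?N" and ?b = "alternating j i ?N"
  have fin': "finite (rank_two_pos j i)" using fin rank_two_pos_commute by metis
  note A = maximal_alternating[OF ij fin]
  note B = maximal_alternating[OF ij(2,1) ij(3)[symmetric] fin', unfolded rank_two_pos_commute[of j i]]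
  have sa: "set ?a \<subseteq> {..l}" and sb: "set ?b \<subseteq> {..l}" using alternating_W_hat ij by blast+
  have a: "sw ?a \<in> W_hat" and b: "sw ?b \<in> W_hat" using sa sb by (auto intro: sw_W_hat)
  have "inj_on (\<lambda>\<beta>. neg (sw ?a \<beta>)) (rank_two_pos i j)"
  proof (rule inj_onI)
    fix u v assume "neg (sw ?a u) = neg (sw ?a v)"
    then have "sw ?a u = sw ?a v" by (simp add: fun_eq_iff)
    then show "u = v" by (metis iv_left[OF a])
  qed
  then have surj: "(\<lambda>\<beta>. neg (sw ?a \<beta>)) ` rank_two_pos i j = rank_two_pos i j"
    by (intro endo_inj_surj fin) (use A(3) in auto)
  have P: "sw (rev ?a @ ?b) (\<alpha> e) \<in> Pos" if e: "e \<le> l" for e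
  proof (cases "e = i \<or> e = j")
    case True
    then have "\<alpha> e \<in> rank_two_pos i j" using alpha_Pos[OF e] by (auto simp: rank_two_pos_def unit_vec_def)
    then have "neg (sw ?b (\<alpha> e)) \<in> rank_two_pos i j" by (rule B(3))
    then have "neg (sw ?b (\<alpha> e)) \<in> (\<lambda>\<beta>. neg (sw ?a \<beta>)) ` rank_two_pos i j" unfolding surj .
    then obtain \<beta> where \<beta>: "\<beta> \<in> rank_two_pos i j" "neg (sw ?b (\<alpha> e)) = neg (sw ?a \<beta>)" by (elim imageE)
    then have "sw ?b (\<alpha> e) = sw ?a \<beta>" by (simp add: fun_eq_iff)
    then have "sw (rev ?a @ ?b) (\<alpha> e) = \<beta>" using sw_rev[OF sa] by (simp add: sw_append)
    then show ?thesis using \<beta>(1) by (simp add: rank_two_pos_def)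
  next
    case False
    have "set (rev ?a @ ?b) \<subseteq> {i, j}" using set_alternating[of i j ?N] set_alternating[of j i ?N] by auto
    then have "sw (rev ?a @ ?b) (\<alpha> e) e = \<alpha> e e" using False by (intro sw_other) auto
    moreover have "sw (rev ?a @ ?b) (\<alpha> e) \<in> real_roots"
      by (rule sw_real_roots) (use sa sb Pos_real_roots[OF alpha_Pos[OF e]] in auto)
    ultimately show ?thesis by (intro pos_by_coord[of _ e]) (auto simp: unit_vec_def)
  qed
  have "sw (rev ?a @ ?b) = id" by (rule sw_eq_id) (use sa sb P in auto)
  then have "sw (rev ?a) (sw ?b v) = v" for v by (simp add: sw_append fun_eq_iff)
  then have "sw ?b v = sw ?a v" for v using sw_rev'[OF sa] by metis
  then show ?thesis by auto
qed

text \<open>The longest words agree, which bounds the order of s_i s_j from above. If a smaller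
  power q were trivial, the two alternating words of length q would be equal and, as prefixes of the
  longest ones, reduced; their element would invert \<alpha>_i and \<alpha>_j, hence every positive
  root of the plane, which are more than q.\<close>

lemma rank_two:
  assumes ij: "i \<le> l" "j \<le> l" "i \<noteq> j" and fin: "finite (rank_two_pos i j)"
  shows "finite_order i j" "m_ord i j = card (rank_two_pos i j)"
proof -
  let ?N = "card (rank_two_pos i j)"
  have al: "\<alpha> i \<in> rank_two_pos i j" "\<alpha> j \<in> rank_two_pos i j" using alpha_Pos ij by (auto simp: rank_two_pos_def unit_vec_def)
  have N: "?N > 0" using al fin by (auto simp: card_gt_0_iff)
  have id: "(s i \<circ> s j) ^^ ?N = id" using alternating_longest_eq[OF ij fin] alternating_eq_iff[OF ij(1,2)] by blast
  then show "finite_order i j" using N unfolding finite_order_def by blast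
  have min: "?N \<le> q" if q: "q > 0" "(s i \<circ> s j) ^^ q = id" for q
  proof (rule ccontr)
    assume "\<not> ?N \<le> q"
    then have qN: "q < ?N" by simp
    have pre: "\<exists>ks. alternating i j n = alternating i j q @ ks" if "q \<le> n" for n and i j :: nat
      using that by (induction n rule: dec_induct) (auto simp: alternating_snoc simp del: alternating.simps(2))
    have fin': "finite (rank_two_pos j i)" using fin rank_two_pos_commute by metis
    have "reduced_word (alternating i j q)"
      using maximal_alternating(1)[OF ij fin] pre[of ?N i j] qN reduced_word_append_left by (metis less_imp_le)
    moreover have "reduced_word (alternating j i q)"
      using maximal_alternating(1)[OF ij(2,1) ij(3)[symmetric] fin'] pre[of ?N j i] qN reduced_word_append_left
      by (metis rank_two_pos_commute less_imp_le)
    moreover obtain q' where q': "q = Suc q'" using q by (cases q) auto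
    ultimately have "\<alpha> i \<in> inversions (sw (alternating i j q))" "\<alpha> j \<in> inversions (sw (alternating j i q))"
      and rq: "card (inversions (sw (alternating i j q))) = q"
      using reduced_word_Cons(3)[of i "alternating j i q'"] reduced_word_Cons(3)[of j "alternating i j q'"]
      by (auto simp: reduced_word_def length_alternating)
    moreover have "sw (alternating i j q) = sw (alternating j i q)" using alternating_eq_iff[OF ij(1,2)] q by blast
    ultimately have "rank_two_pos i j \<subseteq> inversions (sw (alternating i j q))"
      using alternating_W_hat[OF ij(1,2)] by (intro rank_two_pos_subset_inversions ij sw_W_hat) auto
    then have "?N \<le> q" using rq inversions_sw[OF alternating_W_hat[OF ij(1,2)]] card_mono by metis
    then show False using qN by simp
  qed
  show "m_ord i j = ?N" unfolding m_ord_def by (rule Least_equality) (use N id min in auto)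
qed

section \<open>Reduced words and Matsumoto's theorem\<close>

lemma reduced_word_exists_W:
  assumes "w = sw ks" "set ks \<subseteq> {..l}"
  shows "\<exists>is. reduced_word is \<and> sw is = w"
  using assms
proof (induction "card (inversions w)" arbitrary: w ks)
  case 0
  have "w (\<alpha> e) \<in> Pos" if e: "e \<le> l" for e
  proof (rule ccontr)
    assume n: "w (\<alpha> e) \<notin> Pos"
    have w: "w \<in> W_hat" using 0 by (auto intro: sw_W_hat)
    have "inversions w = {}" using 0 inversions_sw by auto
    have "neg (w (\<alpha> e)) \<in> Pos" using W_hat_sign[OF w Pos_real_roots[OF alpha_Pos[OF e]]] n by blast
    moreover have "neg (iv w (neg (w (\<alpha> e)))) = \<alpha> e" by (simp add: W_hat_neg[OF iv_W_hat[OF w]] iv_left[OF w])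
    ultimately have "neg (w (\<alpha> e)) \<in> inversions w" using alpha_Pos[OF e] unfolding inversions_eq[OF w] mem_Collect_eq by metis
    then show False using \<open>inversions w = {}\<close> by simp
  qed
  then have "w = id" using sw_eq_id 0 by metis
  moreover have "reduced_word []" unfolding reduced_word_def sw_Nil inversions_id by simp
  ultimately show ?case using sw_Nil by blast
next
  case (Suc n)
  have w: "w \<in> W_hat" using Suc by (auto intro: sw_W_hat)
  have "\<exists>i\<le>l. \<alpha> i \<in> inversions w"
  proof (rule ccontr)
    assume "\<not> ?thesis"
    then have "iv w (\<alpha> i) \<in> Pos" if "i \<le> l" for i
      using that alpha_in_inversions[OF w that] W_hat_sign[OF iv_W_hat[OF w] Pos_real_roots[OF alpha_Pos[OF that]]] by blast
    then have "sw (rev ks) = id" using Suc.prems by (intro sw_eq_id) (auto simp: inv_sw)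
    then have "w v = v" for v using sw_rev'[OF Suc.prems(2), of v] Suc.prems(1) by simp
    then have "w = id" by (simp add: fun_eq_iff)
    then show False using Suc.hyps(2) inversions_id by simp
  qed
  then obtain i where i: "i \<le> l" "\<alpha> i \<in> inversions w" by blast
  note d = inversions_step_down[OF w i]
  have fin: "finite (inversions w)" using Suc.prems inversions_sw by blast
  have u: "card (inversions w) = Suc (card (inversions (s i \<circ> w)))"
    using inversions_step_up(3,4)[OF d(3) i(1) d(1), unfolded d(2)] fin by blast
  have "s i \<circ> w = sw (i # ks)" using Suc.prems by (simp add: sw_Cons)
  moreover have "set (i # ks) \<subseteq> {..l}" using Suc.prems i by auto
  moreover have "n = card (inversions (s i \<circ> w))" using u Suc.hyps(2) by simp
  ultimately obtain js where js: "reduced_word js" "sw js = s i \<circ> w" using Suc.hyps(1) by blast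
  have "sw (i # js) = w" unfolding sw_Cons js(2) d(2) ..
  moreover have "reduced_word (i # js)" using js(1) u unfolding reduced_word_def \<open>sw (i # js) = w\<close> using i by (simp add: js(2))
  ultimately show ?case by blast
qed

lemma root_sequence_append: "root_sequence (is @ js) = root_sequence is @ map (sw is) (root_sequence js)"
  by (induction "is") (auto simp: sw_Nil sw_Cons)

text \<open>Matsumoto's theorem for the words in the reflections: two reduced words of the same element start with
  distinct letters \<open>i\<close>, \<open>j\<close> only if the element is divisible by the longest element of the
  dihedral group of \<open>i\<close> and \<open>j\<close>.\<close>

lemma matsumoto:
  fixes R :: "vec list \<Rightarrow> vec list \<Rightarrow> bool"
  assumes R: "\<And>u. R u u" "\<And>u v. R u v \<Longrightarrow> R v u" "\<And>u v w. R u v \<Longrightarrow> R v w \<Longrightarrow> R u w"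
    and ctx: "\<And>u u' v. set u \<subseteq> real_roots \<Longrightarrow> set u' \<subseteq> real_roots \<Longrightarrow> set v \<subseteq> real_roots \<Longrightarrow> R u u' \<Longrightarrow> R (u @ v) (u' @ v)"
      "\<And>u u' v. set u \<subseteq> real_roots \<Longrightarrow> set u' \<subseteq> real_roots \<Longrightarrow> set v \<subseteq> real_roots \<Longrightarrow> R u u' \<Longrightarrow> R (v @ u) (v @ u')"
    and braid: "\<And>w i j. w \<in> W_hat \<Longrightarrow> i \<le> l \<Longrightarrow> j \<le> l \<Longrightarrow> i \<noteq> j \<Longrightarrow> finite_order i j \<Longrightarrow>
      R (map w (root_sequence (alternating i j (m_ord i j)))) (map w (root_sequence (alternating j i (m_ord i j))))"
  shows "reduced_word is \<Longrightarrow> reduced_word js \<Longrightarrow> sw is = sw js \<Longrightarrow> w \<in> W_hat \<Longrightarrow> R (map w (root_sequence is)) (map w (root_sequence js))"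
proof (induction "length is" arbitrary: "is" js w)
  case 0
  have "length js = length is" using 0(2-4) unfolding reduced_word_def by metis
  then have "is = []" "js = []" using 0(1) by simp_all
  then show ?case using R(1) by simp
next
  case (Suc n)
  have len: "length js = length is" using Suc.prems(1-3) unfolding reduced_word_def by metis
  obtain i is' where i: "is = i # is'" using Suc.hyps(2) by (cases "is") auto
  obtain j js' where j: "js = j # js'" using Suc.hyps(2) len by (cases js) auto
  note ri = reduced_word_Cons[OF Suc.prems(1)[unfolded i]] and rj = reduced_word_Cons[OF Suc.prems(2)[unfolded j]]
  have real: "set (map w (root_sequence ks)) \<subseteq> real_roots" if "set ks \<subseteq> {..l}" "w \<in> W_hat" for ks w
  proof -
    have "set (root_sequence ks) \<subseteq> real_roots" using that(1)
      by (induction ks) (auto intro: Pos_real_roots alpha_Pos W_hat_real_roots s_W_hat)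
    then show ?thesis using that(2) by (auto intro: W_hat_real_roots)
  qed
  \<comment> \<open>A common first letter k is stripped by applying the induction hypothesis with w
    s_k in place of w; this is why the claim is made for all transforms of the root
    sequences.\<close>
  have same_head: "R (map w (root_sequence (k # ks))) (map w (root_sequence (k # ls)))"
    if k: "reduced_word (k # ks)" "reduced_word (k # ls)" "sw (k # ks) = sw (k # ls)" "length ks = n" for k ks ls
  proof -
    have kl: "k \<le> l" using reduced_word_Cons[OF k(1)] by simp
    have "sw ks v = sw ls v" for v
      using fun_cong[OF k(3), of v] s_invol[OF kl] by (metis comp_apply sw_Cons)
    then have e: "sw ks = sw ls" by auto
    have wk: "w \<circ> s k \<in> W_hat" by (intro W_hat_comp Suc.prems s_W_hat kl)
    note rk = reduced_word_Cons[OF k(1)] reduced_word_Cons[OF k(2)]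
    have "R (map (w \<circ> s k) (root_sequence ks)) (map (w \<circ> s k) (root_sequence ls))"
      using Suc.hyps(1)[of ks ls "w \<circ> s k"] k(4) rk e wk by simp
    then have "R ([w (\<alpha> k)] @ map (w \<circ> s k) (root_sequence ks)) ([w (\<alpha> k)] @ map (w \<circ> s k) (root_sequence ls))"
      using rk kl real[OF _ wk] W_hat_real_roots[OF Suc.prems(4) Pos_real_roots[OF alpha_Pos[OF kl]]]
      by (intro ctx(2)) (auto simp: reduced_word_def)
    then show ?thesis by (simp add: comp_assoc)
  qed
  show ?case
  proof (cases "i = j")
    case True
    then show ?thesis using same_head[of i is' js'] Suc.prems i j Suc.hyps(2) by simp
  next
    case False
    let ?u = "sw is"
    have sl: "set is \<subseteq> {..l}" using Suc.prems by (simp add: reduced_word_def)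
    have u: "?u \<in> W_hat" by (rule sw_W_hat[OF sl])
    have al: "\<alpha> i \<in> inversions ?u" "\<alpha> j \<in> inversions ?u" using ri(3) rj(3) Suc.prems(3) by (simp_all add: i j)
    have sub: "rank_two_pos i j \<subseteq> inversions ?u" by (rule rank_two_pos_subset_inversions[OF u ri(1) rj(1) False al])
    then have fin: "finite (rank_two_pos i j)" using inversions_sw[OF sl] finite_subset by blast
    let ?m = "card (rank_two_pos i j)"
    let ?a = "alternating i j ?m" and ?b = "alternating j i ?m"
    note A = maximal_alternating[OF ri(1) rj(1) False fin]
    have sa: "set ?a \<subseteq> {..l}" and sb: "set ?b \<subseteq> {..l}" using alternating_W_hat ri(1) rj(1) by blast+
    have ab: "sw ?a = sw ?b" by (rule alternating_longest_eq[OF ri(1) rj(1) False fin])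
    have a: "sw ?a \<in> W_hat" by (rule sw_W_hat[OF sa])
    \<comment> \<open>A reduced word for the element left after splitting off the longest element of
      the dihedral group of i and j.\<close>
    obtain vs where vs: "reduced_word vs" "sw vs = sw (rev ?a @ is)"
      using reduced_word_exists_W[of _ "rev ?a @ is"] sa sl by auto
    have svl: "set vs \<subseteq> {..l}" using vs by (simp add: reduced_word_def)
    have v: "sw vs \<in> W_hat" by (rule sw_W_hat[OF svl])
    have uv: "?u = sw ?a \<circ> sw vs" using sw_rev'[OF sa] by (auto simp: vs(2) sw_append)
    \<comment> \<open>An inversion of this remainder made negative by the longest element would
      yield an inversion of the longest element, hence of the whole element, whose preimage
      nevertheless has the wrong sign. So lengths add and the concatenated words are
      reduced.\<close>
    have p: "sw ?a \<beta> \<in> Pos" if b: "\<beta> \<in> inversions (sw vs)" for \<beta>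
    proof (rule ccontr)
      assume n: "sw ?a \<beta> \<notin> Pos"
      have bP: "\<beta> \<in> Pos" "neg (iv (sw vs) \<beta>) \<in> Pos" using b by (auto simp: inversions_eq[OF v])
      have np: "neg (sw ?a \<beta>) \<in> Pos" using n W_hat_sign[OF a Pos_real_roots[OF bP(1)]] by blast
      have "neg (iv (sw ?a) (neg (sw ?a \<beta>))) = \<beta>" by (simp add: W_hat_neg[OF iv_W_hat[OF a]] iv_left[OF a])
      then have "neg (sw ?a \<beta>) \<in> inversions (sw ?a)" using np bP(1) unfolding inversions_eq[OF a] mem_Collect_eq by metis
      then have "neg (sw ?a \<beta>) \<in> inversions ?u" using A(2) sub by auto
      then have "neg (iv ?u (neg (sw ?a \<beta>))) \<in> Pos" by (simp add: inversions_eq[OF u])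
      moreover have "neg (iv ?u (neg (sw ?a \<beta>))) = iv (sw vs) \<beta>"
        by (simp add: uv iv_comp[OF a v] W_hat_neg[OF iv_W_hat[OF a]] W_hat_neg[OF iv_W_hat[OF v]] iv_left[OF a])
      ultimately show False using Pos_not_neg bP(2) by simp
    qed
    have c: "inversions (sw ?a \<circ> sw vs) = inversions (sw ?a) \<union> sw ?a ` inversions (sw vs)"
      "inversions (sw ?a) \<inter> sw ?a ` inversions (sw vs) = {}"
      by (rule inversions_comp[OF a v], erule p)+
    have card: "card (inversions ?u) = ?m + length vs"
      unfolding uv c(1) using c(2) inversions_sw[OF sa] inversions_sw[OF svl] vs(1) A(1) card_image[OF W_hat_inj[OF a]]
      by (subst card_Un_disjoint) (auto simp: reduced_word_def length_alternating)
    have ra: "reduced_word (?a @ vs)" and ea: "sw (?a @ vs) = ?u"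
      using card sa svl by (auto simp: reduced_word_def sw_append uv[symmetric] length_alternating)
    have eb: "sw (?b @ vs) = ?u" using ea ab by (simp add: sw_append)
    have rb: "reduced_word (?b @ vs)" using card sb svl eb by (auto simp: reduced_word_def length_alternating)
    have "\<alpha> i \<in> rank_two_pos i j" using alpha_Pos[OF ri(1)] by (auto simp: rank_two_pos_def unit_vec_def)
    then have "?m \<noteq> 0" using fin by auto
    then obtain m' where m': "?m = Suc m'" by (cases ?m) auto
    have la: "length (?a @ vs) = Suc n" "length (?b @ vs) = Suc n"
      using ra rb ea eb Suc.prems(1) Suc.hyps(2) by (auto simp: reduced_word_def)
    \<comment> \<open>The given words are linked through the two words that start with the two
      longest alternating words and continue with the same remainder. The outer links share a first
      letter; the middle one is a transformed braid relation.\<close>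
    have "R (map w (root_sequence is)) (map w (root_sequence (?a @ vs)))"
      using same_head[of i is' "alternating j i m' @ vs"] ra ea Suc.prems(1) Suc.hyps(2) by (simp add: i m')
    moreover have "R (map w (root_sequence (?b @ vs))) (map w (root_sequence js))"
      using same_head[of j "alternating i j m' @ vs" js'] rb eb Suc.prems(2,3) la(2) by (simp add: j m')
    moreover have "R (map w (root_sequence (?a @ vs))) (map w (root_sequence (?b @ vs)))"
    proof -
      note r2 = rank_two[OF ri(1) rj(1) False fin]
      have "R (map w (root_sequence ?a)) (map w (root_sequence ?b))"
        using braid[OF Suc.prems(4) ri(1) rj(1) False r2(1)] unfolding r2(2) .
      moreover have "set (map (w \<circ> sw ?a) (root_sequence vs)) \<subseteq> real_roots"
        by (rule real[OF svl W_hat_comp[OF Suc.prems(4) a]])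
      ultimately have "R (map w (root_sequence ?a) @ map (w \<circ> sw ?a) (root_sequence vs))
        (map w (root_sequence ?b) @ map (w \<circ> sw ?a) (root_sequence vs))"
        using real[OF sa Suc.prems(4)] real[OF sb Suc.prems(4)] by (intro ctx(1))
      then show ?thesis by (simp add: root_sequence_append ab)
    qed
    ultimately show ?thesis using R(3) by blast
  qed
qed

section \<open>Reduced expressions in the extended affine Weyl group\<close>

lemma Nats_Re_nonneg: "z \<in> \<nat> \<Longrightarrow> 0 \<le> Re z" by (auto elim: Nats_cases)

lemma sum_Nats: "(\<And>k. k \<in> S \<Longrightarrow> f k \<in> \<nat>) \<Longrightarrow> sum f S \<in> (\<nat> :: complex set)"
  by (induction S rule: infinite_finite_induct) (auto intro: Nats_add)

lemma form_real: "(\<And>i. u i \<in> \<real>) \<Longrightarrow> (\<And>i. v i \<in> \<real>) \<Longrightarrow> form u v \<in> \<real>"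
  unfolding form_def form_basis_def by (intro sum_in_Reals) (auto intro!: Reals_mult Reals_divide)

lemma M_hat_real:
  assumes \<mu>: "\<mu> \<in> M_hat" shows "\<mu> i \<in> \<real>"
proof (rule finite_part_real[OF M_hat_finite_part[OF \<mu>]])
  fix k assume "k \<in> {1..l}"
  then have "\<alpha> k \<in> real_roots" by (intro Pos_real_roots alpha_Pos) simp
  then show "form (\<alpha> k) \<mu> \<in> \<real>" using M_hat_form[OF \<mu>] by fastforce
qed

lemma s_hdual_real:
  assumes i: "i \<le> l" and v: "v \<in> hdual_real" shows "s i v \<in> hdual_real"
proof -
  have "pairing v (\<alpha>_vee i) \<in> \<real>"
    unfolding pairing_coroot[OF i] using v by (intro Reals_add sum_in_Reals Reals_mult) (auto simp: hdual_real_def)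
  then show ?thesis using v i unfolding hdual_real_def hdual_def s_def by (auto simp: unit_vec_def)
qed

lemma sw_hdual_real: "set is \<subseteq> {..l} \<Longrightarrow> v \<in> hdual_real \<Longrightarrow> sw is v \<in> hdual_real"
  by (induction "is") (auto simp: sw_Nil sw_Cons intro: s_hdual_real)

lemma t_hdual_real:
  assumes \<mu>: "\<mu> \<in> M_hat" and v: "v \<in> hdual_real" shows "t \<mu> v \<in> hdual_real"
proof -
  have r: "form v \<mu> \<in> \<real>" "form \<mu> \<mu> \<in> \<real>"
    using v M_hat_real[OF \<mu>] by (auto intro!: form_real simp: hdual_real_def)
  have "t \<mu> v i \<in> \<real>" for i
    unfolding t_alt using r v M_hat_real[OF \<mu>] by (auto simp: hdual_real_def \<delta>_def intro!: Reals_diff Reals_add Reals_mult Reals_divide)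
  moreover have "t \<mu> v i = 0" if "i > Suc l" for i
    unfolding t_alt using that v M_hat_finite_part[OF \<mu>] by (auto simp: hdual_real_def hdual_def finite_part_def \<delta>_def)
  ultimately show ?thesis by (simp add: hdual_real_def hdual_def)
qed

lemma W_hat_hdual_real:
  assumes "w \<in> W_hat" "v \<in> hdual_real" shows "w v \<in> hdual_real"
proof -
  obtain js \<mu> where w: "set js \<subseteq> {1..l}" "\<mu> \<in> M_hat" "w = sw js \<circ> t \<mu>" using assms(1) by (rule W_hatE)
  have js: "set js \<subseteq> {..l}" using w by auto
  show ?thesis using sw_hdual_real[OF js t_hdual_real[OF w(2) assms(2)]] by (simp add: w(3))
qed

lemma affine_chamber_iff:
  "v \<in> affine_chamber \<longleftrightarrow> v \<in> hdual_real \<and> (\<forall>i\<le>l. 0 \<le> Re (form (\<alpha> i) v))"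
  unfolding affine_chamber_def using half_norm_pos by (auto simp: form_alpha_pairing zero_le_mult_iff) (meson less_le_not_le)+

lemma Pos_form_chamber:
  assumes \<beta>: "\<beta> \<in> Pos" and v: "\<And>i. i \<le> l \<Longrightarrow> 0 \<le> Re (form (\<alpha> i) v)"
  shows "0 \<le> Re (form \<beta> v)"
proof -
  have "0 \<le> Re (\<beta> k * form (\<alpha> k) v)" if "k \<le> l" for k
  proof -
    have "\<beta> k \<in> \<nat>" using \<beta> by (simp add: Pos_def)
    then obtain n where "\<beta> k = of_nat n" by (auto elim: Nats_cases)
    then show ?thesis using v[OF that] by simp
  qed
  then show ?thesis unfolding form_real_root_expand[OF Pos_real_roots[OF \<beta>]] by (auto intro: sum_nonneg)
qed

lemma chamber_mapped:
  assumes w: "w \<in> W_hat" and P: "\<And>i. i \<le> l \<Longrightarrow> iv w (\<alpha> i) \<in> Pos" and v: "v \<in> affine_chamber"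
  shows "w v \<in> affine_chamber"
  unfolding affine_chamber_iff
proof (intro conjI allI impI)
  show "w v \<in> hdual_real" using W_hat_hdual_real[OF w] v by (simp add: affine_chamber_iff)
  fix i assume i: "i \<le> l"
  have "form (\<alpha> i) (w v) = form (iv w (\<alpha> i)) v"
    using W_hat_form[OF w, of "iv w (\<alpha> i)" v] iv_right[OF w] by simp
  then show "0 \<le> Re (form (\<alpha> i) (w v))" using Pos_form_chamber[OF P[OF i]] v by (simp add: affine_chamber_iff)
qed

lemma simple_to_Pos:
  assumes w: "w \<in> W_hat" and P: "\<And>i. i \<le> l \<Longrightarrow> w (\<alpha> i) \<in> Pos" and \<beta>: "\<beta> \<in> Pos"
  shows "w \<beta> \<in> Pos"
proof -
  have "w \<beta> m \<in> \<nat>" for m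
  proof -
    have "w \<beta> m = (\<Sum>k\<le>l. \<beta> k * w (\<alpha> k) m)"
      using lin_real_root[OF W_hat_lin[OF w] Pos_real_roots[OF \<beta>]] by (rule fun_cong)
    moreover have "\<beta> k * w (\<alpha> k) m \<in> \<nat>" if "k \<le> l" for k
      using P[OF that] \<beta> by (auto simp: Pos_def intro: Nats_mult)
    ultimately show ?thesis using sum_Nats[of "{..l}" "\<lambda>k. \<beta> k * w (\<alpha> k) m"] by simp
  qed
  then show ?thesis using W_hat_real_roots[OF w Pos_real_roots[OF \<beta>]] by (simp add: Pos_def)
qed

lemma Pos_inverse:
  assumes w: "w \<in> W_hat" and P: "\<And>i. i \<le> l \<Longrightarrow> w (\<alpha> i) \<in> Pos" and i: "i \<le> l"
  shows "iv w (\<alpha> i) \<in> Pos"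
proof (rule ccontr)
  assume "\<not> ?thesis"
  then have n: "neg (iv w (\<alpha> i)) \<in> Pos" using W_hat_sign[OF iv_W_hat[OF w] Pos_real_roots[OF alpha_Pos[OF i]]] by blast
  have "w (neg (iv w (\<alpha> i))) \<in> Pos" by (rule simple_to_Pos[OF w _ n]) (rule P)
  then show False using Pos_not_neg[OF alpha_Pos[OF i]] by (simp add: W_hat_neg[OF w] iv_right[OF w])
qed

text \<open>The chamber is cut out by products with simple roots, and an isometry whose inverse
  keeps simple roots positive maps it into itself. By \<open>Pos_inverse\<close> the same holds for
  the inverse map, so the image is the whole chamber. \<open>Omega_Pos\<close> is the
  converse.\<close>

lemma OmegaI:
  assumes w: "w \<in> W_hat" and P: "\<And>i. i \<le> l \<Longrightarrow> iv w (\<alpha> i) \<in> Pos"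
  shows "w \<in> \<Omega>"
proof -
  have P': "iv (iv w) (\<alpha> i) \<in> Pos" if "i \<le> l" for i by (rule Pos_inverse[OF iv_W_hat[OF w] _ that]) (rule P)
  have "w ` affine_chamber = affine_chamber"
  proof (intro equalityI subsetI)
    fix v assume "v \<in> w ` affine_chamber"
    then obtain u where "u \<in> affine_chamber" "v = w u" by blast
    moreover have "w u \<in> affine_chamber" if "u \<in> affine_chamber" for u by (rule chamber_mapped[OF w _ that]) (rule P)
    ultimately show "v \<in> affine_chamber" by blast
  next
    fix v assume v: "v \<in> affine_chamber"
    have "iv w v \<in> affine_chamber" by (rule chamber_mapped[OF iv_W_hat[OF w] _ v]) (rule P')
    moreover have "v = w (iv w v)" using iv_right[OF w] by simp
    ultimately show "v \<in> w ` affine_chamber" by blast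
  qed
  then show ?thesis using w by (simp add: \<Omega>_def)
qed

text \<open>A point in the interior of the affine chamber: a real vector dual to the finite simple
  roots, moved in the direction of \<Lambda>_0 until its product with \<alpha>_0 is positive as
  well.\<close>

lemma rho_exists: "\<exists>\<rho>\<in>hdual_real. \<forall>i\<le>l. 0 < Re (form (\<alpha> i) \<rho>)"
proof -
  obtain v where v: "v \<in> finite_part" "\<And>k. k \<in> {1..l} \<Longrightarrow> form (\<alpha> k) v = 1"
    using finite_part_dual_exists[of "\<lambda>_. 1"] by auto
  have vr: "v i \<in> \<real>" for i by (rule finite_part_real[OF v(1)]) (simp add: v)
  \<comment> \<open>Chosen to make the product with \<alpha>_0 equal to 1 / a_0: the finite vector
    contributes minus the sum of the other labels over a_0, and \<Lambda>_0 contributes c /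
    a_0.\<close>
  define c where "c = 1 + (\<Sum>j\<in>{1..l}. lr j)"
  define \<rho> where "\<rho> = (\<lambda>i. v i + of_real c * unit_vec (Suc l) i)"
  have f: "form (\<alpha> k) \<rho> = form (\<alpha> k) v + of_real c * form (\<alpha> k) (unit_vec (Suc l))" for k
    using form_lin'[of "\<alpha> k" 1 v "of_real c" "unit_vec (Suc l)"] by (simp add: \<rho>_def)
  have L: "form (\<alpha> k) (unit_vec (Suc l)) = (if k = 0 then of_real (half_norm 0) else 0)" if "k \<le> l" for k
    using that by (simp add: form_alpha_pairing pairing_coroot) (simp add: unit_vec_def)
  have l0: "lr 0 > 0" using lr_pos by simp
  have "complex_of_real (lr 0) * form (\<alpha> 0) v = - complex_of_real (\<Sum>j\<in>{1..l}. lr j)"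
    using alpha_0_form[OF v(1)] by (simp add: v)
  then have "form (\<alpha> 0) v = of_real (- (\<Sum>j\<in>{1..l}. lr j) / lr 0)" using l0 by (simp add: field_simps)
  then have "form (\<alpha> 0) \<rho> = of_real (- (\<Sum>j\<in>{1..l}. lr j) / lr 0) + of_real c * of_real (1 / lr 0)"
    unfolding f using L[OF le0] by (simp only: half_norm_0 refl if_True)
  then have "form (\<alpha> 0) \<rho> = of_real (- (\<Sum>j\<in>{1..l}. lr j) / lr 0 + c * (1 / lr 0))"
    by (simp only: of_real_add of_real_mult)
  moreover have "- (\<Sum>j\<in>{1..l}. lr j) / lr 0 + c * (1 / lr 0) = 1 / lr 0"
    using l0 by (simp add: c_def field_simps)
  ultimately have 0: "form (\<alpha> 0) \<rho> = of_real (1 / lr 0)" by (simp only:)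
  have "0 < Re (form (\<alpha> i) \<rho>)" if i: "i \<le> l" for i
  proof (cases "i = 0")
    case True then show ?thesis using 0 l0 by simp
  next
    case False then show ?thesis using v(2)[of i] L[OF i] i unfolding f by simp
  qed
  moreover have "\<rho> \<in> hdual_real"
    using v(1) vr by (auto simp: hdual_real_def hdual_def \<rho>_def finite_part_def unit_vec_def)
  ultimately show ?thesis by blast
qed

lemma Pos_form_rho:
  assumes \<beta>: "\<beta> \<in> Pos" and v: "\<And>i. i \<le> l \<Longrightarrow> 0 < Re (form (\<alpha> i) v)"
  shows "0 < Re (form \<beta> v)"
proof -
  obtain n :: "nat \<Rightarrow> nat" where n: "\<And>k. \<beta> k = of_nat (n k)" using \<beta> by (auto simp: Pos_def Nats_def image_iff) metis
  obtain k where k: "k \<le> l" "n k \<noteq> 0" using real_root_nonzero[OF Pos_real_roots[OF \<beta>]] n by auto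
  have "0 < (\<Sum>k\<le>l. real (n k) * Re (form (\<alpha> k) v))"
    by (rule sum_pos2[of _ k]) (use k v in \<open>auto intro!: mult_nonneg_nonneg less_imp_le[OF v]\<close>)
  then show ?thesis unfolding form_real_root_expand[OF Pos_real_roots[OF \<beta>]] by (simp add: n)
qed

text \<open>Every negative real root has a strictly negative product with an interior point \<rho>,
  while both w and its inverse move \<rho> within the closed chamber, where products with simple
  roots are nonnegative.\<close>

lemma Omega_Pos:
  assumes "w \<in> \<Omega>" and i: "i \<le> l"
  shows "w (\<alpha> i) \<in> Pos" "iv w (\<alpha> i) \<in> Pos"
proof -
  have w: "w \<in> W_hat" and ch: "w ` affine_chamber = affine_chamber" using assms by (auto simp: \<Omega>_def)
  obtain \<rho> where \<rho>: "\<rho> \<in> hdual_real" "\<And>i. i \<le> l \<Longrightarrow> 0 < Re (form (\<alpha> i) \<rho>)" using rho_exists by blast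
  then have "\<rho> \<in> affine_chamber" by (auto simp: affine_chamber_iff intro: less_imp_le)
  then have wr: "w \<rho> \<in> affine_chamber" "iv w \<rho> \<in> affine_chamber" using ch iv_left[OF w] by (blast, metis imageE)
  have a: "\<alpha> i \<in> real_roots" by (rule Pos_real_roots[OF alpha_Pos[OF i]])
  show "w (\<alpha> i) \<in> Pos"
  proof (rule ccontr)
    assume "\<not> ?thesis"
    then have "neg (w (\<alpha> i)) \<in> Pos" using W_hat_sign[OF w a] by blast
    then have "0 < Re (form (neg (w (\<alpha> i))) \<rho>)" by (rule Pos_form_rho[OF _ \<rho>(2)])
    moreover have "form (w (\<alpha> i)) \<rho> = form (\<alpha> i) (iv w \<rho>)"
      using W_hat_form[OF w, of "\<alpha> i" "iv w \<rho>"] iv_right[OF w] by simp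
    ultimately show False using wr(2) i by (auto simp: form_uminus affine_chamber_iff)
  qed
  show "iv w (\<alpha> i) \<in> Pos"
  proof (rule ccontr)
    assume "\<not> ?thesis"
    then have "neg (iv w (\<alpha> i)) \<in> Pos" using W_hat_sign[OF iv_W_hat[OF w] a] by blast
    then have "0 < Re (form (neg (iv w (\<alpha> i))) \<rho>)" by (rule Pos_form_rho[OF _ \<rho>(2)])
    moreover have "form (iv w (\<alpha> i)) \<rho> = form (\<alpha> i) (w \<rho>)"
      using W_hat_form[OF w, of "iv w (\<alpha> i)" \<rho>] iv_right[OF w] by simp
    ultimately show False using wr(1) i by (auto simp: form_uminus affine_chamber_iff)
  qed
qed

lemma Omega_W_hat: "w \<in> \<Omega> \<Longrightarrow> w \<in> W_hat" by (simp add: \<Omega>_def)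

lemma Omega_comp: "w \<in> \<Omega> \<Longrightarrow> w' \<in> \<Omega> \<Longrightarrow> w \<circ> w' \<in> \<Omega>"
proof -
  assume a: "w \<in> \<Omega>" "w' \<in> \<Omega>"
  have "(w \<circ> w') ` affine_chamber = w ` w' ` affine_chamber" by (simp only: image_comp)
  then have "(w \<circ> w') ` affine_chamber = affine_chamber" using a by (simp add: \<Omega>_def)
  moreover have "w \<circ> w' \<in> W_hat" using W_hat_comp[OF Omega_W_hat[OF a(1)] Omega_W_hat[OF a(2)]] .
  ultimately show ?thesis unfolding \<Omega>_def mem_Collect_eq by (intro conjI)
qed

lemma Omega_inversions: assumes w: "w \<in> \<Omega>" shows "inversions w = {}"
proof -
  note W = Omega_W_hat[OF w]
  have "iv w \<beta> \<in> Pos" if "\<beta> \<in> Pos" for \<beta> using simple_to_Pos[OF iv_W_hat[OF W] Omega_Pos(2)[OF w] that] .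
  then show ?thesis using Pos_not_neg by (auto simp: inversions_eq[OF W])
qed

text \<open>If w(\<alpha>_i) is the sum of n_k \<alpha>_k, then \<alpha>_i is the sum of n_k times
  the inverse images of the \<alpha>_k, which are positive of height at least 1. Total height 1
  leaves a single index with n_k = 1.\<close>

lemma Omega_simple:
  assumes w: "w \<in> \<Omega>" and i: "i \<le> l" shows "\<exists>k\<le>l. w (\<alpha> i) = \<alpha> k"
proof -
  note W = Omega_W_hat[OF w]
  have b: "w (\<alpha> i) \<in> Pos" by (rule Omega_Pos(1)[OF w i])
  obtain n :: "nat \<Rightarrow> nat" where n: "\<And>k. w (\<alpha> i) k = of_nat (n k)" using b by (auto simp: Pos_def Nats_def image_iff) metis
  define m where "m k j = nat \<lfloor>Re (iv w (\<alpha> k) j)\<rfloor>" for k j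
  have m: "iv w (\<alpha> k) j = of_nat (m k j)" if "k \<le> l" for k j
  proof -
    have "iv w (\<alpha> k) j \<in> \<nat>" using Omega_Pos(2)[OF w that] by (simp add: Pos_def)
    then show ?thesis by (auto simp: m_def elim: Nats_cases)
  qed
  have ht: "1 \<le> (\<Sum>j\<le>l. m k j)" if k: "k \<le> l" for k
  proof -
    obtain j where j: "j \<le> l" "iv w (\<alpha> k) j \<noteq> 0" using real_root_nonzero[OF Pos_real_roots[OF Omega_Pos(2)[OF w k]]] by blast
    then have "m k j \<noteq> 0" using m[OF k] by auto
    moreover have "m k j \<le> (\<Sum>j\<le>l. m k j)" using j by (intro member_le_sum) auto
    ultimately show ?thesis by simp
  qed
  have "\<alpha> i j = (\<Sum>k\<le>l. w (\<alpha> i) k * iv w (\<alpha> k) j)" for j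
    using fun_cong[OF lin_real_root[OF W_hat_lin[OF iv_W_hat[OF W]] Pos_real_roots[OF b]], of j] iv_left[OF W] by simp
  then have "\<alpha> i j = of_nat (\<Sum>k\<le>l. n k * m k j)" for j by (simp add: n m)
  then have "(\<Sum>k\<le>l. n k * m k j) = (if j = i then 1 else 0)" for j
    unfolding unit_vec_def by (metis of_nat_0 of_nat_1 of_nat_eq_iff)
  then have "(\<Sum>j\<le>l. \<Sum>k\<le>l. n k * m k j) = 1" using i by simp
  then have one: "(\<Sum>k\<le>l. n k * (\<Sum>j\<le>l. m k j)) = 1" by (subst (asm) sum.swap) (simp add: sum_distrib_left)
  obtain k where k: "k \<le> l" "n k \<noteq> 0" using real_root_nonzero[OF Pos_real_roots[OF b]] n by auto
  have split: "(\<Sum>k\<le>l. n k * (\<Sum>j\<le>l. m k j)) = n k * (\<Sum>j\<le>l. m k j) + (\<Sum>q\<in>{..l}-{k}. n q * (\<Sum>j\<le>l. m q j))"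
    by (rule sum.remove) (use k in auto)
  have "1 \<le> n k * (\<Sum>j\<le>l. m k j)" using k ht[OF k(1)] by (simp add: Suc_le_eq)
  then have nk: "n k * (\<Sum>j\<le>l. m k j) = 1" and rest: "(\<Sum>q\<in>{..l}-{k}. n q * (\<Sum>j\<le>l. m q j)) = 0"
    using one split by linarith+
  have "n q = 0" if "q \<noteq> k" for q
  proof (cases "q \<le> l")
    case True then show ?thesis using rest that ht[OF True] by auto
  next
    case False then show ?thesis using n[of q] real_root_support[OF Pos_real_roots[OF b], of q] by simp
  qed
  moreover have "n k = 1" using nk by simp
  ultimately have "w (\<alpha> i) = \<alpha> k" using n by (auto simp: unit_vec_def fun_eq_iff)
  then show ?thesis using k by blast
qed

lemma foldr_sw: "foldr (\<lambda>i f. s i \<circ> f) is w = sw is \<circ> w"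
  by (induction "is") (auto simp: sw_Nil sw_Cons)

lemma reduced_expression_iff:
  "reduced_expression w (is, \<omega>) \<longleftrightarrow> set is \<subseteq> {..l} \<and> \<omega> \<in> \<Omega> \<and> length is = card (inversions w) \<and> w = sw is \<circ> \<omega>"
  by (simp add: reduced_expression_def foldr_sw len_def atLeast0AtMost)

lemma reduced_expression_exists:
  assumes "w \<in> W_hat" "finite (inversions w)"
  shows "\<exists>is \<omega>. reduced_expression w (is, \<omega>)"
  using assms
proof (induction "card (inversions w)" arbitrary: w)
  case 0
  \<comment> \<open>Cardinality 0 means empty here only because the inversion set is assumed
    finite.\<close>
  then have n: "\<alpha> i \<notin> inversions w" for i by auto
  have "w \<in> \<Omega>"
  proof (rule OmegaI[OF 0(2)])
    fix i assume i: "i \<le> l"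
    show "iv w (\<alpha> i) \<in> Pos"
      using n[of i] alpha_in_inversions[OF 0(2) i] W_hat_sign[OF iv_W_hat[OF 0(2)] Pos_real_roots[OF alpha_Pos[OF i]]] by blast
  qed
  then have "reduced_expression w ([], w)" using 0 unfolding reduced_expression_iff by (simp add: sw_Nil)
  then show ?case by blast
next
  case (Suc n)
  note w = Suc.prems(1)
  show ?case
  proof (cases "\<exists>i\<le>l. \<alpha> i \<in> inversions w")
    case False
    have "w \<in> \<Omega>"
    proof (rule OmegaI[OF w])
      fix i assume i: "i \<le> l"
      show "iv w (\<alpha> i) \<in> Pos"
        using False alpha_in_inversions[OF w i] W_hat_sign[OF iv_W_hat[OF w] Pos_real_roots[OF alpha_Pos[OF i]]] i by blast
    qed
    then show ?thesis using Omega_inversions Suc.hyps(2) by simp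
  next
    case True
    then obtain i where i: "i \<le> l" "\<alpha> i \<in> inversions w" by blast
    note d = inversions_step_down[OF w i]
    note u = inversions_step_up(3,4)[OF d(3) i(1) d(1), unfolded d(2)]
    have f: "finite (inversions (s i \<circ> w))" using u(1) Suc.prems(2) by blast
    have c: "card (inversions w) = Suc (card (inversions (s i \<circ> w)))" using u(2)[OF f] .
    then have "n = card (inversions (s i \<circ> w))" using Suc.hyps(2) by simp
    from Suc.hyps(1)[OF this d(3) f] obtain js \<omega> where j: "reduced_expression (s i \<circ> w) (js, \<omega>)" by blast
    then have "sw (i # js) \<circ> \<omega> = w" using d(2) unfolding reduced_expression_iff sw_Cons by (metis comp_assoc)
    then have "reduced_expression w (i # js, \<omega>)"
      using j c i(1) unfolding reduced_expression_iff by (metis insert_subset length_Cons list.simps(15) atMost_iff)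
    then show ?thesis by blast
  qed
qed

lemma inversions_sw_Omega:
  assumes s: "set is \<subseteq> {..l}" and w: "\<omega> \<in> \<Omega>"
  shows "inversions (sw is \<circ> \<omega>) = inversions (sw is)"
  using inversions_comp(1)[OF sw_W_hat[OF s] Omega_W_hat[OF w]] Omega_inversions[OF w] by simp

text \<open>The quotient of the two words equals a quotient of elements of \<Omega>, so it keeps
  simple roots positive and is trivial by \<open>sw_eq_id\<close>.\<close>

lemma decomposition_unique:
  assumes s: "set is \<subseteq> {..l}" "set js \<subseteq> {..l}" and w: "\<omega> \<in> \<Omega>" "\<omega>' \<in> \<Omega>" and e: "sw is \<circ> \<omega> = sw js \<circ> \<omega>'"
  shows "sw is = sw js"
proof -
  note W = Omega_W_hat[OF w(1)]
  have u: "sw (rev js @ is) v = \<omega>' (iv \<omega> v)" for v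
  proof -
    have "sw is v = sw js (\<omega>' (iv \<omega> v))" using fun_cong[OF e, of "iv \<omega> v"] iv_right[OF W] by simp
    then show ?thesis using sw_rev[OF s(2)] by (simp add: sw_append)
  qed
  have "sw (rev js @ is) = id"
  proof (rule sw_eq_id)
    fix i assume i: "i \<le> l"
    show "sw (rev js @ is) (\<alpha> i) \<in> Pos" unfolding u
      using simple_to_Pos[OF Omega_W_hat[OF w(2)] Omega_Pos(1)[OF w(2)] Omega_Pos(2)[OF w(1) i]] .
  qed (use s in auto)
  then have "sw (rev js) (sw is v) = v" for v by (simp add: sw_append fun_eq_iff)
  then have "sw is v = sw js v" for v using sw_rev'[OF s(2)] by metis
  then show ?thesis by auto
qed

section \<open>Finiteness of the inversion sets of translations\<close>

lemma real_root_B: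
  assumes "rvec x \<in> real_roots" shows "B x x \<le> 2 * real r"
proof -
  obtain i where i: "i \<le> l" "form (rvec x) (rvec x) = of_real (2 * half_norm i)" using real_root_form[OF assms] by blast
  have "x (Suc l) = 0" using real_root_support[OF assms, of "Suc l"] by (simp add: rvec_def)
  then have "complex_of_real (B x x) = of_real (2 * half_norm i)" using form_rvec[of x x] i by simp
  then have "B x x = 2 * half_norm i" using of_real_eq_iff by blast
  then show ?thesis using half_norm_le_twist[OF i(1)] by simp
qed

text \<open>By \<open>B_squares\<close>, each squared difference along an edge is bounded by the
  norm, and norms of real roots are at most 2 r. Connectedness carries the bound from vertex 0 to
  all vertices: real roots are bounded modulo \<delta>.\<close>

lemma roots_bounded_mod_delta:
  assumes "i \<le> l"
  shows "\<exists>C. \<forall>x. rvec x \<in> real_roots \<longrightarrow> \<bar>x i / lr i - x 0 / lr 0\<bar> \<le> C"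
proof (rule dynkin_connected[OF admissible _ _ assms, of "\<lambda>i. \<exists>C. \<forall>x. rvec x \<in> real_roots \<longrightarrow> \<bar>x i / lr i - x 0 / lr 0\<bar> \<le> C"])
  show "\<exists>C. \<forall>x. rvec x \<in> real_roots \<longrightarrow> \<bar>x 0 / lr 0 - x 0 / lr 0\<bar> \<le> C" by (intro exI[of _ 0]) simp
next
  fix i j assume e: "(i, j) \<in> dynkin_edges X"
  define a where "a = - (half_norm i * ar i j * lr i * lr j)"
  have a: "a > 0" unfolding a_def by (rule edge_coeff_pos[OF e])
  have d: "\<bar>x i / lr i - x j / lr j\<bar> \<le> 1 + 4 * real r / a" if "rvec x \<in> real_roots" for x
  proof -
    let ?y = "x i / lr i - x j / lr j"
    have "a * ?y\<^sup>2 \<le> 2 * B x x" unfolding a_def using edge_le[OF e] by (intro B_squares_term_le) auto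
    then have "?y\<^sup>2 \<le> 4 * real r / a" using real_root_B[OF that] a by (simp add: field_simps)
    moreover have "\<bar>?y\<bar> \<le> 1 + ?y\<^sup>2"
    proof -
      have "0 \<le> (\<bar>?y\<bar> - 1)\<^sup>2 + \<bar>?y\<bar>" by simp
      then show ?thesis by (simp add: power2_eq_square algebra_simps)
    qed
    ultimately show ?thesis by simp
  qed
  show "(\<exists>C. \<forall>x. rvec x \<in> real_roots \<longrightarrow> \<bar>x i / lr i - x 0 / lr 0\<bar> \<le> C) \<longleftrightarrow>
        (\<exists>C. \<forall>x. rvec x \<in> real_roots \<longrightarrow> \<bar>x j / lr j - x 0 / lr 0\<bar> \<le> C)"
  proof (intro iffI; elim exE)
    fix C assume "\<forall>x. rvec x \<in> real_roots \<longrightarrow> \<bar>x i / lr i - x 0 / lr 0\<bar> \<le> C"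
    then show "\<exists>C. \<forall>x. rvec x \<in> real_roots \<longrightarrow> \<bar>x j / lr j - x 0 / lr 0\<bar> \<le> C"
      using d by (intro exI[of _ "C + (1 + 4 * real r / a)"]) (smt (verit))
  next
    fix C assume "\<forall>x. rvec x \<in> real_roots \<longrightarrow> \<bar>x j / lr j - x 0 / lr 0\<bar> \<le> C"
    then show "\<exists>C. \<forall>x. rvec x \<in> real_roots \<longrightarrow> \<bar>x i / lr i - x 0 / lr 0\<bar> \<le> C"
      using d by (intro exI[of _ "C + (1 + 4 * real r / a)"]) (smt (verit))
  qed
qed

lemma form_bounded:
  assumes \<mu>: "\<mu> \<in> M_hat"
  shows "\<exists>D. \<forall>\<beta>\<in>real_roots. \<bar>Re (form \<beta> \<mu>)\<bar> \<le> D"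
proof -
  obtain C where C: "\<And>i x. i \<le> l \<Longrightarrow> rvec x \<in> real_roots \<Longrightarrow> \<bar>x i / lr i - x 0 / lr 0\<bar> \<le> C i"
    using roots_bounded_mod_delta by metis
  define y where "y i = Re (\<mu> i)" for i
  have my: "\<mu> = rvec y" using M_hat_real[OF \<mu>] by (auto simp: rvec_def y_def fun_eq_iff)
  have y0: "y (Suc l) = 0" using M_hat_finite_part[OF \<mu>] by (simp add: y_def finite_part_def)
  have "\<bar>Re (form \<beta> \<mu>)\<bar> \<le> (\<Sum>i\<le>l. lr i * C i * \<bar>B (er i) y\<bar>)" if \<beta>: "\<beta> \<in> real_roots" for \<beta>
  proof -
    obtain x where x: "\<beta> = rvec x" using real_rootE[OF \<beta>] by metis
    have x0: "x (Suc l) = 0" using real_root_support[OF \<beta>, of "Suc l"] by (simp add: rvec_def x)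
    \<comment> \<open>Subtracting the multiple of \<delta> that kills coordinate 0 does not change
      the product with \<mu>, and leaves coordinates bounded uniformly over all real roots.\<close>
    define z where "z i = x i - x 0 / lr 0 * lr i" for i
    have z: "z = (\<lambda>i. 1 * x i + (- x 0 / lr 0) * lr i)" by (simp add: z_def fun_eq_iff)
    have "B x y = B z y" unfolding z B_lin using B_sym[of lr y] B_lab[of y] by simp
    also have "\<dots> = (\<Sum>i\<le>l. z i * B (er i) y)"
      unfolding B_def[of z y] by (intro sum.cong refl) (simp add: B_er sum_distrib_left mult_ac)
    finally have e: "Re (form \<beta> \<mu>) = (\<Sum>i\<le>l. z i * B (er i) y)" using form_rvec[of x y] x0 y0 by (simp add: x my)
    have zb: "\<bar>z i\<bar> \<le> lr i * C i" if i: "i \<le> l" for i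
    proof -
      have p: "lr i > 0" using lr_pos[OF i] .
      have "z i = lr i * (x i / lr i - x 0 / lr 0)" using p by (simp add: z_def field_simps)
      then have "\<bar>z i\<bar> = lr i * \<bar>x i / lr i - x 0 / lr 0\<bar>" by (simp add: abs_mult)
      then show ?thesis using C[OF i, of x] \<beta> p unfolding x by (simp add: mult_left_mono)
    qed
    have "\<bar>\<Sum>i\<le>l. z i * B (er i) y\<bar> \<le> (\<Sum>i\<le>l. \<bar>z i * B (er i) y\<bar>)" by (rule sum_abs)
    also have "\<dots> \<le> (\<Sum>i\<le>l. lr i * C i * \<bar>B (er i) y\<bar>)"
      using zb by (intro sum_mono) (simp add: abs_mult mult_right_mono)
    finally show ?thesis by (simp add: e)
  qed
  then show ?thesis by blast
qed

lemma iv_t: "\<mu> \<in> M_hat \<Longrightarrow> iv (t \<mu>) = t (\<lambda>i. - \<mu> i)"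
proof (rule inv_unique_comp)
  assume m: "\<mu> \<in> M_hat"
  note f = M_hat_finite_part[OF m] M_hat_finite_part[OF M_hat_uminus[OF m]]
  show "t \<mu> \<circ> t (\<lambda>i. - \<mu> i) = id" using t_comp[OF f] t_zero by simp
  show "t (\<lambda>i. - \<mu> i) \<circ> t \<mu> = id" using t_comp[OF f(2,1)] t_zero by simp
qed

text \<open>The inverse translation adds (\<beta>|\<mu>) \<delta> to \<beta>. For the result to be
  negative, every coordinate of \<beta> must lie below -(\<beta>|\<mu>) a_i; together with
  \<open>form_bounded\<close> this leaves finitely many roots.\<close>

lemma inversions_t:
  assumes \<mu>: "\<mu> \<in> M_hat" and b: "\<beta> \<in> inversions (t \<mu>)"
  shows "\<beta> \<in> Pos" "\<And>i. i \<le> l \<Longrightarrow> Re (\<beta> i) \<le> - Re (form \<beta> \<mu>) * lr i"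
proof -
  note m = M_hat_uminus[OF \<mu>]
  have p: "\<beta> \<in> Pos" "neg (t (\<lambda>i. - \<mu> i) \<beta>) \<in> Pos"
    using b by (auto simp: inversions_eq[OF t_W_hat[OF \<mu>]] iv_t[OF \<mu>])
  show "\<beta> \<in> Pos" by (rule p)
  fix i assume i: "i \<le> l"
  have "neg (t (\<lambda>i. - \<mu> i) \<beta>) i \<in> \<nat>" using p by (simp add: Pos_def)
  then have "0 \<le> Re (neg (t (\<lambda>i. - \<mu> i) \<beta>) i)" by (rule Nats_Re_nonneg)
  moreover have "form \<beta> (\<lambda>i. - \<mu> i) = - form \<beta> \<mu>" using form_uminus[of \<mu> \<beta>] form_sym by metis
  ultimately show "Re (\<beta> i) \<le> - Re (form \<beta> \<mu>) * lr i"
    unfolding t_real_root[OF Pos_real_roots[OF p(1)]] using i by (simp add: \<delta>_def)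
qed

lemma finite_inversions_t:
  assumes \<mu>: "\<mu> \<in> M_hat" shows "finite (inversions (t \<mu>))"
proof -
  obtain D where D: "\<And>\<beta>. \<beta> \<in> real_roots \<Longrightarrow> \<bar>Re (form \<beta> \<mu>)\<bar> \<le> D" using form_bounded[OF \<mu>] by blast
  define N where "N = nat \<lceil>D * (\<Sum>i\<le>l. lr i)\<rceil>"
  have "inversions (t \<mu>) \<subseteq> {f. \<forall>i. (i \<in> {..l} \<longrightarrow> f i \<in> of_nat ` {..N}) \<and> (i \<notin> {..l} \<longrightarrow> f i = (0::complex))}"
  proof (intro subsetI CollectI allI conjI impI)
    fix \<beta> i assume b: "\<beta> \<in> inversions (t \<mu>)"
    have bP: "\<beta> \<in> Pos" by (rule inversions_t(1)[OF \<mu> b])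
    show "\<beta> i = 0" if "i \<notin> {..l}" using real_root_support[OF Pos_real_roots[OF bP]] that by simp
    assume i: "i \<in> {..l}"
    have "\<beta> i \<in> \<nat>" using bP by (simp add: Pos_def)
    then obtain n where n: "\<beta> i = of_nat n" by (auto elim: Nats_cases)
    have "real n \<le> - Re (form \<beta> \<mu>) * lr i" using inversions_t(2)[OF \<mu> b, of i] i n by simp
    also have "\<dots> \<le> D * lr i" using D[OF Pos_real_roots[OF bP]] by (intro mult_right_mono) auto
    also have "\<dots> \<le> D * (\<Sum>i\<le>l. lr i)"
    proof (rule mult_left_mono)
      show "lr i \<le> (\<Sum>i\<le>l. lr i)" by (rule member_le_sum) (use i in auto)
      show "0 \<le> D" using D[OF Pos_real_roots[OF bP]] by linarith
    qed
    finally have "n \<le> N" unfolding N_def by linarith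
    then show "\<beta> i \<in> of_nat ` {..N}" using n by auto
  qed
  then show ?thesis by (rule finite_subset) (rule finite_set_of_finite_funs, auto)
qed

section \<open>Antidominant translations and additivity of length\<close>

lemma form_sum_right: "finite S \<Longrightarrow> form w (\<lambda>k. \<Sum>i\<in>S. c i * u i k) = (\<Sum>i\<in>S. c i * form w (u i))"
proof (induction S rule: finite_induct)
  case empty then show ?case by (simp add: form_def)
next
  case (insert a S)
  then show ?case using form_lin'[of w "c a" "u a" 1 "\<lambda>k. \<Sum>i\<in>S. c i * u i k"] by simp
qed

definition lam :: "(nat \<Rightarrow> int) \<Rightarrow> vec" where "lam n = (\<lambda>k. \<Sum>i=1..l. of_int (n i) * basis_M_hat i k)"

lemma M_hat_minus_eq: "M_hat_minus = {lam n | n. \<forall>i\<in>{1..l}. n i \<le> 0}"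
  by (simp add: M_hat_minus_def lam_def)

lemma lam_finite_part: "lam n \<in> finite_part"
  using basis_M_hat_props(1) unfolding finite_part_def lam_def by (auto intro!: sum.neutral)

lemma form_alpha_lam: "j \<in> {1..l} \<Longrightarrow> form (\<alpha> j) (lam n) = of_real (of_int (n j) * bnorm j)"
proof -
  assume j: "j \<in> {1..l}"
  have "form (\<alpha> j) (lam n) = (\<Sum>i=1..l. of_int (n i) * form (\<alpha> j) (basis_M_hat i))"
    unfolding lam_def by (rule form_sum_right) simp
  also have "\<dots> = (\<Sum>i=1..l. if i = j then of_real (of_int (n j) * bnorm j) else 0)"
    by (intro sum.cong refl) (use basis_M_hat_props(2)[OF _ j] in auto)
  finally show ?thesis using j by simp
qed

lemma lam_M_hat: "lam n \<in> M_hat"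
  unfolding M_hat_def
proof (intro CollectI conjI ballI lam_finite_part)
  fix \<beta> assume \<beta>: "\<beta> \<in> real_roots"
  obtain m :: "nat \<Rightarrow> int" where m: "\<And>i. i \<in> {1..l} \<Longrightarrow> form \<beta> (basis_M_hat i) = of_int (int (\<gamma> \<beta>) * m i)"
    using M_hat_form[OF basis_M_hat_M_hat \<beta>] by metis
  have "form \<beta> (lam n) = (\<Sum>i=1..l. of_int (n i) * form \<beta> (basis_M_hat i))"
    unfolding lam_def by (rule form_sum_right) simp
  also have "\<dots> = (\<Sum>i=1..l. of_nat (\<gamma> \<beta>) * (of_int (n i) * of_int (m i)))"
    by (intro sum.cong refl) (simp add: m)
  also have "\<dots> = of_nat (\<gamma> \<beta>) * of_int (\<Sum>i=1..l. n i * m i)" by (simp add: sum_distrib_left)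
  finally show "\<exists>k::int. form \<beta> (lam n) = of_nat (\<gamma> \<beta>) * of_int k" by blast
qed

lemma M_hat_minus_M_hat: "\<mu> \<in> M_hat_minus \<Longrightarrow> \<mu> \<in> M_hat"
  using lam_M_hat by (auto simp: M_hat_minus_eq)

lemma lam_add: "(\<lambda>i. lam m i + lam n i) = lam (\<lambda>i. m i + n i)"
  by (simp add: lam_def sum.distrib distrib_right)

lemma lam_inj: "lam m = lam n \<Longrightarrow> j \<in> {1..l} \<Longrightarrow> m j = n j"
  using form_alpha_lam[of j m] form_alpha_lam[of j n] bnorm_pos[of j] by auto

text \<open>A Weyl group element is a finite word after a translation, and the translation moves
  \<alpha>_i by a multiple of \<delta> only. For i \<ge> 1 this gives q = 1; for i = 0 one writes
  \<alpha>_0 = (\<delta> - \<theta>) / a_0, so the direction is that of a finite conjugate of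
  -\<theta> and q = 1 / a_0.\<close>

lemma real_root_finite_direction:
  assumes \<beta>: "\<beta> \<in> real_roots"
  obtains \<beta>' q c where "\<beta>' \<in> real_roots" "\<beta>' 0 = 0" "q > 0" "\<beta> = (\<lambda>i. of_real q * \<beta>' i + c * \<delta> i)"
proof -
  obtain "is" i where i: "\<beta> = sw is (\<alpha> i)" "set is \<subseteq> {..l}" "i \<le> l" using \<beta> by (auto simp: real_roots_eq)
  obtain js \<mu> where w: "set js \<subseteq> {1..l}" "\<mu> \<in> M_hat" "sw is = sw js \<circ> t \<mu>" using sw_W_hat[OF i(2)] by (rule W_hatE)
  have js: "set js \<subseteq> {..l}" using w by auto
  have a: "\<alpha> i \<in> real_roots" by (rule Pos_real_roots[OF alpha_Pos[OF i(3)]])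
  define c where "c = - form (\<alpha> i) \<mu>"
  have "\<beta> = sw js (\<lambda>k. 1 * \<alpha> i k + c * \<delta> k)" using i(1) w(3) t_real_root[OF a, of \<mu>] by (simp add: c_def)
  then have b: "\<beta> = (\<lambda>k. sw js (\<alpha> i) k + c * \<delta> k)"
    using lin_comb[OF sw_lin, of js 1 "\<alpha> i" c \<delta>] sw_delta[OF js] by simp
  show ?thesis
  proof (cases "i = 0")
    case False
    have "sw js (\<alpha> i) 0 = \<alpha> i 0" using w by (intro sw_other) auto
    then have "sw js (\<alpha> i) 0 = 0" using False by (simp add: unit_vec_def)
    then show ?thesis using that[of "sw js (\<alpha> i)" 1 c] sw_real_roots[OF js a] b by simp
  next
    case True
    obtain ks j where k: "set ks \<subseteq> {1..l}" "j \<in> {1..l}" "half_norm j = lr 0" "rvec theta = sw ks (\<alpha> j)" by (rule theta_orbit)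
    define a0 where "a0 = lr 0"
    have a0: "a0 > 0" using lr_pos[of 0] by (simp add: a0_def)
    let ?b = "sw (js @ ks) (\<alpha> j)"
    have bs: "set (js @ ks) \<subseteq> {..l}" using js k by auto
    have jr: "\<alpha> j \<in> real_roots" using k by (intro Pos_real_roots alpha_Pos) simp
    have br: "neg ?b \<in> real_roots" by (rule real_root_uminus[OF sw_real_roots[OF bs jr]])
    have "?b 0 = \<alpha> j 0" using w k by (intro sw_other) auto
    then have b0: "neg ?b 0 = 0" using k by (simp add: unit_vec_def)
    have "\<alpha> 0 = (\<lambda>i. of_real (1 / a0) * \<delta> i + of_real (- 1 / a0) * rvec theta i)"
      using a0 by (auto simp: rvec_theta a0_def fun_eq_iff field_simps)
    then have "sw js (\<alpha> 0) = (\<lambda>i. of_real (1 / a0) * \<delta> i + of_real (- 1 / a0) * ?b i)"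
      using lin_comb[OF sw_lin, of js "of_real (1 / a0)" \<delta> "of_real (- 1 / a0)" "rvec theta"] sw_delta[OF js] k(4)
      by (simp add: sw_append)
    then have "\<beta> = (\<lambda>i. of_real (1 / a0) * neg ?b i + (of_real (1 / a0) + c) * \<delta> i)"
      using b True by (simp add: fun_eq_iff algebra_simps)
    then show ?thesis using that[OF br b0, of "1 / a0"] a0 by simp
  qed
qed

lemma Pos_form_lam:
  assumes n: "\<forall>i\<in>{1..l}. n i \<le> 0" and \<beta>: "\<beta> \<in> Pos" "\<beta> 0 = 0"
  shows "Re (form \<beta> (lam n)) \<le> 0"
proof -
  have "Re (\<beta> k * form (\<alpha> k) (lam n)) \<le> 0" if "k \<le> l" for k
  proof (cases "k = 0")
    case False
    then have k: "k \<in> {1..l}" using that by simp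
    have "\<beta> k \<in> \<nat>" using \<beta> by (simp add: Pos_def)
    then obtain m where m: "\<beta> k = of_nat m" by (auto elim: Nats_cases)
    have "real m * (of_int (n k) * bnorm k) \<le> 0"
      using bspec[OF n k] bnorm_pos[OF that] by (intro mult_nonneg_nonpos mult_nonpos_nonneg) auto
    then show ?thesis using form_alpha_lam[OF k, of n] m by simp
  qed (use \<beta> in simp)
  then show ?thesis unfolding form_real_root_expand[OF Pos_real_roots[OF \<beta>(1)]] by (auto intro: sum_nonpos)
qed

text \<open>Modulo \<open>\<delta>\<close> every real root is a positive multiple of a root of the finite root system, so
  two antidominant translations shift it in the same direction.\<close>

lemma antidominant_inversions:
  assumes m: "\<forall>i\<in>{1..l}. m i \<le> 0" and n: "\<forall>i\<in>{1..l}. n i \<le> 0" and b: "\<beta> \<in> inversions (t (lam n))"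
  shows "t (lam m) \<beta> \<in> Pos"
proof -
  note i = inversions_t[OF lam_M_hat b]
  have br: "\<beta> \<in> real_roots" by (rule Pos_real_roots[OF i(1)])
  obtain \<beta>' q c where d: "\<beta>' \<in> real_roots" "\<beta>' 0 = 0" "q > 0" "\<beta> = (\<lambda>i. of_real q * \<beta>' i + c * \<delta> i)"
    using real_root_finite_direction[OF br] by metis
  have f: "Re (form \<beta> (lam k)) = q * Re (form \<beta>' (lam k))" for k
    using form_lin[of "of_real q" \<beta>' c \<delta> "lam k"] form_delta'[of "lam k"] finite_part_Suc[OF lam_finite_part] by (simp add: d(4))
  obtain k where k: "k \<le> l" "\<beta> k \<noteq> 0" using real_root_nonzero[OF br] by blast
  have "\<beta> k \<in> \<nat>" using i(1) by (simp add: Pos_def)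
  then have rk: "0 < Re (\<beta> k)" using k by (auto elim!: Nats_cases)
  \<comment> \<open>A positive coordinate bounded as in \<open>inversions_t\<close> makes the
    product of \<beta> with \<open>lam n\<close> negative. Antidominance then forces the finite
    direction of \<beta> to be positive, so its product with \<open>lam m\<close> cannot be
    positive.\<close>
  then have "0 < - Re (form \<beta> (lam n)) * lr k" using i(2)[OF k(1)] by linarith
  then have "Re (form \<beta> (lam n)) < 0" using lr_pos[OF k(1)] by (simp add: mult_less_0_iff)
  then have "Re (form \<beta>' (lam n)) < 0" using f d(3) by (simp add: mult_less_0_iff)
  then have "neg \<beta>' \<notin> Pos" using Pos_form_lam[OF n, of "neg \<beta>'"] d(2) by (auto simp: form_uminus)
  then have "\<beta>' \<in> Pos" using real_root_sign[OF d(1)] by blast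
  then have "Re (form \<beta> (lam m)) \<le> 0" using Pos_form_lam[OF m, of \<beta>'] d(2) f d(3) by (simp add: mult_nonneg_nonpos)
  then have "Re (form \<beta> (lam m)) * lr k \<le> 0" by (rule mult_nonpos_nonneg) simp
  moreover have "Re (t (lam m) \<beta> k) = Re (\<beta> k) - Re (form \<beta> (lam m)) * lr k"
    unfolding t_real_root[OF br] using k by (simp add: \<delta>_def)
  ultimately have pos: "0 < Re (t (lam m) \<beta> k)" using rk by simp
  \<comment> \<open>The translated vector is a real root with one positive coordinate, which
    excludes that it is negative.\<close>
  have tr: "t (lam m) \<beta> \<in> real_roots" by (rule t_real_roots[OF lam_M_hat br])
  show ?thesis
  proof (rule ccontr)
    assume "\<not> ?thesis"
    then have "neg (t (lam m) \<beta>) \<in> Pos" using real_root_sign[OF tr] by blast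
    then have "- t (lam m) \<beta> k \<in> \<nat>" by (simp add: Pos_def)
    then have "0 \<le> Re (- t (lam m) \<beta> k)" by (rule Nats_Re_nonneg)
    then show False using pos by simp
  qed
qed

lemma t_lam_comp: "t (lam m) \<circ> t (lam n) = t (lam (\<lambda>i. m i + n i))"
  using t_comp[OF lam_finite_part lam_finite_part] by (simp add: lam_add)

lemma antidominant_length:
  assumes m: "\<forall>i\<in>{1..l}. m i \<le> 0" and n: "\<forall>i\<in>{1..l}. n i \<le> 0"
  shows "card (inversions (t (lam m) \<circ> t (lam n))) = card (inversions (t (lam m))) + card (inversions (t (lam n)))"
proof -
  note W = t_W_hat[OF lam_M_hat]
  have c: "inversions (t (lam m) \<circ> t (lam n)) = inversions (t (lam m)) \<union> t (lam m) ` inversions (t (lam n))"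
    "inversions (t (lam m)) \<inter> t (lam m) ` inversions (t (lam n)) = {}"
    by (rule inversions_comp[OF W W], erule antidominant_inversions[OF m n])+
  show ?thesis unfolding c(1)
    using card_Un_disjoint[OF _ _ c(2)] finite_inversions_t[OF lam_M_hat] card_image[OF W_hat_inj[OF W]] by simp
qed

text \<open>An element of \<Omega> permutes the simple roots and thereby conjugates simple
  reflections into simple reflections, so it can be pushed through a word letter by letter without
  changing the length.\<close>

lemma Omega_word:
  assumes w: "\<omega> \<in> \<Omega>" and js: "set js \<subseteq> {..l}"
  shows "\<exists>ks. set ks \<subseteq> {..l} \<and> length ks = length js \<and> \<omega> \<circ> sw js = sw ks \<circ> \<omega> \<and>
    root_sequence ks = map \<omega> (root_sequence js)"
  using js
proof (induction js)
  case Nil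
  then show ?case by (intro exI[of _ "[]"]) (simp add: sw_Nil)
next
  case (Cons j js)
  from Cons.prems have "set js \<subseteq> {..l}" by simp
  from Cons.IH[OF this] obtain ks where k: "set ks \<subseteq> {..l}" "length ks = length js" "\<omega> \<circ> sw js = sw ks \<circ> \<omega>"
    "root_sequence ks = map \<omega> (root_sequence js)" by blast
  have j: "j \<le> l" using Cons.prems by simp
  obtain i where i: "i \<le> l" "\<omega> (\<alpha> j) = \<alpha> i" using Omega_simple[OF w j] by blast
  have c: "\<omega> \<circ> s j = s i \<circ> \<omega>" by (rule reflection_conj[OF Omega_W_hat[OF w] j i])
  have "\<omega> \<circ> sw (j # js) = sw (i # ks) \<circ> \<omega>" unfolding sw_Cons using c k(3) by (metis comp_assoc)
  moreover have "root_sequence (i # ks) = map \<omega> (root_sequence (j # js))" using k(4) c i(2) by simp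
  ultimately show ?case using k i by (intro exI[of _ "i # ks"]) simp
qed

text \<open>The factor \<omega> of the first expression is pushed through the second word. Since the
  first word followed by \<omega> is the translation itself, the second root sequence appears
  transformed by exactly that translation. Additivity of length makes the concatenation reduced, and
  \<open>decomposition_unique\<close> compares it with any expression of the product.\<close>

lemma concatenated_reduced_expressions:
  assumes m: "\<forall>i\<in>{1..l}. m i \<le> 0" and n: "\<forall>i\<in>{1..l}. n i \<le> 0"
    and x: "reduced_expression (t (lam m)) (is, \<omega>)" and y: "reduced_expression (t (lam n)) (js, \<omega>')"
    and z: "reduced_expression (t (lam (\<lambda>i. m i + n i))) (ks, \<omega>'')"
  obtains ls where "reduced_word ls" "reduced_word ks" "sw ls = sw ks"
    "root_sequence ls = root_sequence is @ map (t (lam m)) (root_sequence js)"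
proof -
  note X = x[unfolded reduced_expression_iff] and Y = y[unfolded reduced_expression_iff] and Z = z[unfolded reduced_expression_iff]
  obtain js' where j: "set js' \<subseteq> {..l}" "length js' = length js" "\<omega> \<circ> sw js = sw js' \<circ> \<omega>"
    "root_sequence js' = map \<omega> (root_sequence js)" using Omega_word X Y by blast
  let ?l = "is @ js'"
  have O: "\<omega> \<circ> \<omega>' \<in> \<Omega>" using Omega_comp X Y by blast
  have l: "set ?l \<subseteq> {..l}" using X j by auto
  have e: "sw ?l \<circ> (\<omega> \<circ> \<omega>') = t (lam m) \<circ> t (lam n)"
    using X Y j(3) by (metis comp_assoc sw_append)
  then have e': "sw ?l \<circ> (\<omega> \<circ> \<omega>') = sw ks \<circ> \<omega>''" using Z t_lam_comp by metis
  have "card (inversions (sw ?l)) = card (inversions (t (lam m) \<circ> t (lam n)))"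
    using inversions_sw_Omega[OF l O] e by simp
  then have "reduced_word ?l" using antidominant_length[OF m n] X Y j(2) l by (simp add: reduced_word_def)
  moreover have "reduced_word ks" using Z inversions_sw_Omega[of ks \<omega>''] unfolding reduced_word_def by metis
  moreover have "sw ?l = sw ks" using decomposition_unique[OF l _ O _ e'] Z by blast
  moreover have "root_sequence ?l = root_sequence is @ map (t (lam m)) (root_sequence js)"
    using X j(4) by (simp add: root_sequence_append)
  ultimately show ?thesis using that by blast
qed

text \<open>Evaluate at \<Lambda>_0: the result determines the translation vector up to a multiple
  of \<delta>, and the coordinate at 0, absent from the finite part, removes that ambiguity.\<close>

lemma t_inj:
  assumes f: "\<mu> \<in> finite_part" "\<nu> \<in> finite_part" and e: "t \<mu> = t \<nu>" shows "\<mu> = \<nu>"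
proof -
  let ?L = "unit_vec (Suc l)"
  have L: "?L (Suc l) = 1" by (simp add: unit_vec_def)
  define c where "c \<mu> = form ?L \<mu> + 1 / 2 * form \<mu> \<mu>" for \<mu>
  have v: "t \<eta> ?L k = ?L k + \<eta> k - c \<eta> * \<delta> k" for \<eta> k unfolding t_alt L c_def by simp
  have e': "\<mu> k - c \<mu> * \<delta> k = \<nu> k - c \<nu> * \<delta> k" for k using fun_cong[OF fun_cong[OF e, of ?L], of k] unfolding v by simp
  have "\<mu> 0 = 0" "\<nu> 0 = 0" using f by (auto simp: finite_part_def)
  then have "c \<mu> = c \<nu>" using e'[of 0] lr_pos[of 0] by (simp add: \<delta>_def)
  then show ?thesis using e' by (simp add: fun_eq_iff)
qed

end

section \<open>Monoid algebras\<close>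

lemma abelian_group_complex_algebra: "abelian_group complex_algebra"
  by (rule abelian_groupI) (auto simp: complex_algebra_def intro: exI[of _ "- _"] simp: add_eq_0_iff)

lemma ring_complex_algebra: "ring complex_algebra"
proof (rule ringI[OF abelian_group_complex_algebra])
  show "Group.monoid complex_algebra" by (rule monoidI) (auto simp: complex_algebra_def)
qed (auto simp: complex_algebra_def algebra_simps)

lemma finsum_complex_algebra: "finite S \<Longrightarrow> finsum complex_algebra f S = sum f S"
proof (induction S rule: finite_induct)
  case empty
  interpret abelian_group complex_algebra by (rule abelian_group_complex_algebra)
  show ?case by (simp add: finsum_empty) (simp add: complex_algebra_def)
next
  case (insert a S)
  interpret abelian_group complex_algebra by (rule abelian_group_complex_algebra)
  have "f \<in> S \<rightarrow> carrier complex_algebra" "f a \<in> carrier complex_algebra" by (auto simp: complex_algebra_def)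
  then show ?case using insert by (simp add: finsum_insert) (simp add: complex_algebra_def)
qed

lemma complex_algebra_simps:
  "carrier complex_algebra = UNIV" "mult complex_algebra = (*)" "one complex_algebra = 1"
  "zero complex_algebra = 0" "add complex_algebra = (+)" "smult complex_algebra = (*)"
  by (simp_all add: complex_algebra_def)

definition supp :: "('g \<Rightarrow> complex) \<Rightarrow> 'g set" where "supp f = {g. f g \<noteq> 0}"

lemma monoid_algebra_carrier: "f \<in> carrier (monoid_algebra G) \<longleftrightarrow> finite (supp f) \<and> supp f \<subseteq> carrier G"
  by (auto simp: monoid_algebra_def crossed_product_def complex_algebra_def supp_def)

lemma monoid_algebra_simps:
  "one (monoid_algebra G) = (\<lambda>g. if g = one G then 1 else 0)" "zero (monoid_algebra G) = (\<lambda>g. 0)"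
  "add (monoid_algebra G) f h = (\<lambda>g. f g + h g)" "smult (monoid_algebra G) c f = (\<lambda>g. c * f g)"
  by (simp_all add: monoid_algebra_def crossed_product_def complex_algebra_simps cong: if_cong)

lemma monoid_algebra_mult:
  assumes "finite (supp f)" "finite (supp h)"
  shows "mult (monoid_algebra G) f h k =
    (\<Sum>p\<in>{(x, y). f x \<noteq> 0 \<and> h y \<noteq> 0 \<and> x \<otimes>\<^bsub>G\<^esub> y = k}. f (fst p) * h (snd p))"
proof -
  have "finite {(x, y). f x \<noteq> 0 \<and> h y \<noteq> 0 \<and> x \<otimes>\<^bsub>G\<^esub> y = k}"
    by (rule finite_subset[of _ "supp f \<times> supp h"]) (use assms in \<open>auto simp: supp_def\<close>)
  from finsum_complex_algebra[OF this, of "\<lambda>p. f (fst p) * h (snd p)"] show ?thesis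
    by (simp add: monoid_algebra_def crossed_product_def complex_algebra_simps)
qed

text \<open>Allowing arbitrary finite supersets of the supports lets several products be written
  over common index sets, as the distributive and associative laws require.\<close>

lemma monoid_algebra_mult_sum:
  assumes S: "finite S" "supp f \<subseteq> S" and T: "finite T" "supp h \<subseteq> T"
  shows "mult (monoid_algebra G) f h k = (\<Sum>x\<in>S. \<Sum>y\<in>T. if x \<otimes>\<^bsub>G\<^esub> y = k then f x * h y else 0)"
proof -
  have "mult (monoid_algebra G) f h k =
    (\<Sum>p\<in>{(x, y). f x \<noteq> 0 \<and> h y \<noteq> 0 \<and> x \<otimes>\<^bsub>G\<^esub> y = k}. f (fst p) * h (snd p))"
    using assms finite_subset by (intro monoid_algebra_mult) auto
  also have "\<dots> = (\<Sum>p\<in>S \<times> T. if fst p \<otimes>\<^bsub>G\<^esub> snd p = k then f (fst p) * h (snd p) else 0)"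
    by (rule sum.mono_neutral_cong_left) (use assms in \<open>auto simp: supp_def\<close>)
  also have "\<dots> = (\<Sum>x\<in>S. \<Sum>y\<in>T. if x \<otimes>\<^bsub>G\<^esub> y = k then f x * h y else 0)"
    by (simp add: sum.cartesian_product case_prod_beta)
  finally show ?thesis .
qed

lemma supp_mult:
  assumes "finite (supp f)" "finite (supp h)"
  shows "supp (mult (monoid_algebra G) f h) \<subseteq> (\<lambda>(x, y). x \<otimes>\<^bsub>G\<^esub> y) ` (supp f \<times> supp h)"
proof
  fix k assume "k \<in> supp (mult (monoid_algebra G) f h)"
  then have "mult (monoid_algebra G) f h k \<noteq> 0" by (simp add: supp_def)
  then have "(\<Sum>x\<in>supp f. \<Sum>y\<in>supp h. if x \<otimes>\<^bsub>G\<^esub> y = k then f x * h y else 0) \<noteq> 0"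
    unfolding monoid_algebra_mult_sum[OF assms(1) order_refl assms(2) order_refl] .
  then obtain x where x: "x \<in> supp f" "(\<Sum>y\<in>supp h. if x \<otimes>\<^bsub>G\<^esub> y = k then f x * h y else 0) \<noteq> 0"
    by (rule sum.not_neutral_contains_not_neutral)
  from x(2) obtain y where "y \<in> supp h" "(if x \<otimes>\<^bsub>G\<^esub> y = k then f x * h y else 0) \<noteq> 0"
    by (rule sum.not_neutral_contains_not_neutral)
  then show "k \<in> (\<lambda>(x, y). x \<otimes>\<^bsub>G\<^esub> y) ` (supp f \<times> supp h)" using x(1) by (auto split: if_splits)
qed

lemma monoid_algebra_mult_closed:
  assumes "Group.monoid G" and f: "f \<in> carrier (monoid_algebra G)" and h: "h \<in> carrier (monoid_algebra G)"
  shows "mult (monoid_algebra G) f h \<in> carrier (monoid_algebra G)"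
proof -
  interpret Group.monoid G by fact
  have fin: "finite (supp f)" "finite (supp h)" and sub: "supp f \<subseteq> carrier G" "supp h \<subseteq> carrier G"
    using f h by (auto simp: monoid_algebra_carrier)
  note s = supp_mult[OF fin, of G]
  have "finite (supp (mult (monoid_algebra G) f h))" by (rule finite_subset[OF s]) (use fin in auto)
  moreover have "supp (mult (monoid_algebra G) f h) \<subseteq> carrier G" using s sub by force
  ultimately show ?thesis by (simp add: monoid_algebra_carrier)
qed

lemma supp_add: "supp (\<lambda>g. f g + h g) \<subseteq> supp f \<union> supp h" by (auto simp: supp_def)

lemma monoid_algebra_assoc:
  assumes "Group.monoid G" and f: "f \<in> carrier (monoid_algebra G)" and h: "h \<in> carrier (monoid_algebra G)"
    and e: "e \<in> carrier (monoid_algebra G)"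
  shows "mult (monoid_algebra G) (mult (monoid_algebra G) f h) e = mult (monoid_algebra G) f (mult (monoid_algebra G) h e)"
proof
  fix k
  interpret Group.monoid G by fact
  let ?S = "supp f" and ?T = "supp h" and ?U = "supp e"
  have fin: "finite ?S" "finite ?T" "finite ?U" and sub: "?S \<subseteq> carrier G" "?T \<subseteq> carrier G" "?U \<subseteq> carrier G"
    using f h e by (auto simp: monoid_algebra_carrier)
  define P Q where "P = (\<lambda>(x, y). x \<otimes>\<^bsub>G\<^esub> y) ` (?S \<times> ?T)" and "Q = (\<lambda>(x, y). x \<otimes>\<^bsub>G\<^esub> y) ` (?T \<times> ?U)"
  have P: "finite P" "supp (mult (monoid_algebra G) f h) \<subseteq> P" and Q: "finite Q" "supp (mult (monoid_algebra G) h e) \<subseteq> Q"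
    using fin supp_mult[of f h G] supp_mult[of h e G] by (auto simp: P_def Q_def)
  \<comment> \<open>Both bracketings are compared with this triple sum; the intermediate product is
    eliminated by summing over its value, which runs through a set of products.\<close>
  define M where "M = (\<Sum>x\<in>?S. \<Sum>y\<in>?T. \<Sum>z\<in>?U. if x \<otimes>\<^bsub>G\<^esub> y \<otimes>\<^bsub>G\<^esub> z = k then f x * h y * e z else 0)"
  have "mult (monoid_algebra G) (mult (monoid_algebra G) f h) e k =
    (\<Sum>u\<in>P. \<Sum>z\<in>?U. if u \<otimes>\<^bsub>G\<^esub> z = k then (\<Sum>x\<in>?S. \<Sum>y\<in>?T. if x \<otimes>\<^bsub>G\<^esub> y = u then f x * h y else 0) * e z else 0)"
    unfolding monoid_algebra_mult_sum[OF P fin(3) order_refl]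
    by (simp only: monoid_algebra_mult_sum[OF fin(1) order_refl fin(2) order_refl])
  also have "\<dots> = (\<Sum>u\<in>P. \<Sum>z\<in>?U. \<Sum>x\<in>?S. \<Sum>y\<in>?T. if u = x \<otimes>\<^bsub>G\<^esub> y then (if x \<otimes>\<^bsub>G\<^esub> y \<otimes>\<^bsub>G\<^esub> z = k then f x * h y * e z else 0) else 0)"
  proof (intro sum.cong refl)
    fix u z
    show "(if u \<otimes>\<^bsub>G\<^esub> z = k then (\<Sum>x\<in>?S. \<Sum>y\<in>?T. if x \<otimes>\<^bsub>G\<^esub> y = u then f x * h y else 0) * e z else 0) =
      (\<Sum>x\<in>?S. \<Sum>y\<in>?T. if u = x \<otimes>\<^bsub>G\<^esub> y then (if x \<otimes>\<^bsub>G\<^esub> y \<otimes>\<^bsub>G\<^esub> z = k then f x * h y * e z else 0) else 0)"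
    proof (cases "u \<otimes>\<^bsub>G\<^esub> z = k")
      case True then show ?thesis by (auto simp: sum_distrib_right intro!: sum.cong)
    next
      case False then show ?thesis by (auto intro!: sum.neutral[symmetric] sum.neutral)
    qed
  qed
  also have "\<dots> = (\<Sum>u\<in>P. \<Sum>x\<in>?S. \<Sum>z\<in>?U. \<Sum>y\<in>?T. if u = x \<otimes>\<^bsub>G\<^esub> y then (if x \<otimes>\<^bsub>G\<^esub> y \<otimes>\<^bsub>G\<^esub> z = k then f x * h y * e z else 0) else 0)"
    by (rule sum.cong[OF refl], rule sum.swap)
  also have "\<dots> = (\<Sum>x\<in>?S. \<Sum>u\<in>P. \<Sum>y\<in>?T. \<Sum>z\<in>?U. if u = x \<otimes>\<^bsub>G\<^esub> y then (if x \<otimes>\<^bsub>G\<^esub> y \<otimes>\<^bsub>G\<^esub> z = k then f x * h y * e z else 0) else 0)"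
    by (subst sum.swap, rule sum.cong[OF refl], rule sum.cong[OF refl], rule sum.swap)
  also have "\<dots> = (\<Sum>x\<in>?S. \<Sum>y\<in>?T. \<Sum>u\<in>P. \<Sum>z\<in>?U. if u = x \<otimes>\<^bsub>G\<^esub> y then (if x \<otimes>\<^bsub>G\<^esub> y \<otimes>\<^bsub>G\<^esub> z = k then f x * h y * e z else 0) else 0)"
    by (rule sum.cong[OF refl], rule sum.swap)
  also have "\<dots> = (\<Sum>x\<in>?S. \<Sum>y\<in>?T. \<Sum>z\<in>?U. \<Sum>u\<in>P. if u = x \<otimes>\<^bsub>G\<^esub> y then (if x \<otimes>\<^bsub>G\<^esub> y \<otimes>\<^bsub>G\<^esub> z = k then f x * h y * e z else 0) else 0)"
    by (rule sum.cong[OF refl], rule sum.cong[OF refl], rule sum.swap)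
  also have "\<dots> = M" unfolding M_def
  proof (intro sum.cong refl)
    fix x y z assume "x \<in> ?S" "y \<in> ?T"
    then have "x \<otimes>\<^bsub>G\<^esub> y \<in> P" by (auto simp: P_def)
    then show "(\<Sum>u\<in>P. if u = x \<otimes>\<^bsub>G\<^esub> y then (if x \<otimes>\<^bsub>G\<^esub> y \<otimes>\<^bsub>G\<^esub> z = k then f x * h y * e z else 0) else 0) =
      (if x \<otimes>\<^bsub>G\<^esub> y \<otimes>\<^bsub>G\<^esub> z = k then f x * h y * e z else 0)" using P(1) by simp
  qed
  finally have L: "mult (monoid_algebra G) (mult (monoid_algebra G) f h) e k = M" .
  have "mult (monoid_algebra G) f (mult (monoid_algebra G) h e) k =
    (\<Sum>x\<in>?S. \<Sum>v\<in>Q. if x \<otimes>\<^bsub>G\<^esub> v = k then f x * (\<Sum>y\<in>?T. \<Sum>z\<in>?U. if y \<otimes>\<^bsub>G\<^esub> z = v then h y * e z else 0) else 0)"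
    unfolding monoid_algebra_mult_sum[OF fin(1) order_refl Q]
    by (simp only: monoid_algebra_mult_sum[OF fin(2) order_refl fin(3) order_refl])
  also have "\<dots> = (\<Sum>x\<in>?S. \<Sum>v\<in>Q. \<Sum>y\<in>?T. \<Sum>z\<in>?U. if v = y \<otimes>\<^bsub>G\<^esub> z then (if x \<otimes>\<^bsub>G\<^esub> (y \<otimes>\<^bsub>G\<^esub> z) = k then f x * h y * e z else 0) else 0)"
  proof (intro sum.cong refl)
    fix x v
    show "(if x \<otimes>\<^bsub>G\<^esub> v = k then f x * (\<Sum>y\<in>?T. \<Sum>z\<in>?U. if y \<otimes>\<^bsub>G\<^esub> z = v then h y * e z else 0) else 0) =
      (\<Sum>y\<in>?T. \<Sum>z\<in>?U. if v = y \<otimes>\<^bsub>G\<^esub> z then (if x \<otimes>\<^bsub>G\<^esub> (y \<otimes>\<^bsub>G\<^esub> z) = k then f x * h y * e z else 0) else 0)"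
    proof (cases "x \<otimes>\<^bsub>G\<^esub> v = k")
      case True then show ?thesis by (auto simp: sum_distrib_left mult.assoc intro!: sum.cong)
    next
      case False then show ?thesis by (auto intro!: sum.neutral[symmetric] sum.neutral)
    qed
  qed
  also have "\<dots> = (\<Sum>x\<in>?S. \<Sum>y\<in>?T. \<Sum>v\<in>Q. \<Sum>z\<in>?U. if v = y \<otimes>\<^bsub>G\<^esub> z then (if x \<otimes>\<^bsub>G\<^esub> (y \<otimes>\<^bsub>G\<^esub> z) = k then f x * h y * e z else 0) else 0)"
    by (rule sum.cong[OF refl], rule sum.swap)
  also have "\<dots> = (\<Sum>x\<in>?S. \<Sum>y\<in>?T. \<Sum>z\<in>?U. \<Sum>v\<in>Q. if v = y \<otimes>\<^bsub>G\<^esub> z then (if x \<otimes>\<^bsub>G\<^esub> (y \<otimes>\<^bsub>G\<^esub> z) = k then f x * h y * e z else 0) else 0)"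
    by (rule sum.cong[OF refl], rule sum.cong[OF refl], rule sum.swap)
  also have "\<dots> = M" unfolding M_def
  proof (intro sum.cong refl)
    fix x y z assume xyz: "x \<in> ?S" "y \<in> ?T" "z \<in> ?U"
    then have "y \<otimes>\<^bsub>G\<^esub> z \<in> Q" by (auto simp: Q_def)
    moreover have "x \<otimes>\<^bsub>G\<^esub> (y \<otimes>\<^bsub>G\<^esub> z) = x \<otimes>\<^bsub>G\<^esub> y \<otimes>\<^bsub>G\<^esub> z" using xyz sub by (intro m_assoc[symmetric]) auto
    ultimately show "(\<Sum>v\<in>Q. if v = y \<otimes>\<^bsub>G\<^esub> z then (if x \<otimes>\<^bsub>G\<^esub> (y \<otimes>\<^bsub>G\<^esub> z) = k then f x * h y * e z else 0) else 0) =
      (if x \<otimes>\<^bsub>G\<^esub> y \<otimes>\<^bsub>G\<^esub> z = k then f x * h y * e z else 0)" using Q(1) by simp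
  qed
  finally show "mult (monoid_algebra G) (mult (monoid_algebra G) f h) e k = mult (monoid_algebra G) f (mult (monoid_algebra G) h e) k"
    using L by simp
qed

definition sterm :: "complex \<Rightarrow> 'g \<Rightarrow> 'g \<Rightarrow> complex" where "sterm c g = (\<lambda>k. if k = g then c else 0)"

lemma supp_sterm: "supp (sterm c g) \<subseteq> {g}" by (auto simp: supp_def sterm_def)

lemma finite_supp_sterm: "finite (supp (sterm c g))" by (rule finite_subset[OF supp_sterm]) simp

lemma sterm_carrier: "g \<in> carrier G \<Longrightarrow> sterm c g \<in> carrier (monoid_algebra G)"
  using supp_sterm[of c g] finite_supp_sterm[of c g] by (auto simp: monoid_algebra_carrier)

lemma sterm_mult: "mult (monoid_algebra G) (sterm c x) (sterm d y) = sterm (c * d) (x \<otimes>\<^bsub>G\<^esub> y)"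
proof
  fix k
  show "mult (monoid_algebra G) (sterm c x) (sterm d y) k = sterm (c * d) (x \<otimes>\<^bsub>G\<^esub> y) k"
    using monoid_algebra_mult_sum[OF _ supp_sterm[of c x] _ supp_sterm[of d y], of G k] by (simp add: sterm_def)
qed

lemma sterm_one_mult:
  assumes "Group.monoid G" and f: "f \<in> carrier (monoid_algebra G)"
  shows "mult (monoid_algebra G) (sterm c (one G)) f = (\<lambda>g. c * f g)"
    and "mult (monoid_algebra G) f (sterm c (one G)) = (\<lambda>g. c * f g)"
proof -
  interpret Group.monoid G by fact
  have fin: "finite (supp f)" and sub: "supp f \<subseteq> carrier G" using f by (auto simp: monoid_algebra_carrier)
  have z: "k \<notin> supp f \<Longrightarrow> f k = 0" for k by (auto simp: supp_def)
  show "mult (monoid_algebra G) (sterm c (one G)) f = (\<lambda>g. c * f g)"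
  proof
    fix k
    have "mult (monoid_algebra G) (sterm c (one G)) f k = (\<Sum>y\<in>supp f. if y = k then c * f k else 0)"
      unfolding monoid_algebra_mult_sum[OF finite.intros(2)[OF finite.emptyI] supp_sterm fin order_refl]
      using sub by (auto simp: sterm_def intro!: sum.cong)
    then show "mult (monoid_algebra G) (sterm c (one G)) f k = c * f k" using fin z[of k] by simp
  qed
  show "mult (monoid_algebra G) f (sterm c (one G)) = (\<lambda>g. c * f g)"
  proof
    fix k
    have "mult (monoid_algebra G) f (sterm c (one G)) k = (\<Sum>y\<in>supp f. if y = k then c * f k else 0)"
      unfolding monoid_algebra_mult_sum[OF fin order_refl finite.intros(2)[OF finite.emptyI] supp_sterm]
      using sub by (auto simp: sterm_def intro!: sum.cong)
    then show "mult (monoid_algebra G) f (sterm c (one G)) k = c * f k" using fin z[of k] by simp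
  qed
qed

lemma monoid_algebra_one: "one (monoid_algebra G) = sterm 1 (one G)"
  by (auto simp: monoid_algebra_simps sterm_def)

lemma abelian_group_monoid_algebra: "abelian_group (monoid_algebra G)"
proof (rule abelian_groupI)
  fix f h assume "f \<in> carrier (monoid_algebra G)" "h \<in> carrier (monoid_algebra G)"
  then show "f \<oplus>\<^bsub>monoid_algebra G\<^esub> h \<in> carrier (monoid_algebra G)"
    using supp_add[of f h] finite_subset[OF supp_add[of f h]] by (auto simp: monoid_algebra_carrier monoid_algebra_simps)
next
  fix f assume "f \<in> carrier (monoid_algebra G)"
  then show "\<exists>h\<in>carrier (monoid_algebra G). h \<oplus>\<^bsub>monoid_algebra G\<^esub> f = \<zero>\<^bsub>monoid_algebra G\<^esub>"
    by (intro bexI[of _ "\<lambda>g. - f g"]) (auto simp: monoid_algebra_carrier monoid_algebra_simps supp_def)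
qed (auto simp: monoid_algebra_carrier monoid_algebra_simps supp_def)

lemma ring_monoid_algebra:
  assumes G: "Group.monoid G" shows "ring (monoid_algebra G)"
proof (rule ringI[OF abelian_group_monoid_algebra])
  interpret Group.monoid G by fact
  show "Group.monoid (monoid_algebra G)"
  proof (rule monoidI)
    show "\<one>\<^bsub>monoid_algebra G\<^esub> \<in> carrier (monoid_algebra G)" unfolding monoid_algebra_one by (rule sterm_carrier) simp
  qed (auto simp: monoid_algebra_one sterm_one_mult[OF G] monoid_algebra_mult_closed[OF G] monoid_algebra_assoc[OF G])
next
  fix f h e assume "f \<in> carrier (monoid_algebra G)" "h \<in> carrier (monoid_algebra G)" "e \<in> carrier (monoid_algebra G)"
  then have fin: "finite (supp f)" "finite (supp h)" "finite (supp e)" by (auto simp: monoid_algebra_carrier)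
  let ?S = "supp f \<union> supp h"
  have S: "finite ?S" "supp f \<subseteq> ?S" "supp h \<subseteq> ?S" using fin by auto
  show "(f \<oplus>\<^bsub>monoid_algebra G\<^esub> h) \<otimes>\<^bsub>monoid_algebra G\<^esub> e =
    f \<otimes>\<^bsub>monoid_algebra G\<^esub> e \<oplus>\<^bsub>monoid_algebra G\<^esub> h \<otimes>\<^bsub>monoid_algebra G\<^esub> e"
    unfolding monoid_algebra_simps
    by (rule ext)
       (simp add: monoid_algebra_mult_sum[OF S(1) supp_add fin(3) order_refl] monoid_algebra_mult_sum[OF S(1,2) fin(3) order_refl]
        monoid_algebra_mult_sum[OF S(1,3) fin(3) order_refl] flip: sum.distrib, intro sum.cong refl, simp add: distrib_right)
  show "e \<otimes>\<^bsub>monoid_algebra G\<^esub> (f \<oplus>\<^bsub>monoid_algebra G\<^esub> h) =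
    e \<otimes>\<^bsub>monoid_algebra G\<^esub> f \<oplus>\<^bsub>monoid_algebra G\<^esub> e \<otimes>\<^bsub>monoid_algebra G\<^esub> h"
    unfolding monoid_algebra_simps
    by (rule ext)
       (simp add: monoid_algebra_mult_sum[OF fin(3) order_refl S(1) supp_add] monoid_algebra_mult_sum[OF fin(3) order_refl S(1,2)]
        monoid_algebra_mult_sum[OF fin(3) order_refl S(1,3)] flip: sum.distrib, intro sum.cong refl, simp add: distrib_left)
qed

text \<open>The character sending every monoid element to 1. It recovers scalar coefficients from a
  quotient by differences of words.\<close>

definition augmentation :: "('g \<Rightarrow> complex) \<Rightarrow> complex" where "augmentation f = sum f (supp f)"

lemma augmentation_superset: "finite S \<Longrightarrow> supp f \<subseteq> S \<Longrightarrow> augmentation f = sum f S"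
  unfolding augmentation_def by (rule sum.mono_neutral_left) (auto simp: supp_def)

lemma augmentation_sterm: "augmentation (sterm c g) = c"
  using augmentation_superset[of "{g}" "sterm c g"] supp_sterm[of c g] by (simp add: sterm_def)

lemma augmentation_hom:
  assumes G: "Group.monoid G" shows "augmentation \<in> ring_hom (monoid_algebra G) complex_algebra"
proof (rule ring_hom_memI)
  interpret Group.monoid G by fact
  fix f h assume "f \<in> carrier (monoid_algebra G)" "h \<in> carrier (monoid_algebra G)"
  then have fin: "finite (supp f)" "finite (supp h)" by (auto simp: monoid_algebra_carrier)
  let ?S = "supp f \<union> supp h"
  have S: "finite ?S" "supp f \<subseteq> ?S" "supp h \<subseteq> ?S" using fin by auto
  show "augmentation (f \<oplus>\<^bsub>monoid_algebra G\<^esub> h) = augmentation f \<oplus>\<^bsub>complex_algebra\<^esub> augmentation h"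
    unfolding monoid_algebra_simps augmentation_superset[OF S(1,2)] augmentation_superset[OF S(1,3)] augmentation_superset[OF S(1) supp_add]
    by (simp add: complex_algebra_def sum.distrib)
  define P where "P = (\<lambda>(x, y). x \<otimes>\<^bsub>G\<^esub> y) ` (supp f \<times> supp h)"
  have P: "finite P" "supp (mult (monoid_algebra G) f h) \<subseteq> P" using fin supp_mult[OF fin, of G] by (auto simp: P_def)
  have "augmentation (mult (monoid_algebra G) f h) = (\<Sum>k\<in>P. \<Sum>x\<in>supp f. \<Sum>y\<in>supp h. if x \<otimes>\<^bsub>G\<^esub> y = k then f x * h y else 0)"
    unfolding augmentation_superset[OF P]
    by (rule sum.cong[OF refl]) (rule monoid_algebra_mult_sum[OF fin(1) order_refl fin(2) order_refl])
  also have "\<dots> = (\<Sum>x\<in>supp f. \<Sum>y\<in>supp h. \<Sum>k\<in>P. if x \<otimes>\<^bsub>G\<^esub> y = k then f x * h y else 0)"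
    by (subst sum.swap, rule sum.cong[OF refl], rule sum.swap)
  also have "\<dots> = (\<Sum>x\<in>supp f. \<Sum>y\<in>supp h. f x * h y)"
  proof (intro sum.cong refl)
    fix x y assume "x \<in> supp f" "y \<in> supp h"
    then have "x \<otimes>\<^bsub>G\<^esub> y \<in> P" by (auto simp: P_def)
    then show "(\<Sum>k\<in>P. if x \<otimes>\<^bsub>G\<^esub> y = k then f x * h y else 0) = f x * h y" using P(1) by simp
  qed
  also have "\<dots> = augmentation f * augmentation h" by (simp add: augmentation_def sum_product)
  finally show "augmentation (f \<otimes>\<^bsub>monoid_algebra G\<^esub> h) = augmentation f \<otimes>\<^bsub>complex_algebra\<^esub> augmentation h"
    by (simp add: complex_algebra_def)
next
  show "augmentation \<one>\<^bsub>monoid_algebra G\<^esub> = \<one>\<^bsub>complex_algebra\<^esub>"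
    unfolding monoid_algebra_one augmentation_sterm by (simp add: complex_algebra_def)
qed (simp add: complex_algebra_def)

text \<open>\<open>alg_iso\<close> does not require its arguments to be algebras, so closure of A
  under the operations, used when the inverse map is applied, is supplied as hypotheses.\<close>

lemma alg_isomorphic_sym:
  assumes h: "h \<in> alg_iso A B"
    and cl: "\<one>\<^bsub>A\<^esub> \<in> carrier A" "\<And>x y. x \<in> carrier A \<Longrightarrow> y \<in> carrier A \<Longrightarrow> x \<otimes>\<^bsub>A\<^esub> y \<in> carrier A"
      "\<And>x y. x \<in> carrier A \<Longrightarrow> y \<in> carrier A \<Longrightarrow> x \<oplus>\<^bsub>A\<^esub> y \<in> carrier A"
      "\<And>c x. x \<in> carrier A \<Longrightarrow> c \<odot>\<^bsub>A\<^esub> x \<in> carrier A"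
  shows "alg_isomorphic B A"
proof -
  let ?g = "inv_into (carrier A) h"
  have bij: "bij_betw h (carrier A) (carrier B)" and hom: "h \<in> ring_hom A B"
    and sm: "\<And>c x. x \<in> carrier A \<Longrightarrow> h (c \<odot>\<^bsub>A\<^esub> x) = c \<odot>\<^bsub>B\<^esub> h x"
    using h by (auto simp: alg_iso_def ring_iso_def)
  have gb: "bij_betw ?g (carrier B) (carrier A)" by (rule bij_betw_inv_into[OF bij])
  have gc: "?g y \<in> carrier A" "h (?g y) = y" if "y \<in> carrier B" for y
    using that gb bij by (auto simp: bij_betw_def f_inv_into_f)
  have gh: "?g (h x) = x" if "x \<in> carrier A" for x using that bij by (simp add: bij_betw_def)
  have "?g \<in> alg_iso B A" unfolding alg_iso_def ring_iso_def
  proof (intro CollectI conjI gb allI ballI ring_hom_memI)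
    fix x y assume x: "x \<in> carrier B" and y: "y \<in> carrier B"
    have "h (?g x \<otimes>\<^bsub>A\<^esub> ?g y) = x \<otimes>\<^bsub>B\<^esub> y" using hom gc[OF x] gc[OF y] by (simp add: ring_hom_mult)
    then show "?g (x \<otimes>\<^bsub>B\<^esub> y) = ?g x \<otimes>\<^bsub>A\<^esub> ?g y" using gh[OF cl(2)] gc x y by metis
    have "h (?g x \<oplus>\<^bsub>A\<^esub> ?g y) = x \<oplus>\<^bsub>B\<^esub> y" using hom gc[OF x] gc[OF y] by (simp add: ring_hom_add)
    then show "?g (x \<oplus>\<^bsub>B\<^esub> y) = ?g x \<oplus>\<^bsub>A\<^esub> ?g y" using gh[OF cl(3)] gc x y by metis
  next
    show "?g \<one>\<^bsub>B\<^esub> = \<one>\<^bsub>A\<^esub>" using gh[OF cl(1)] ring_hom_one[OF hom] by metis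
  next
    fix c x assume x: "x \<in> carrier B"
    have "h (c \<odot>\<^bsub>A\<^esub> ?g x) = c \<odot>\<^bsub>B\<^esub> x" using sm gc[OF x] by simp
    then show "?g (c \<odot>\<^bsub>B\<^esub> x) = c \<odot>\<^bsub>A\<^esub> ?g x" using gh[OF cl(4)] gc x by metis
  qed (use gc in auto)
  then show ?thesis by (auto simp: alg_isomorphic_def)
qed

section \<open>The root algebra\<close>

lemma lookup_times_keys:
  fixes p q :: "('a::monoid_add) \<Rightarrow>\<^sub>0 complex"
  shows "Poly_Mapping.lookup (p * q) m = (\<Sum>a\<in>Poly_Mapping.keys p. \<Sum>b\<in>Poly_Mapping.keys q.
    if a + b = m then Poly_Mapping.lookup p a * Poly_Mapping.lookup q b else 0)"
proof -
  let ?g = "\<lambda>(a, b). Poly_Mapping.lookup p a * Poly_Mapping.lookup q b when m = a + b"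
  have "Poly_Mapping.lookup (p * q) m = Sum_any ?g"
    unfolding times_poly_mapping.rep_eq by (rule prod_fun_unfold_prod) simp_all
  also have "\<dots> = sum ?g (Poly_Mapping.keys p \<times> Poly_Mapping.keys q)"
    by (rule Sum_any.expand_superset) (auto simp: when_def in_keys_iff split: if_splits)
  also have "\<dots> = (\<Sum>a\<in>Poly_Mapping.keys p. \<Sum>b\<in>Poly_Mapping.keys q.
    if a + b = m then Poly_Mapping.lookup p a * Poly_Mapping.lookup q b else 0)"
    by (subst sum.cartesian_product, rule sum.cong) (auto simp: when_def)
  finally show ?thesis .
qed

context affine_datum
begin

lemma monoid_free: "Group.monoid (free_monoid real_roots)"
  by (rule monoidI) (auto simp: free_monoid_def)

lemma free_monoid_simps:
  "mult (free_monoid V) = (@)" "one (free_monoid V) = []" "carrier (free_monoid V) = lists V"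
  by (simp_all add: free_monoid_def)

lemma ring_tensor: "ring tensor_alg"
  unfolding tensor_alg_def free_algebra_def by (rule ring_monoid_algebra[OF monoid_free])

lemma tensor_alg_eq: "tensor_alg = monoid_algebra (free_monoid real_roots)"
  by (simp add: tensor_alg_def free_algebra_def)

definition mon :: "vec list \<Rightarrow> tensor" where "mon ws = sterm 1 ws"

lemma mon_carrier: "set ws \<subseteq> real_roots \<Longrightarrow> mon ws \<in> carrier tensor_alg"
  unfolding mon_def tensor_alg_eq by (rule sterm_carrier) (auto simp: free_monoid_simps)

lemma sterm_tensor_carrier: "set ws \<subseteq> real_roots \<Longrightarrow> sterm c ws \<in> carrier tensor_alg"
  unfolding tensor_alg_eq by (rule sterm_carrier) (auto simp: free_monoid_simps)

lemma sterm_tensor_mult: "sterm c u \<otimes>\<^bsub>tensor_alg\<^esub> sterm d v = sterm (c * d) (u @ v)"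
  unfolding tensor_alg_eq sterm_mult by (simp add: free_monoid_simps)

lemma mon_append: "mon (u @ v) = mon u \<otimes>\<^bsub>tensor_alg\<^esub> mon v"
  by (simp add: mon_def sterm_tensor_mult)

lemma tensor_one: "\<one>\<^bsub>tensor_alg\<^esub> = mon []"
  by (simp add: tensor_alg_eq mon_def monoid_algebra_one free_monoid_simps)

lemma tensor_simps:
  "f \<oplus>\<^bsub>tensor_alg\<^esub> h = (\<lambda>g. f g + h g)" "\<zero>\<^bsub>tensor_alg\<^esub> = (\<lambda>g. 0)" "c \<odot>\<^bsub>tensor_alg\<^esub> f = (\<lambda>g. c * f g)"
  by (simp_all add: tensor_alg_eq monoid_algebra_simps)

lemma tensor_gen_eq: "tensor_gen \<beta> = mon [\<beta>]"
  by (auto simp: tensor_gen_def single_term_def mon_def sterm_def complex_algebra_def)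

lemma mult_list_gen: "mult_list tensor_alg (map tensor_gen ws) = mon ws"
proof (induction ws)
  case (Cons b ws)
  then show ?case using mon_append[of "[b]" ws] by (simp add: mult_list_def tensor_gen_eq)
qed (simp add: mult_list_def tensor_one)

lemma tensor_minus:
  assumes "f \<in> carrier tensor_alg" "h \<in> carrier tensor_alg"
  shows "f \<ominus>\<^bsub>tensor_alg\<^esub> h = (\<lambda>g. f g - h g)"
proof -
  interpret ring tensor_alg by (rule ring_tensor)
  have "(\<lambda>g. - h g) \<in> carrier tensor_alg"
    using assms(2) by (simp add: tensor_alg_eq monoid_algebra_carrier supp_def)
  then have "\<ominus>\<^bsub>tensor_alg\<^esub> h = (\<lambda>g. - h g)"
    using assms(2) by (intro minus_equality) (auto simp: tensor_simps)
  then show ?thesis by (simp add: minus_eq tensor_simps)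
qed

lemma map_eq_iff_W_hat: "w \<in> W_hat \<Longrightarrow> map (iv w) u = v \<longleftrightarrow> u = map w v"
  by (auto simp: map_idI)

lemma tensor_act_sterm: "w \<in> W_hat \<Longrightarrow> tensor_act w (sterm c ws) = sterm c (map w ws)"
  by (auto simp: tensor_act_def sterm_def map_eq_iff_W_hat)

lemma tensor_act_mon: "w \<in> W_hat \<Longrightarrow> tensor_act w (mon ws) = mon (map w ws)"
  by (simp add: mon_def tensor_act_sterm)

lemma supp_tensor_act: assumes w: "w \<in> W_hat" shows "supp (tensor_act w f) = map w ` supp f"
proof (intro equalityI subsetI)
  fix u assume "u \<in> supp (tensor_act w f)"
  moreover have "u = map w (map (iv w) u)" using w by (simp add: map_idI)
  ultimately show "u \<in> map w ` supp f" unfolding supp_def tensor_act_def by blast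
next
  fix u assume "u \<in> map w ` supp f"
  then show "u \<in> supp (tensor_act w f)" using w by (auto simp: supp_def tensor_act_def map_idI)
qed

lemma tensor_act_carrier:
  assumes w: "w \<in> W_hat" and f: "f \<in> carrier tensor_alg" shows "tensor_act w f \<in> carrier tensor_alg"
  using f W_hat_real_roots[OF w] by (force simp: tensor_alg_eq monoid_algebra_carrier supp_tensor_act[OF w] free_monoid_simps)

lemma tensor_act_hom:
  assumes w: "w \<in> W_hat" shows "tensor_act w \<in> ring_hom tensor_alg tensor_alg"
proof (rule ring_hom_memI)
  fix f h assume f: "f \<in> carrier tensor_alg" and h: "h \<in> carrier tensor_alg"
  then have fin: "finite (supp f)" "finite (supp h)" by (auto simp: tensor_alg_eq monoid_algebra_carrier)
  have fin': "finite (map w ` supp f)" "finite (map w ` supp h)" using fin by auto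
  have inj: "inj_on (map w) S" for S using W_hat_inj[OF w] by (simp add: inj_on_mapI)
  show "tensor_act w (f \<otimes>\<^bsub>tensor_alg\<^esub> h) = tensor_act w f \<otimes>\<^bsub>tensor_alg\<^esub> tensor_act w h"
  proof
    fix k
    have eq: "x @ y = map (iv w) k \<longleftrightarrow> map w x @ map w y = k" for x y
      using map_eq_iff_W_hat[OF w, of k "x @ y"] by auto
    have act: "tensor_act w g (map w x) = g x" for g x using w by (simp add: tensor_act_def map_idI)
    have "(tensor_act w f \<otimes>\<^bsub>tensor_alg\<^esub> tensor_act w h) k =
      (\<Sum>x\<in>map w ` supp f. \<Sum>y\<in>map w ` supp h. if x @ y = k then tensor_act w f x * tensor_act w h y else 0)"
      unfolding tensor_alg_eq
      by (subst monoid_algebra_mult_sum[OF fin'(1) _ fin'(2)]) (simp_all add: supp_tensor_act[OF w] free_monoid_simps)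
    also have "\<dots> = (\<Sum>x\<in>supp f. \<Sum>y\<in>supp h. if map w x @ map w y = k then f x * h y else 0)"
      unfolding sum.reindex[OF inj] by (simp add: act cong: if_cong)
    also have "\<dots> = (f \<otimes>\<^bsub>tensor_alg\<^esub> h) (map (iv w) k)"
      unfolding tensor_alg_eq monoid_algebra_mult_sum[OF fin(1) order_refl fin(2) order_refl] free_monoid_simps eq ..
    finally show "tensor_act w (f \<otimes>\<^bsub>tensor_alg\<^esub> h) k = (tensor_act w f \<otimes>\<^bsub>tensor_alg\<^esub> tensor_act w h) k"
      by (simp add: tensor_act_def)
  qed
next
  show "tensor_act w \<one>\<^bsub>tensor_alg\<^esub> = \<one>\<^bsub>tensor_alg\<^esub>" by (simp add: tensor_one tensor_act_mon[OF w])
qed (auto simp: tensor_act_carrier[OF w] tensor_simps, simp_all add: tensor_act_def)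

lemma tensor_act_comp: "w \<in> W_hat \<Longrightarrow> w' \<in> W_hat \<Longrightarrow> tensor_act w (tensor_act w' f) = tensor_act (w \<circ> w') f"
  by (auto simp: tensor_act_def iv_comp)

lemma root_sequence_real: "set is \<subseteq> {..l} \<Longrightarrow> set (root_sequence is) \<subseteq> real_roots"
  by (induction "is") (auto intro: Pos_real_roots alpha_Pos W_hat_real_roots s_W_hat)

lemma map_W_hat_real: "w \<in> W_hat \<Longrightarrow> set ws \<subseteq> real_roots \<Longrightarrow> set (map w ws) \<subseteq> real_roots"
  using W_hat_real_roots by auto

definition braid_word :: "linmap \<Rightarrow> nat \<Rightarrow> nat \<Rightarrow> vec list" where
  "braid_word w i j = map w (root_sequence (alternating i j (m_ord i j)))"

definition braid_word' :: "linmap \<Rightarrow> nat \<Rightarrow> nat \<Rightarrow> vec list" where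
  "braid_word' w i j = map w (root_sequence (alternating j i (m_ord i j)))"

lemma braid_words_real:
  assumes "w \<in> W_hat" "i \<le> l" "j \<le> l"
  shows "set (braid_word w i j) \<subseteq> real_roots" "set (braid_word' w i j) \<subseteq> real_roots"
proof -
  have "set (alternating i j n) \<subseteq> {..l}" "set (alternating j i n) \<subseteq> {..l}" for n
    using alternating_W_hat[OF assms(2,3)] alternating_W_hat[OF assms(3,2)] by auto
  then show "set (braid_word w i j) \<subseteq> real_roots" "set (braid_word' w i j) \<subseteq> real_roots"
    unfolding braid_word_def braid_word'_def by (auto intro!: map_W_hat_real[OF assms(1)] root_sequence_real simp del: set_map)
qed

lemma braid_relations_eq:
  "braid_relations = {mon (braid_word w i j) \<ominus>\<^bsub>tensor_alg\<^esub> mon (braid_word' w i j) | w i j.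
    w \<in> W_hat \<and> i \<le> l \<and> j \<le> l \<and> i \<noteq> j \<and> finite_order i j}"
  unfolding braid_relations_def mult_list_gen braid_word_def braid_word'_def using tensor_act_mon by (intro Collect_cong) metis

lemma braid_relations_carrier: "braid_relations \<subseteq> carrier tensor_alg"
proof -
  interpret ring tensor_alg by (rule ring_tensor)
  show ?thesis unfolding braid_relations_eq using mon_carrier[OF braid_words_real(1)] mon_carrier[OF braid_words_real(2)]
    by (auto intro!: minus_closed)
qed

lemma ideal_braid: "ideal braid_ideal tensor_alg"
  unfolding braid_ideal_def by (rule ring.genideal_ideal[OF ring_tensor braid_relations_carrier])

lemma augmentation_ring_hom: "ring_hom_ring tensor_alg complex_algebra augmentation"
  unfolding tensor_alg_eq
  by (rule ring_hom_ringI2[OF ring_monoid_algebra[OF monoid_free] ring_complex_algebra augmentation_hom[OF monoid_free]])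

lemma augmentation_tensor_minus:
  assumes "f \<in> carrier tensor_alg" "h \<in> carrier tensor_alg"
  shows "augmentation (f \<ominus>\<^bsub>tensor_alg\<^esub> h) = augmentation f - augmentation h"
proof -
  have fin: "finite (supp f \<union> supp h)" using assms by (auto simp: tensor_alg_eq monoid_algebra_carrier)
  have s: "supp (\<lambda>g. f g - h g) \<subseteq> supp f \<union> supp h" by (auto simp: supp_def)
  show ?thesis unfolding tensor_minus[OF assms] augmentation_superset[OF fin s]
      augmentation_superset[OF fin Un_upper1] augmentation_superset[OF fin Un_upper2]
    by (simp add: sum_subtractf)
qed

lemma augmentation_mon: "augmentation (mon ws) = 1" by (simp add: mon_def augmentation_sterm)

text \<open>Every braid relation is a difference of two words, each of augmentation 1, so the whole
  ideal lies in the kernel. The augmentation thus takes a single value on each coset and keeps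
  scalar multiples of a word apart.\<close>

lemma braid_ideal_augmentation: "f \<in> braid_ideal \<Longrightarrow> augmentation f = 0"
proof -
  interpret ring tensor_alg by (rule ring_tensor)
  have "ideal {x \<in> carrier tensor_alg. augmentation x = 0} tensor_alg"
    using ring_hom_ring.kernel_is_ideal[OF augmentation_ring_hom] by (simp add: a_kernel_def' complex_algebra_simps)
  moreover have "braid_relations \<subseteq> {x \<in> carrier tensor_alg. augmentation x = 0}"
  proof
    fix f assume f: "f \<in> braid_relations"
    then obtain w i j where "w \<in> W_hat" "i \<le> l" "j \<le> l" and e: "f = mon (braid_word w i j) \<ominus>\<^bsub>tensor_alg\<^esub> mon (braid_word' w i j)"
      by (auto simp: braid_relations_eq)
    then have "augmentation f = 0" unfolding e
      by (simp add: augmentation_tensor_minus mon_carrier braid_words_real augmentation_mon)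
    then show "f \<in> {x \<in> carrier tensor_alg. augmentation x = 0}" using f braid_relations_carrier by auto
  qed
  ultimately have "braid_ideal \<subseteq> {x \<in> carrier tensor_alg. augmentation x = 0}"
    unfolding braid_ideal_def by (rule genideal_minimal)
  then show "f \<in> braid_ideal \<Longrightarrow> augmentation f = 0" by auto
qed

text \<open>The relations are stable under \<open>W_hat\<close> because they were imposed in all
  translates, and the preimage of the ideal under a ring homomorphism is an ideal containing
  them.\<close>

lemma tensor_act_braid_ideal: assumes w: "w \<in> W_hat" and f: "f \<in> braid_ideal" shows "tensor_act w f \<in> braid_ideal"
proof -
  interpret ring tensor_alg by (rule ring_tensor)
  have hr: "ring_hom_ring tensor_alg tensor_alg (tensor_act w)"
    by (rule ring_hom_ringI2[OF ring_tensor ring_tensor tensor_act_hom[OF w]])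
  have I: "ideal {r \<in> carrier tensor_alg. tensor_act w r \<in> braid_ideal} tensor_alg"
    by (rule ring_hom_ring.ideal_vimage[OF hr ideal_braid])
  have "braid_relations \<subseteq> {r \<in> carrier tensor_alg. tensor_act w r \<in> braid_ideal}"
  proof
    fix f assume f: "f \<in> braid_relations"
    then obtain u i j where u: "u \<in> W_hat" "i \<le> l" "j \<le> l" "i \<noteq> j" "finite_order i j"
      and e: "f = mon (braid_word u i j) \<ominus>\<^bsub>tensor_alg\<^esub> mon (braid_word' u i j)"
      by (auto simp: braid_relations_eq)
    note c = mon_carrier[OF braid_words_real(1)[OF u(1-3)]] mon_carrier[OF braid_words_real(2)[OF u(1-3)]]
    have "w \<circ> u \<in> W_hat" by (rule W_hat_comp[OF w u(1)])
    note c' = mon_carrier[OF braid_words_real(1)[OF this u(2,3)]] mon_carrier[OF braid_words_real(2)[OF this u(2,3)]]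
    have "tensor_act w f = (\<lambda>g. tensor_act w (mon (braid_word u i j)) g - tensor_act w (mon (braid_word' u i j)) g)"
      unfolding e tensor_minus[OF c] by (simp add: tensor_act_def)
    also have "\<dots> = mon (braid_word (w \<circ> u) i j) \<ominus>\<^bsub>tensor_alg\<^esub> mon (braid_word' (w \<circ> u) i j)"
      unfolding tensor_minus[OF c'] by (simp add: tensor_act_mon[OF w] braid_word_def braid_word'_def)
    also have "\<dots> \<in> braid_relations" unfolding braid_relations_eq using \<open>w \<circ> u \<in> W_hat\<close> u by blast
    finally have "tensor_act w f \<in> braid_ideal" unfolding braid_ideal_def using genideal_self[OF braid_relations_carrier] by auto
    then show "f \<in> {r \<in> carrier tensor_alg. tensor_act w r \<in> braid_ideal}" using f braid_relations_carrier by auto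
  qed
  then have "braid_ideal \<subseteq> {r \<in> carrier tensor_alg. tensor_act w r \<in> braid_ideal}"
    unfolding braid_ideal_def using genideal_minimal I by (simp add: braid_ideal_def)
  then show ?thesis using f by auto
qed

section \<open>The quotient by the braid ideal\<close>

definition braid_coset :: "tensor \<Rightarrow> tensor set" where "braid_coset f = braid_ideal +>\<^bsub>tensor_alg\<^esub> f"

lemma braid_coset_eq_iff: "f \<in> carrier tensor_alg \<Longrightarrow> h \<in> carrier tensor_alg \<Longrightarrow> braid_coset f = braid_coset h \<longleftrightarrow> f \<ominus>\<^bsub>tensor_alg\<^esub> h \<in> braid_ideal"
  unfolding braid_coset_def using ring.quotient_eq_iff_same_a_r_cos[OF ring_tensor ideal_braid] by blast

lemma braid_coset_augmentation: "f \<in> carrier tensor_alg \<Longrightarrow> h \<in> carrier tensor_alg \<Longrightarrow> braid_coset f = braid_coset h \<Longrightarrow> augmentation f = augmentation h"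
  using braid_coset_eq_iff braid_ideal_augmentation augmentation_tensor_minus by fastforce

lemma R_act_braid_coset:
  assumes w: "w \<in> W_hat" and f: "f \<in> carrier tensor_alg"
  shows "R_act w (braid_coset f) = braid_coset (tensor_act w f)"
proof -
  have add: "tensor_act w (j \<oplus>\<^bsub>tensor_alg\<^esub> f) = tensor_act w j \<oplus>\<^bsub>tensor_alg\<^esub> tensor_act w f" for j
    by (simp add: tensor_simps tensor_act_def)
  have inv: "tensor_act w (tensor_act (iv w) j) = j" for j
  proof -
    have "iv (w \<circ> iv w) = id" by (rule inv_unique_comp) (use w in \<open>auto simp: fun_eq_iff\<close>)
    then show ?thesis unfolding tensor_act_comp[OF w iv_W_hat[OF w]] by (simp add: tensor_act_def)
  qed
  show ?thesis
  proof (intro equalityI subsetI)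
    fix x assume "x \<in> R_act w (braid_coset f)"
    then obtain j where "j \<in> braid_ideal" "x = tensor_act w (j \<oplus>\<^bsub>tensor_alg\<^esub> f)" by (auto simp: R_act_def braid_coset_def a_r_coset_def')
    then show "x \<in> braid_coset (tensor_act w f)" using add tensor_act_braid_ideal[OF w] by (auto simp: braid_coset_def a_r_coset_def')
  next
    fix x assume "x \<in> braid_coset (tensor_act w f)"
    then obtain j where j: "j \<in> braid_ideal" "x = j \<oplus>\<^bsub>tensor_alg\<^esub> tensor_act w f" by (auto simp: braid_coset_def a_r_coset_def')
    then have "x = tensor_act w (tensor_act (iv w) j \<oplus>\<^bsub>tensor_alg\<^esub> f)" unfolding add inv by simp
    moreover have "tensor_act (iv w) j \<in> braid_ideal" by (rule tensor_act_braid_ideal[OF iv_W_hat[OF w] j(1)])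
    ultimately show "x \<in> R_act w (braid_coset f)" unfolding R_act_def braid_coset_def a_r_coset_def' by blast
  qed
qed

lemma R_tilde_simps:
  "carrier R_tilde = braid_coset ` carrier tensor_alg" "zero R_tilde = braid_ideal" "one R_tilde = braid_coset (mon [])"
  unfolding R_tilde_def quotient_algebra_def FactRing_def braid_coset_def
  by (auto simp: A_RCOSETS_def' tensor_one)

lemma R_tilde_ops:
  assumes "f \<in> carrier tensor_alg" "h \<in> carrier tensor_alg"
  shows "braid_coset f \<otimes>\<^bsub>R_tilde\<^esub> braid_coset h = braid_coset (f \<otimes>\<^bsub>tensor_alg\<^esub> h)" "braid_coset f \<oplus>\<^bsub>R_tilde\<^esub> braid_coset h = braid_coset (f \<oplus>\<^bsub>tensor_alg\<^esub> h)"
  using ideal.rcoset_mult_add[OF ideal_braid assms] ideal.a_rcos_sum[OF ideal_braid assms]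
  by (auto simp: R_tilde_def quotient_algebra_def FactRing_def braid_coset_def)

lemma braid_coset_zero: "braid_coset (\<lambda>g. 0) = braid_ideal"
  using ring.a_rcos_zero[OF ring_tensor ideal_braid, of "\<lambda>g. 0"]
    additive_subgroup.zero_closed[OF ideal.axioms(1)[OF ideal_braid]] by (simp add: braid_coset_def tensor_simps)

lemma tensor_smult:
  assumes "f \<in> carrier tensor_alg"
  shows "(\<lambda>g. c * f g) = sterm c [] \<otimes>\<^bsub>tensor_alg\<^esub> f" "(\<lambda>g. c * f g) \<in> carrier tensor_alg"
proof -
  show e: "(\<lambda>g. c * f g) = sterm c [] \<otimes>\<^bsub>tensor_alg\<^esub> f"
    using sterm_one_mult(1)[OF monoid_free, of f c] assms by (simp add: tensor_alg_eq free_monoid_simps)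
  interpret ring tensor_alg by (rule ring_tensor)
  show "(\<lambda>g. c * f g) \<in> carrier tensor_alg" unfolding e by (intro m_closed sterm_tensor_carrier assms) simp
qed

text \<open>The scalar action on the quotient is a union of cosets over all representatives. They
  all coincide, because scaling by c is multiplication by c times the empty word and therefore
  preserves the ideal.\<close>

lemma R_tilde_smult:
  assumes f: "f \<in> carrier tensor_alg" shows "c \<odot>\<^bsub>R_tilde\<^esub> braid_coset f = braid_coset (\<lambda>g. c * f g)"
proof -
  interpret ring tensor_alg by (rule ring_tensor)
  interpret J: ideal braid_ideal tensor_alg by (rule ideal_braid)
  have e: "braid_coset (\<lambda>g. c * y g) = braid_coset (\<lambda>g. c * f g)" if y: "y \<in> braid_coset f" for y
  proof -
    obtain j where j: "j \<in> braid_ideal" "y = j \<oplus>\<^bsub>tensor_alg\<^esub> f" using y by (auto simp: braid_coset_def a_r_coset_def')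
    have jc: "j \<in> carrier tensor_alg" by (rule J.Icarr[OF j(1)])
    have yc: "y \<in> carrier tensor_alg" using j(2) jc f by simp
    have "(\<lambda>g. c * y g) \<ominus>\<^bsub>tensor_alg\<^esub> (\<lambda>g. c * f g) = (\<lambda>g. c * j g)"
      unfolding tensor_minus[OF tensor_smult(2)[OF yc] tensor_smult(2)[OF f]] by (simp add: j(2) tensor_simps algebra_simps)
    also have "\<dots> \<in> braid_ideal" unfolding tensor_smult(1)[OF jc] by (intro J.I_l_closed j sterm_tensor_carrier) simp
    finally show ?thesis using braid_coset_eq_iff tensor_smult(2) yc f by blast
  qed
  have "f \<in> braid_coset f" unfolding braid_coset_def by (rule J.a_rcos_self[OF f])
  moreover have "c \<odot>\<^bsub>R_tilde\<^esub> braid_coset f = (\<Union>y\<in>braid_coset f. braid_coset (\<lambda>g. c * y g))"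
    by (simp add: R_tilde_def quotient_algebra_def braid_coset_def tensor_simps)
  ultimately show ?thesis using e by blast
qed

lemma abelian_group_R_tilde: "abelian_group R_tilde"
proof -
  interpret Q: ring "tensor_alg Quot braid_ideal" by (rule ideal.quotient_is_ring[OF ideal_braid])
  have e: "carrier R_tilde = carrier (tensor_alg Quot braid_ideal)" "add R_tilde = add (tensor_alg Quot braid_ideal)"
    "zero R_tilde = zero (tensor_alg Quot braid_ideal)"
    by (simp_all add: R_tilde_def quotient_algebra_def)
  show ?thesis
  proof (rule abelian_groupI, unfold e)
    fix x assume "x \<in> carrier (tensor_alg Quot braid_ideal)"
    then show "\<exists>y\<in>carrier (tensor_alg Quot braid_ideal). y \<oplus>\<^bsub>tensor_alg Quot braid_ideal\<^esub> x = \<zero>\<^bsub>tensor_alg Quot braid_ideal\<^esub>"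
      using Q.l_neg Q.a_inv_closed by blast
  qed (auto simp: Q.a_ac)
qed

section \<open>Classes of scalar multiples of words\<close>

definition word_class :: "complex \<Rightarrow> vec list \<Rightarrow> tensor set" where "word_class c ws = braid_coset (sterm c ws)"

lemma word_class_carrier: "set ws \<subseteq> real_roots \<Longrightarrow> word_class c ws \<in> carrier R_tilde"
  unfolding R_tilde_simps word_class_def using sterm_tensor_carrier by blast

lemma word_class_zero: "word_class 0 ws = \<zero>\<^bsub>R_tilde\<^esub>"
proof -
  have "sterm 0 ws = (\<lambda>g. 0)" by (auto simp: sterm_def)
  then show ?thesis by (simp add: word_class_def braid_coset_zero R_tilde_simps)
qed

lemma word_class_add: assumes "set ws \<subseteq> real_roots" shows "word_class c ws \<oplus>\<^bsub>R_tilde\<^esub> word_class d ws = word_class (c + d) ws"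
proof -
  have "sterm c ws \<oplus>\<^bsub>tensor_alg\<^esub> sterm d ws = sterm (c + d) ws" by (auto simp: tensor_simps sterm_def)
  then show ?thesis using R_tilde_ops(2)[OF sterm_tensor_carrier[OF assms] sterm_tensor_carrier[OF assms]] by (simp add: word_class_def)
qed

lemma word_class_mult: "set u \<subseteq> real_roots \<Longrightarrow> set v \<subseteq> real_roots \<Longrightarrow> word_class c u \<otimes>\<^bsub>R_tilde\<^esub> word_class d v = word_class (c * d) (u @ v)"
  using R_tilde_ops(1)[OF sterm_tensor_carrier sterm_tensor_carrier] by (simp add: word_class_def sterm_tensor_mult)

lemma word_class_smult: assumes "set u \<subseteq> real_roots" shows "c \<odot>\<^bsub>R_tilde\<^esub> word_class d u = word_class (c * d) u"
proof -
  have "(\<lambda>g. c * sterm d u g) = sterm (c * d) u" by (auto simp: sterm_def)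
  then show ?thesis using R_tilde_smult[OF sterm_tensor_carrier[OF assms]] by (simp add: word_class_def)
qed

lemma word_class_act: "w \<in> W_hat \<Longrightarrow> set u \<subseteq> real_roots \<Longrightarrow> R_act w (word_class c u) = word_class c (map w u)"
  using R_act_braid_coset[OF _ sterm_tensor_carrier] by (simp add: word_class_def tensor_act_sterm)

text \<open>The augmentation reads the scalar off the class. This is the source of linear
  independence.\<close>

lemma word_class_inj: "set u \<subseteq> real_roots \<Longrightarrow> word_class c u = word_class d u \<Longrightarrow> c = d"
  unfolding word_class_def using braid_coset_augmentation[OF sterm_tensor_carrier sterm_tensor_carrier] augmentation_sterm by metis

lemma word_class_eq_zero_iff: "set u \<subseteq> real_roots \<Longrightarrow> word_class c u = \<zero>\<^bsub>R_tilde\<^esub> \<longleftrightarrow> c = 0"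
  using word_class_inj[of u c 0] word_class_zero by metis

text \<open>A congruence of words passes to all scalar multiples since \<open>c ws\<close> is the product of \<open>c\<close> and \<open>ws\<close>.\<close>

lemma word_class_cong:
  assumes "set u \<subseteq> real_roots" "set v \<subseteq> real_roots" "word_class 1 u = word_class 1 v" shows "word_class c u = word_class c v"
  using word_class_mult[of "[]" u c 1] word_class_mult[of "[]" v c 1] assms by simp

lemma finsum_word_class:
  assumes "finite S" and u: "set u \<subseteq> real_roots"
  shows "finsum R_tilde (\<lambda>p. word_class (c p) u) S = word_class (sum c S) u"
  using assms(1)
proof (induction S rule: finite_induct)
  interpret abelian_group R_tilde by (rule abelian_group_R_tilde)
  case empty
  show ?case by (simp add: word_class_zero)
next
  interpret abelian_group R_tilde by (rule abelian_group_R_tilde)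
  case (insert a S)
  have "(\<lambda>p. word_class (c p) u) \<in> S \<rightarrow> carrier R_tilde" "word_class (c a) u \<in> carrier R_tilde" using word_class_carrier[OF u] by auto
  then show ?case using insert word_class_add[OF u] by (simp add: finsum_insert)
qed

lemma mult_list_R_gen:
  assumes "set ws \<subseteq> real_roots" shows "mult_list R_tilde (map R_gen ws) = word_class 1 ws"
  using assms
proof (induction ws)
  case Nil
  show ?case by (simp add: mult_list_def R_tilde_simps word_class_def mon_def)
next
  case (Cons b ws)
  have "R_gen b = word_class 1 [b]" by (simp add: R_gen_def word_class_def braid_coset_def tensor_gen_eq mon_def)
  then show ?case using Cons word_class_mult[of "[b]" ws 1 1] by (simp add: mult_list_def)
qed

text \<open>The word behind \<open>R_elem\<close>, with the same choice of reduced expression.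
  Keeping the word instead of its class lets translations act letter by letter.\<close>

definition root_word :: "linmap \<Rightarrow> vec list" where "root_word w = root_sequence (fst (SOME e. reduced_expression w e))"

lemma reduced_some:
  assumes "\<mu> \<in> M_hat"
  obtains "is" \<omega> where "reduced_expression (t \<mu>) (is, \<omega>)" "root_word (t \<mu>) = root_sequence is"
proof -
  have "\<exists>e. reduced_expression (t \<mu>) e"
    using reduced_expression_exists[OF t_W_hat[OF assms] finite_inversions_t[OF assms]] by blast
  then have "reduced_expression (t \<mu>) (SOME e. reduced_expression (t \<mu>) e)" by (rule someI_ex)
  then show ?thesis using that unfolding root_word_def by (metis prod.collapse)
qed

lemma root_word_real: "\<mu> \<in> M_hat \<Longrightarrow> set (root_word (t \<mu>)) \<subseteq> real_roots"
  by (rule reduced_some) (auto simp: reduced_expression_iff intro: root_sequence_real[THEN subsetD])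

lemma R_elem_eq: "\<mu> \<in> M_hat \<Longrightarrow> R_elem (t \<mu>) = word_class 1 (root_word (t \<mu>))"
  using mult_list_R_gen[OF root_word_real] by (simp add: R_elem_def root_word_def)

lemma word_class_matsumoto:
  assumes "reduced_word is" "reduced_word js" "sw is = sw js"
  shows "word_class 1 (root_sequence is) = word_class 1 (root_sequence js)"
proof -
  have "word_class 1 (map id (root_sequence is)) = word_class 1 (map id (root_sequence js))"
  \<comment> \<open>Equality of classes is an equivalence compatible with concatenation on both
    sides, and it contains all transformed braid relations.\<close>
  proof (rule matsumoto[where R = "\<lambda>u v. word_class 1 u = word_class 1 v", OF _ _ _ _ _ _ assms id_W_hat])
    fix u u' v :: "vec list" assume s: "set u \<subseteq> real_roots" "set u' \<subseteq> real_roots" "set v \<subseteq> real_roots" and e: "word_class 1 u = word_class 1 u'"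
    show "word_class 1 (u @ v) = word_class 1 (u' @ v)" using word_class_mult[OF s(1,3), of 1 1] word_class_mult[OF s(2,3), of 1 1] e by simp
    show "word_class 1 (v @ u) = word_class 1 (v @ u')" using word_class_mult[OF s(3,1), of 1 1] word_class_mult[OF s(3,2), of 1 1] e by simp
  next
    fix w i j assume w: "w \<in> W_hat" "i \<le> l" "j \<le> l" "i \<noteq> j" "finite_order i j"
    have "mon (braid_word w i j) \<ominus>\<^bsub>tensor_alg\<^esub> mon (braid_word' w i j) \<in> braid_relations"
      unfolding braid_relations_eq using w by blast
    then have "mon (braid_word w i j) \<ominus>\<^bsub>tensor_alg\<^esub> mon (braid_word' w i j) \<in> braid_ideal"
      unfolding braid_ideal_def using ring.genideal_self[OF ring_tensor braid_relations_carrier] by blast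
    then have "braid_coset (mon (braid_word w i j)) = braid_coset (mon (braid_word' w i j))"
      using braid_coset_eq_iff mon_carrier braid_words_real[OF w(1-3)] by blast
    then show "word_class 1 (map w (root_sequence (alternating i j (m_ord i j)))) = word_class 1 (map w (root_sequence (alternating j i (m_ord i j))))"
      by (simp add: word_class_def mon_def braid_word_def braid_word'_def)
  qed auto
  then show ?thesis by simp
qed

text \<open>The multiplication rule for the Y at the level of words: the two chosen expressions
  concatenate, after a twist by the first translation, to a reduced word that Matsumoto's theorem
  compares with the expression chosen for the product.\<close>

lemma M_hat_minus_comp:
  assumes "\<mu> \<in> M_hat_minus" "\<nu> \<in> M_hat_minus"
  obtains \<rho> where "\<rho> \<in> M_hat_minus" "t \<mu> \<circ> t \<nu> = t \<rho>" "\<And>c. word_class c (root_word (t \<mu>) @ map (t \<mu>) (root_word (t \<nu>))) = word_class c (root_word (t \<rho>))"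
proof -
  obtain m n where m: "\<mu> = lam m" "\<forall>i\<in>{1..l}. m i \<le> 0" and n: "\<nu> = lam n" "\<forall>i\<in>{1..l}. n i \<le> 0"
    using assms by (auto simp: M_hat_minus_eq)
  let ?p = "\<lambda>i. m i + n i"
  have p: "\<forall>i\<in>{1..l}. ?p i \<le> 0" using m n by force
  obtain is1 \<omega>1 where 1: "reduced_expression (t (lam m)) (is1, \<omega>1)" "root_word (t (lam m)) = root_sequence is1" by (rule reduced_some[OF lam_M_hat])
  obtain is2 \<omega>2 where 2: "reduced_expression (t (lam n)) (is2, \<omega>2)" "root_word (t (lam n)) = root_sequence is2" by (rule reduced_some[OF lam_M_hat])
  obtain is3 \<omega>3 where 3: "reduced_expression (t (lam ?p)) (is3, \<omega>3)" "root_word (t (lam ?p)) = root_sequence is3" by (rule reduced_some[OF lam_M_hat])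
  obtain ls where ls: "reduced_word ls" "reduced_word is3" "sw ls = sw is3" "root_sequence ls = root_sequence is1 @ map (t (lam m)) (root_sequence is2)"
    by (rule concatenated_reduced_expressions[OF m(2) n(2) 1(1) 2(1) 3(1)])
  have "word_class 1 (root_sequence ls) = word_class 1 (root_sequence is3)" by (rule word_class_matsumoto[OF ls(1-3)])
  moreover have "set (root_sequence ls) \<subseteq> real_roots" "set (root_sequence is3) \<subseteq> real_roots"
    using ls(1,2) root_sequence_real by (auto simp: reduced_word_def)
  ultimately have "word_class c (root_sequence ls) = word_class c (root_sequence is3)" for c using word_class_cong by blast
  then have "word_class c (root_word (t \<mu>) @ map (t \<mu>) (root_word (t \<nu>))) = word_class c (root_word (t (lam ?p)))" for c
    using ls(4) 1(2) 2(2) 3(2) m(1) n(1) by simp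
  moreover have "lam ?p \<in> M_hat_minus" unfolding M_hat_minus_eq using p by blast
  moreover have "t \<mu> \<circ> t \<nu> = t (lam ?p)" using t_lam_comp m n by simp
  ultimately show ?thesis using that by blast
qed

lemma M_hat_minus_zero: "(\<lambda>i. 0) \<in> M_hat_minus"
proof -
  have "lam (\<lambda>i. 0) = (\<lambda>i. 0)" by (simp add: lam_def)
  then show ?thesis unfolding M_hat_minus_eq by (auto intro!: exI[of _ "\<lambda>i. 0"])
qed

abbreviation Tm :: "linmap set" where "Tm \<equiv> t ` M_hat_minus"

lemma T_minus_simps: "carrier T_minus = Tm" "mult T_minus = (\<circ>)" "one T_minus = id"
  by (simp_all add: T_minus_def)

lemma id_Tm: "id \<in> Tm" using M_hat_minus_zero t_zero by force

lemma Tm_comp: "x \<in> Tm \<Longrightarrow> y \<in> Tm \<Longrightarrow> x \<circ> y \<in> Tm"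
proof (elim imageE)
  fix \<mu> \<nu> assume a: "x = t \<mu>" "y = t \<nu>" "\<mu> \<in> M_hat_minus" "\<nu> \<in> M_hat_minus"
  obtain \<rho> where "\<rho> \<in> M_hat_minus" "t \<mu> \<circ> t \<nu> = t \<rho>" by (rule M_hat_minus_comp[OF a(3,4)])
  then show "x \<circ> y \<in> Tm" using a by auto
qed

lemma monoid_T_minus: "Group.monoid T_minus"
  by (rule monoidI) (auto simp: T_minus_simps id_Tm comp_assoc intro: Tm_comp)

lemma Tm_root_word: "x \<in> Tm \<Longrightarrow> set (root_word x) \<subseteq> real_roots" using root_word_real M_hat_minus_M_hat by auto

lemma Tm_W_hat: "x \<in> Tm \<Longrightarrow> x \<in> W_hat" using t_W_hat M_hat_minus_M_hat by auto

lemma Tm_root_word_comp: "x \<in> Tm \<Longrightarrow> y \<in> Tm \<Longrightarrow> word_class c (root_word x @ map x (root_word y)) = word_class c (root_word (x \<circ> y))"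
  by (elim imageE) (metis M_hat_minus_comp)

lemma root_word_id: "root_word id = []"
proof -
  obtain js \<omega> where "reduced_expression (t (\<lambda>i. 0)) (js, \<omega>)" "root_word (t (\<lambda>i. 0)) = root_sequence js" by (rule reduced_some[OF M_hat_zero])
  then show ?thesis using inversions_id unfolding t_zero reduced_expression_iff by simp
qed

section \<open>The monoid algebra inside the root algebra\<close>

abbreviation MA :: "(complex, linmap \<Rightarrow> complex) module" where "MA \<equiv> monoid_algebra T_minus"

text \<open>The linear extension of the map from t_\<lambda> to Y^\<lambda>: the coefficient at
  t_\<lambda> becomes a scalar multiple of R at t_\<lambda>.\<close>

definition emb :: "(linmap \<Rightarrow> complex) \<Rightarrow> linmap \<Rightarrow> tensor set" where
  "emb p = (\<lambda>g. if g \<in> Tm then word_class (p g) (root_word g) else \<zero>\<^bsub>R_tilde\<^esub>)"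

lemma root_alg_simps:
  "carrier root_alg = {f. range f \<subseteq> carrier R_tilde \<and> finite {g. f g \<noteq> \<zero>\<^bsub>R_tilde\<^esub>} \<and> {g. f g \<noteq> \<zero>\<^bsub>R_tilde\<^esub>} \<subseteq> t ` M_hat}"
  "one root_alg = (\<lambda>g. if g = id then \<one>\<^bsub>R_tilde\<^esub> else \<zero>\<^bsub>R_tilde\<^esub>)" "zero root_alg = (\<lambda>g. \<zero>\<^bsub>R_tilde\<^esub>)"
  "f \<oplus>\<^bsub>root_alg\<^esub> h = (\<lambda>g. f g \<oplus>\<^bsub>R_tilde\<^esub> h g)" "c \<odot>\<^bsub>root_alg\<^esub> f = (\<lambda>g. c \<odot>\<^bsub>R_tilde\<^esub> f g)"
  by (simp_all add: root_alg_def crossed_product_def T_group_def)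

lemma root_alg_mult:
  "f \<otimes>\<^bsub>root_alg\<^esub> h = (\<lambda>k. finsum R_tilde (\<lambda>p. f (fst p) \<otimes>\<^bsub>R_tilde\<^esub> R_act (fst p) (h (snd p)))
    {(x, y). f x \<noteq> \<zero>\<^bsub>R_tilde\<^esub> \<and> h y \<noteq> \<zero>\<^bsub>R_tilde\<^esub> \<and> x \<circ> y = k})"
  by (simp add: root_alg_def crossed_product_def T_group_def)

lemma MA_carrier: "p \<in> carrier MA \<longleftrightarrow> finite (supp p) \<and> supp p \<subseteq> Tm"
  by (simp add: monoid_algebra_carrier T_minus_simps)

lemma emb_zero: "emb (\<lambda>g. 0) = \<zero>\<^bsub>root_alg\<^esub>"
  unfolding emb_def word_class_zero root_alg_simps by simp

text \<open>The product of the crossed product runs over pairs with nonzero coefficients. As no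
  nonzero scalar dies in the quotient, these are the same pairs before and after the
  embedding.\<close>

lemma emb_nonzero: "p \<in> carrier MA \<Longrightarrow> emb p g \<noteq> \<zero>\<^bsub>R_tilde\<^esub> \<longleftrightarrow> p g \<noteq> 0"
  using word_class_eq_zero_iff[OF Tm_root_word] by (auto simp: emb_def MA_carrier supp_def)

lemma emb_carrier: assumes p: "p \<in> carrier MA" shows "emb p \<in> carrier root_alg"
proof -
  have "{g. emb p g \<noteq> \<zero>\<^bsub>R_tilde\<^esub>} = supp p" using emb_nonzero[OF p] by (auto simp: supp_def)
  moreover have "\<zero>\<^bsub>R_tilde\<^esub> \<in> carrier R_tilde" using word_class_carrier[of "[]" 0] by (simp add: word_class_zero)
  moreover have "supp p \<subseteq> t ` M_hat" "finite (supp p)" using p M_hat_minus_M_hat by (auto simp: MA_carrier)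
  ultimately show ?thesis using word_class_carrier[OF Tm_root_word] by (auto simp: root_alg_simps emb_def)
qed

lemma emb_add: "emb (\<lambda>g. p g + q g) = emb p \<oplus>\<^bsub>root_alg\<^esub> emb q"
proof -
  have "\<zero>\<^bsub>R_tilde\<^esub> \<oplus>\<^bsub>R_tilde\<^esub> \<zero>\<^bsub>R_tilde\<^esub> = \<zero>\<^bsub>R_tilde\<^esub>" using word_class_add[of "[]" 0 0] by (simp add: word_class_zero)
  then show ?thesis using word_class_add[OF Tm_root_word] by (auto simp: emb_def root_alg_simps fun_eq_iff)
qed

lemma emb_smult: "emb (\<lambda>g. c * p g) = c \<odot>\<^bsub>root_alg\<^esub> emb p"
proof -
  have "c \<odot>\<^bsub>R_tilde\<^esub> \<zero>\<^bsub>R_tilde\<^esub> = \<zero>\<^bsub>R_tilde\<^esub>" using word_class_smult[of "[]" c 0] by (simp add: word_class_zero)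
  then show ?thesis using word_class_smult[OF Tm_root_word] by (auto simp: emb_def root_alg_simps fun_eq_iff)
qed

lemma emb_one: "emb \<one>\<^bsub>MA\<^esub> = \<one>\<^bsub>root_alg\<^esub>"
proof
  fix g show "emb \<one>\<^bsub>MA\<^esub> g = \<one>\<^bsub>root_alg\<^esub> g"
    using id_Tm root_word_id by (auto simp: emb_def monoid_algebra_simps T_minus_simps root_alg_simps word_class_zero R_tilde_simps(3) word_class_def[of 1] mon_def)
qed

text \<open>All pairs with product k contribute scalar multiples of one and the same class, that of
  the word chosen for k, so adding classes amounts to adding scalars.\<close>

lemma emb_mult:
  assumes p: "p \<in> carrier MA" and q: "q \<in> carrier MA"
  shows "emb (p \<otimes>\<^bsub>MA\<^esub> q) = emb p \<otimes>\<^bsub>root_alg\<^esub> emb q"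
proof
  fix k
  let ?S = "{(x, y). p x \<noteq> 0 \<and> q y \<noteq> 0 \<and> x \<circ> y = k}"
  have fin: "finite (supp p)" "finite (supp q)" and sub: "supp p \<subseteq> Tm" "supp q \<subseteq> Tm"
    using p q by (auto simp: MA_carrier)
  have S: "finite ?S" by (rule finite_subset[of _ "supp p \<times> supp q"]) (use fin in \<open>auto simp: supp_def\<close>)
  have inT: "x \<in> Tm" "y \<in> Tm" if "(x, y) \<in> ?S" for x y using that sub by (auto simp: supp_def)
  have L: "(p \<otimes>\<^bsub>MA\<^esub> q) k = (\<Sum>z\<in>?S. p (fst z) * q (snd z))"
    unfolding monoid_algebra_mult[OF fin] T_minus_simps ..
  have R: "(emb p \<otimes>\<^bsub>root_alg\<^esub> emb q) k = finsum R_tilde (\<lambda>z. emb p (fst z) \<otimes>\<^bsub>R_tilde\<^esub> R_act (fst z) (emb q (snd z))) ?S"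
    unfolding root_alg_mult emb_nonzero[OF p] emb_nonzero[OF q] ..
  show "emb (p \<otimes>\<^bsub>MA\<^esub> q) k = (emb p \<otimes>\<^bsub>root_alg\<^esub> emb q) k"
  proof (cases "k \<in> Tm")
    case True
    interpret abelian_group R_tilde by (rule abelian_group_R_tilde)
    have summand: "emb p (fst z) \<otimes>\<^bsub>R_tilde\<^esub> R_act (fst z) (emb q (snd z)) = word_class (p (fst z) * q (snd z)) (root_word k)" if z: "z \<in> ?S" for z
    proof -
      obtain x y where xy: "z = (x, y)" "x \<in> Tm" "y \<in> Tm" "x \<circ> y = k" using z inT by (cases z) auto
      have "R_act x (word_class (q y) (root_word y)) = word_class (q y) (map x (root_word y))" by (rule word_class_act[OF Tm_W_hat Tm_root_word]) (use xy in auto)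
      moreover have "set (map x (root_word y)) \<subseteq> real_roots" by (rule map_W_hat_real[OF Tm_W_hat Tm_root_word]) (use xy in auto)
      ultimately show ?thesis using xy Tm_root_word_comp[OF xy(2,3)] word_class_mult[OF Tm_root_word[OF xy(2)]] by (simp add: emb_def)
    qed
    have "(emb p \<otimes>\<^bsub>root_alg\<^esub> emb q) k = finsum R_tilde (\<lambda>z. word_class (p (fst z) * q (snd z)) (root_word k)) ?S"
      unfolding R by (rule finsum_cong') (use summand word_class_carrier[OF Tm_root_word[OF True]] in auto)
    also have "\<dots> = word_class (\<Sum>z\<in>?S. p (fst z) * q (snd z)) (root_word k)" by (rule finsum_word_class[OF S Tm_root_word[OF True]])
    finally show ?thesis using True L by (simp add: emb_def)
  next
    case False
    \<comment> \<open>Antidominant translations are closed under composition, so no pair has its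
      product outside.\<close>
    then have e: "?S = {}" using inT Tm_comp by blast
    interpret abelian_group R_tilde by (rule abelian_group_R_tilde)
    show ?thesis unfolding R e using False by (simp add: emb_def)
  qed
qed

lemma emb_inj: assumes p: "p \<in> carrier MA" "q \<in> carrier MA" and e: "emb p = emb q" shows "p = q"
proof
  fix g
  show "p g = q g"
  proof (cases "g \<in> Tm")
    case True
    then show ?thesis using fun_cong[OF e, of g] word_class_inj[OF Tm_root_word[OF True]] by (simp add: emb_def)
  next
    case False
    then have "g \<notin> supp p" "g \<notin> supp q" using p by (auto simp: MA_carrier)
    then show ?thesis by (simp add: supp_def)
  qed
qed

text \<open>The additive inverse in the root algebra is a description; the group laws allow the
  inverse of an embedded element to be recognized as the embedding of its negative.\<close>

lemma abelian_group_root_alg: "abelian_group root_alg"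
proof -
  interpret abelian_group R_tilde by (rule abelian_group_R_tilde)
  have fin: "finite {g. f g \<oplus>\<^bsub>R_tilde\<^esub> h g \<noteq> \<zero>\<^bsub>R_tilde\<^esub>}" if "finite {g. f g \<noteq> \<zero>\<^bsub>R_tilde\<^esub>}" "finite {g. h g \<noteq> \<zero>\<^bsub>R_tilde\<^esub>}" for f h :: "linmap \<Rightarrow> tensor set"
    by (rule finite_subset[of _ "{g. f g \<noteq> \<zero>\<^bsub>R_tilde\<^esub>} \<union> {g. h g \<noteq> \<zero>\<^bsub>R_tilde\<^esub>}"]) (use that in auto)
  show ?thesis
  proof (rule abelian_groupI)
    fix f assume f: "f \<in> carrier root_alg"
    have c: "f g \<in> carrier R_tilde" for g using f by (auto simp: root_alg_simps)
    have "\<ominus>\<^bsub>R_tilde\<^esub> f g \<noteq> \<zero>\<^bsub>R_tilde\<^esub> \<longleftrightarrow> f g \<noteq> \<zero>\<^bsub>R_tilde\<^esub>" for g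
      using l_neg[OF c[of g]] l_zero[OF c[of g]] r_zero[OF a_inv_closed[OF c[of g]]] by metis
    then have "(\<lambda>g. \<ominus>\<^bsub>R_tilde\<^esub> f g) \<in> carrier root_alg"
      using f c by (simp add: root_alg_simps image_subset_iff)
    then show "\<exists>h\<in>carrier root_alg. h \<oplus>\<^bsub>root_alg\<^esub> f = \<zero>\<^bsub>root_alg\<^esub>"
      using c by (intro bexI[of _ "\<lambda>g. \<ominus>\<^bsub>R_tilde\<^esub> f g"]) (auto simp: root_alg_simps l_neg)
  next
    fix f h assume f: "f \<in> carrier root_alg" and h: "h \<in> carrier root_alg"
    show "f \<oplus>\<^bsub>root_alg\<^esub> h \<in> carrier root_alg"
    proof -
      have "{g. f g \<oplus>\<^bsub>R_tilde\<^esub> h g \<noteq> \<zero>\<^bsub>R_tilde\<^esub>} \<subseteq> {g. f g \<noteq> \<zero>\<^bsub>R_tilde\<^esub>} \<union> {g. h g \<noteq> \<zero>\<^bsub>R_tilde\<^esub>}"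
        by (rule subsetI) (use l_zero[OF zero_closed] in force)
      also have "\<dots> \<subseteq> t ` M_hat" using f h unfolding root_alg_simps by simp
      finally show ?thesis using f h fin[of f h] unfolding root_alg_simps by (simp add: image_subset_iff)
    qed
    show "f \<oplus>\<^bsub>root_alg\<^esub> h = h \<oplus>\<^bsub>root_alg\<^esub> f"
      using f h by (auto simp: root_alg_simps fun_eq_iff image_subset_iff a_comm)
  qed (auto simp: root_alg_simps fun_eq_iff image_subset_iff a_assoc)
qed

lemma ring_MA: "ring MA" by (rule ring_monoid_algebra[OF monoid_T_minus])

lemma MA_smult_closed: "p \<in> carrier MA \<Longrightarrow> (\<lambda>g. c * p g) \<in> carrier MA"
  using finite_subset[of "supp (\<lambda>g. c * p g)" "supp p"] by (auto simp: MA_carrier supp_def)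

lemma subalgebra_emb: "is_subalgebra (emb ` carrier MA) root_alg"
proof -
  interpret M: ring MA by (rule ring_MA)
  interpret A: abelian_group root_alg by (rule abelian_group_root_alg)
  have add: "emb p \<oplus>\<^bsub>root_alg\<^esub> emb q \<in> emb ` carrier MA" if "p \<in> carrier MA" "q \<in> carrier MA" for p q
    unfolding emb_add[symmetric] using M.a_closed[OF that] by (auto simp: monoid_algebra_simps)
  have inv: "\<ominus>\<^bsub>root_alg\<^esub> (emb p) \<in> emb ` carrier MA" if p: "p \<in> carrier MA" for p
  proof -
    have m: "(\<lambda>g. - 1 * p g) \<in> carrier MA" by (rule MA_smult_closed[OF p])
    have "emb (\<lambda>g. - 1 * p g) \<oplus>\<^bsub>root_alg\<^esub> emb p = \<zero>\<^bsub>root_alg\<^esub>"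
      unfolding emb_add[symmetric] emb_zero[symmetric] by simp
    then have "\<ominus>\<^bsub>root_alg\<^esub> (emb p) = emb (\<lambda>g. - 1 * p g)"
      by (intro A.minus_equality emb_carrier m p)
    then show ?thesis using m by blast
  qed
  have "subring (emb ` carrier MA) root_alg"
  proof (rule subring.intro)
    show "subgroup (emb ` carrier MA) (add_monoid root_alg)"
    proof (rule subgroup.intro)
      show "\<one>\<^bsub>add_monoid root_alg\<^esub> \<in> emb ` carrier MA"
        using M.zero_closed emb_zero by (force simp: monoid_algebra_simps)
    qed (use add inv emb_carrier in \<open>auto simp: a_inv_def\<close>)
    show "submonoid (emb ` carrier MA) root_alg"
    proof (rule submonoid.intro)
      show "\<one>\<^bsub>root_alg\<^esub> \<in> emb ` carrier MA" unfolding emb_one[symmetric] by (rule imageI[OF M.one_closed])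
    next
      fix x y assume x: "x \<in> emb ` carrier MA" and y: "y \<in> emb ` carrier MA"
      show "x \<otimes>\<^bsub>root_alg\<^esub> y \<in> emb ` carrier MA"
      proof -
        obtain p where p: "x = emb p" "p \<in> carrier MA" using x by (rule imageE)
        obtain q where q: "y = emb q" "q \<in> carrier MA" using y by (rule imageE)
        note pq = p(2) q(2) p(1) q(1)
        show ?thesis unfolding pq(3,4) emb_mult[OF pq(1,2), symmetric] by (rule imageI[OF M.m_closed[OF pq(1,2)]])
      qed
    next
      show "emb ` carrier MA \<subseteq> carrier root_alg" using emb_carrier by (rule image_subsetI)
    qed
  qed
  moreover have "c \<odot>\<^bsub>root_alg\<^esub> x \<in> emb ` carrier MA" if x: "x \<in> emb ` carrier MA" for c x
  proof -
    obtain p where p: "x = emb p" "p \<in> carrier MA" using x by (rule imageE)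
    show ?thesis unfolding p(1) emb_smult[symmetric] by (rule imageI[OF MA_smult_closed[OF p(2)]])
  qed
  ultimately show ?thesis by (simp add: is_subalgebra_def)
qed

lemma Y_emb: "\<mu> \<in> M_hat_minus \<Longrightarrow> Y \<mu> = emb (sterm 1 (t \<mu>))"
proof (intro ext)
  fix g assume m: "\<mu> \<in> M_hat_minus"
  then show "Y \<mu> g = emb (sterm 1 (t \<mu>)) g"
    using R_elem_eq[OF M_hat_minus_M_hat[OF m]] by (cases "g = t \<mu>") (simp_all add: Y_def single_term_def emb_def sterm_def word_class_zero)
qed

lemma sterm_MA: "g \<in> Tm \<Longrightarrow> sterm c g \<in> carrier MA"
  by (rule sterm_carrier) (simp add: T_minus_simps)

text \<open>Splitting off one support element at a time writes an embedded element as a linear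
  combination of the Y. So the image lies in every subalgebra containing them, and being such a
  subalgebra itself it is their intersection.\<close>

lemma emb_in_subalgebra:
  assumes D: "is_subalgebra D root_alg" and Y: "Y ` M_hat_minus \<subseteq> D"
  shows "finite F \<Longrightarrow> F \<subseteq> Tm \<Longrightarrow> supp p \<subseteq> F \<Longrightarrow> emb p \<in> D"
proof (induction F arbitrary: p rule: finite_induct)
  interpret subring D root_alg using D by (simp add: is_subalgebra_def)
  case empty
  then have "p = (\<lambda>g. 0)" by (auto simp: supp_def)
  then have "emb p = \<zero>\<^bsub>root_alg\<^esub>" by (simp add: emb_zero)
  then show ?case using subgroup.one_closed[OF subgroup_axioms] by simp
next
  interpret subring D root_alg using D by (simp add: is_subalgebra_def)
  case (insert a F)
  have "p = (\<lambda>g. p a * sterm 1 a g + (p(a := 0)) g)" by (auto simp: sterm_def)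
  then have e: "emb p = (p a \<odot>\<^bsub>root_alg\<^esub> emb (sterm 1 a)) \<oplus>\<^bsub>root_alg\<^esub> emb (p(a := 0))"
    using emb_add[of "\<lambda>g. p a * sterm 1 a g" "p(a := 0)"] emb_smult[of "p a" "sterm 1 a"] by simp
  have "a \<in> Tm" using insert.prems by simp
  then have "emb (sterm 1 a) \<in> D" using Y Y_emb by force
  then have 1: "p a \<odot>\<^bsub>root_alg\<^esub> emb (sterm 1 a) \<in> D" using D by (simp add: is_subalgebra_def)
  have 2: "emb (p(a := 0)) \<in> D" by (rule insert.IH) (use insert.prems in \<open>auto simp: supp_def\<close>)
  show ?case unfolding e using subgroup.m_closed[OF subgroup_axioms 1 2] by simp
qed

lemma carrier_S_alg: "carrier S_alg = emb ` carrier MA"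
proof -
  have Y: "Y ` M_hat_minus \<subseteq> emb ` carrier MA" using Y_emb sterm_MA by (auto intro!: imageI)
  show ?thesis unfolding S_alg_def subalgebra_generated_def
  proof (simp, intro equalityI)
    show "\<Inter> {D. is_subalgebra D root_alg \<and> Y ` M_hat_minus \<subseteq> D} \<subseteq> emb ` carrier MA"
      using subalgebra_emb Y by blast
    show "emb ` carrier MA \<subseteq> \<Inter> {D. is_subalgebra D root_alg \<and> Y ` M_hat_minus \<subseteq> D}"
    proof (intro subsetI InterI)
      fix x D assume "x \<in> emb ` carrier MA" "D \<in> {D. is_subalgebra D root_alg \<and> Y ` M_hat_minus \<subseteq> D}"
      then show "x \<in> D" using emb_in_subalgebra[OF _ _ _ _ order_refl] by (auto simp: MA_carrier)
    qed
  qed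
qed

lemma S_alg_simps:
  "mult S_alg = mult root_alg" "one S_alg = one root_alg" "add S_alg = add root_alg" "smult S_alg = smult root_alg"
  by (simp_all add: S_alg_def subalgebra_generated_def)

lemma emb_alg_iso: "emb \<in> alg_iso MA S_alg"
  unfolding alg_iso_def ring_iso_def
proof (intro CollectI conjI allI ballI ring_hom_memI)
  show "bij_betw emb (carrier MA) (carrier S_alg)"
    unfolding carrier_S_alg by (rule inj_on_imp_bij_betw, rule inj_onI, rule emb_inj)
next
  fix p assume "p \<in> carrier MA"
  then show "emb p \<in> carrier S_alg" unfolding carrier_S_alg by (rule imageI)
next
  fix p q assume "p \<in> carrier MA" "q \<in> carrier MA"
  then show "emb (p \<otimes>\<^bsub>MA\<^esub> q) = emb p \<otimes>\<^bsub>S_alg\<^esub> emb q" unfolding S_alg_simps by (rule emb_mult)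
  show "emb (p \<oplus>\<^bsub>MA\<^esub> q) = emb p \<oplus>\<^bsub>S_alg\<^esub> emb q" unfolding S_alg_simps emb_add[symmetric] by (simp add: monoid_algebra_simps)
next
  show "emb \<one>\<^bsub>MA\<^esub> = \<one>\<^bsub>S_alg\<^esub>" unfolding S_alg_simps by (rule emb_one)
next
  fix c p show "emb (c \<odot>\<^bsub>MA\<^esub> p) = c \<odot>\<^bsub>S_alg\<^esub> emb p" unfolding S_alg_simps emb_smult[symmetric] by (simp add: monoid_algebra_simps)
qed

theorem S_alg_isomorphic: "alg_isomorphic S_alg (monoid_algebra T_minus)"
proof -
  interpret M: ring MA by (rule ring_MA)
  have smult: "c \<odot>\<^bsub>MA\<^esub> p \<in> carrier MA" if "p \<in> carrier MA" for c p
    using MA_smult_closed[OF that, of c] by (simp add: monoid_algebra_simps(4))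
  show ?thesis
    by (rule alg_isomorphic_sym[OF emb_alg_iso M.one_closed M.m_closed M.a_closed smult])
qed

section \<open>Antidominant translations as monomials in l variables\<close>

definition expo :: "(nat \<Rightarrow>\<^sub>0 nat) \<Rightarrow> linmap" where
  "expo m = t (lam (\<lambda>i. - int (Poly_Mapping.lookup m i)))"

definition exponents :: "(nat \<Rightarrow>\<^sub>0 nat) set" where "exponents = {m. Poly_Mapping.keys m \<subseteq> {1..l}}"

lemma expo_Tm: "expo m \<in> Tm" unfolding expo_def M_hat_minus_eq by (intro imageI) auto

lemma expo_add: "expo (a + b) = expo a \<circ> expo b"
  unfolding expo_def t_lam_comp lookup_add by simp

lemma expo_zero: "expo 0 = id"
proof -
  have "lam (\<lambda>i. 0) = (\<lambda>i. 0)" by (simp add: lam_def)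
  then show ?thesis by (simp add: expo_def t_zero)
qed

text \<open>Translation is injective on the finite part, and products with the simple roots recover
  the coefficients of the \<lambda>_i, so the exponents are determined.\<close>

lemma expo_inj: "inj_on expo exponents"
proof (rule inj_onI)
  fix a b assume a: "a \<in> exponents" "b \<in> exponents" and e: "expo a = expo b"
  have "lam (\<lambda>i. - int (Poly_Mapping.lookup a i)) = lam (\<lambda>i. - int (Poly_Mapping.lookup b i))"
    using e unfolding expo_def by (rule t_inj[OF lam_finite_part lam_finite_part])
  then have "Poly_Mapping.lookup a i = Poly_Mapping.lookup b i" if "i \<in> {1..l}" for i using lam_inj[OF \<open>lam _ = lam _\<close> that] by simp
  moreover have "Poly_Mapping.lookup a i = Poly_Mapping.lookup b i" if "i \<notin> {1..l}" for i
    using a that by (metis (no_types, lifting) exponents_def in_keys_iff mem_Collect_eq subsetD)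
  ultimately show "a = b" by (intro poly_mapping_eqI) blast
qed

lemma expo_surj: "Tm = expo ` exponents"
proof (intro equalityI subsetI)
  fix x assume "x \<in> Tm"
  then obtain n where n: "x = t (lam n)" "\<forall>i\<in>{1..l}. n i \<le> 0" by (auto simp: M_hat_minus_eq)
  \<comment> \<open>Exponents are the negated coefficients, since these are nonpositive. Outside 1,
    ..., l the function is set to zero to have finite support; \<open>lam\<close> does not see those
    indices.\<close>
  define f where "f i = (if i \<in> {1..l} then nat (- n i) else 0)" for i
  have "finite {i. f i \<noteq> 0}" by (rule finite_subset[of _ "{1..l}"]) (auto simp: f_def)
  then have lk: "Poly_Mapping.lookup (Abs_poly_mapping f) = f" by simp
  have "lam n = lam (\<lambda>i. - int (f i))" unfolding lam_def using n(2) by (intro ext sum.cong) (auto simp: f_def)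
  then have "x = expo (Abs_poly_mapping f)" by (simp add: expo_def lk n(1))
  moreover have "Abs_poly_mapping f \<in> exponents" unfolding exponents_def by (auto simp: in_keys_iff lk f_def split: if_splits)
  ultimately show "x \<in> expo ` exponents" by blast
qed (use expo_Tm in auto)

abbreviation PA :: "(complex, (nat \<Rightarrow>\<^sub>0 nat) \<Rightarrow>\<^sub>0 complex) module" where "PA \<equiv> polynomial_algebra {1..l}"

lemma PA_carrier: "p \<in> carrier PA \<longleftrightarrow> Poly_Mapping.keys p \<subseteq> exponents"
  by (auto simp: polynomial_algebra_def exponents_def)

text \<open>The coefficient function of a polynomial, relabelled along the bijection from exponents
  to translations.\<close>

definition of_poly :: "((nat \<Rightarrow>\<^sub>0 nat) \<Rightarrow>\<^sub>0 complex) \<Rightarrow> linmap \<Rightarrow> complex" where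
  "of_poly p g = (if g \<in> Tm then Poly_Mapping.lookup p (inv_into exponents expo g) else 0)"

lemma of_poly_expo: "m \<in> exponents \<Longrightarrow> of_poly p (expo m) = Poly_Mapping.lookup p m"
  using expo_inj expo_Tm by (simp add: of_poly_def)

lemma of_poly_notin: "g \<notin> Tm \<Longrightarrow> of_poly p g = 0" by (simp add: of_poly_def)

lemma of_poly_eqI:
  assumes "\<And>m. m \<in> exponents \<Longrightarrow> f (expo m) = Poly_Mapping.lookup p m" "\<And>g. g \<notin> Tm \<Longrightarrow> f g = 0"
  shows "of_poly p = f"
proof
  fix g show "of_poly p g = f g"
  proof (cases "g \<in> Tm")
    case True
    then obtain m where "m \<in> exponents" "g = expo m" using expo_surj by auto
    then show ?thesis using of_poly_expo assms(1) by simp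
  qed (use assms(2) of_poly_notin in simp)
qed

lemma supp_of_poly: assumes "Poly_Mapping.keys p \<subseteq> exponents" shows "supp (of_poly p) = expo ` Poly_Mapping.keys p"
proof (intro equalityI subsetI)
  fix g assume g: "g \<in> supp (of_poly p)"
  then have "g \<in> Tm" using of_poly_notin by (auto simp: supp_def)
  then obtain m where m: "m \<in> exponents" "g = expo m" using expo_surj by auto
  then show "g \<in> expo ` Poly_Mapping.keys p" using g of_poly_expo[OF m(1), of p] by (auto simp: supp_def in_keys_iff)
next
  fix g assume "g \<in> expo ` Poly_Mapping.keys p"
  then obtain m where m: "m \<in> Poly_Mapping.keys p" "g = expo m" by auto
  then show "g \<in> supp (of_poly p)" using of_poly_expo[of m p] assms by (auto simp: supp_def in_keys_iff)
qed

text \<open>Both products are convolutions, and \<open>expo\<close> turns addition of exponents into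
  composition. Its injectivity ensures that the same pairs contribute to a given monomial and to the
  corresponding translation.\<close>

lemma of_poly_mult:
  assumes p: "Poly_Mapping.keys p \<subseteq> exponents" and q: "Poly_Mapping.keys q \<subseteq> exponents"
  shows "of_poly (p * q) = of_poly p \<otimes>\<^bsub>MA\<^esub> of_poly q"
proof (rule of_poly_eqI)
  let ?P = "Poly_Mapping.keys p" and ?Q = "Poly_Mapping.keys q"
  have fin: "finite (expo ` ?P)" "finite (expo ` ?Q)" by auto
  have inj: "inj_on expo ?P" "inj_on expo ?Q" using expo_inj p q by (auto intro: inj_on_subset)
  have k: "(of_poly p \<otimes>\<^bsub>MA\<^esub> of_poly q) g = (\<Sum>a\<in>?P. \<Sum>b\<in>?Q. if expo (a + b) = g then Poly_Mapping.lookup p a * Poly_Mapping.lookup q b else 0)" for g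
  proof -
    have "(of_poly p \<otimes>\<^bsub>MA\<^esub> of_poly q) g = (\<Sum>x\<in>expo ` ?P. \<Sum>y\<in>expo ` ?Q. if x \<circ> y = g then of_poly p x * of_poly q y else 0)"
      by (subst monoid_algebra_mult_sum[OF fin(1) _ fin(2)]) (simp_all add: supp_of_poly p q T_minus_simps)
    also have "\<dots> = (\<Sum>a\<in>?P. \<Sum>b\<in>?Q. if expo a \<circ> expo b = g then of_poly p (expo a) * of_poly q (expo b) else 0)"
      unfolding sum.reindex[OF inj(1)] sum.reindex[OF inj(2)] by simp
    also have "\<dots> = (\<Sum>a\<in>?P. \<Sum>b\<in>?Q. if expo (a + b) = g then Poly_Mapping.lookup p a * Poly_Mapping.lookup q b else 0)"
      unfolding expo_add by (intro sum.cong refl) (use p q in \<open>auto simp: of_poly_expo subset_iff\<close>)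
    finally show ?thesis .
  qed
  have exponents_add: "a + b \<in> exponents" if "a \<in> exponents" "b \<in> exponents" for a b using that keys_add[of a b] by (auto simp: exponents_def)
  show "(of_poly p \<otimes>\<^bsub>MA\<^esub> of_poly q) (expo m) = Poly_Mapping.lookup (p * q) m" if m: "m \<in> exponents" for m
    unfolding k lookup_times_keys
  proof (intro sum.cong refl)
    fix a b assume "a \<in> ?P" "b \<in> ?Q"
    then have "a + b \<in> exponents" using p q exponents_add by auto
    then show "(if expo (a + b) = expo m then Poly_Mapping.lookup p a * Poly_Mapping.lookup q b else 0) =
      (if a + b = m then Poly_Mapping.lookup p a * Poly_Mapping.lookup q b else 0)"
      using expo_inj m by (auto dest: inj_onD)
  qed
  show "(of_poly p \<otimes>\<^bsub>MA\<^esub> of_poly q) g = 0" if "g \<notin> Tm" for g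
    unfolding k using expo_Tm that by (intro sum.neutral ballI) auto
qed

lemma of_poly_alg_iso: "of_poly \<in> alg_iso PA MA"
  unfolding alg_iso_def ring_iso_def
proof (intro CollectI conjI allI ballI ring_hom_memI)
  fix p assume "p \<in> carrier PA"
  then show "of_poly p \<in> carrier MA"
    using supp_of_poly[of p] expo_Tm by (auto simp del: One_nat_def simp: PA_carrier MA_carrier)
next
  fix p q assume "p \<in> carrier PA" "q \<in> carrier PA"
  then show "of_poly (p \<otimes>\<^bsub>PA\<^esub> q) = of_poly p \<otimes>\<^bsub>MA\<^esub> of_poly q"
    using of_poly_mult[of p q] unfolding PA_carrier by (simp add: polynomial_algebra_def)
  show "of_poly (p \<oplus>\<^bsub>PA\<^esub> q) = of_poly p \<oplus>\<^bsub>MA\<^esub> of_poly q"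
    by (simp add: polynomial_algebra_def monoid_algebra_simps of_poly_def lookup_add fun_eq_iff)
next
  have "of_poly 1 = \<one>\<^bsub>MA\<^esub>"
  proof (rule of_poly_eqI)
    fix m assume m: "m \<in> exponents"
    have "0 \<in> exponents" by (simp add: exponents_def)
    then have "expo m = id \<longleftrightarrow> m = 0" using expo_inj m expo_zero by (metis inj_onD)
    then show "\<one>\<^bsub>MA\<^esub> (expo m) = Poly_Mapping.lookup 1 m"
      by (simp add: monoid_algebra_simps T_minus_simps lookup_one)
  next
    fix g assume "g \<notin> Tm"
    then show "\<one>\<^bsub>MA\<^esub> g = 0" using id_Tm by (auto simp: monoid_algebra_simps T_minus_simps)
  qed
  then show "of_poly \<one>\<^bsub>PA\<^esub> = \<one>\<^bsub>MA\<^esub>" by (simp add: polynomial_algebra_def)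
next
  fix c p
  show "of_poly (c \<odot>\<^bsub>PA\<^esub> p) = c \<odot>\<^bsub>MA\<^esub> of_poly p"
    by (simp add: polynomial_algebra_def monoid_algebra_simps of_poly_def map.rep_eq when_def fun_eq_iff)
next
  show "bij_betw of_poly (carrier PA) (carrier MA)" unfolding bij_betw_def
  proof (intro conjI equalityI subsetI inj_onI)
    fix p q assume p: "p \<in> carrier PA" and q: "q \<in> carrier PA" and e: "of_poly p = of_poly q"
    have "Poly_Mapping.lookup p m = Poly_Mapping.lookup q m" for m
    proof (cases "m \<in> exponents")
      case True then show ?thesis using of_poly_expo[OF True] e by metis
    next
      case False then show ?thesis using p q by (metis PA_carrier in_keys_iff subsetD)
    qed
    then show "p = q" by (rule poly_mapping_eqI)
  next
    fix f assume "f \<in> of_poly ` carrier PA"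
    then show "f \<in> carrier MA" using supp_of_poly expo_Tm by (auto simp del: One_nat_def simp: PA_carrier MA_carrier)
  next
    fix f assume f: "f \<in> carrier MA"
    define g where "g m = (if m \<in> exponents then f (expo m) else 0)" for m
    have "{m. g m \<noteq> 0} \<subseteq> inv_into exponents expo ` supp f"
    proof
      fix m assume "m \<in> {m. g m \<noteq> 0}"
      then have "m \<in> exponents" "expo m \<in> supp f" by (auto simp: g_def supp_def split: if_splits)
      then show "m \<in> inv_into exponents expo ` supp f" using expo_inj by (intro image_eqI[of _ _ "expo m"]) simp_all
    qed
    then have "finite {m. g m \<noteq> 0}" using f finite_subset by (auto simp: MA_carrier)
    then have lk: "Poly_Mapping.lookup (Abs_poly_mapping g) = g" by simp
    have "of_poly (Abs_poly_mapping g) = f"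
      by (rule of_poly_eqI) (use f in \<open>auto simp: lk g_def MA_carrier supp_def\<close>)
    moreover have "Abs_poly_mapping g \<in> carrier PA" by (auto simp del: One_nat_def simp: PA_carrier in_keys_iff lk g_def split: if_splits)
    ultimately show "f \<in> of_poly ` carrier PA" by blast
  qed
qed

theorem T_minus_polynomial: "alg_isomorphic (monoid_algebra T_minus) (polynomial_algebra {1..l})"
proof (rule alg_isomorphic_sym[OF of_poly_alg_iso])
  have exponents_add: "a + b \<in> exponents" if "a \<in> exponents" "b \<in> exponents" for a b using that keys_add[of a b] by (auto simp: exponents_def)
  show "\<one>\<^bsub>PA\<^esub> \<in> carrier PA" by (simp add: polynomial_algebra_def)
  fix p q c assume p: "p \<in> carrier PA"
  show "c \<odot>\<^bsub>PA\<^esub> p \<in> carrier PA"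
    using p by (auto simp: polynomial_algebra_def in_keys_iff map.rep_eq when_def split: if_splits)
  assume q: "q \<in> carrier PA"
  show "p \<oplus>\<^bsub>PA\<^esub> q \<in> carrier PA" using p q keys_add[of p q] by (auto simp: polynomial_algebra_def)
  show "p \<otimes>\<^bsub>PA\<^esub> q \<in> carrier PA" using p q keys_mult[of p q] exponents_add unfolding PA_carrier
    by (simp add: polynomial_algebra_def) blast
qed

end

theorem corollary6p9:
  fixes X :: affine_type
  assumes "affine_datum X"
  shows "alg_isomorphic (affine_datum.S_alg X) (monoid_algebra (affine_datum.T_minus X))
       \<and> alg_isomorphic (monoid_algebra (affine_datum.T_minus X)) (polynomial_algebra {1..affine_rank X})"
  using affine_datum.S_alg_isomorphic[OF assms] affine_datum.T_minus_polynomial[OF assms] by blast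

end
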